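(* Let $\varphi$, $\mu=\varphi^2dx$, $A$, $B$ on $\mathbb R^d$ satisfy the assumptions stated in the context, let $\widetilde A$ be the symmetric part of $A$, $\beta$ the vector field defined in the context, with $|\beta|\in L^\infty_{loc}(K_0^c,\mu)$, and let $(T_t)_{t>0}$ be the $L^2(\mathbb R^d,\mu)$-semigroup associated with the non-symmetric Dirichlet form $(\mathcal E^{A,B},\mathcal F)$. Suppose there are constants $M,C>0$ and $0<\alpha<1$ such that $$\left|\frac{\langle\widetilde A(x)x,x\rangle}{|x|^2}+\frac{(|x|+1)}{C|x|}\langle\beta(x),x\rangle\right|\le M(|x|+1)^2\log(|x|+1)$$ for $dx$-a.e. $x$ outside some compact subset $K$ of $\mathbb R^d$ with $K\supset K_0$, and $$\widehat A_n(\phi)\le n(n+1)^{\alpha C}$$ for all sufficiently large $n$, where $\phi(r)=C\log(r+1)$. Then $(T_t)_{t>0}$ is conservative.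
   Context: $\varphi\in H^{1,2}_{loc}(\mathbb R^d,dx)$, $\varphi>0$ $dx$-a.e., $d\mu=\varphi^2dx$. $H^{1,2}(\mathbb R^d,\mu)$ is the closure of $C_0^\infty(\mathbb R^d)$ in $L^2(\mathbb R^d,\mu)$ with respect to $(\int(|\nabla f|^2+f^2)\,d\mu)^{1/2}$, and $H^{1,2}_{loc}(\mathbb R^d,\mu)=\{f:f\chi\in H^{1,2}(\mathbb R^d,\mu)\ \forall\chi\in C_0^\infty(\mathbb R^d)\}$. $A=(a_{ij})_{1\le i,j\le d}$ with $a_{ij}\in L^1_{loc}(\mathbb R^d,\mu)$; $\widetilde A=(\widetilde a_{ij})$, $\widetilde a_{ij}=\frac12(a_{ij}+a_{ji})\in L^\infty_{loc}(K_0^c,\mu)$ for some compact $K_0\subset\mathbb R^d$; $\check A=(\check a_{ij})$, $\check a_{ij}=\frac12(a_{ij}-a_{ji})\in H^{1,2}_{loc}(\mathbb R^d,\mu)\cap L^\infty_{loc}(\mathbb R^d,\mu)$. There is a constant $L>0$, and for any compact $K\subset\mathbb R^d$ a constant $\nu_K>0$, such that $\max_{i,j}\operatorname{ess\,sup}_K|\check a_{ij}|\le L\nu_K$ and $\nu_K|\xi|^2\le\langle\widetilde A(x)\xi,\xi\rangle$ for all $\xi\in\mathbb R^d$, $\mu$-a.e. $x\in K$. $B=(B_1,\dots,B_d)\in L^2_{loc}(\mathbb R^d,\mathbb R^d,\mu)$ satisfies $\int\langle B,\nabla f\rangle\,d\mu=0$ for all $f\in C_0^\infty(\mathbb R^d)$,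 and there is a constant $c_B>0$ with $|\int\langle B,\nabla f\rangle g\,d\mu|\le c_B\,\mathcal E^{\widetilde A}_1(f,f)^{1/2}\mathcal E^{\widetilde A}_1(g,g)^{1/2}$ for all $f,g\in C_0^\infty(\mathbb R^d)$, where $\mathcal E^{\widetilde A}(f,g)=\int\langle\widetilde A\nabla f,\nabla g\rangle\,d\mu$ and $\mathcal E^{\widetilde A}_1(f,g)=\mathcal E^{\widetilde A}(f,g)+\int fg\,d\mu$. $\mathcal E^{A,B}(f,g)=\int\langle A\nabla f,\nabla g\rangle\,d\mu-\int\langle B,\nabla f\rangle g\,d\mu$, $f,g\in C_0^\infty(\mathbb R^d)$, with the convention $\langle A\nabla f,\nabla g\rangle=\sum_{i,j}a_{ij}\,\partial_if\,\partial_jg$. It is closable on $L^2(\mathbb R^d,\mu)$ and its closure $(\mathcal E^{A,B},\mathcal F)$ is a non-symmetric (sectorial) regular Dirichlet form; $(T_t)_{t>0}$ is its semigroup (resolvent given by $\mathcal E^{A,B}(G_\alpha f,g)+\alpha(G_\alpha f,g)_{L^2(\mu)}=(f,g)_{L^2(\mu)}$, $g\in\mathcal F$). The vector field $\beta=(\beta_1,\dots,\beta_d)\in L^2_{loc}(\mathbb R^d,\mathbb R^d,\mu)$ is $$\beta_i=B_i+\sum_{j=1}^d\Bigl(\partial_j\check a_{ij}+\check a_{ij}\frac{2\partial_j\varphi}{\varphi}\Bigr),$$ so that $\mathcal E^{A,B}(f,g)=\mathcal E^{\widetilde A}(f,g)-\int\langle\beta,\nabla f\rangle g\,d\mu$ for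 $f,g\in C_0^\infty(\mathbb R^d)$. With $E_r=\{x\in\mathbb R^d:|x|<r\}$, $$\widehat A_n(\phi)=(\sqrt{a_n}+b_n)\,\mu(E_{4n}\setminus E_{2n})^{1/2}+\Bigl\|\frac{\langle\beta(x),x\rangle}{|x|}\Bigr\|_{L^2(E_{4n}\setminus E_{2n},\mu)},$$ $$a_n=\operatorname*{ess\,sup}_{x\in E_{4n}\setminus E_{2n}}\frac{\langle\widetilde A(x)x,x\rangle}{|x|^2},\qquad b_n=\operatorname*{ess\,sup}_{x\in E_{4n}\setminus E_{2n}}\phi'(|x|)\frac{\langle\widetilde A(x)x,x\rangle}{|x|^2}.$$ $T_t$ is extended to $L^\infty(\mathbb R^d,\mu)$ by monotone approximation from $L^2\cap L^\infty$; $(T_t)_{t>0}$ is conservative if $T_t1=1$ $\mu$-a.e. for some (equivalently any) $t>0$. *)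

theory Defs
  imports "HOL-Analysis.Analysis" "HOL-Probability.Essential_Supremum"
begin

section \<open>Test functions\<close>

definition partial_deriv :: "'n::finite \<Rightarrow> (real^'n \<Rightarrow> real) \<Rightarrow> real^'n \<Rightarrow> real" where
  "partial_deriv i f x = frechet_derivative f (at x) (axis i 1)"

definition grad :: "(real^'n::finite \<Rightarrow> real) \<Rightarrow> real^'n \<Rightarrow> real^'n" where
  "grad f x = (\<chi> i. partial_deriv i f x)"

text \<open>Smoothness: all iterated partial derivatives exist and are (totally) differentiable
  everywhere; in particular they are all continuous.\<close>

definition smooth_fun :: "(real^'n::finite \<Rightarrow> real) \<Rightarrow> bool" where
  "smooth_fun f \<longleftrightarrow> (\<forall>is. fold partial_deriv is f differentiable_on UNIV)"

definition test_fun :: "(real^'n::finite \<Rightarrow> real) \<Rightarrow> bool" where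
  "test_fun f \<longleftrightarrow> smooth_fun f \<and> compact (closure {x. f x \<noteq> 0})"


section \<open>Function spaces\<close>

text \<open>Elements of \<open>L\<^sup>2\<close> are represented by functions; every notion below is invariant under
  changes on null sets.\<close>

definition L2 :: "'a measure \<Rightarrow> ('a \<Rightarrow> 'b::{banach,second_countable_topology}) \<Rightarrow> bool" where
  "L2 M f \<longleftrightarrow> f \<in> borel_measurable M \<and> integrable M (\<lambda>x. (norm (f x))\<^sup>2)"

definition L2_norm :: "'a measure \<Rightarrow> ('a \<Rightarrow> 'b::{banach,second_countable_topology}) \<Rightarrow> real" where
  "L2_norm M f = sqrt (\<integral>x. (norm (f x))\<^sup>2 \<partial>M)"

definition L2_inner :: "'a measure \<Rightarrow> ('a \<Rightarrow> real) \<Rightarrow> ('a \<Rightarrow> real) \<Rightarrow> real" where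
  "L2_inner M f g = (\<integral>x. f x * g x \<partial>M)"

definition L1_loc :: "(real^'n::finite) measure \<Rightarrow> (real^'n \<Rightarrow> real) \<Rightarrow> bool" where
  "L1_loc M f \<longleftrightarrow> f \<in> borel_measurable M \<and> (\<forall>K. compact K \<longrightarrow> set_integrable M K f)"

definition L2_loc ::
    "(real^'n::finite) measure \<Rightarrow> (real^'n \<Rightarrow> 'b::{banach,second_countable_topology}) \<Rightarrow> bool" where
  "L2_loc M f \<longleftrightarrow>
     f \<in> borel_measurable M \<and> (\<forall>K. compact K \<longrightarrow> set_integrable M K (\<lambda>x. (norm (f x))\<^sup>2))"

definition Linf_loc :: "(real^'n::finite) set \<Rightarrow> (real^'n) measure \<Rightarrow> (real^'n \<Rightarrow> real) \<Rightarrow> bool" where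
  "Linf_loc U M f \<longleftrightarrow> set_borel_measurable M U f \<and>
     (\<forall>K. compact K \<and> K \<subseteq> U \<longrightarrow> (\<exists>c. AE x in M. x \<in> K \<longrightarrow> \<bar>f x\<bar> \<le> c))"

text \<open>\<open>f\<close> lies in the closure \<open>H\<^sup>1\<^sup>,\<^sup>2(M)\<close> of the test functions and has gradient \<open>G\<close> there. With
  \<open>M = lborel\<close> this is the usual Sobolev space.\<close>

definition H12_grad ::
    "(real^'n::finite) measure \<Rightarrow> (real^'n \<Rightarrow> real) \<Rightarrow> (real^'n \<Rightarrow> real^'n) \<Rightarrow> bool" where
  "H12_grad M f G \<longleftrightarrow> L2 M f \<and> L2 M G \<and>
     (\<exists>u. (\<forall>n. test_fun (u n)) \<and>
          (\<lambda>n::nat. L2_norm M (\<lambda>x. u n x - f x)) \<longlonglongrightarrow> 0 \<and>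
          (\<lambda>n::nat. L2_norm M (\<lambda>x. grad (u n) x - G x)) \<longlonglongrightarrow> 0)"

definition H12 :: "(real^'n::finite) measure \<Rightarrow> (real^'n \<Rightarrow> real) \<Rightarrow> bool" where
  "H12 M f \<longleftrightarrow> (\<exists>G. H12_grad M f G)"

definition H12_loc :: "(real^'n::finite) measure \<Rightarrow> (real^'n \<Rightarrow> real) \<Rightarrow> bool" where
  "H12_loc M f \<longleftrightarrow> (\<forall>\<zeta>. test_fun \<zeta> \<longrightarrow> H12 M (\<lambda>x. f x * \<zeta> x))"

text \<open>\<open>G\<close> is (a version of) the gradient of \<open>f \<in> H\<^sup>1\<^sup>,\<^sup>2\<^sub>l\<^sub>o\<^sub>c(M)\<close>: it agrees with the gradient of
  \<open>f \<zeta>\<close> wherever \<open>\<zeta> = 1\<close> near the point, by the product rule below.\<close>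

definition H12_loc_grad ::
    "(real^'n::finite) measure \<Rightarrow> (real^'n \<Rightarrow> real) \<Rightarrow> (real^'n \<Rightarrow> real^'n) \<Rightarrow> bool" where
  "H12_loc_grad M f G \<longleftrightarrow>
     (\<forall>\<zeta>. test_fun \<zeta> \<longrightarrow> H12_grad M (\<lambda>x. f x * \<zeta> x) (\<lambda>x. \<zeta> x *\<^sub>R G x + f x *\<^sub>R grad \<zeta> x))"


section \<open>The bilinear form\<close>

definition weighted :: "(real^'n::finite \<Rightarrow> real) \<Rightarrow> (real^'n) measure" where
  "weighted \<phi> = density lborel (\<lambda>x. ennreal ((\<phi> x)\<^sup>2))"

definition sym_part :: "(real^'n::finite \<Rightarrow> real^'n^'n) \<Rightarrow> real^'n \<Rightarrow> real^'n^'n" where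
  "sym_part A x = (\<chi> i j. (A x $ i $ j + A x $ j $ i) / 2)"

definition skew_part :: "(real^'n::finite \<Rightarrow> real^'n^'n) \<Rightarrow> real^'n \<Rightarrow> real^'n^'n" where
  "skew_part A x = (\<chi> i j. (A x $ i $ j - A x $ j $ i) / 2)"

text \<open>The index convention matters for non-symmetric matrices.\<close>

definition bil :: "real^'n::finite^'n \<Rightarrow> real^'n \<Rightarrow> real^'n \<Rightarrow> real" where
  "bil m \<xi> \<eta> = (\<Sum>i\<in>UNIV. \<Sum>j\<in>UNIV. m $ i $ j * \<xi> $ i * \<eta> $ j)"

definition energy ::
    "(real^'n::finite) measure \<Rightarrow> (real^'n \<Rightarrow> real^'n^'n) \<Rightarrow>
     (real^'n \<Rightarrow> real) \<Rightarrow> (real^'n \<Rightarrow> real) \<Rightarrow> real" where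
  "energy M A f g = (\<integral>x. bil (A x) (grad f x) (grad g x) \<partial>M)"

definition energy1 ::
    "(real^'n::finite) measure \<Rightarrow> (real^'n \<Rightarrow> real^'n^'n) \<Rightarrow>
     (real^'n \<Rightarrow> real) \<Rightarrow> (real^'n \<Rightarrow> real) \<Rightarrow> real" where
  "energy1 M A f g = energy M A f g + L2_inner M f g"

definition form ::
    "(real^'n::finite) measure \<Rightarrow> (real^'n \<Rightarrow> real^'n^'n) \<Rightarrow> (real^'n \<Rightarrow> real^'n) \<Rightarrow>
     (real^'n \<Rightarrow> real) \<Rightarrow> (real^'n \<Rightarrow> real) \<Rightarrow> real" where
  "form M A B f g = energy M A f g - (\<integral>x. (B x \<bullet> grad f x) * g x \<partial>M)"

text \<open>The closure of a form \<open>Q\<close> given on test functions: its domain consists of the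
  \<open>L\<^sup>2\<close>-limits of \<open>Q\<close>-Cauchy sequences, and its values are the limits along such sequences.\<close>

definition form_approx ::
    "(real^'n::finite) measure \<Rightarrow> ((real^'n \<Rightarrow> real) \<Rightarrow> (real^'n \<Rightarrow> real) \<Rightarrow> real) \<Rightarrow>
     (real^'n \<Rightarrow> real) \<Rightarrow> (nat \<Rightarrow> real^'n \<Rightarrow> real) \<Rightarrow> bool" where
  "form_approx M Q f u \<longleftrightarrow> L2 M f \<and> (\<forall>n. test_fun (u n)) \<and>
     (\<lambda>n. L2_norm M (\<lambda>x. u n x - f x)) \<longlonglongrightarrow> 0 \<and>
     (\<forall>e>0. \<exists>N. \<forall>m\<ge>N. \<forall>n\<ge>N. Q (\<lambda>x. u m x - u n x) (\<lambda>x. u m x - u n x) < e)"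

definition form_domain ::
    "(real^'n::finite) measure \<Rightarrow> ((real^'n \<Rightarrow> real) \<Rightarrow> (real^'n \<Rightarrow> real) \<Rightarrow> real) \<Rightarrow>
     (real^'n \<Rightarrow> real) set" where
  "form_domain M Q = {f. \<exists>u. form_approx M Q f u}"

definition closure_has_value ::
    "(real^'n::finite) measure \<Rightarrow> ((real^'n \<Rightarrow> real) \<Rightarrow> (real^'n \<Rightarrow> real) \<Rightarrow> real) \<Rightarrow>
     (real^'n \<Rightarrow> real) \<Rightarrow> (real^'n \<Rightarrow> real) \<Rightarrow> real \<Rightarrow> bool" where
  "closure_has_value M Q f g c \<longleftrightarrow> f \<in> form_domain M Q \<and> g \<in> form_domain M Q \<and>
     (\<forall>u v. form_approx M Q f u \<and> form_approx M Q g v \<longrightarrow> (\<lambda>n. Q (u n) (v n)) \<longlonglongrightarrow> c)"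


section \<open>The semigroup\<close>

definition contraction_semigroup ::
    "'a measure \<Rightarrow> (real \<Rightarrow> ('a \<Rightarrow> real) \<Rightarrow> 'a \<Rightarrow> real) \<Rightarrow> bool" where
  "contraction_semigroup M T \<longleftrightarrow>
     (\<forall>t>0. \<forall>f. L2 M f \<longrightarrow> L2 M (T t f) \<and> L2_norm M (T t f) \<le> L2_norm M f) \<and>
     (\<forall>t>0. \<forall>f g a b. L2 M f \<and> L2 M g \<longrightarrow>
        (AE x in M. T t (\<lambda>y. a * f y + b * g y) x = a * T t f x + b * T t g x)) \<and>
     (\<forall>s>0. \<forall>t>0. \<forall>f. L2 M f \<longrightarrow> (AE x in M. T (s + t) f x = T s (T t f) x)) \<and>
     (\<forall>f. L2 M f \<longrightarrow> ((\<lambda>t. L2_norm M (\<lambda>x. T t f x - f x)) \<longlongrightarrow> 0) (at_right 0))"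

text \<open>\<open>u\<close> is the resolvent \<open>\<integral>\<^sub>0\<^sup>\<infinity> exp (-\<alpha> t) T\<^sub>t f dt\<close>, the \<open>L\<^sup>2\<close>-valued integral being taken weakly.\<close>

definition is_resolvent ::
    "'a measure \<Rightarrow> (real \<Rightarrow> ('a \<Rightarrow> real) \<Rightarrow> 'a \<Rightarrow> real) \<Rightarrow> real \<Rightarrow>
     ('a \<Rightarrow> real) \<Rightarrow> ('a \<Rightarrow> real) \<Rightarrow> bool" where
  "is_resolvent M T \<alpha> f u \<longleftrightarrow> L2 M u \<and>
     (\<forall>h. L2 M h \<longrightarrow>
        L2_inner M u h = (LINT t:{0<..}|lborel. exp (- \<alpha> * t) * L2_inner M (T t f) h))"

definition semigroup_of_form ::
    "(real^'n::finite) measure \<Rightarrow> ((real^'n \<Rightarrow> real) \<Rightarrow> (real^'n \<Rightarrow> real) \<Rightarrow> real) \<Rightarrow>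
     (real \<Rightarrow> (real^'n \<Rightarrow> real) \<Rightarrow> real^'n \<Rightarrow> real) \<Rightarrow> bool" where
  "semigroup_of_form M Q T \<longleftrightarrow> contraction_semigroup M T \<and>
     (\<forall>\<alpha>>0. \<forall>f. L2 M f \<longrightarrow>
        (\<exists>u. is_resolvent M T \<alpha> f u \<and> u \<in> form_domain M Q \<and>
             (\<forall>g\<in>form_domain M Q.
                closure_has_value M Q u g (L2_inner M f g - \<alpha> * L2_inner M u g))))"

definition monotone_approx ::
    "'a measure \<Rightarrow> ('a \<Rightarrow> real) \<Rightarrow> (nat \<Rightarrow> 'a \<Rightarrow> real) \<Rightarrow> bool" where
  "monotone_approx M f g \<longleftrightarrow> (\<forall>n. L2 M (g n)) \<and>
     (AE x in M. (\<forall>n. 0 \<le> g n x) \<and> incseq (\<lambda>n. g n x) \<and> (\<lambda>n. g n x) \<longlonglongrightarrow> f x)"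

text \<open>\<open>h\<close> is the value at a nonnegative bounded \<open>f\<close> of the extension of \<open>S\<close> from \<open>L\<^sup>2 \<inter> L\<^sup>\<infinity>\<close>
  to \<open>L\<^sup>\<infinity>\<close>. The approximating functions are bounded by \<open>f\<close>, hence in \<open>L\<^sup>\<infinity>\<close>.\<close>

definition Linf_extension ::
    "'a measure \<Rightarrow> (('a \<Rightarrow> real) \<Rightarrow> 'a \<Rightarrow> real) \<Rightarrow> ('a \<Rightarrow> real) \<Rightarrow> ('a \<Rightarrow> real) \<Rightarrow> bool" where
  "Linf_extension M S f h \<longleftrightarrow> (\<exists>g. monotone_approx M f g) \<and>
     (\<forall>g. monotone_approx M f g \<longrightarrow> (AE x in M. (\<lambda>n. S (g n) x) \<longlonglongrightarrow> h x))"

definition conservative ::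
    "'a measure \<Rightarrow> (real \<Rightarrow> ('a \<Rightarrow> real) \<Rightarrow> 'a \<Rightarrow> real) \<Rightarrow> bool" where
  "conservative M T \<longleftrightarrow> (\<forall>t>0. Linf_extension M (T t) (\<lambda>_. 1) (\<lambda>_. 1))"


section \<open>Drift and growth quantities\<close>

text \<open>\<open>D\<phi>\<close> and \<open>Da i j\<close> stand for the gradients of \<open>\<phi>\<close> and of the \<open>(i, j)\<close> entry of the
  antisymmetric part of \<open>A\<close>.\<close>

definition drift ::
    "(real^'n::finite \<Rightarrow> real) \<Rightarrow> (real^'n \<Rightarrow> real^'n) \<Rightarrow>
     (real^'n \<Rightarrow> real^'n^'n) \<Rightarrow> ('n \<Rightarrow> 'n \<Rightarrow> real^'n \<Rightarrow> real^'n) \<Rightarrow>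
     (real^'n \<Rightarrow> real^'n) \<Rightarrow> real^'n \<Rightarrow> real^'n" where
  "drift \<phi> D\<phi> A Da B x =
     (\<chi> i. B x $ i + (\<Sum>j\<in>UNIV. Da i j x $ j + skew_part A x $ i $ j * (2 * D\<phi> x $ j / \<phi> x)))"

definition annulus :: "nat \<Rightarrow> (real^'n::finite) set" where
  "annulus n = ball 0 (real (4 * n)) - ball 0 (real (2 * n))"

text \<open>The conversion sends infinite essential suprema to \<open>0\<close>. It is only applied to functions that
  are locally bounded off a compact set, over annuli that avoid this set once \<open>n\<close> is large.\<close>

definition esssup_on :: "'a measure \<Rightarrow> 'a set \<Rightarrow> ('a \<Rightarrow> real) \<Rightarrow> real" where
  "esssup_on M S f = real_of_ereal (esssup (restrict_space M S) (\<lambda>x. ereal (f x)))"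

definition radial_coeff :: "(real^'n::finite \<Rightarrow> real^'n^'n) \<Rightarrow> real^'n \<Rightarrow> real" where
  "radial_coeff A x = bil (sym_part A x) x x / (norm x)\<^sup>2"

definition A_hat ::
    "(real^'n::finite) measure \<Rightarrow> (real^'n \<Rightarrow> real^'n^'n) \<Rightarrow> (real^'n \<Rightarrow> real^'n) \<Rightarrow>
     (real \<Rightarrow> real) \<Rightarrow> nat \<Rightarrow> real" where
  "A_hat M A \<beta> \<psi> n =
     (sqrt (esssup_on M (annulus n) (radial_coeff A)) +
      esssup_on M (annulus n) (\<lambda>x. deriv \<psi> (norm x) * radial_coeff A x)) *
       sqrt (measure M (annulus n)) +
     L2_norm (restrict_space M (annulus n)) (\<lambda>x. (\<beta> x \<bullet> x) / norm x)"

end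

theory Submission
  imports Defs "HOL-Computational_Algebra.Polynomial" "HOL-Probability.Sinc_Integral"
begin

text \<open>Let \<open>\<zeta>\<close> be a cutoff equal to 1 on the ball of radius \<open>2n\<close> and \<open>w = T\<^sub>t \<zeta> - \<zeta>\<close>. Test the
  equation of \<open>w\<close> with \<open>exp (- 2 c(t) \<theta>) w\<close>, where \<open>\<theta>\<close> is a smooth truncation of \<open>log (|x| + 1)\<close>, constant
  near \<open>K\<close> and beyond radius \<open>2n\<close>, and \<open>c(t)\<close> increases from \<open>c0 > \<alpha> C\<close> to \<open>c1 < C\<close>. The logarithmic
  bound makes \<open>c' \<theta>\<close> absorb \<open>\<langle>A c \<nabla>\<theta>, c \<nabla>\<theta>\<rangle> + \<langle>\<beta>, c \<nabla>\<theta>\<rangle>\<close>, and what remains is supported in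
  the annulus, where it is at most \<open>exp (- 2 c0 \<theta>)\<close> times the square of \<open>A_hat / n\<close> and tends to 0.
  Hence \<open>T\<^sub>t \<zeta> \<rightarrow> 1\<close> locally in \<open>L\<^sup>2\<close> for small \<open>t\<close>; the sub-Markov property turns this into
  \<open>T\<^sub>t 1 = 1\<close>, and the semigroup law removes the restriction on \<open>t\<close>. The estimate runs along
  \<open>\<lambda> G\<^sub>\<lambda> T\<^sub>t \<zeta>\<close>, which lies in the form domain and is Lipschitz in \<open>t\<close>, and then \<open>\<lambda> \<rightarrow> \<infinity>\<close>.\<close>

section \<open>Smooth functions of one real variable\<close>

text \<open>The growth hypothesis bounds only a combination of diffusion and drift; neither term is
  controlled alone. For radial \<theta>, c^2 a(grad \<theta>, grad \<theta>) + c <\<beta>, grad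
  \<theta>> is therefore compared with a nonnegative multiple of that combination: the drift terms
  match exactly, and the diffusion term is dominated as long as c stays a little below C and |x| is
  large. On the other side, exp (-2 c0 \<theta>) is at most a constant times n^(-2 c0) on the
  annulus and has to beat the square of (n+1)^(\<alpha> C). Both demands fit because \<alpha> < 1,
  and the exponent needs only a time \<open>t0\<close>, independent of n, to travel from c0 to c1.
  The gradients of \<theta> and \<zeta> never meet, so no mixed term of the two arises. The drift
  terms without a sign are exact: they have the form <\<beta>, grad h>, and \<beta> is
  divergence-free with respect to \<mu>, by integration by parts and the antisymmetry of the skew
  part. As the semigroup is only strongly continuous in time, derivatives are taken, at fixed
  \<lambda>, of scalar products and of functionals whose remainder is quadratic.\<close>

fun cont_diff :: "nat \<Rightarrow> (real \<Rightarrow> real) \<Rightarrow> bool" where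
  "cont_diff 0 F \<longleftrightarrow> F differentiable_on UNIV"
| "cont_diff (Suc k) F \<longleftrightarrow> (\<exists>F'. (\<forall>x. (F has_real_derivative F' x) (at x)) \<and> cont_diff k F')"

definition smooth_real :: "(real \<Rightarrow> real) \<Rightarrow> bool" where
  "smooth_real F \<longleftrightarrow> (\<forall>k. cont_diff k F)"

lemma cont_diff_differentiable: "cont_diff k F \<Longrightarrow> F differentiable (at x)"
  by (cases k) (auto simp: differentiable_on_def real_differentiable_def)

lemma cont_diff_Suc_imp: "cont_diff (Suc k) F \<Longrightarrow> cont_diff k F"
proof (induction k arbitrary: F)
  case 0
  then show ?case by (auto simp: differentiable_on_def real_differentiable_def)
next
  case (Suc k)
  then show ?case by (metis cont_diff.simps(2))
qed

lemma cont_diff_const: "cont_diff k (\<lambda>x. c)"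
proof (induction k arbitrary: c)
  case (Suc k)
  then show ?case by (auto intro!: exI[of _ "\<lambda>_. 0"])
qed simp

lemma cont_diff_affine: "cont_diff k (\<lambda>x. a * x + b)"
proof (cases k)
  case 0
  have "(\<lambda>x. a * x + b) differentiable at x" for x
    unfolding real_differentiable_def by (intro exI) (auto intro!: derivative_eq_intros)
  with 0 show ?thesis by (auto simp: differentiable_on_def)
next
  case (Suc j)
  show ?thesis unfolding Suc cont_diff.simps
    by (intro exI[of _ "\<lambda>_. a"] conjI allI cont_diff_const) (auto intro!: derivative_eq_intros)
qed

lemma cont_diff_add: "cont_diff k F \<Longrightarrow> cont_diff k G \<Longrightarrow> cont_diff k (\<lambda>x. F x + G x)"
proof (induction k arbitrary: F G)
  case 0
  then show ?case by (auto intro!: derivative_intros)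
next
  case (Suc k)
  then obtain F' G' where "\<forall>x. (F has_real_derivative F' x) (at x)" "cont_diff k F'"
    "\<forall>x. (G has_real_derivative G' x) (at x)" "cont_diff k G'" by auto
  then show ?case
    by (auto intro!: exI[of _ "\<lambda>x. F' x + G' x"] Suc.IH derivative_intros)
qed

lemma cont_diff_mult: "cont_diff k F \<Longrightarrow> cont_diff k G \<Longrightarrow> cont_diff k (\<lambda>x. F x * G x)"
proof (induction k arbitrary: F G)
  case 0
  then show ?case by (auto intro!: derivative_intros)
next
  case (Suc k)
  then obtain F' G' where F': "\<And>x. (F has_real_derivative F' x) (at x)" "cont_diff k F'"
    and G': "\<And>x. (G has_real_derivative G' x) (at x)" "cont_diff k G'" by auto
  have FG: "cont_diff k F" "cont_diff k G" using Suc.prems cont_diff_Suc_imp by blast+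
  show ?case
    unfolding cont_diff.simps
    by (rule exI[of _ "\<lambda>x. F' x * G x + G' x * F x"])
       (auto intro!: cont_diff_add Suc.IH F' G' FG DERIV_mult)
qed

lemma cont_diff_affine_compose: "cont_diff k F \<Longrightarrow> cont_diff k (\<lambda>x. F (a * x + b))"
proof (induction k arbitrary: F)
  case 0
  have "(\<lambda>x. F (a * x + b)) differentiable at x" for x
  proof -
    have "F differentiable at (a * x + b)" using 0 by (auto simp: differentiable_on_def)
    moreover have "(\<lambda>x. a * x + b) differentiable at x"
      using cont_diff_affine cont_diff_differentiable by blast
    ultimately show ?thesis
      using differentiable_chain_at[of "\<lambda>x. a * x + b" x F] by (simp add: o_def)
  qed
  then show ?case by (auto simp: differentiable_on_def)
next
  case (Suc k)
  then obtain F' where F': "\<And>x. (F has_real_derivative F' x) (at x)" "cont_diff k F'" by auto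
  have "((\<lambda>x. F (a * x + b)) has_real_derivative F' (a * x + b) * a) (at x)" for x
    by (rule DERIV_chain2[where f=F], rule F'(1)) (auto intro!: derivative_eq_intros)
  moreover have "cont_diff k (\<lambda>x. F' (a * x + b) * a)"
    by (intro cont_diff_mult cont_diff_const Suc.IH F')
  ultimately show ?case
    unfolding cont_diff.simps by (intro exI[of _ "\<lambda>x. F' (a * x + b) * a"]) auto
qed

lemma smooth_real_const: "smooth_real (\<lambda>x. c)"
  and smooth_real_affine: "smooth_real (\<lambda>x. a * x + b)"
  and smooth_real_add: "smooth_real F \<Longrightarrow> smooth_real G \<Longrightarrow> smooth_real (\<lambda>x. F x + G x)"
  and smooth_real_mult: "smooth_real F \<Longrightarrow> smooth_real G \<Longrightarrow> smooth_real (\<lambda>x. F x * G x)"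
  and smooth_real_affine_compose: "smooth_real F \<Longrightarrow> smooth_real (\<lambda>x. F (a * x + b))"
  by (auto simp: smooth_real_def cont_diff_const cont_diff_affine cont_diff_add cont_diff_mult
      cont_diff_affine_compose)

lemma smooth_real_antideriv:
  assumes "\<And>x. (G has_real_derivative g x) (at x)" "smooth_real g"
  shows "smooth_real G"
  unfolding smooth_real_def
proof
  fix k
  have "cont_diff (Suc k) G" using assms by (auto simp: smooth_real_def)
  then show "cont_diff k G" by (rule cont_diff_Suc_imp)
qed

lemma smooth_real_exp: "smooth_real exp"
proof -
  have "cont_diff k exp" for k
    by (induction k) (auto intro!: exI[of _ exp] derivative_eq_intros DERIV_exp
        simp: differentiable_on_def real_differentiable_def)
  then show ?thesis by (simp add: smooth_real_def)
qed

lemma mean_value_obtain: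
  fixes G :: "real \<Rightarrow> real"
  assumes "\<And>x. (G has_real_derivative g x) (at x)" "a < b"
  obtains z where "a < z" "z < b" "G b - G a = (b - a) * g z"
  using MVT2[OF assms(2), of G g] assms(1) by blast

lemma antideriv_ex:
  fixes g :: "real \<Rightarrow> real"
  assumes "continuous_on UNIV g"
  shows "\<exists>G. G 0 = 0 \<and> (\<forall>x. (G has_real_derivative g x) (at x))"
proof -
  have "\<exists>F. \<forall>x::real. -\<infinity> < ereal x \<longrightarrow> ereal x < \<infinity> \<longrightarrow> (F has_vector_derivative g x) (at x)"
    by (rule einterval_antiderivative)
       (use assms in \<open>auto simp: continuous_on_eq_continuous_at\<close>)
  then obtain F where "\<And>x. (F has_vector_derivative g x) (at x)" by auto
  then show ?thesis
    by (intro exI[of _ "\<lambda>x. F x - F 0"])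
       (auto simp: has_real_derivative_iff_has_vector_derivative intro!: derivative_eq_intros)
qed

subsection \<open>The smooth step\<close>

text \<open>Flat functions p(1/x) exp(-1/x), extended by 0. An induction on the order of
  differentiability needs the whole family over all polynomials p, since differentiation changes
  p.\<close>

definition poly_exp_inv :: "real poly \<Rightarrow> real \<Rightarrow> real" where
  "poly_exp_inv p x = (if x > 0 then poly p (inverse x) * exp (- inverse x) else 0)"

lemma poly_times_exp_neg_tendsto_0: "((\<lambda>y. poly p y * exp (- y)) \<longlongrightarrow> (0::real)) at_top"
proof -
  have "((\<lambda>y. \<Sum>i\<le>degree p. coeff p i * (y ^ i / exp y)) \<longlongrightarrow> (\<Sum>i\<le>degree p. coeff p i * 0)) at_top"
    by (intro tendsto_intros tendsto_power_div_exp_0)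
  moreover have "(\<Sum>i\<le>degree p. coeff p i * (y ^ i / exp y)) = poly p y * exp (- y)" for y
    by (simp add: poly_altdef sum_divide_distrib sum_distrib_right exp_minus divide_inverse mult.assoc)
  ultimately show ?thesis by simp
qed

text \<open>With y = 1/x the derivative of p(y) exp(-y) in x is y^2 (p(y) - p'(y)) exp(-y), and
  \<open>[:0,0,1:]\<close> is the factor y^2. At 0 the right difference quotient is y p(y) exp(-y),
  which tends to 0 as y grows.\<close>

lemma poly_exp_inv_deriv:
  "(poly_exp_inv p has_real_derivative poly_exp_inv ([:0,0,1:] * (p - pderiv p)) x) (at x)"
proof -
  consider "x > 0" | "x < 0" | "x = 0" by linarith
  then show ?thesis
  proof cases
    case 1
    have "((\<lambda>x. poly p (inverse x) * exp (- inverse x)) has_real_derivative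
        poly_exp_inv ([:0,0,1:] * (p - pderiv p)) x) (at x)"
      using 1 by (auto intro!: derivative_eq_intros DERIV_chain2[OF poly_DERIV]
          simp: poly_exp_inv_def algebra_simps power2_eq_square)
    moreover have "\<forall>\<^sub>F y in nhds x. y > 0" using 1 by (rule order_tendstoD[OF tendsto_ident_at[where s=UNIV, unfolded at_within_def]] | simp add: eventually_nhds_in_open[of "{0<..}", simplified])
    then have "\<forall>\<^sub>F y in nhds x. poly_exp_inv p y = poly p (inverse y) * exp (- inverse y)"
      by eventually_elim (simp add: poly_exp_inv_def)
    ultimately show ?thesis by (subst DERIV_cong_ev) auto
  next
    case 2
    have "\<forall>\<^sub>F y in nhds x. y < 0" using 2 eventually_nhds_in_open[of "{..<0}" x] by simp
    then have "\<forall>\<^sub>F y in nhds x. poly_exp_inv p y = 0"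
      by eventually_elim (simp add: poly_exp_inv_def)
    then show ?thesis using 2 by (subst DERIV_cong_ev[where g="\<lambda>_. 0"]) (auto simp: poly_exp_inv_def)
  next
    case 3
    have "((\<lambda>h. poly_exp_inv p h / h) \<longlongrightarrow> 0) (at_right 0)"
    proof -
      have "((\<lambda>h. poly ([:0,1:] * p) (inverse h) * exp (- inverse h)) \<longlongrightarrow> 0) (at_right (0::real))"
        by (rule filterlim_compose[OF poly_times_exp_neg_tendsto_0 filterlim_inverse_at_top_right])
      moreover have "\<forall>\<^sub>F h in at_right (0::real). poly ([:0,1:] * p) (inverse h) * exp (- inverse h) = poly_exp_inv p h / h"
        unfolding eventually_at_right_field by (intro exI[of _ 1]) (auto simp: poly_exp_inv_def field_simps)
      ultimately show ?thesis by (rule Lim_transform_eventually)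
    qed
    moreover have "((\<lambda>h. poly_exp_inv p h / h) \<longlongrightarrow> 0) (at_left 0)"
    proof (rule Lim_transform_eventually[OF tendsto_const])
      show "\<forall>\<^sub>F h in at_left (0::real). 0 = poly_exp_inv p h / h"
        unfolding eventually_at_left_field by (intro exI[of _ "-1"]) (auto simp: poly_exp_inv_def)
    qed
    ultimately have "((\<lambda>h. poly_exp_inv p h / h) \<longlongrightarrow> 0) (at 0)" by (simp add: filterlim_split_at)
    then show ?thesis using 3 by (simp add: DERIV_def poly_exp_inv_def)
  qed
qed

lemma smooth_real_poly_exp_inv: "smooth_real (poly_exp_inv p)"
proof -
  have "cont_diff k (poly_exp_inv p)" for k
  proof (induction k arbitrary: p)
    case 0
    then show ?case using poly_exp_inv_deriv
      by (auto simp: differentiable_on_def real_differentiable_def)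
  next
    case (Suc k)
    then show ?case using poly_exp_inv_deriv by (auto intro!: exI)
  qed
  then show ?thesis by (simp add: smooth_real_def)
qed

lemma smooth_real_continuous_on: "smooth_real F \<Longrightarrow> continuous_on S F"
  by (metis cont_diff_differentiable continuous_on_eq_continuous_at continuous_on_subset
      differentiable_imp_continuous_within open_UNIV smooth_real_def subset_UNIV)

text \<open>One normalised bump S' supplies every auxiliary function: the step S for cutoffs, with L
  bounding their gradients; P, a smooth positive part, for truncation and as a normal contraction;
  and Q, whose strict positivity on the right half-line detects values above a threshold.\<close>

lemma smooth_step_ex:
  "\<exists>S' S P Q :: real \<Rightarrow> real. \<exists>L.
     smooth_real S \<and> smooth_real P \<and> smooth_real Q \<and>
     (\<forall>x. (S has_real_derivative S' x) (at x)) \<and>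
     (\<forall>x. (P has_real_derivative S x) (at x)) \<and>
     (\<forall>x. (Q has_real_derivative P x) (at x)) \<and>
     (\<forall>x. 0 \<le> S' x \<and> S' x \<le> L) \<and> (\<forall>x\<le>0. S' x = 0) \<and> (\<forall>x\<ge>1. S' x = 0) \<and>
     (\<forall>x\<le>0. S x = 0 \<and> P x = 0 \<and> Q x = 0) \<and> (\<forall>x\<ge>1. S x = 1) \<and>
     (\<forall>x>0. 0 < Q x)"
proof -
  define b where "b = (\<lambda>x. poly_exp_inv 1 x * poly_exp_inv 1 ((-1) * x + 1))"
  have b_smooth: "smooth_real b" unfolding b_def
    by (intro smooth_real_mult smooth_real_affine_compose smooth_real_poly_exp_inv)
  have b_nonneg: "0 \<le> b x" for x by (simp add: b_def poly_exp_inv_def)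
  have b_pos: "0 < b x" if "0 < x" "x < 1" for x using that by (simp add: b_def poly_exp_inv_def)
  have b_0: "b x = 0" if "x \<le> 0 \<or> x \<ge> 1" for x using that by (auto simp: b_def poly_exp_inv_def)
  have b_le: "b x \<le> 1" for x
  proof -
    have "poly_exp_inv 1 y \<le> 1" "0 \<le> poly_exp_inv 1 y" for y by (auto simp: poly_exp_inv_def)
    then show ?thesis unfolding b_def by (intro mult_le_one) auto
  qed
  obtain G where G: "G 0 = 0" "\<And>x. (G has_real_derivative b x) (at x)"
    using antideriv_ex smooth_real_continuous_on[OF b_smooth] by metis
  have G_neg: "G x = 0" if "x \<le> 0" for x
  proof (cases "x = 0")
    case False
    then obtain z where "x < z" "z < 0" "G 0 - G x = (0 - x) * b z"
      using mean_value_obtain[OF G(2), of x 0] \<open>x \<le> 0\<close> by (auto simp del: diff_0)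
    then show ?thesis using b_0[of z] G(1) by simp
  qed (simp add: G)
  have G_ge1: "G x = G 1" if "1 \<le> x" for x
  proof (cases "x = 1")
    case False
    then obtain z where "1 < z" "z < x" "G x - G 1 = (x - 1) * b z"
      using mean_value_obtain[OF G(2), of 1 x] \<open>1 \<le> x\<close> by auto
    then show ?thesis using b_0[of z] by simp
  qed simp
  have G_pos: "0 < G x" if "0 < x" for x
  proof -
    obtain z where z: "0 < z" "z < min x 1" "G (min x 1) - G 0 = (min x 1 - 0) * b z"
      using mean_value_obtain[OF G(2), of 0 "min x 1"] \<open>0 < x\<close> by auto
    have "G (min x 1) > 0" using z b_pos[of z] G(1) that by (auto simp: min_def split: if_splits)
    moreover have "G x = G (min x 1)" using G_ge1[of x] by (auto simp: min_def)
    ultimately show ?thesis by simp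
  qed
  define S where "S = (\<lambda>x. G x / G 1)"
  define S' where "S' = (\<lambda>x. b x / G 1)"
  have G1: "G 1 > 0" using G_pos[of 1] by simp
  have S: "(S has_real_derivative S' x) (at x)" for x
    unfolding S_def S'_def using G(2) DERIV_cdivide by blast
  have S'_smooth: "smooth_real S'"
    using smooth_real_mult[OF b_smooth smooth_real_const[of "1 / G 1"]] by (simp add: S'_def)
  have S_smooth: "smooth_real S" using smooth_real_antideriv[OF S S'_smooth] .
  obtain P where P: "P 0 = 0" "\<And>x. (P has_real_derivative S x) (at x)"
    using antideriv_ex smooth_real_continuous_on[OF S_smooth] by metis
  have P_smooth: "smooth_real P" using smooth_real_antideriv[OF P(2) S_smooth] .
  obtain Q where Q: "Q 0 = 0" "\<And>x. (Q has_real_derivative P x) (at x)"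
    using antideriv_ex smooth_real_continuous_on[OF P_smooth] by metis
  have Q_smooth: "smooth_real Q" using smooth_real_antideriv[OF Q(2) P_smooth] .
  have S_neg: "S x = 0" if "x \<le> 0" for x using G_neg that by (simp add: S_def)
  have P_neg: "P x = 0" if "x \<le> 0" for x
  proof (cases "x = 0")
    case False
    then obtain z where "x < z" "z < 0" "P 0 - P x = (0 - x) * S z"
      using mean_value_obtain[OF P(2), of x 0] \<open>x \<le> 0\<close> by (auto simp del: diff_0)
    then show ?thesis using S_neg[of z] P(1) by simp
  qed (simp add: P)
  have Q_neg: "Q x = 0" if "x \<le> 0" for x
  proof (cases "x = 0")
    case False
    then obtain z where "x < z" "z < 0" "Q 0 - Q x = (0 - x) * P z"
      using mean_value_obtain[OF Q(2), of x 0] \<open>x \<le> 0\<close> by (auto simp del: diff_0)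
    then show ?thesis using P_neg[of z] Q(1) by simp
  qed (simp add: Q)
  have S_pos: "0 < S x" if "0 < x" for x using G_pos[OF that] G1 by (simp add: S_def)
  have P_pos: "0 < P x" if "0 < x" for x
  proof -
    obtain z where "0 < z" "z < x" "P x - P 0 = (x - 0) * S z"
      using mean_value_obtain[OF P(2), of 0 x] \<open>0 < x\<close> by auto
    then show ?thesis using S_pos[of z] P(1) that by simp
  qed
  have Q_pos: "0 < Q x" if "0 < x" for x
  proof -
    obtain z where "0 < z" "z < x" "Q x - Q 0 = (x - 0) * P z"
      using mean_value_obtain[OF Q(2), of 0 x] \<open>0 < x\<close> by auto
    then show ?thesis using P_pos[of z] Q(1) that by simp
  qed
  have "\<forall>x. 0 \<le> S' x \<and> S' x \<le> 1 / G 1"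
    using b_nonneg b_le G1 by (auto simp: S'_def divide_right_mono)
  moreover have "\<forall>x\<le>0. S' x = 0" "\<forall>x\<ge>1. S' x = 0" using b_0 by (auto simp: S'_def)
  moreover have "S x = 1" if "1 \<le> x" for x using G_ge1[OF that] G1 by (simp add: S_def)
  ultimately show ?thesis
    using S S_smooth P(2) P_smooth Q(2) Q_smooth S_neg P_neg Q_neg Q_pos
    by - (rule exI[of _ S'], rule exI[of _ S], rule exI[of _ P], rule exI[of _ Q],
          rule exI[of _ "1 / G 1"], blast)
qed

section \<open>Test functions\<close>

lemma has_derivative_grad:
  fixes f :: "real^'n::finite \<Rightarrow> real"
  assumes "f differentiable (at x)"
  shows "(f has_derivative (\<lambda>h. grad f x \<bullet> h)) (at x)"
proof -
  have D: "(f has_derivative frechet_derivative f (at x)) (at x)"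
    using assms frechet_derivative_works by blast
  then have lin: "linear (frechet_derivative f (at x))" by (rule has_derivative_linear)
  have "frechet_derivative f (at x) h = grad f x \<bullet> h" for h
  proof -
    have "frechet_derivative f (at x) h = frechet_derivative f (at x) (\<Sum>i\<in>UNIV. (h $ i) *\<^sub>R axis i 1)"
      using basis_expansion[of h] by (simp add: scalar_mult_eq_scaleR)
    also have "\<dots> = (\<Sum>i\<in>UNIV. h $ i * frechet_derivative f (at x) (axis i 1))"
      by (simp add: linear_sum[OF lin] linear_scale[OF lin])
    also have "\<dots> = grad f x \<bullet> h"
      by (simp add: grad_def partial_deriv_def inner_vec_def mult.commute)
    finally show ?thesis .
  qed
  then have "frechet_derivative f (at x) = (\<lambda>h. grad f x \<bullet> h)" by (rule ext)
  then show ?thesis using D by (simp only:)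
qed

lemma grad_eqI:
  assumes "(f has_derivative (\<lambda>h. G \<bullet> h)) (at x)"
  shows "grad f x = G"
  unfolding grad_def partial_deriv_def
  using frechet_derivative_at[OF assms, symmetric] by (simp add: vec_eq_iff inner_axis)

lemma partial_deriv_eq_grad: "partial_deriv i f x = grad f x $ i"
  by (simp add: grad_def)

text \<open>Smoothness graded by order, with plain differentiability at level 0 as in
  \<open>cont_diff\<close>. Products and compositions spend one order per derivative, so closure
  under them is an induction on the order with the functions arbitrary; the quantifier over index
  lists in \<open>smooth_fun\<close> has no such induction.\<close>

fun vec_diff :: "nat \<Rightarrow> (real^'n::finite \<Rightarrow> real) \<Rightarrow> bool" where
  "vec_diff 0 f \<longleftrightarrow> f differentiable_on UNIV"
| "vec_diff (Suc k) f \<longleftrightarrow> f differentiable_on UNIV \<and> (\<forall>i. vec_diff k (partial_deriv i f))"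

lemma vec_diff_iff:
  "vec_diff k f \<longleftrightarrow> (\<forall>is. length is \<le> k \<longrightarrow> fold partial_deriv is f differentiable_on UNIV)"
proof (induction k arbitrary: f)
  case (Suc k)
  show ?case
  proof
    assume L: "vec_diff (Suc k) f"
    show "\<forall>is. length is \<le> Suc k \<longrightarrow> fold partial_deriv is f differentiable_on UNIV"
    proof (intro allI impI)
      fix "is" :: "'a list" assume len: "length is \<le> Suc k"
      show "fold partial_deriv is f differentiable_on UNIV"
        using L len Suc.IH by (cases "is") auto
    qed
  next
    assume R: "\<forall>is. length is \<le> Suc k \<longrightarrow> fold partial_deriv is f differentiable_on UNIV"
    have "f differentiable_on UNIV" using R[rule_format, of "[]"] by simp
    moreover have "vec_diff k (partial_deriv i f)" for i
      unfolding Suc.IH using R by (metis Suc_le_mono fold_simps(2) length_Cons)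
    ultimately show "vec_diff (Suc k) f" by simp
  qed
qed simp

lemma smooth_fun_iff: "smooth_fun f \<longleftrightarrow> (\<forall>k. vec_diff k f)"
  unfolding smooth_fun_def vec_diff_iff by auto

lemma vec_diff_differentiable: "vec_diff k f \<Longrightarrow> f differentiable (at x)"
  by (cases k) (auto simp: differentiable_on_def)

lemma vec_diff_Suc_imp: "vec_diff (Suc k) f \<Longrightarrow> vec_diff k f"
  unfolding vec_diff_iff by auto

lemma smooth_fun_differentiable: "smooth_fun f \<Longrightarrow> f differentiable (at x)"
  using vec_diff_differentiable smooth_fun_iff by blast

lemma smooth_fun_partial_deriv: "smooth_fun f \<Longrightarrow> smooth_fun (partial_deriv i f)"
  by (metis smooth_fun_iff vec_diff.simps(2))

lemma grad_add:
  assumes "f differentiable (at x)" "g differentiable (at x)"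
  shows "grad (\<lambda>x. f x + g x) x = grad f x + grad g x"
  by (rule grad_eqI)
     (use has_derivative_add[OF assms[THEN has_derivative_grad]] in \<open>simp add: inner_add_left\<close>)

lemma grad_diff:
  assumes "f differentiable (at x)" "g differentiable (at x)"
  shows "grad (\<lambda>x. f x - g x) x = grad f x - grad g x"
  by (rule grad_eqI)
     (use has_derivative_diff[OF assms[THEN has_derivative_grad]] in \<open>simp add: inner_diff_left\<close>)

lemma grad_const: "grad (\<lambda>x. c) x = 0"
  by (rule grad_eqI) simp

lemma grad_mult:
  assumes "f differentiable (at x)" "g differentiable (at x)"
  shows "grad (\<lambda>x. f x * g x) x = f x *\<^sub>R grad g x + g x *\<^sub>R grad f x"
  by (rule grad_eqI)
     (use has_derivative_mult[OF assms[THEN has_derivative_grad]] in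
       \<open>simp add: inner_add_left mult.commute\<close>)

lemma grad_cmult:
  assumes "f differentiable (at x)"
  shows "grad (\<lambda>x. c * f x) x = c *\<^sub>R grad f x"
  using grad_mult[OF differentiable_const assms, of c] by (simp add: grad_const)

lemma grad_compose:
  assumes "f differentiable (at x)" "(F has_real_derivative D) (at (f x))"
  shows "grad (\<lambda>x. F (f x)) x = D *\<^sub>R grad f x"
  by (rule grad_eqI)
     (use has_derivative_compose[OF has_derivative_grad[OF assms(1)], of F "(*) D"] assms(2)
       in \<open>simp add: has_field_derivative_def\<close>)

lemma vec_diff_const: "vec_diff k (\<lambda>x::real^'n::finite. c)"
proof (induction k arbitrary: c)
  case (Suc k)
  moreover have "partial_deriv i (\<lambda>x::real^'n. c) = (\<lambda>x. 0)" for i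
    by (rule ext) (simp add: partial_deriv_eq_grad grad_const)
  ultimately show ?case by simp
qed simp

lemma vec_diff_add: "vec_diff k f \<Longrightarrow> vec_diff k g \<Longrightarrow> vec_diff k (\<lambda>x. f x + g x)"
proof (induction k arbitrary: f g)
  case 0
  then show ?case by (auto intro!: derivative_intros)
next
  case (Suc k)
  have "partial_deriv i (\<lambda>x. f x + g x) = (\<lambda>x. partial_deriv i f x + partial_deriv i g x)" for i
    using Suc.prems by (intro ext) (simp add: partial_deriv_eq_grad grad_add vec_diff_differentiable[of "Suc k"])
  then show ?case using Suc by (auto intro!: derivative_intros)
qed

lemma vec_diff_mult: "vec_diff k f \<Longrightarrow> vec_diff k g \<Longrightarrow> vec_diff k (\<lambda>x. f x * g x)"
proof (induction k arbitrary: f g)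
  case 0
  then show ?case by (auto intro!: derivative_intros)
next
  case (Suc k)
  have "partial_deriv i (\<lambda>x. f x * g x) = (\<lambda>x. f x * partial_deriv i g x + g x * partial_deriv i f x)" for i
    using Suc.prems by (intro ext) (simp add: partial_deriv_eq_grad grad_mult vec_diff_differentiable[of "Suc k"])
  moreover have "vec_diff k f" "vec_diff k g" using Suc.prems vec_diff_Suc_imp by blast+
  ultimately show ?case using Suc by (auto intro!: derivative_intros vec_diff_add)
qed

lemma vec_diff_compose: "cont_diff k F \<Longrightarrow> vec_diff k f \<Longrightarrow> vec_diff k (\<lambda>x. F (f x))"
proof (induction k arbitrary: F f)
  case 0
  have "(\<lambda>x. F (f x)) differentiable at x" for x
    using differentiable_chain_at[of f x F] 0 by (auto simp: differentiable_on_def o_def)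
  then show ?case by (auto simp: differentiable_on_def)
next
  case (Suc k)
  then obtain F' where F': "\<And>x. (F has_real_derivative F' x) (at x)" "cont_diff k F'" by auto
  have df: "f differentiable (at x)" for x using Suc.prems(2) vec_diff_differentiable by blast
  have "partial_deriv i (\<lambda>x. F (f x)) = (\<lambda>x. F' (f x) * partial_deriv i f x)" for i
    by (intro ext) (simp add: partial_deriv_eq_grad grad_compose[OF df F'(1)])
  moreover have "vec_diff k f" using Suc.prems vec_diff_Suc_imp by blast
  then have "vec_diff k (\<lambda>x. F' (f x) * partial_deriv i f x)" for i
    using Suc.prems(2) by (intro vec_diff_mult Suc.IH[OF F'(2)]) auto
  moreover have "F differentiable at y" for y using F'(1) by (auto simp: real_differentiable_def)
  then have "(\<lambda>x. F (f x)) differentiable at x" for x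
    using differentiable_chain_at[of f x F] df by (auto simp: o_def)
  ultimately show ?case by (auto simp: differentiable_on_def)
qed

lemma smooth_fun_const: "smooth_fun (\<lambda>x. c)"
  and smooth_fun_add: "smooth_fun f \<Longrightarrow> smooth_fun g \<Longrightarrow> smooth_fun (\<lambda>x. f x + g x)"
  and smooth_fun_mult: "smooth_fun f \<Longrightarrow> smooth_fun g \<Longrightarrow> smooth_fun (\<lambda>x. f x * g x)"
  and smooth_fun_compose: "smooth_real F \<Longrightarrow> smooth_fun f \<Longrightarrow> smooth_fun (\<lambda>x. F (f x))"
  by (auto simp: smooth_fun_iff smooth_real_def vec_diff_const vec_diff_add vec_diff_mult
      vec_diff_compose)

lemma smooth_fun_diff: "smooth_fun f \<Longrightarrow> smooth_fun g \<Longrightarrow> smooth_fun (\<lambda>x. f x - g x)"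
  using smooth_fun_add[of f "\<lambda>x. (-1) * g x"] smooth_fun_mult[OF smooth_fun_const, of g "-1"] by simp

lemma has_derivative_inner_self:
  fixes x :: "'a::real_inner"
  shows "((\<lambda>x. x \<bullet> x) has_derivative (\<lambda>h. (2 *\<^sub>R x) \<bullet> h)) (at x)"
  by (auto intro!: derivative_eq_intros simp: inner_commute)

lemma grad_inner_self: "grad (\<lambda>x. x \<bullet> x) x = 2 *\<^sub>R x"
  by (rule grad_eqI[OF has_derivative_inner_self])

lemma smooth_fun_component: "smooth_fun (\<lambda>x::real^'n::finite. c * x $ i)"
proof -
  have D: "((\<lambda>x::real^'n. c * x $ i) has_derivative (\<lambda>h. (c *\<^sub>R axis i 1) \<bullet> h)) (at x)" for x
  proof -
    have "(\<lambda>h::real^'n. (c *\<^sub>R axis i 1) \<bullet> h) = (\<lambda>h. c * h $ i)"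
      by (simp add: inner_axis')
    then show ?thesis
      using bounded_linear_imp_has_derivative[OF
          bounded_linear_compose[OF bounded_linear_mult_right bounded_linear_vec_nth]] by simp
  qed
  have "vec_diff k (\<lambda>x::real^'n. c * x $ i)" for k
  proof (cases k)
    case 0
    then show ?thesis using D by (auto simp: differentiable_on_def differentiable_def)
  next
    case (Suc j)
    have "partial_deriv l (\<lambda>x::real^'n. c * x $ i) = (\<lambda>x. (c *\<^sub>R axis i 1) $ l)" for l
      by (rule ext) (simp only: partial_deriv_eq_grad grad_eqI[OF D])
    then show ?thesis using D
      by (auto simp: Suc differentiable_on_def differentiable_def vec_diff_const)
  qed
  then show ?thesis by (simp add: smooth_fun_iff)
qed

lemma smooth_fun_inner_self: "smooth_fun (\<lambda>x::real^'n::finite. x \<bullet> x)"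
proof -
  have D: "((\<lambda>x::real^'n. x \<bullet> x) has_derivative (\<lambda>h. (2 *\<^sub>R x) \<bullet> h)) (at x)" for x
    by (rule has_derivative_inner_self)
  have "vec_diff k (\<lambda>x::real^'n. x \<bullet> x)" for k
  proof (cases k)
    case 0
    then show ?thesis using D by (auto simp: differentiable_on_def differentiable_def)
  next
    case (Suc j)
    have "partial_deriv l (\<lambda>x::real^'n. x \<bullet> x) = (\<lambda>x. 2 * x $ l)" for l
      by (rule ext) (simp add: partial_deriv_eq_grad grad_inner_self)
    then show ?thesis using D smooth_fun_component[of 2]
      by (auto simp: Suc differentiable_on_def differentiable_def smooth_fun_iff)
  qed
  then show ?thesis by (simp add: smooth_fun_iff)
qed

lemma test_fun_smooth: "test_fun f \<Longrightarrow> smooth_fun f"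
  by (simp add: test_fun_def)

lemma test_fun_differentiable: "test_fun f \<Longrightarrow> f differentiable (at x)"
  by (simp add: test_fun_def smooth_fun_differentiable)

lemma test_funI:
  assumes "smooth_fun f" "\<And>x. r < norm x \<Longrightarrow> f x = 0"
  shows "test_fun f"
proof -
  have "{x. f x \<noteq> 0} \<subseteq> cball 0 r" using assms(2) by (force simp: not_less[symmetric])
  then have "bounded {x. f x \<noteq> 0}" using bounded_cball bounded_subset by blast
  then show ?thesis using assms(1) by (simp add: test_fun_def)
qed

lemma test_fun_bounded_support:
  assumes "test_fun f"
  shows "\<exists>r>0. \<forall>x. r \<le> norm x \<longrightarrow> f x = 0"
proof -
  have "bounded {x. f x \<noteq> 0}" using assms by (simp add: test_fun_def)
  then obtain r where r: "r > 0" "\<forall>x\<in>{x. f x \<noteq> 0}. norm x \<le> r" using bounded_pos by metis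
  show ?thesis
    by (rule exI[of _ "r + 1"]) (use r in force)
qed

lemma test_fun_mult_smooth:
  assumes "test_fun f" "smooth_fun g"
  shows "test_fun (\<lambda>x. f x * g x)" "test_fun (\<lambda>x. g x * f x)"
proof -
  obtain r where "\<And>x. r \<le> norm x \<Longrightarrow> f x = 0" using test_fun_bounded_support[OF assms(1)] by auto
  then show "test_fun (\<lambda>x. f x * g x)" "test_fun (\<lambda>x. g x * f x)"
    using assms
    by (intro test_funI[where r=r] smooth_fun_mult; simp add: test_fun_smooth)+
qed

lemma test_fun_mult: "test_fun f \<Longrightarrow> test_fun g \<Longrightarrow> test_fun (\<lambda>x. f x * g x)"
  using test_fun_mult_smooth test_fun_smooth by blast

lemma test_fun_cmult: "test_fun f \<Longrightarrow> test_fun (\<lambda>x. c * f x)"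
  using test_fun_mult_smooth(2)[OF _ smooth_fun_const] .

lemma test_fun_add:
  assumes "test_fun f" "test_fun g"
  shows "test_fun (\<lambda>x. f x + g x)"
proof -
  obtain r s where "\<And>x. r \<le> norm x \<Longrightarrow> f x = 0" "\<And>x. s \<le> norm x \<Longrightarrow> g x = 0"
    using test_fun_bounded_support assms by metis
  then show ?thesis
    using assms by (intro test_funI[where r="max r s"] smooth_fun_add; simp add: test_fun_smooth)
qed

lemma test_fun_diff: "test_fun f \<Longrightarrow> test_fun g \<Longrightarrow> test_fun (\<lambda>x. f x - g x)"
  using test_fun_add[of f "\<lambda>x. (-1) * g x"] test_fun_cmult[of g "-1"] by simp

lemma test_fun_compose:
  assumes "smooth_real F" "F 0 = 0" "test_fun f"
  shows "test_fun (\<lambda>x. F (f x))"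
proof -
  obtain r where "\<And>x. r \<le> norm x \<Longrightarrow> f x = 0" using test_fun_bounded_support[OF assms(3)] by auto
  then show ?thesis
    using assms by (intro test_funI[where r=r] smooth_fun_compose[OF assms(1)]; simp add: test_fun_smooth)
qed

lemma smooth_fun_continuous: "smooth_fun f \<Longrightarrow> continuous_on S f"
  by (meson continuous_at_imp_continuous_on differentiable_imp_continuous_within smooth_fun_differentiable)

lemma smooth_fun_continuous_grad: "smooth_fun f \<Longrightarrow> continuous_on S (grad f)"
  unfolding grad_def
  by (intro continuous_on_vec_lambda smooth_fun_continuous smooth_fun_partial_deriv)

lemma smooth_fun_borel [measurable (raw)]: "smooth_fun f \<Longrightarrow> f \<in> borel_measurable borel"
  by (intro borel_measurable_continuous_onI smooth_fun_continuous)

lemma smooth_fun_borel_grad [measurable (raw)]: "smooth_fun f \<Longrightarrow> grad f \<in> borel_measurable borel"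
  by (intro borel_measurable_continuous_onI smooth_fun_continuous_grad)

lemma grad_zero_outside:
  assumes "\<And>x. r \<le> norm x \<Longrightarrow> f x = c" "r < norm x"
  shows "grad f x = 0"
proof (rule grad_eqI)
  have "open {x. r < norm x}" by (intro open_Collect_less continuous_intros)
  then have "(f has_derivative (\<lambda>h. 0)) (at x)"
    by (rule has_derivative_transform_within_open[where f="\<lambda>_. c", rotated])
       (use assms in auto)
  then show "(f has_derivative (\<lambda>h. 0 \<bullet> h)) (at x)" by simp
qed

lemma test_fun_bounds:
  assumes "test_fun f"
  obtains r b where "r > 0" "b > 0" "\<And>x. r < norm x \<Longrightarrow> f x = 0 \<and> grad f x = 0"
    "\<And>x. \<bar>f x\<bar> \<le> b" "\<And>x. norm (grad f x) \<le> b"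
proof -
  obtain r where r: "r > 0" "\<And>x. r \<le> norm x \<Longrightarrow> f x = 0"
    using test_fun_bounded_support[OF assms] by auto
  have sm: "smooth_fun f" using assms by (rule test_fun_smooth)
  have "bounded (f ` cball 0 r)"
    by (intro compact_imp_bounded compact_continuous_image smooth_fun_continuous sm compact_cball)
  then obtain b1 where b1: "b1 > 0" "\<forall>x\<in>cball 0 r. norm (f x) \<le> b1" unfolding bounded_pos by auto
  have "bounded (grad f ` cball 0 r)"
    by (intro compact_imp_bounded compact_continuous_image smooth_fun_continuous_grad sm compact_cball)
  then obtain b2 where b2: "b2 > 0" "\<forall>x\<in>cball 0 r. norm (grad f x) \<le> b2" unfolding bounded_pos by auto
  have z: "f x = 0 \<and> grad f x = 0" if "r < norm x" for x
    using that r(2) grad_zero_outside[of r f 0 x] by auto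
  have "\<bar>f x\<bar> \<le> max b1 b2" "norm (grad f x) \<le> max b1 b2" for x
    using z[of x] b1 b2 by (cases "norm x \<le> r"; force simp: le_max_iff_disj)+
  then show ?thesis using r(1) b1(1) z by (intro that[of r "max b1 b2"]) auto
qed

section \<open>Square-integrable functions\<close>

lemma L2_real_iff:
  "L2 M (f :: 'a \<Rightarrow> real) \<longleftrightarrow> f \<in> borel_measurable M \<and> integrable M (\<lambda>x. (f x)\<^sup>2)"
  by (simp add: L2_def)

lemma L2_measurable: "L2 M f \<Longrightarrow> f \<in> borel_measurable M"
  by (simp add: L2_def)

lemma L2_bound:
  fixes f :: "'a \<Rightarrow> 'b::{banach,second_countable_topology}"
    and g :: "'a \<Rightarrow> 'c::{banach,second_countable_topology}"
  assumes "L2 M g" "f \<in> borel_measurable M" "AE x in M. norm (f x) \<le> c * norm (g x)"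
  shows "L2 M f"
proof -
  have "integrable M (\<lambda>x. c\<^sup>2 * (norm (g x))\<^sup>2)" using assms(1) by (simp add: L2_def)
  then have "integrable M (\<lambda>x. (norm (f x))\<^sup>2)"
  proof (rule Bochner_Integration.integrable_bound)
    show "(\<lambda>x. (norm (f x))\<^sup>2) \<in> borel_measurable M" using assms(2) by measurable
    show "AE x in M. norm ((norm (f x))\<^sup>2) \<le> norm (c\<^sup>2 * (norm (g x))\<^sup>2)"
      using assms(3)
    proof eventually_elim
      case (elim x)
      then have "(norm (f x))\<^sup>2 \<le> (c * norm (g x))\<^sup>2" by (intro power_mono) auto
      then show ?case by (simp add: power_mult_distrib)
    qed
  qed
  then show ?thesis using assms(2) by (simp add: L2_def)
qed

lemma L2_integrable_mult:
  fixes f g :: "'a \<Rightarrow> real"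
  assumes "L2 M f" "L2 M g"
  shows "integrable M (\<lambda>x. f x * g x)"
proof (rule Bochner_Integration.integrable_bound)
  show "integrable M (\<lambda>x. (f x)\<^sup>2 + (g x)\<^sup>2)" using assms by (simp add: L2_real_iff)
  show "(\<lambda>x. f x * g x) \<in> borel_measurable M"
    using assms[THEN L2_measurable] by measurable
  have "\<bar>a * b\<bar> \<le> a\<^sup>2 + b\<^sup>2" for a b :: real
  proof -
    have "2 * (\<bar>a\<bar> * \<bar>b\<bar>) \<le> a\<^sup>2 + b\<^sup>2" using sum_squares_bound[of "\<bar>a\<bar>" "\<bar>b\<bar>"] by simp
    moreover have "0 \<le> \<bar>a\<bar> * \<bar>b\<bar>" by simp
    ultimately show ?thesis unfolding abs_mult by linarith
  qed
  then show "AE x in M. norm (f x * g x) \<le> norm ((f x)\<^sup>2 + (g x)\<^sup>2)" by simp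
qed

lemma L2_add:
  fixes f g :: "'a \<Rightarrow> real"
  assumes "L2 M f" "L2 M g"
  shows "L2 M (\<lambda>x. f x + g x)"
  using assms L2_integrable_mult[OF assms]
  by (auto simp: L2_real_iff power2_sum mult.assoc)

lemma L2_cmult: "L2 M f \<Longrightarrow> L2 M (\<lambda>x. c * f x)" for c :: real
  by (auto simp: L2_real_iff power_mult_distrib)

lemma L2_diff: "L2 M f \<Longrightarrow> L2 M g \<Longrightarrow> L2 M (\<lambda>x. f x - g x :: real)"
  using L2_add[of M f "\<lambda>x. (-1) * g x"] L2_cmult[of M g "-1"] by simp

lemma L2_mult_bounded:
  fixes f g :: "'a \<Rightarrow> real"
  assumes "L2 M f" "g \<in> borel_measurable M" "\<And>x. \<bar>g x\<bar> \<le> c"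
  shows "L2 M (\<lambda>x. g x * f x)"
proof (rule L2_bound[OF assms(1)])
  show "(\<lambda>x. g x * f x) \<in> borel_measurable M" using assms(2) L2_measurable[OF assms(1)] by measurable
  show "AE x in M. norm (g x * f x) \<le> c * norm (f x)"
    using assms(3) by (simp add: abs_mult mult_right_mono)
qed

lemma L2_zero: "L2 M (\<lambda>x. 0::real)"
  by (simp add: L2_def)

lemma L2_norm_nonneg: "0 \<le> L2_norm M f"
  by (simp add: L2_norm_def)

lemma L2_norm_sq: "(L2_norm M f)\<^sup>2 = (\<integral>x. (norm (f x))\<^sup>2 \<partial>M)"
  by (simp add: L2_norm_def)

lemma L2_norm_sq_inner: "(L2_norm M f)\<^sup>2 = L2_inner M f f" for f :: "'a \<Rightarrow> real"
  by (simp add: L2_norm_sq L2_inner_def flip: power2_eq_square)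

lemma L2_inner_commute: "L2_inner M f g = L2_inner M g f"
  by (simp add: L2_inner_def mult.commute)

lemma L2_inner_add_left:
  "L2 M f \<Longrightarrow> L2 M g \<Longrightarrow> L2 M h \<Longrightarrow>
    L2_inner M (\<lambda>x. f x + g x) h = L2_inner M f h + L2_inner M g h"
  by (simp add: L2_inner_def distrib_right L2_integrable_mult)

lemma L2_inner_diff_left:
  "L2 M f \<Longrightarrow> L2 M g \<Longrightarrow> L2 M h \<Longrightarrow>
    L2_inner M (\<lambda>x. f x - g x) h = L2_inner M f h - L2_inner M g h"
  by (simp add: L2_inner_def left_diff_distrib L2_integrable_mult)

lemma L2_inner_cmult_left: "L2_inner M (\<lambda>x. c * f x) h = c * L2_inner M f h"
  by (simp add: L2_inner_def mult.assoc)

lemma L2_inner_cong: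
  assumes "L2 M f" "L2 M f'" "L2 M g" "L2 M g'" "AE x in M. f x = f' x" "AE x in M. g x = g' x"
  shows "L2_inner M f g = L2_inner M f' g'"
  unfolding L2_inner_def
proof (rule integral_cong_AE)
  show "AE x in M. f x * g x = f' x * g' x" using assms(5,6) by eventually_elim simp
qed (use assms(1-4)[THEN L2_measurable] in measurable)

lemma L2_norm_cong:
  fixes f g :: "'a \<Rightarrow> real"
  assumes "L2 M f" "L2 M g" "AE x in M. f x = g x"
  shows "L2_norm M f = L2_norm M g"
proof -
  have "(L2_norm M f)\<^sup>2 = (L2_norm M g)\<^sup>2"
    unfolding L2_norm_sq_inner by (rule L2_inner_cong) (use assms in auto)
  then show ?thesis using L2_norm_nonneg power2_eq_imp_eq by blast
qed

lemma L2_norm_eq_0: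
  fixes f :: "'a \<Rightarrow> real"
  assumes "L2 M f"
  shows "L2_norm M f = 0 \<longleftrightarrow> (AE x in M. f x = 0)"
proof -
  have "L2_norm M f = 0 \<longleftrightarrow> (\<integral>x. (f x)\<^sup>2 \<partial>M) = 0" by (simp add: L2_norm_def)
  also have "\<dots> \<longleftrightarrow> (AE x in M. (f x)\<^sup>2 = 0)"
    using assms by (intro integral_nonneg_eq_0_iff_AE) (auto simp: L2_real_iff)
  finally show ?thesis by simp
qed

lemma L2_Cauchy_Schwarz:
  assumes "L2 M f" "L2 M g"
  shows "\<bar>L2_inner M f g\<bar> \<le> L2_norm M f * L2_norm M g"
proof (cases "L2_norm M g = 0")
  case True
  then have "AE x in M. g x = 0" using L2_norm_eq_0 assms(2) by blast
  then have "L2_inner M f g = L2_inner M f (\<lambda>_. 0)"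
    by (intro L2_inner_cong assms L2_zero) auto
  then show ?thesis using True by (simp add: L2_inner_def)
next
  case False
  let ?p = "L2_inner M f g" and ?n = "(L2_norm M g)\<^sup>2"
  have n: "?n > 0" using False by simp
  define t where "t = ?p / ?n"
  have tg: "L2 M (\<lambda>x. t * g x)" by (rule L2_cmult[OF assms(2)])
  have d: "L2 M (\<lambda>x. f x - t * g x)" by (rule L2_diff[OF assms(1) tg])
  have "0 \<le> (L2_norm M (\<lambda>x. f x - t * g x))\<^sup>2" by simp
  also have "\<dots> = L2_inner M f (\<lambda>x. f x - t * g x) - t * L2_inner M g (\<lambda>x. f x - t * g x)"
    by (simp add: L2_norm_sq_inner L2_inner_diff_left[OF assms(1) tg d] L2_inner_cmult_left)
  also have "\<dots> = (L2_norm M f)\<^sup>2 - 2 * t * ?p + t\<^sup>2 * ?n"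
    by (simp add: L2_inner_commute[of M _ "\<lambda>x. f x - t * g x"] L2_inner_diff_left[OF assms(1) tg]
        assms L2_inner_cmult_left L2_norm_sq_inner L2_inner_commute[of M g f] power2_eq_square[of t] algebra_simps)
  also have "\<dots> = (L2_norm M f)\<^sup>2 - ?p\<^sup>2 / ?n"
    using n by (simp add: t_def field_simps power2_eq_square)
  finally have "?p\<^sup>2 \<le> (L2_norm M f * L2_norm M g)\<^sup>2"
    using n by (simp add: field_simps power_mult_distrib)
  then have "\<bar>?p\<bar>\<^sup>2 \<le> (L2_norm M f * L2_norm M g)\<^sup>2" by simp
  then show ?thesis by (rule power2_le_imp_le) (simp add: L2_norm_nonneg)
qed

lemma L2_norm_triangle:
  fixes f g :: "'a \<Rightarrow> real"
  assumes "L2 M f" "L2 M g"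
  shows "L2_norm M (\<lambda>x. f x + g x) \<le> L2_norm M f + L2_norm M g"
proof -
  have s: "L2 M (\<lambda>x. f x + g x)" by (rule L2_add[OF assms])
  have "(L2_norm M (\<lambda>x. f x + g x))\<^sup>2 = (L2_norm M f)\<^sup>2 + 2 * L2_inner M f g + (L2_norm M g)\<^sup>2"
    by (simp add: L2_norm_sq_inner L2_inner_add_left[OF assms s] L2_inner_commute[of M _ "\<lambda>x. f x + g x"]
        L2_inner_add_left assms L2_inner_commute[of M g f])
  also have "\<dots> \<le> (L2_norm M f + L2_norm M g)\<^sup>2"
    using L2_Cauchy_Schwarz[OF assms] by (simp add: power2_sum)
  finally show ?thesis by (rule power2_le_imp_le) (simp add: L2_norm_nonneg)
qed

lemma L2_norm_cmult: "L2_norm M (\<lambda>x. c * f x) = \<bar>c\<bar> * L2_norm M f" for f :: "'a \<Rightarrow> real"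
  by (simp add: L2_norm_def power_mult_distrib real_sqrt_mult)

lemma L2_norm_minus_commute: "L2_norm M (\<lambda>x. f x - g x) = L2_norm M (\<lambda>x. g x - f x)"
  by (simp add: L2_norm_def norm_minus_commute)

lemma L2_norm_triangle_diff:
  fixes f g h :: "'a \<Rightarrow> real"
  assumes "L2 M f" "L2 M g" "L2 M h"
  shows "L2_norm M (\<lambda>x. f x - h x) \<le> L2_norm M (\<lambda>x. f x - g x) + L2_norm M (\<lambda>x. g x - h x)"
  using L2_norm_triangle[OF L2_diff[OF assms(1,2)] L2_diff[OF assms(2,3)]] by simp

lemma L2_norm_mono:
  fixes f :: "'a \<Rightarrow> 'b::{banach,second_countable_topology}"
    and g :: "'a \<Rightarrow> 'c::{banach,second_countable_topology}"
  assumes "L2 M g" "f \<in> borel_measurable M" "AE x in M. norm (f x) \<le> c * norm (g x)" "0 \<le> c"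
  shows "L2_norm M f \<le> c * L2_norm M g"
proof -
  have "L2 M f" by (rule L2_bound[OF assms(1-3)])
  then have "(\<integral>x. (norm (f x))\<^sup>2 \<partial>M) \<le> (\<integral>x. c\<^sup>2 * (norm (g x))\<^sup>2 \<partial>M)"
    using assms(1)
  proof (intro integral_mono_AE)
    show "AE x in M. (norm (f x))\<^sup>2 \<le> c\<^sup>2 * (norm (g x))\<^sup>2"
      using assms(3)
    proof eventually_elim
      case (elim x)
      then have "(norm (f x))\<^sup>2 \<le> (c * norm (g x))\<^sup>2" by (intro power_mono) auto
      then show ?case by (simp add: power_mult_distrib)
    qed
  qed (auto simp: L2_def)
  then have "(L2_norm M f)\<^sup>2 \<le> (c * L2_norm M g)\<^sup>2"
    by (simp add: L2_norm_sq power_mult_distrib)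
  then show ?thesis by (rule power2_le_imp_le) (simp add: L2_norm_nonneg assms(4))
qed

lemma L2_inner_tendsto:
  assumes "\<And>n. L2 M (u n)" "\<And>n. L2 M (v n)" "L2 M f" "L2 M g"
    and "(\<lambda>n. L2_norm M (\<lambda>x. u n x - f x)) \<longlonglongrightarrow> 0" "(\<lambda>n. L2_norm M (\<lambda>x. v n x - g x)) \<longlonglongrightarrow> 0"
  shows "(\<lambda>n. L2_inner M (u n) (v n)) \<longlonglongrightarrow> L2_inner M f g"
proof -
  let ?a = "\<lambda>n. L2_norm M (\<lambda>x. u n x - f x)" and ?b = "\<lambda>n. L2_norm M (\<lambda>x. v n x - g x)"
  have "(\<lambda>n. ?a n * (?b n + L2_norm M g) + L2_norm M f * ?b n) \<longlonglongrightarrow> 0 * (0 + L2_norm M g) + L2_norm M f * 0"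
    by (intro tendsto_intros assms)
  then have lim: "(\<lambda>n. ?a n * (?b n + L2_norm M g) + L2_norm M f * ?b n) \<longlonglongrightarrow> 0" by simp
  have "\<bar>L2_inner M (u n) (v n) - L2_inner M f g\<bar> \<le> ?a n * (?b n + L2_norm M g) + L2_norm M f * ?b n" for n
  proof -
    have du: "L2 M (\<lambda>x. u n x - f x)" and dv: "L2 M (\<lambda>x. v n x - g x)"
      using assms L2_diff by blast+
    have "L2_inner M (u n) (v n) - L2_inner M f g
        = L2_inner M (\<lambda>x. u n x - f x) (v n) + L2_inner M f (\<lambda>x. v n x - g x)"
      using assms(1-4)
      by (simp add: L2_inner_diff_left L2_inner_commute[of M f] )
    moreover have "\<bar>L2_inner M (\<lambda>x. u n x - f x) (v n)\<bar> \<le> ?a n * L2_norm M (v n)"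
      by (rule L2_Cauchy_Schwarz[OF du assms(2)])
    moreover have "L2_norm M (v n) \<le> ?b n + L2_norm M g"
      using L2_norm_triangle[OF dv assms(4)] by simp
    then have "?a n * L2_norm M (v n) \<le> ?a n * (?b n + L2_norm M g)"
      by (intro mult_left_mono L2_norm_nonneg)
    moreover have "\<bar>L2_inner M f (\<lambda>x. v n x - g x)\<bar> \<le> L2_norm M f * ?b n"
      by (rule L2_Cauchy_Schwarz[OF assms(3) dv])
    ultimately show ?thesis by linarith
  qed
  then have "(\<lambda>n. L2_inner M (u n) (v n) - L2_inner M f g) \<longlonglongrightarrow> 0"
    by (intro tendsto_rabs_zero_cancel[OF tendsto_sandwich[OF _ _ tendsto_const lim]]) auto
  then show ?thesis by (simp add: LIM_zero_iff)
qed

lemma L2_AE_subseq: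
  fixes f :: "'a \<Rightarrow> real"
  assumes "\<And>n. L2 M (u n)" "L2 M f" "(\<lambda>n. L2_norm M (\<lambda>x. u n x - f x)) \<longlonglongrightarrow> 0"
  shows "\<exists>r::nat\<Rightarrow>nat. strict_mono r \<and> (AE x in M. (\<lambda>n. u (r n) x) \<longlonglongrightarrow> f x)"
proof -
  have d: "L2 M (\<lambda>x. u n x - f x)" for n using assms L2_diff by blast
  have "(\<lambda>n. (L2_norm M (\<lambda>x. u n x - f x))\<^sup>2) \<longlonglongrightarrow> 0\<^sup>2" by (intro tendsto_intros assms)
  then have "(\<lambda>n. \<integral>x. norm ((u n x - f x)\<^sup>2) \<partial>M) \<longlonglongrightarrow> 0" by (simp add: L2_norm_sq)
  moreover have "integrable M (\<lambda>x. (u n x - f x)\<^sup>2)" for n using d by (simp add: L2_real_iff)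
  ultimately obtain r where r: "strict_mono r" "AE x in M. (\<lambda>n. (u (r n) x - f x)\<^sup>2) \<longlonglongrightarrow> 0"
    using tendsto_L1_AE_subseq[of M "\<lambda>n x. (u n x - f x)\<^sup>2"] by auto
  from r(2) have "AE x in M. (\<lambda>n. u (r n) x) \<longlonglongrightarrow> f x"
  proof eventually_elim
    case (elim x)
    have "(\<lambda>n. sqrt ((u (r n) x - f x)\<^sup>2)) \<longlonglongrightarrow> sqrt 0" by (intro tendsto_intros elim)
    then have "(\<lambda>n. u (r n) x - f x) \<longlonglongrightarrow> 0" by (simp add: tendsto_rabs_zero_iff)
    then show ?case by (simp add: LIM_zero_iff)
  qed
  with r(1) show ?thesis by blast
qed

section \<open>Laplace transforms\<close>

lemma set_integrable_exp_bounded: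
  fixes m :: "real \<Rightarrow> real"
  assumes "continuous_on {0..} m" "\<And>s. 0 \<le> s \<Longrightarrow> \<bar>m s\<bar> \<le> K" "0 < l"
  shows "set_integrable lborel {0<..} (\<lambda>s. exp (- l * s) * m s)"
proof (rule set_integrable_bound)
  show "set_integrable lborel {0<..} (\<lambda>s. K * exp (- (s * l)))"
    by (intro set_integrable_mult_right integrable_I0i_exp_mscale assms(3))
  have "continuous_on {0<..} (\<lambda>s. exp (- l * s) * m s)"
    by (intro continuous_intros continuous_on_subset[OF assms(1)]) auto
  then show "set_borel_measurable lborel {0<..} (\<lambda>s. exp (- l * s) * m s)"
    using set_measurable_continuous_on[of "{0<..}" "\<lambda>s. exp (- l * s) * m s"]
    by (simp add: set_borel_measurable_def)
  have "\<bar>m s\<bar> \<le> \<bar>K\<bar>" if "s > 0" for s using assms(2)[of s] that by linarith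
  then show "AE s in lborel. s \<in> {0<..} \<longrightarrow> norm (exp (- l * s) * m s) \<le> norm (K * exp (- (s * l)))"
    by (auto simp: abs_mult mult.commute intro!: mult_left_mono)
qed

text \<open>A substitution moves the dependence on t out of m, which is merely continuous, into an
  exponential factor and an endpoint of integration. This is what makes the Laplace integral
  differentiable in t.\<close>

lemma laplace_shift:
  fixes m :: "real \<Rightarrow> real"
  assumes "continuous_on {0..} m" "\<And>s. 0 \<le> s \<Longrightarrow> \<bar>m s\<bar> \<le> K" "0 < l" "0 \<le> t"
  shows "(LINT s:{0<..}|lborel. exp (- l * s) * m (s + t)) =
    exp (l * t) * ((LINT s:{0<..}|lborel. exp (- l * s) * m s) - integral {0..t} (\<lambda>s. exp (- l * s) * m s))"
proof -
  define k where "k = (\<lambda>s. exp (- l * s) * m s)"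
  have kc: "continuous_on {0..} k" unfolding k_def by (intro continuous_intros assms)
  have ki: "set_integrable lborel {0<..} k"
    unfolding k_def by (rule set_integrable_exp_bounded[OF assms(1-3)])
  have "(LINT s:{0<..}|lborel. exp (- l * s) * m (s + t)) =
      (LINT s|lborel. exp (l * t) * (indicator {t<..} (t + 1 * s) * k (t + 1 * s)))"
    unfolding set_lebesgue_integral_def
  proof (intro Bochner_Integration.integral_cong refl)
    fix s
    have "exp (- l * s) = exp (l * t) * exp (- l * (t + s))"
      by (simp add: algebra_simps flip: exp_add)
    then show "indicat_real {0<..} s *\<^sub>R (exp (- l * s) * m (s + t)) =
        exp (l * t) * (indicat_real {t<..} (t + 1 * s) * k (t + 1 * s))"
      by (simp add: k_def indicator_def add.commute)
  qed
  also have "\<dots> = exp (l * t) * (LINT s|lborel. indicator {t<..} s * k s)"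
    using lborel_integral_real_affine[of 1 "\<lambda>s. indicator {t<..} s * k s" t] by simp
  also have "(LINT s|lborel. indicator {t<..} s * k s) = (LINT s:{t<..}|lborel. k s)"
    by (simp add: set_lebesgue_integral_def)
  also have "\<dots> = (LINT s:{0<..}|lborel. k s) - (LINT s:{0<..t}|lborel. k s)"
  proof -
    have "(LINT s:{0<..t} \<union> {t<..}|lborel. k s) = (LINT s:{0<..t}|lborel. k s) + (LINT s:{t<..}|lborel. k s)"
      by (rule set_integral_Un) (auto intro!: set_integrable_subset[OF ki] simp: assms(4))
    moreover have "{0<..t} \<union> {t<..} = {0<..}" using assms(4) by auto
    ultimately show ?thesis by simp
  qed
  also have "(LINT s:{0<..t}|lborel. k s) = (LINT s:{0..t}|lborel. k s)"
    unfolding set_lebesgue_integral_def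
  proof (rule integral_cong_AE)
    have "continuous_on {0..t} k" by (rule continuous_on_subset[OF kc]) auto
    moreover have "continuous_on {0<..t} k" by (rule continuous_on_subset[OF kc]) auto
    ultimately show "(\<lambda>s. indicat_real {0..t} s *\<^sub>R k s) \<in> borel_measurable lborel"
      "(\<lambda>s. indicat_real {0<..t} s *\<^sub>R k s) \<in> borel_measurable lborel"
      by (simp_all add: borel_measurable_continuous_on_indicator del: real_scaleR_def)
    show "AE s in lborel. indicat_real {0<..t} s *\<^sub>R k s = indicat_real {0..t} s *\<^sub>R k s"
      using AE_lborel_singleton[of 0] by eventually_elim (auto simp: indicator_def)
  qed
  also have "(LINT s:{0..t}|lborel. k s) = integral {0..t} k"
    by (intro set_borel_integral_eq_integral(2) borel_integrable_atLeastAtMost' continuous_on_subset[OF kc]) auto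
  finally show ?thesis by (simp add: k_def)
qed

lemma laplace_shift_deriv:
  fixes m :: "real \<Rightarrow> real"
  assumes "continuous_on {0..} m" "\<And>s. 0 \<le> s \<Longrightarrow> \<bar>m s\<bar> \<le> K" "0 < l"
  defines "g \<equiv> \<lambda>t. LINT s:{0<..}|lborel. exp (- l * s) * m (s + t)"
  shows "continuous_on {0..} g"
    and "0 < t \<Longrightarrow> (g has_real_derivative (l * g t - m t)) (at t)"
proof -
  define k where "k = (\<lambda>s. exp (- l * s) * m s)"
  define G where "G = (\<lambda>t. exp (l * t) * ((LINT s:{0<..}|lborel. k s) - integral {0..t} k))"
  have kc: "continuous_on {0..} k" unfolding k_def by (intro continuous_intros assms)
  have gG: "g t = G t" if "0 \<le> t" for t
    unfolding g_def G_def k_def using laplace_shift[OF assms(1-3) that] .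
  have der: "((\<lambda>t. integral {0..t} k) has_real_derivative k t) (at t within {0..b})" if "0 \<le> t" "t \<le> b" for t b
    by (rule integral_has_real_derivative) (use that kc in \<open>auto intro: continuous_on_subset\<close>)
  have der': "((\<lambda>t. integral {0..t} k) has_real_derivative k t) (at t)" if "0 < t" for t
    using der[of t "t + 1"] that at_within_Icc_at[of 0 t "t + 1"] by simp
  have "continuous_on {0..b} (\<lambda>t. integral {0..t} k)" for b
    by (rule DERIV_continuous_on) (use der in auto)
  then have "continuous_on {0..b} G" for b unfolding G_def by (intro continuous_intros)
  then have Gb: "continuous_on {0..b} g" for b by (subst continuous_on_cong[OF refl gG]) auto
  show "continuous_on {0..} g"
    unfolding continuous_on_eq_continuous_within
  proof
    fix t :: real assume t: "t \<in> {0..}"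
    have "continuous (at t within {0..t+1}) g" using Gb[of "t+1"] t
      by (auto simp: continuous_on_eq_continuous_within)
    moreover have "at t within {0..t+1} = at t within {0..}"
      by (rule at_within_nhd[of _ "{..<t+1}"]) (use t in auto)
    ultimately show "continuous (at t within {0..}) g" by simp
  qed
  assume t: "0 < t"
  have "(G has_real_derivative (l * G t - m t)) (at t)"
    unfolding G_def
    by (rule derivative_eq_intros der' t refl)+
       (auto simp: k_def algebra_simps simp flip: exp_add)
  moreover have "\<forall>\<^sub>F s in nhds t. g s = G s"
    using eventually_nhds_in_open[of "{0<..}" t] t by (auto elim!: eventually_mono intro!: gG)
  ultimately show "(g has_real_derivative (l * g t - m t)) (at t)"
    using t gG[of t] by (subst DERIV_cong_ev) auto
qed

text \<open>The Gamma integrals of order 0 and 1, rescaled by l. Affine integrands are all that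
  \<open>resolvent_approx\<close> has to integrate.\<close>

lemma laplace_moments:
  fixes l :: real
  assumes "0 < l"
  shows "set_integrable lborel {0<..} (\<lambda>s. exp (- l * s) * (a + b * s))"
    and "(LINT s:{0<..}|lborel. exp (- l * s) * (a + b * s)) = a / l + b / l\<^sup>2"
proof -
  have 0: "has_bochner_integral lborel (\<lambda>x. exp (- (l * x)) * indicator {0<..} x) (1 / l)"
    using lborel_has_bochner_integral_real_affine_iff[of l
        "\<lambda>x. x ^ 0 * exp (- x) * indicator {0<..} x" 1 0] has_bochner_integral_I0i_power_exp_m[of 0] assms
    by (simp add: indicator_def zero_less_mult_iff divide_inverse not_less[symmetric] cong: if_cong)
  have 1: "has_bochner_integral lborel (\<lambda>x. l * x * exp (- (l * x)) * indicator {0<..} x) (1 / l)"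
    using lborel_has_bochner_integral_real_affine_iff[of l
        "\<lambda>x. x ^ 1 * exp (- x) * indicator {0<..} x" 1 0] has_bochner_integral_I0i_power_exp_m[of 1] assms
    by (simp add: indicator_def zero_less_mult_iff divide_inverse not_less[symmetric] cong: if_cong)
  have "has_bochner_integral lborel
      (\<lambda>x. a * (exp (- (l * x)) * indicator {0<..} x) + b / l * (l * x * exp (- (l * x)) * indicator {0<..} x))
      (a * (1 / l) + b / l * (1 / l))"
    by (intro has_bochner_integral_add has_bochner_integral_mult_right 0 1)
  moreover have "(\<lambda>x. a * (exp (- (l * x)) * indicator {0<..} x) + b / l * (l * x * exp (- (l * x)) * indicator {0<..} x))
     = (\<lambda>x. indicator {0<..} x *\<^sub>R (exp (- l * x) * (a + b * x)))"
    using assms by (auto simp: fun_eq_iff indicator_def field_simps)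
  ultimately have "has_bochner_integral lborel (\<lambda>x. indicator {0<..} x *\<^sub>R (exp (- l * x) * (a + b * x)))
     (a / l + b / l\<^sup>2)" by (simp add: power2_eq_square)
  then show "set_integrable lborel {0<..} (\<lambda>s. exp (- l * s) * (a + b * s))"
    "(LINT s:{0<..}|lborel. exp (- l * s) * (a + b * s)) = a / l + b / l\<^sup>2"
    by (auto simp: set_integrable_def set_lebesgue_integral_def has_bochner_integral_iff)
qed

section \<open>Contraction semigroups and their resolvents\<close>

text \<open>Made for nonlinear functionals F of an orbit: q is the linearisation frozen at t,
  essentially a scalar product with the orbit, whose derivative is known, and a quadratic remainder
  does not affect the derivative.\<close>

lemma DERIV_quadratic_close:
  fixes F q :: "real \<Rightarrow> real"
  assumes q: "(q has_real_derivative d) (at t)"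
    and A: "open A" "t \<in> A" "\<And>s. s \<in> A \<Longrightarrow> \<bar>F s - F t - (q s - q t)\<bar> \<le> c * (s - t)\<^sup>2"
  shows "(F has_real_derivative d) (at t)"
proof -
  have "((\<lambda>s. (F s - F t) / (s - t) - (q s - q t) / (s - t)) \<longlongrightarrow> 0) (at t)"
  proof (rule Lim_null_comparison)
    show "\<forall>\<^sub>F s in at t. norm ((F s - F t) / (s - t) - (q s - q t) / (s - t)) \<le> \<bar>c\<bar> * \<bar>s - t\<bar>"
      using eventually_at_in_open[OF A(1,2)]
    proof eventually_elim
      case (elim s)
      then have "\<bar>F s - F t - (q s - q t)\<bar> \<le> c * (s - t)\<^sup>2" using A(3) by auto
      also have "\<dots> \<le> \<bar>c\<bar> * (s - t)\<^sup>2" by (intro mult_right_mono) auto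
      also have "\<dots> = \<bar>c\<bar> * \<bar>s - t\<bar> * \<bar>s - t\<bar>" by (simp add: power2_eq_square mult.assoc)
      finally show ?case using elim
        by (simp add: diff_divide_distrib[symmetric] abs_divide pos_divide_le_eq)
    qed
    have "((\<lambda>s. \<bar>c\<bar> * \<bar>s - t\<bar>) \<longlongrightarrow> \<bar>c\<bar> * \<bar>t - t\<bar>) (at t)" by (intro tendsto_intros)
    then show "((\<lambda>s. \<bar>c\<bar> * \<bar>s - t\<bar>) \<longlongrightarrow> 0) (at t)" by simp
  qed
  moreover have "((\<lambda>s. (q s - q t) / (s - t)) \<longlongrightarrow> d) (at t)"
    using q by (simp add: has_field_derivative_iff)
  ultimately have "((\<lambda>s. ((F s - F t) / (s - t) - (q s - q t) / (s - t)) + (q s - q t) / (s - t)) \<longlongrightarrow> 0 + d) (at t)"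
    by (rule tendsto_add)
  then show ?thesis by (simp add: has_field_derivative_iff)
qed

locale l2_semigroup =
  fixes M :: "'a measure" and T :: "real \<Rightarrow> ('a \<Rightarrow> real) \<Rightarrow> 'a \<Rightarrow> real"
  assumes semigroup: "contraction_semigroup M T"
begin

text \<open>\<open>contraction_semigroup\<close> leaves \<open>T 0\<close> unspecified. Putting the
  identity there makes the semigroup law, continuity and the Laplace integrals available on the
  closed half-line.\<close>

definition Tz :: "real \<Rightarrow> ('a \<Rightarrow> real) \<Rightarrow> 'a \<Rightarrow> real" where
  "Tz t f = (if t = 0 then f else T t f)"

lemma Tz_0: "Tz 0 f = f" and Tz_pos: "0 < t \<Longrightarrow> Tz t f = T t f"
  by (auto simp: Tz_def)

lemma Tz_L2: "0 \<le> t \<Longrightarrow> L2 M f \<Longrightarrow> L2 M (Tz t f)"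
  using semigroup by (auto simp: Tz_def contraction_semigroup_def)

lemma Tz_norm_le: "0 \<le> t \<Longrightarrow> L2 M f \<Longrightarrow> L2_norm M (Tz t f) \<le> L2_norm M f"
  using semigroup by (auto simp: Tz_def contraction_semigroup_def)

lemma Tz_linear:
  "0 \<le> t \<Longrightarrow> L2 M f \<Longrightarrow> L2 M g \<Longrightarrow> AE x in M. Tz t (\<lambda>y. a * f y + b * g y) x = a * Tz t f x + b * Tz t g x"
  using semigroup by (auto simp: Tz_def contraction_semigroup_def)

lemma Tz_diff:
  "0 \<le> t \<Longrightarrow> L2 M f \<Longrightarrow> L2 M g \<Longrightarrow> AE x in M. Tz t (\<lambda>y. f y - g y) x = Tz t f x - Tz t g x"
  using Tz_linear[of t f g 1 "-1"] by simp

lemma Tz_add: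
  assumes "0 \<le> s" "0 \<le> t" "L2 M f"
  shows "AE x in M. Tz (s + t) f x = Tz s (Tz t f) x"
  using semigroup assms by (cases "s = 0 \<or> t = 0") (auto simp: Tz_def contraction_semigroup_def)

text \<open>The increment is \<open>Tz s\<close> applied to the increment at time 0, and
  \<open>Tz s\<close> is a contraction. Strong continuity at 0 thus controls all times uniformly,
  from both sides.\<close>

lemma Tz_increment:
  assumes "0 \<le> s" "s \<le> t" "L2 M f"
  shows "L2_norm M (\<lambda>x. Tz t f x - Tz s f x) \<le> L2_norm M (\<lambda>x. Tz (t - s) f x - f x)"
proof -
  have r: "L2 M (Tz (t - s) f)" using assms by (intro Tz_L2) auto
  have d: "L2 M (\<lambda>x. Tz (t - s) f x - f x)" by (rule L2_diff[OF r assms(3)])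
  have "AE x in M. Tz t f x - Tz s f x = Tz s (\<lambda>x. Tz (t - s) f x - f x) x"
    using Tz_add[OF assms(1) _ assms(3), of "t - s"] Tz_diff[OF assms(1) r assms(3)] assms(2) by auto
  then have "L2_norm M (\<lambda>x. Tz t f x - Tz s f x) = L2_norm M (Tz s (\<lambda>x. Tz (t - s) f x - f x))"
    using assms by (intro L2_norm_cong L2_diff Tz_L2 d) auto
  then show ?thesis using Tz_norm_le[OF assms(1) d] by simp
qed

lemma Tz_small:
  assumes "L2 M f" "0 < e"
  shows "\<exists>d>0. \<forall>h. 0 \<le> h \<and> h < d \<longrightarrow> L2_norm M (\<lambda>x. Tz h f x - f x) < e"
proof -
  have "((\<lambda>t. L2_norm M (\<lambda>x. T t f x - f x)) \<longlongrightarrow> 0) (at_right 0)"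
    using semigroup assms(1) by (auto simp: contraction_semigroup_def)
  then have "\<forall>\<^sub>F t in at_right 0. L2_norm M (\<lambda>x. T t f x - f x) < e"
    using assms(2) order_tendstoD(2) by blast
  then obtain d where d: "d > 0" "\<forall>t>0. t < d \<longrightarrow> L2_norm M (\<lambda>x. T t f x - f x) < e"
    unfolding eventually_at_right_field by auto
  have "L2_norm M (\<lambda>x. Tz h f x - f x) < e" if "0 \<le> h" "h < d" for h
    using d that assms(2) by (cases "h = 0") (auto simp: Tz_def L2_norm_def)
  with d(1) show ?thesis by blast
qed

lemma Tz_inner_bound:
  "0 \<le> t \<Longrightarrow> L2 M f \<Longrightarrow> L2 M h \<Longrightarrow> \<bar>L2_inner M (Tz t f) h\<bar> \<le> L2_norm M f * L2_norm M h"
  using L2_Cauchy_Schwarz[OF Tz_L2, of t f h] Tz_norm_le[of t f] L2_norm_nonneg[of M h]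
  by (meson mult_right_mono order_trans)

lemma Tz_inner_continuous:
  assumes "L2 M f" "L2 M h"
  shows "continuous_on {0..} (\<lambda>t. L2_inner M (Tz t f) h)"
  unfolding continuous_on_iff
proof (intro ballI allI impI)
  fix t e :: real assume t: "t \<in> {0..}" and e: "0 < e"
  have "0 < e / (L2_norm M h + 1)" using e L2_norm_nonneg[of M h] by simp
  then obtain d where d: "d > 0" "\<And>r. 0 \<le> r \<Longrightarrow> r < d \<Longrightarrow>
      L2_norm M (\<lambda>x. Tz r f x - f x) < e / (L2_norm M h + 1)"
    using Tz_small[OF assms(1)] by blast
  have *: "\<bar>L2_inner M (Tz b f) h - L2_inner M (Tz a f) h\<bar> < e" if "0 \<le> a" "a \<le> b" "b - a < d" for a b
  proof -
    have L: "L2 M (Tz a f)" "L2 M (Tz b f)" using that by (auto intro!: Tz_L2 assms)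
    have "\<bar>L2_inner M (Tz b f) h - L2_inner M (Tz a f) h\<bar> = \<bar>L2_inner M (\<lambda>x. Tz b f x - Tz a f x) h\<bar>"
      using L assms by (simp add: L2_inner_diff_left)
    also have "\<dots> \<le> L2_norm M (\<lambda>x. Tz b f x - Tz a f x) * L2_norm M h"
      by (rule L2_Cauchy_Schwarz[OF L2_diff[OF L(2,1)] assms(2)])
    also have "\<dots> \<le> (e / (L2_norm M h + 1)) * L2_norm M h"
      using Tz_increment[OF that(1,2) assms(1)] d(2)[of "b - a"] that
      by (intro mult_right_mono L2_norm_nonneg) auto
    also have "\<dots> < e" using e L2_norm_nonneg[of M h] by (simp add: field_simps)
    finally show ?thesis .
  qed
  show "\<exists>d>0. \<forall>s\<in>{0..}. dist s t < d \<longrightarrow> dist (L2_inner M (Tz s f) h) (L2_inner M (Tz t f) h) < e"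
  proof (intro exI[of _ d] conjI ballI impI d(1))
    fix s assume s: "s \<in> {0..}" "dist s t < d"
    show "dist (L2_inner M (Tz s f) h) (L2_inner M (Tz t f) h) < e"
      using *[of s t] *[of t s] s t by (cases "s \<le> t") (auto simp: dist_real_def abs_minus_commute)
  qed
qed

text \<open>Formally l u - g is the average of T_s g - g against l exp(-l s) ds; the integral being
  weak, it is tested against k = l u - g itself. The norm of T_s g - g is at most e for s < d and at
  most 2 |g| \<le> (2 |g| / d) s afterwards, so one affine majorant covers both ranges.\<close>

lemma resolvent_approx:
  assumes g: "L2 M g" and l: "0 < l" and u: "is_resolvent M T l g u"
    and d: "0 < d" "\<And>h. 0 \<le> h \<Longrightarrow> h < d \<Longrightarrow> L2_norm M (\<lambda>x. Tz h g x - g x) \<le> e"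
  shows "L2_norm M (\<lambda>x. l * u x - g x) \<le> e + 2 * L2_norm M g / d / l"
proof -
  define k where "k = (\<lambda>x. l * u x - g x)"
  have uL: "L2 M u" using u by (simp add: is_resolvent_def)
  have k: "L2 M k" unfolding k_def by (intro L2_diff L2_cmult uL g)
  let ?K = "L2_norm M k"
  have e: "0 \<le> e" using d(2)[of 0] d(1) L2_norm_nonneg[of M "\<lambda>x. Tz 0 g x - g x"] by simp
  have Ti: "set_integrable lborel {0<..} (\<lambda>s. exp (- l * s) * L2_inner M (Tz s g) k)"
    by (rule set_integrable_exp_bounded[OF Tz_inner_continuous[OF g k] _ l])
       (rule Tz_inner_bound[OF _ g k])
  have gi: "set_integrable lborel {0<..} (\<lambda>s. exp (- l * s) * L2_inner M g k)"
    using laplace_moments(1)[OF l, of "L2_inner M g k" 0] by simp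
  have "L2_inner M u k = (LINT s:{0<..}|lborel. exp (- l * s) * L2_inner M (Tz s g) k)"
    using u k by (auto simp: is_resolvent_def Tz_def intro!: set_lebesgue_integral_cong)
  moreover have "(LINT s:{0<..}|lborel. exp (- l * s) * L2_inner M g k) = L2_inner M g k / l"
    using laplace_moments(2)[OF l, of "L2_inner M g k" 0] by simp
  ultimately have "?K\<^sup>2 = l * ((LINT s:{0<..}|lborel. exp (- l * s) * L2_inner M (Tz s g) k)
      - (LINT s:{0<..}|lborel. exp (- l * s) * L2_inner M g k))"
  proof -
    assume a: "L2_inner M u k = (LINT s:{0<..}|lborel. exp (- l * s) * L2_inner M (Tz s g) k)"
      and b: "(LINT s:{0<..}|lborel. exp (- l * s) * L2_inner M g k) = L2_inner M g k / l"
    have "?K\<^sup>2 = L2_inner M (\<lambda>x. l * u x - g x) k" by (simp add: L2_norm_sq_inner k_def)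
    also have "\<dots> = l * L2_inner M u k - L2_inner M g k"
      by (simp add: L2_inner_diff_left[OF L2_cmult[OF uL] g k] L2_inner_cmult_left)
    also have "\<dots> = l * (L2_inner M u k - L2_inner M g k / l)" using l by (simp add: field_simps)
    finally show ?thesis unfolding a b .
  qed
  also have "\<dots> = l * (LINT s:{0<..}|lborel. exp (- l * s) * L2_inner M (Tz s g) k - exp (- l * s) * L2_inner M g k)"
    using set_integral_diff(2)[OF Ti gi] by simp
  also have "\<dots> \<le> l * (LINT s:{0<..}|lborel. exp (- l * s) * (e * ?K + 2 * L2_norm M g / d * ?K * s))"
  proof (intro mult_left_mono set_integral_mono set_integral_diff(1)[OF Ti gi] laplace_moments(1) l)
    fix s :: real assume "s \<in> {0<..}"
    then have s: "0 \<le> s" by simp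
    have TL: "L2 M (Tz s g)" by (rule Tz_L2[OF s g])
    have "L2_inner M (Tz s g) k - L2_inner M g k = L2_inner M (\<lambda>x. Tz s g x - g x) k"
      by (simp add: L2_inner_diff_left[OF TL g k])
    also have "\<dots> \<le> L2_norm M (\<lambda>x. Tz s g x - g x) * ?K"
      using L2_Cauchy_Schwarz[OF L2_diff[OF TL g] k] by simp
    also have "\<dots> \<le> (e + 2 * L2_norm M g / d * s) * ?K"
    proof (rule mult_right_mono[OF _ L2_norm_nonneg])
      show "L2_norm M (\<lambda>x. Tz s g x - g x) \<le> e + 2 * L2_norm M g / d * s"
      proof (cases "s < d")
        case True
        have "0 \<le> 2 * L2_norm M g / d * s" using s d(1) L2_norm_nonneg[of M g] by simp
        then show ?thesis using d(2)[OF s True] by linarith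
      next
        case False
        have "L2_norm M (\<lambda>x. Tz s g x - g x) \<le> L2_norm M (Tz s g) + L2_norm M (\<lambda>x. (-1) * g x)"
          using L2_norm_triangle[OF TL L2_cmult[OF g], of "-1"] by simp
        also have "\<dots> \<le> 2 * L2_norm M g * 1" using Tz_norm_le[OF s g] unfolding L2_norm_cmult by simp
        also have "\<dots> \<le> 2 * L2_norm M g * (s / d)"
          using False d(1) L2_norm_nonneg[of M g] by (intro mult_left_mono) auto
        finally show ?thesis using e by simp
      qed
    qed
    finally have "exp (- l * s) * (L2_inner M (Tz s g) k - L2_inner M g k)
       \<le> exp (- l * s) * ((e + 2 * L2_norm M g / d * s) * ?K)"
      by (intro mult_left_mono) auto
    moreover have "(e + 2 * L2_norm M g / d * s) * ?K = e * ?K + 2 * L2_norm M g / d * ?K * s"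
      by (simp add: algebra_simps)
    ultimately show "exp (- l * s) * L2_inner M (Tz s g) k - exp (- l * s) * L2_inner M g k
       \<le> exp (- l * s) * (e * ?K + 2 * L2_norm M g / d * ?K * s)"
      by (simp add: right_diff_distrib)
  qed (use l in auto)
  also have "\<dots> = (e + 2 * L2_norm M g / d / l) * ?K"
    unfolding laplace_moments(2)[OF l] using l by (simp add: field_simps power2_eq_square)
  finally have "?K * ?K \<le> (e + 2 * L2_norm M g / d / l) * ?K" by (simp add: power2_eq_square)
  moreover have "0 \<le> e + 2 * L2_norm M g / d / l" using e d(1) l L2_norm_nonneg[of M g] by simp
  ultimately show ?thesis unfolding k_def[symmetric]
    using L2_norm_nonneg[of M k] by (cases "?K = 0") (auto simp: mult_le_cancel_right)
qed

lemma resolvent_tendsto: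
  assumes g: "L2 M g" and u: "\<And>n::nat. is_resolvent M T (real (Suc n)) g (u n)"
  shows "(\<lambda>n. L2_norm M (\<lambda>x. real (Suc n) * u n x - g x)) \<longlonglongrightarrow> 0"
proof (rule LIMSEQ_I)
  fix r :: real assume r: "0 < r"
  obtain d where d: "d > 0" "\<And>h. 0 \<le> h \<Longrightarrow> h < d \<Longrightarrow> L2_norm M (\<lambda>x. Tz h g x - g x) < r / 2"
    using Tz_small[OF g, of "r / 2"] r by auto
  have "(\<lambda>n. 2 * L2_norm M g / d / real (Suc n)) \<longlonglongrightarrow> 0"
    by (rule LIMSEQ_Suc[OF lim_const_over_n])
  then obtain N where N: "\<And>n. n \<ge> N \<Longrightarrow> \<bar>2 * L2_norm M g / d / real (Suc n)\<bar> < r / 2"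
    using LIMSEQ_D[of _ 0 "r / 2"] r by (metis diff_zero half_gt_zero real_norm_def)
  show "\<exists>N. \<forall>n\<ge>N. norm (L2_norm M (\<lambda>x. real (Suc n) * u n x - g x) - 0) < r"
  proof (intro exI[of _ N] allI impI)
    fix n assume n: "N \<le> n"
    have "L2_norm M (\<lambda>x. real (Suc n) * u n x - g x) \<le> r / 2 + 2 * L2_norm M g / d / real (Suc n)"
      by (rule resolvent_approx[OF g _ u d(1)]) (use d(2) in force)+
    then show "norm (L2_norm M (\<lambda>x. real (Suc n) * u n x - g x) - 0) < r"
      using N[OF n] L2_norm_nonneg[of M "\<lambda>x. real (Suc n) * u n x - g x"]
      unfolding real_norm_def diff_zero by linarith
  qed
qed

end

text \<open>\<open>V t\<close> is \<open>l\<close> times the resolvent of \<open>T t f\<close>; along this orbit everything is differentiable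
  in \<open>t\<close>, and no commutation of resolvent and semigroup is needed.\<close>

locale resolvent_orbit = l2_semigroup +
  fixes l :: real and f :: "'a \<Rightarrow> real" and U :: "real \<Rightarrow> 'a \<Rightarrow> real"
  assumes l: "0 < l" and f: "L2 M f"
    and U: "\<And>t. 0 \<le> t \<Longrightarrow> is_resolvent M T l (Tz t f) (U t)"
begin

definition "V t x = l * U t x"

text \<open>The Yosida approximation of the generator, applied to T_t f. It is the time derivative
  of \<open>V\<close> and, read through the form, also the generator applied to
  \<open>V t\<close>.\<close>

definition "P t x = l * (V t x - Tz t f x)"

lemma U_L2: "0 \<le> t \<Longrightarrow> L2 M (U t)"
  using U by (simp add: is_resolvent_def)

lemma V_L2: "0 \<le> t \<Longrightarrow> L2 M (V t)"
  unfolding V_def by (intro L2_cmult U_L2)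

lemma P_L2: "0 \<le> t \<Longrightarrow> L2 M (P t)"
  unfolding P_def by (intro L2_cmult L2_diff V_L2 Tz_L2 f)

lemma U_inner:
  assumes "0 \<le> t" "L2 M h"
  shows "L2_inner M (U t) h = (LINT s:{0<..}|lborel. exp (- l * s) * L2_inner M (Tz (s + t) f) h)"
proof -
  have "L2_inner M (T s (Tz t f)) h = L2_inner M (Tz (s + t) f) h" if "0 < s" for s
  proof -
    have "AE x in M. Tz (s + t) f x = T s (Tz t f) x"
      using Tz_add[of s t f] that assms(1) f by (simp add: Tz_pos)
    moreover have "L2 M (T s (Tz t f))" using Tz_L2[of s "Tz t f"] Tz_L2[of t f] that assms f by (simp add: Tz_pos)
    ultimately show ?thesis using assms that f by (intro L2_inner_cong Tz_L2) auto
  qed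
  then show ?thesis using U[OF assms(1)] assms(2)
    by (auto simp: is_resolvent_def intro!: set_lebesgue_integral_cong)
qed

lemma V_inner_deriv:
  assumes "L2 M h"
  shows "continuous_on {0..} (\<lambda>t. L2_inner M (V t) h)"
    and "0 < t \<Longrightarrow> ((\<lambda>t. L2_inner M (V t) h) has_real_derivative L2_inner M (P t) h) (at t)"
proof -
  let ?g = "\<lambda>t. LINT s:{0<..}|lborel. exp (- l * s) * L2_inner M (Tz (s + t) f) h"
  note L = laplace_shift_deriv[OF Tz_inner_continuous[OF f assms] Tz_inner_bound[OF _ f assms] l]
  have V: "L2_inner M (V t) h = l * ?g t" if "0 \<le> t" for t
    unfolding V_def L2_inner_cmult_left using U_inner[OF that assms] by simp
  have "continuous_on {0..} (\<lambda>t. l * ?g t)" by (intro continuous_intros L(1))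
  then show "continuous_on {0..} (\<lambda>t. L2_inner M (V t) h)"
    by (subst continuous_on_cong[OF refl V]) auto
  assume t: "0 < t"
  have "((\<lambda>t. l * ?g t) has_real_derivative l * (l * ?g t - L2_inner M (Tz t f) h)) (at t)"
    by (intro DERIV_cmult L(2) t)
  moreover have "l * (l * ?g t - L2_inner M (Tz t f) h) = L2_inner M (P t) h"
    using t f V_L2[of t] Tz_L2[of t f] assms V[of t]
    unfolding P_def by (simp add: L2_inner_cmult_left L2_inner_diff_left)
  moreover have "\<forall>\<^sub>F s in nhds t. s \<in> {0<..}"
    using t by (intro eventually_nhds_in_open) auto
  then have "\<forall>\<^sub>F s in nhds t. L2_inner M (V s) h = l * ?g s"
    by eventually_elim (rule V, simp)
  ultimately show "((\<lambda>t. L2_inner M (V t) h) has_real_derivative L2_inner M (P t) h) (at t)"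
    by (subst DERIV_cong_ev) auto
qed

text \<open>The constant of \<open>resolvent_approx\<close> with e = 2 |f| and d = 1, multiplied by
  l. It blows up with l, which is harmless: it serves only to justify continuity and
  differentiability at fixed l.\<close>

definition "Pmax = 2 * (l + 1) * L2_norm M f"

lemma Pmax_nonneg: "0 \<le> Pmax"
  using l L2_norm_nonneg[of M f] by (simp add: Pmax_def)

lemma P_norm_le:
  assumes t: "0 \<le> t"
  shows "L2_norm M (P t) \<le> Pmax"
proof -
  have TL: "L2 M (Tz t f)" by (rule Tz_L2[OF t f])
  have "L2_norm M (\<lambda>x. Tz h (Tz t f) x - Tz t f x) \<le> 2 * L2_norm M f" if "0 \<le> h" for h
  proof -
    have "L2_norm M (\<lambda>x. Tz h (Tz t f) x + (-1) * Tz t f x)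
        \<le> L2_norm M (Tz h (Tz t f)) + L2_norm M (\<lambda>x. (-1) * Tz t f x)"
      by (rule L2_norm_triangle[OF Tz_L2[OF that TL] L2_cmult[OF TL]])
    then show ?thesis using Tz_norm_le[OF that TL] Tz_norm_le[OF t f] unfolding L2_norm_cmult by simp
  qed
  then have "L2_norm M (\<lambda>x. l * U t x - Tz t f x) \<le> 2 * L2_norm M f + 2 * L2_norm M (Tz t f) / 1 / l"
    by (intro resolvent_approx TL l U t) auto
  also have "\<dots> \<le> 2 * L2_norm M f + 2 * L2_norm M f / l"
    using Tz_norm_le[OF t f] l by (simp add: divide_right_mono)
  finally have "l * L2_norm M (\<lambda>x. l * U t x - Tz t f x) \<le> l * (2 * L2_norm M f + 2 * L2_norm M f / l)"
    using l by (intro mult_left_mono) auto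
  also have "\<dots> = Pmax" using l by (simp add: Pmax_def field_simps)
  finally show ?thesis unfolding P_def V_def L2_norm_cmult using l by simp
qed

text \<open>No vector-valued derivative is involved: with h = V b - V a frozen, the scalar mean
  value theorem for the product of \<open>V t\<close> with h bounds |h|^2 by (b - a) Pmax
  |h|.\<close>

lemma V_lipschitz:
  assumes "0 \<le> s" "0 \<le> t"
  shows "L2_norm M (\<lambda>x. V t x - V s x) \<le> Pmax * \<bar>t - s\<bar>"
proof -
  have *: "L2_norm M (\<lambda>x. V b x - V a x) \<le> Pmax * (b - a)" if ab: "0 \<le> a" "a < b" for a b
  proof -
    define h where "h = (\<lambda>x. V b x - V a x)"
    have L: "L2 M (V a)" "L2 M (V b)" using ab by (auto intro!: V_L2)
    have h: "L2 M h" unfolding h_def by (rule L2_diff[OF L(2,1)])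
    obtain D z where z: "a < z" "z < b" "((\<lambda>t. L2_inner M (V t) h) has_real_derivative D) (at z)"
      "L2_inner M (V b) h - L2_inner M (V a) h = (b - a) * D"
    proof -
      have "\<exists>D z. a < z \<and> z < b \<and> DERIV (\<lambda>t. L2_inner M (V t) h) z :> D \<and>
          L2_inner M (V b) h - L2_inner M (V a) h = (b - a) * D"
      proof (rule MVT[OF ab(2)])
        show "continuous_on {a..b} (\<lambda>t. L2_inner M (V t) h)"
          by (rule continuous_on_subset[OF V_inner_deriv(1)[OF h]]) (use ab in auto)
        show "(\<lambda>t. L2_inner M (V t) h) differentiable at z" if "a < z" for z
          using V_inner_deriv(2)[OF h, of z] that ab unfolding real_differentiable_def by auto
      qed
      then show ?thesis using that by blast
    qed
    have "0 < z" using z ab by simp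
    have D: "D = L2_inner M (P z) h" by (rule DERIV_unique[OF z(3) V_inner_deriv(2)[OF h \<open>0 < z\<close>]])
    have "(L2_norm M h)\<^sup>2 = L2_inner M (\<lambda>x. V b x - V a x) h" by (simp add: L2_norm_sq_inner h_def)
    also have "\<dots> = (b - a) * D" using z(4) by (simp add: L2_inner_diff_left[OF L(2,1) h])
    also have "\<dots> \<le> (b - a) * (Pmax * L2_norm M h)"
    proof (rule mult_left_mono)
      have "D \<le> L2_norm M (P z) * L2_norm M h"
        using L2_Cauchy_Schwarz[OF P_L2 h, of z] \<open>0 < z\<close> D by simp
      also have "\<dots> \<le> Pmax * L2_norm M h" using P_norm_le[of z] \<open>0 < z\<close> by (intro mult_right_mono L2_norm_nonneg) auto
      finally show "D \<le> Pmax * L2_norm M h" .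
    qed (use ab in simp)
    finally have "L2_norm M h * L2_norm M h \<le> Pmax * (b - a) * L2_norm M h" by (simp add: power2_eq_square mult_ac)
    moreover have "0 \<le> Pmax * (b - a)" using Pmax_nonneg ab by simp
    ultimately have "L2_norm M h \<le> Pmax * (b - a)"
      using L2_norm_nonneg[of M h] by (cases "L2_norm M h = 0") (auto simp: mult_le_cancel_right)
    then show ?thesis by (simp add: h_def)
  qed
  consider "s < t" | "t < s" | "s = t" by linarith
  then show ?thesis
  proof cases
    case 1 then show ?thesis using *[of s t] assms by simp
  next
    case 2 then show ?thesis using *[of t s] assms L2_norm_minus_commute[of M "V t" "V s"] by simp
  next
    case 3 then show ?thesis by (simp add: L2_norm_def)
  qed
qed

end

section \<open>Further calculus for test functions\<close>

lemma smooth_fun_directional: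
  assumes "smooth_fun f"
  shows "((\<lambda>s. f (x + s *\<^sub>R axis i 1)) has_real_derivative partial_deriv i f (x + s *\<^sub>R axis i 1)) (at s)"
proof -
  have "((\<lambda>s. x + s *\<^sub>R axis i (1::real)) has_derivative (\<lambda>s. s *\<^sub>R axis i 1)) (at s)"
    by (auto intro!: derivative_eq_intros)
  then have "((\<lambda>s. f (x + s *\<^sub>R axis i 1)) has_derivative
      (\<lambda>t. grad f (x + s *\<^sub>R axis i 1) \<bullet> (t *\<^sub>R axis i 1))) (at s)"
    by (rule has_derivative_compose[OF _ has_derivative_grad[OF smooth_fun_differentiable[OF assms]]])
  moreover have "(\<lambda>t. grad f (x + s *\<^sub>R axis i 1) \<bullet> (t *\<^sub>R axis i 1)) = (*) (partial_deriv i f (x + s *\<^sub>R axis i 1))"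
    by (rule ext) (simp add: partial_deriv_eq_grad inner_axis mult.commute)
  ultimately show ?thesis by (simp only: has_field_derivative_def)
qed

lemma smooth_fun_directional_mvt:
  assumes "smooth_fun f" "0 < s"
  obtains t where "0 < t" "t < s"
    "f (x + s *\<^sub>R axis i 1) - f x = s * partial_deriv i f (x + t *\<^sub>R axis i 1)"
proof -
  from mean_value_obtain[OF smooth_fun_directional[OF assms(1)] assms(2), of x i]
  obtain t where "0 < t" "t < s"
    "f (x + s *\<^sub>R axis i 1) - f (x + 0 *\<^sub>R axis i 1) = (s - 0) * partial_deriv i f (x + t *\<^sub>R axis i 1)" .
  then show ?thesis by (intro that[of t]) auto
qed

lemma second_difference:
  fixes f :: "real^'n::finite \<Rightarrow> real"
  assumes "smooth_fun f" "0 < s"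
  obtains y where "norm (y - x) \<le> 2 * s"
    "f (x + s *\<^sub>R axis i 1 + s *\<^sub>R axis j 1) - f (x + s *\<^sub>R axis i 1) - f (x + s *\<^sub>R axis j 1) + f x
       = s * s * partial_deriv j (partial_deriv i f) y"
proof -
  let ?e = "\<lambda>k. axis k (1::real) :: real^'n"
  have "((\<lambda>u. f ((x + s *\<^sub>R ?e j) + u *\<^sub>R ?e i) - f (x + u *\<^sub>R ?e i)) has_real_derivative
      partial_deriv i f ((x + s *\<^sub>R ?e j) + u *\<^sub>R ?e i) - partial_deriv i f (x + u *\<^sub>R ?e i)) (at u)" for u
    by (intro DERIV_diff smooth_fun_directional assms)
  from mean_value_obtain[OF this assms(2)] obtain u where u: "0 < u" "u < s"
    "f ((x + s *\<^sub>R ?e j) + s *\<^sub>R ?e i) - f (x + s *\<^sub>R ?e i) - (f (x + s *\<^sub>R ?e j) - f x)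
      = s * (partial_deriv i f ((x + s *\<^sub>R ?e j) + u *\<^sub>R ?e i) - partial_deriv i f (x + u *\<^sub>R ?e i))"
    by auto
  obtain t where t: "0 < t" "t < s"
    "partial_deriv i f ((x + u *\<^sub>R ?e i) + s *\<^sub>R ?e j) - partial_deriv i f (x + u *\<^sub>R ?e i)
       = s * partial_deriv j (partial_deriv i f) ((x + u *\<^sub>R ?e i) + t *\<^sub>R ?e j)"
    using smooth_fun_directional_mvt[OF smooth_fun_partial_deriv[OF assms(1)] assms(2)] .
  have "norm (u *\<^sub>R ?e i + t *\<^sub>R ?e j) \<le> u + t"
    by (rule norm_triangle_le) (use u(1) t(1) in simp)
  then have "norm ((x + u *\<^sub>R ?e i + t *\<^sub>R ?e j) - x) \<le> 2 * s" using u t by (simp add: add.assoc)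
  moreover have "x + s *\<^sub>R ?e j + s *\<^sub>R ?e i = x + s *\<^sub>R ?e i + s *\<^sub>R ?e j"
    "x + s *\<^sub>R ?e j + u *\<^sub>R ?e i = x + u *\<^sub>R ?e i + s *\<^sub>R ?e j" by (simp_all add: add_ac)
  ultimately have "f (x + s *\<^sub>R ?e i + s *\<^sub>R ?e j) - f (x + s *\<^sub>R ?e i) - (f (x + s *\<^sub>R ?e j) - f x)
      = s * (s * partial_deriv j (partial_deriv i f) ((x + u *\<^sub>R ?e i) + t *\<^sub>R ?e j))"
    using u(3) t(3) by (simp only:)
  then have "f (x + s *\<^sub>R ?e i + s *\<^sub>R ?e j) - f (x + s *\<^sub>R ?e i) - f (x + s *\<^sub>R ?e j) + f x
      = s * s * partial_deriv j (partial_deriv i f) ((x + u *\<^sub>R ?e i) + t *\<^sub>R ?e j)"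
    unfolding mult.assoc by linarith
  with \<open>norm ((x + u *\<^sub>R ?e i + t *\<^sub>R ?e j) - x) \<le> 2 * s\<close> show ?thesis by (rule that)
qed

text \<open>The second difference over a small square is symmetric in the two directions and equals
  s^2 times either mixed derivative at a point within 2 s of x; let s tend to 0. The symmetry of the
  Hessian is what cancels it against the skew part of A.\<close>

lemma partial_deriv_commute:
  fixes f :: "real^'n::finite \<Rightarrow> real"
  assumes "smooth_fun f"
  shows "partial_deriv j (partial_deriv i f) x = partial_deriv i (partial_deriv j f) x"
proof -
  let ?s = "\<lambda>n. inverse (real (Suc n))"
  have "\<exists>y z. norm (y - x) \<le> 2 * ?s n \<and> norm (z - x) \<le> 2 * ?s n \<and>
      partial_deriv j (partial_deriv i f) y = partial_deriv i (partial_deriv j f) z" for n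
  proof -
    have s: "0 < ?s n" by simp
    from second_difference[OF assms s, of x i j] second_difference[OF assms s, of x j i]
    show ?thesis
      by (smt (verit) add.commute add.left_commute mult_left_cancel mult_pos_pos s)
  qed
  then obtain y z where yz: "\<And>n. norm (y n - x) \<le> 2 * ?s n" "\<And>n. norm (z n - x) \<le> 2 * ?s n"
    "\<And>n. partial_deriv j (partial_deriv i f) (y n) = partial_deriv i (partial_deriv j f) (z n)"
    by metis
  have s0: "(\<lambda>n. 2 * ?s n) \<longlonglongrightarrow> 0"
    using tendsto_mult_left[OF LIMSEQ_inverse_real_of_nat, of 2] by simp
  have "y \<longlonglongrightarrow> x" "z \<longlonglongrightarrow> x"
    using Lim_null_comparison[OF always_eventually[OF allI[OF yz(1)]] s0]
      Lim_null_comparison[OF always_eventually[OF allI[OF yz(2)]] s0] by (simp_all add: LIM_zero_iff)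
  moreover have "continuous_on UNIV (partial_deriv j (partial_deriv i f))"
    "continuous_on UNIV (partial_deriv i (partial_deriv j f))"
    by (intro smooth_fun_continuous smooth_fun_partial_deriv assms)+
  ultimately have "(\<lambda>n. partial_deriv j (partial_deriv i f) (y n)) \<longlonglongrightarrow> partial_deriv j (partial_deriv i f) x"
    "(\<lambda>n. partial_deriv i (partial_deriv j f) (z n)) \<longlonglongrightarrow> partial_deriv i (partial_deriv j f) x"
    by (auto intro: continuous_on_tendsto_compose)
  then show ?thesis unfolding yz(3) by (rule LIMSEQ_unique)
qed

lemma grad_mult_smooth:
  "smooth_fun f \<Longrightarrow> smooth_fun g \<Longrightarrow> grad (\<lambda>x. f x * g x) x = f x *\<^sub>R grad g x + g x *\<^sub>R grad f x"
  by (intro grad_mult smooth_fun_differentiable)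

lemma partial_deriv_mult:
  assumes "smooth_fun f" "smooth_fun g"
  shows "partial_deriv i (\<lambda>x. f x * g x) x = f x * partial_deriv i g x + g x * partial_deriv i f x"
  unfolding partial_deriv_eq_grad grad_mult_smooth[OF assms] by simp

section \<open>Bounded functions with bounded support\<close>

text \<open>A class that is closed under products and contains test functions, their derivatives and
  indicators of balls. Local integrability is then one condition, integrability against every
  member, with no further cutoffs or compact sets in later estimates.\<close>

definition bounded_support :: "(real^'n::finite \<Rightarrow> real) \<Rightarrow> bool" where
  "bounded_support g \<longleftrightarrow> g \<in> borel_measurable borel \<and>
     (\<exists>b. \<forall>x. \<bar>g x\<bar> \<le> b) \<and> (\<exists>r. \<forall>x. r < norm x \<longrightarrow> g x = 0)"

lemma bounded_support_measurable: "bounded_support g \<Longrightarrow> g \<in> borel_measurable borel"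
  by (simp add: bounded_support_def)

lemma bounded_supportE:
  assumes "bounded_support g"
  obtains b r where "0 < b" "0 < r" "\<And>x. \<bar>g x\<bar> \<le> b" "\<And>x. r \<le> norm x \<Longrightarrow> g x = 0"
proof -
  obtain b r where br: "\<And>x. \<bar>g x\<bar> \<le> b" "\<And>x. r < norm x \<Longrightarrow> g x = 0"
    using assms unfolding bounded_support_def by auto
  have "0 < \<bar>b\<bar> + 1" "0 < \<bar>r\<bar> + 1" by auto
  moreover have "\<bar>g x\<bar> \<le> \<bar>b\<bar> + 1" for x using br(1)[of x] by linarith
  moreover have "g x = 0" if "\<bar>r\<bar> + 1 \<le> norm x" for x by (rule br(2)) (use that in linarith)
  ultimately show ?thesis using that by blast
qed

lemma test_fun_bounded_support_fun: "test_fun f \<Longrightarrow> bounded_support f"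
  using test_fun_bounds[of f] smooth_fun_borel[OF test_fun_smooth] unfolding bounded_support_def by metis

lemma test_fun_bounded_support_partial:
  assumes "test_fun f"
  shows "bounded_support (partial_deriv i f)"
proof -
  obtain r b where rb: "\<And>x. r < norm x \<Longrightarrow> f x = 0 \<and> grad f x = 0" "\<And>x. norm (grad f x) \<le> b"
    using test_fun_bounds[OF assms] by metis
  have "partial_deriv i f \<in> borel_measurable borel"
    by (intro smooth_fun_borel smooth_fun_partial_deriv test_fun_smooth assms)
  moreover have "\<bar>partial_deriv i f x\<bar> \<le> b" for x
    using component_le_norm_cart[of "grad f x" i] rb(2)[of x] by (simp add: partial_deriv_eq_grad)
  moreover have "partial_deriv i f x = 0" if "r < norm x" for x
    using rb(1)[OF that] by (simp add: partial_deriv_eq_grad)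
  ultimately show ?thesis unfolding bounded_support_def by blast
qed

lemma bounded_support_mult:
  assumes "bounded_support f" "bounded_support g"
  shows "bounded_support (\<lambda>x. f x * g x)"
proof -
  obtain b r where b: "\<And>x. \<bar>f x\<bar> \<le> b" "\<And>x. r \<le> norm x \<Longrightarrow> f x = 0" using bounded_supportE[OF assms(1)] by metis
  obtain c where c: "\<And>x. \<bar>g x\<bar> \<le> c" using bounded_supportE[OF assms(2)] by metis
  have "\<bar>f x * g x\<bar> \<le> b * c" for x
    unfolding abs_mult using b(1)[of x] c[of x] by (intro mult_mono) auto
  moreover have "f x * g x = 0" if "r < norm x" for x using b(2)[of x] that by simp
  ultimately show ?thesis using assms unfolding bounded_support_def by (auto intro!: borel_measurable_times)
qed

lemma bounded_support_mult_smooth: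
  assumes "bounded_support f" "smooth_fun g"
  shows "bounded_support (\<lambda>x. f x * g x)"
proof -
  obtain b r where b: "0 < b" "\<And>x. \<bar>f x\<bar> \<le> b" "\<And>x. r \<le> norm x \<Longrightarrow> f x = 0" using bounded_supportE[OF assms(1)] by metis
  have "bounded (g ` cball 0 r)"
    by (intro compact_imp_bounded compact_continuous_image smooth_fun_continuous assms compact_cball)
  then obtain c where c: "c > 0" "\<And>x. norm x \<le> r \<Longrightarrow> \<bar>g x\<bar> \<le> c" unfolding bounded_pos by auto
  have "\<bar>f x * g x\<bar> \<le> b * c" for x
  proof (cases "norm x \<le> r")
    case True
    then show ?thesis unfolding abs_mult using b(1) b(2)[of x] c(2)[of x] by (intro mult_mono) auto
  next
    case False
    then show ?thesis using b c by simp
  qed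
  moreover have "f x * g x = 0" if "r < norm x" for x using b(3)[of x] that by simp
  moreover have "(\<lambda>x. f x * g x) \<in> borel_measurable borel"
    using assms by (intro borel_measurable_times smooth_fun_borel bounded_support_measurable)
  ultimately show ?thesis unfolding bounded_support_def by blast
qed

lemma bounded_support_indicator: "bounded_support (indicator (cball 0 r))"
proof -
  have "\<bar>indicat_real (cball 0 r) x\<bar> \<le> 1" for x :: "real^'a" by (simp add: indicator_def)
  moreover have "indicat_real (cball 0 r) x = 0" if "r < norm x" for x :: "real^'a"
    using that by (simp add: indicator_def)
  ultimately show ?thesis
    unfolding bounded_support_def by (blast intro: borel_measurable_indicator borel_closed closed_cball)
qed

text \<open>A smooth step composed with an affine function of \<open>x \<bullet> x\<close>, which
  avoids the singularity of the norm at 0. The gradient is radial, so that a(grad \<zeta>, grad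
  \<zeta>) and <\<beta>, grad \<zeta>> reduce to the radial quantities of \<open>A_hat\<close>, and
  c does not depend on r.\<close>

lemma radial_cutoff_ex:
  "\<exists>c>0. \<forall>r>0. \<exists>\<zeta> :: real^'n::finite \<Rightarrow> real. \<exists>k. test_fun \<zeta> \<and> (\<forall>x. 0 \<le> \<zeta> x \<and> \<zeta> x \<le> 1) \<and>
     (\<forall>x. norm x \<le> r \<longrightarrow> \<zeta> x = 1) \<and> (\<forall>x. grad \<zeta> x = k x *\<^sub>R x) \<and>
     (\<forall>x. \<bar>k x\<bar> * norm x \<le> c / r) \<and> (\<forall>x. norm x < r \<or> 2 * r \<le> norm x \<longrightarrow> k x = 0)"
proof -
  obtain S' S P Q :: "real \<Rightarrow> real" and L where S: "smooth_real S"
      "\<And>x. (S has_real_derivative S' x) (at x)" "\<And>x. (P has_real_derivative S x) (at x)"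
      "\<And>x. 0 \<le> S' x" "\<And>x. S' x \<le> L" "\<And>x. x \<le> 0 \<Longrightarrow> S' x = 0" "\<And>x. 1 \<le> x \<Longrightarrow> S' x = 0"
      "\<And>x. x \<le> 0 \<Longrightarrow> S x = 0" "\<And>x. 1 \<le> x \<Longrightarrow> S x = 1"
    using smooth_step_ex by metis
  have L: "0 \<le> L" using S(4)[of 0] S(5)[of 0] by linarith
  have mono: "S x \<le> S y" if "x \<le> y" for x y
    using DERIV_nonneg_imp_nondecreasing[OF that, of S] S(2,4) by blast
  have S01: "0 \<le> S x" "S x \<le> 1" for x
    using mono[of "min x 0" x] mono[of x "max x 1"] S(8)[of "min x 0"] S(9)[of "max x 1"] by auto
  have main: "\<exists>\<zeta> :: real^'n \<Rightarrow> real. \<exists>k. test_fun \<zeta> \<and> (\<forall>x. 0 \<le> \<zeta> x \<and> \<zeta> x \<le> 1) \<and>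
     (\<forall>x. norm x \<le> r \<longrightarrow> \<zeta> x = 1) \<and> (\<forall>x. grad \<zeta> x = k x *\<^sub>R x) \<and>
     (\<forall>x. \<bar>k x\<bar> * norm x \<le> (4 * L / 3 + 1) / r) \<and> (\<forall>x. norm x < r \<or> 2 * r \<le> norm x \<longrightarrow> k x = 0)" if r: "0 < r" for r
  proof -
    \<comment> \<open>The slope for which q = (4 - (|x|/r)^2) / 3, with value 1 on the sphere of
      radius r and 0 on that of radius 2 r.\<close>
    define m where "m = - 1 / (3 * r\<^sup>2)"
    define q where "q = (\<lambda>x::real^'n. m * (x \<bullet> x) + 4 / 3)"
    define \<zeta> where "\<zeta> = (\<lambda>x. S (q x))"
    define k where "k = (\<lambda>x. - 2 * S' (q x) / (3 * r\<^sup>2))"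
    have q: "smooth_fun q" unfolding q_def
      by (intro smooth_fun_add smooth_fun_mult smooth_fun_const smooth_fun_inner_self)
    have qn: "q x = (4 - (norm x / r)\<^sup>2) / 3" for x
      using r by (simp add: q_def m_def dot_square_norm field_simps power2_eq_square)
    have q_ge: "1 \<le> q x" if "norm x \<le> r" for x
    proof -
      have "(norm x / r)\<^sup>2 \<le> 1" using that r by (intro power_le_one) auto
      then show ?thesis by (simp add: qn)
    qed
    have q_le: "q x \<le> 0" if "2 * r \<le> norm x" for x
    proof -
      have "2\<^sup>2 \<le> (norm x / r)\<^sup>2" using that r by (intro power_mono) (auto simp: field_simps)
      then show ?thesis by (simp add: qn)
    qed
    have g: "grad \<zeta> x = k x *\<^sub>R x" for x
    proof -
      have "grad \<zeta> x = S' (q x) *\<^sub>R grad q x"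
        unfolding \<zeta>_def by (rule grad_compose[OF smooth_fun_differentiable[OF q] S(2)])
      moreover have "grad q x = m *\<^sub>R (2 *\<^sub>R x)"
        unfolding q_def
        by (subst grad_add)
           (simp_all add: smooth_fun_differentiable smooth_fun_inner_self smooth_fun_mult smooth_fun_const
             grad_const grad_cmult grad_inner_self)
      ultimately show ?thesis by (simp add: k_def m_def)
    qed
    have "test_fun \<zeta>"
    proof (rule test_funI)
      show "smooth_fun \<zeta>" unfolding \<zeta>_def by (rule smooth_fun_compose[OF S(1) q])
      show "\<zeta> x = 0" if "2 * r < norm x" for x
        unfolding \<zeta>_def using q_le[of x] S(8) that by simp
    qed
    moreover have k0: "k x = 0" if "norm x < r \<or> 2 * r \<le> norm x" for x
      using that q_ge[of x] q_le[of x] S(6,7) by (auto simp: k_def)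
    moreover have "\<bar>k x\<bar> * norm x \<le> (4 * L / 3 + 1) / r" for x
    proof (cases "2 * r \<le> norm x")
      case True
      then show ?thesis using k0 r L by simp
    next
      case False
      have "\<bar>k x\<bar> \<le> 2 * L / (3 * r\<^sup>2)"
        using S(4)[of "q x"] S(5)[of "q x"] r by (simp add: k_def abs_mult divide_right_mono)
      then have "\<bar>k x\<bar> * norm x \<le> 2 * L / (3 * r\<^sup>2) * (2 * r)"
        using False r L by (intro mult_mono) auto
      also have "\<dots> = (4 * L / 3) / r" using r by (simp add: field_simps power2_eq_square)
      also have "\<dots> \<le> (4 * L / 3 + 1) / r" using r by (intro divide_right_mono) auto
      finally show ?thesis .
    qed
    ultimately show ?thesis
      using g S01 q_ge S(9) by (intro exI[of _ \<zeta>] exI[of _ k]) (auto simp: \<zeta>_def)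
  qed
  show ?thesis
    by (rule exI[of _ "4 * L / 3 + 1"]) (use L main in auto)
qed

lemma cutoff_ex:
  assumes "0 < r"
  obtains \<zeta> :: "real^'n::finite \<Rightarrow> real" where "test_fun \<zeta>" "\<And>x. 0 \<le> \<zeta> x \<and> \<zeta> x \<le> 1"
    "\<And>x. norm x < r \<Longrightarrow> \<zeta> x = 1" "\<And>x. norm x < r \<Longrightarrow> grad \<zeta> x = 0"
proof -
  obtain \<zeta> :: "real^'n \<Rightarrow> real" and k where "test_fun \<zeta>" "\<forall>x. 0 \<le> \<zeta> x \<and> \<zeta> x \<le> 1"
     "\<forall>x. norm x \<le> r \<longrightarrow> \<zeta> x = 1" "\<forall>x. grad \<zeta> x = k x *\<^sub>R x" "\<forall>x. norm x < r \<or> 2 * r \<le> norm x \<longrightarrow> k x = 0"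
    using radial_cutoff_ex assms by metis
  then show ?thesis using that[of \<zeta>] by auto
qed

section \<open>Local integrability\<close>

definition locally_finite :: "(real^'n::finite) measure \<Rightarrow> bool" where
  "locally_finite M \<longleftrightarrow> sets M = sets borel \<and> (\<forall>r. emeasure M (cball 0 r) < \<infinity>)"

definition loc_L1 :: "(real^'n::finite) measure \<Rightarrow> (real^'n \<Rightarrow> real) \<Rightarrow> bool" where
  "loc_L1 M a \<longleftrightarrow> (\<forall>g. bounded_support g \<longrightarrow> integrable M (\<lambda>x. a x * g x))"

definition loc_L2 :: "(real^'n::finite) measure \<Rightarrow> (real^'n \<Rightarrow> real) \<Rightarrow> bool" where
  "loc_L2 M a \<longleftrightarrow> (\<forall>g. bounded_support g \<longrightarrow> L2 M (\<lambda>x. a x * g x))"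

lemma locally_finite_lborel: "locally_finite lborel"
  using emeasure_lborel_cball_finite[of 0] unfolding locally_finite_def by auto

lemma locally_finite_measurable:
  fixes f :: "real^'n::finite \<Rightarrow> 'b::topological_space"
  assumes "locally_finite M"
  shows "f \<in> borel_measurable M \<longleftrightarrow> f \<in> borel_measurable borel"
  using measurable_cong_sets[of M borel "borel :: 'b measure" borel] assms
  by (simp add: locally_finite_def)

lemma bounded_support_integrable:
  assumes "locally_finite M" "bounded_support g"
  shows "integrable M g"
proof -
  obtain b r where br: "\<And>x. \<bar>g x\<bar> \<le> b" "\<And>x. r \<le> norm x \<Longrightarrow> g x = 0"
    using bounded_supportE[OF assms(2)] by metis
  have "cball 0 r \<in> sets M" "emeasure M (cball 0 r) < \<infinity>" using assms(1) by (auto simp: locally_finite_def)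
  then have "integrable M (\<lambda>x. b * indicator (cball 0 r) x)" by (intro integrable_mult_right) auto
  then show ?thesis
  proof (rule Bochner_Integration.integrable_bound)
    show "g \<in> borel_measurable M"
      using assms bounded_support_measurable locally_finite_measurable by blast
    have "\<bar>g x\<bar> \<le> \<bar>b\<bar>" for x using br(1)[of x] by linarith
    then show "AE x in M. norm (g x) \<le> norm (b * indicator (cball 0 r) x)"
      using br(2) by (auto simp: indicator_def)
  qed
qed

lemma bounded_support_L2:
  assumes "locally_finite M" "bounded_support g"
  shows "L2 M g"
proof -
  have "integrable M (\<lambda>x. g x * g x)"
    by (intro bounded_support_integrable assms bounded_support_mult)
  then show ?thesis
    using assms bounded_support_measurable locally_finite_measurable
    by (auto simp: L2_real_iff power2_eq_square)
qed

lemma test_fun_L2: "locally_finite M \<Longrightarrow> test_fun f \<Longrightarrow> L2 M f"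
  by (intro bounded_support_L2 test_fun_bounded_support_fun)

lemma test_fun_L2_partial: "locally_finite M \<Longrightarrow> test_fun f \<Longrightarrow> L2 M (partial_deriv i f)"
  by (intro bounded_support_L2 test_fun_bounded_support_partial)

lemma loc_L1D: "loc_L1 M a \<Longrightarrow> bounded_support g \<Longrightarrow> integrable M (\<lambda>x. a x * g x)"
  by (simp add: loc_L1_def)

lemma loc_L2D: "loc_L2 M a \<Longrightarrow> bounded_support g \<Longrightarrow> L2 M (\<lambda>x. a x * g x)"
  by (simp add: loc_L2_def)

lemma loc_L1_add: "loc_L1 M a \<Longrightarrow> loc_L1 M b \<Longrightarrow> loc_L1 M (\<lambda>x. a x + b x)"
  by (auto simp: loc_L1_def distrib_right)

lemma loc_L1_cmult: "loc_L1 M a \<Longrightarrow> loc_L1 M (\<lambda>x. c * a x)"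
  by (auto simp: loc_L1_def mult.assoc)

lemma loc_L1_sum: "(\<And>i. i \<in> I \<Longrightarrow> loc_L1 M (a i)) \<Longrightarrow> loc_L1 M (\<lambda>x. \<Sum>i\<in>I. a i x)"
  by (auto simp: loc_L1_def sum_distrib_right)

lemma loc_L2_mult:
  assumes "loc_L2 M a" "loc_L2 M b"
  shows "loc_L1 M (\<lambda>x. a x * b x)"
  unfolding loc_L1_def
proof (intro allI impI)
  fix g :: "real^'a \<Rightarrow> real" assume g: "bounded_support g"
  obtain r where r: "\<And>x. r \<le> norm x \<Longrightarrow> g x = 0" using bounded_supportE[OF g] by metis
  have "integrable M (\<lambda>x. (a x * g x) * (b x * indicator (cball 0 r) x))"
    by (intro L2_integrable_mult loc_L2D[OF assms(1)] loc_L2D[OF assms(2)] g bounded_support_indicator)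
  moreover have "(a x * g x) * (b x * indicator (cball 0 r) x) = a x * b x * g x" for x
    using r[of x] by (auto simp: indicator_def)
  ultimately show "integrable M (\<lambda>x. a x * b x * g x)" by simp
qed

lemma loc_L2_imp_L1:
  assumes "locally_finite M" "loc_L2 M a"
  shows "loc_L1 M a"
proof -
  have "loc_L2 M (\<lambda>x. 1)" using assms(1) bounded_support_L2 by (auto simp: loc_L2_def)
  from loc_L2_mult[OF assms(2) this] show ?thesis by simp
qed

lemma L1_loc_imp:
  assumes "locally_finite M" "L1_loc M a"
  shows "loc_L1 M a"
  unfolding loc_L1_def
proof (intro allI impI)
  fix g :: "real^'a \<Rightarrow> real" assume g: "bounded_support g"
  obtain b r where br: "\<And>x. \<bar>g x\<bar> \<le> b" "\<And>x. r \<le> norm x \<Longrightarrow> g x = 0"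
    using bounded_supportE[OF g] by metis
  have "integrable M (\<lambda>x. b * (indicator (cball 0 r) x *\<^sub>R a x))"
    using assms(2) compact_cball by (intro integrable_mult_right) (auto simp: L1_loc_def set_integrable_def)
  then show "integrable M (\<lambda>x. a x * g x)"
  proof (rule Bochner_Integration.integrable_bound)
    show "(\<lambda>x. a x * g x) \<in> borel_measurable M"
      using assms bounded_support_measurable[OF g] locally_finite_measurable[OF assms(1), of g]
      by (auto simp: L1_loc_def intro!: borel_measurable_times)
    have "\<bar>g x\<bar> \<le> \<bar>b\<bar>" for x using br(1)[of x] by linarith
    then have "\<bar>a x\<bar> * \<bar>g x\<bar> \<le> \<bar>b\<bar> * \<bar>a x\<bar>" for x
      using mult_left_mono[of "\<bar>g x\<bar>" "\<bar>b\<bar>" "\<bar>a x\<bar>"] by (simp add: mult.commute)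
    then show "AE x in M. norm (a x * g x) \<le> norm (b * (indicator (cball 0 r) x *\<^sub>R a x))"
      using br(2) by (intro AE_I2) (auto simp: indicator_def abs_mult)
  qed
qed

lemma borel_measurable_component [measurable (raw)]:
  fixes F :: "'a \<Rightarrow> real^'n::finite"
  assumes "F \<in> borel_measurable M"
  shows "(\<lambda>x. F x $ i) \<in> borel_measurable M"
  unfolding cart_eq_inner_axis by (intro borel_measurable_inner borel_measurable_const assms)

lemma L2_loc_imp:
  fixes F :: "real^'n::finite \<Rightarrow> real^'n"
  assumes "locally_finite M" "L2_loc M F"
  shows "loc_L2 M (\<lambda>x. F x $ i)"
  unfolding loc_L2_def
proof (intro allI impI)
  fix g :: "real^'n \<Rightarrow> real" assume g: "bounded_support g"
  obtain b r where br: "\<And>x. \<bar>g x\<bar> \<le> b" "\<And>x. r \<le> norm x \<Longrightarrow> g x = 0"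
    using bounded_supportE[OF g] by metis
  have mF: "F \<in> borel_measurable M" using assms(2) by (simp add: L2_loc_def)
  have cb: "cball 0 r \<in> sets M" using assms(1) by (auto simp: locally_finite_def)
  have "L2 M (\<lambda>x. indicator (cball 0 r) x *\<^sub>R F x)"
    unfolding L2_def
  proof
    show "(\<lambda>x. indicator (cball 0 r) x *\<^sub>R F x) \<in> borel_measurable M"
      using mF cb by measurable
    have "integrable M (\<lambda>x. indicator (cball 0 r) x *\<^sub>R (norm (F x))\<^sup>2)"
      using assms(2) compact_cball by (auto simp: L2_loc_def set_integrable_def)
    moreover have "indicator (cball 0 r) x *\<^sub>R (norm (F x))\<^sup>2 = (norm (indicator (cball 0 r) x *\<^sub>R F x))\<^sup>2" for x
      by (auto simp: indicator_def)
    ultimately show "integrable M (\<lambda>x. (norm (indicator (cball 0 r) x *\<^sub>R F x))\<^sup>2)" by simp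
  qed
  then show "L2 M (\<lambda>x. F x $ i * g x)"
  proof (rule L2_bound)
    have "g \<in> borel_measurable M" using bounded_support_measurable[OF g] locally_finite_measurable[OF assms(1)] by blast
    then show "(\<lambda>x. F x $ i * g x) \<in> borel_measurable M"
      by (intro borel_measurable_times borel_measurable_component mF)
    show "AE x in M. norm (F x $ i * g x) \<le> b * norm (indicator (cball 0 r) x *\<^sub>R F x)"
    proof (rule AE_I2)
      fix x
      have "\<bar>F x $ i\<bar> * \<bar>g x\<bar> \<le> norm (F x) * b"
        using br(1)[of x] by (intro mult_mono component_le_norm_cart) auto
      then show "norm (F x $ i * g x) \<le> b * norm (indicator (cball 0 r) x *\<^sub>R F x)"
        using br(2)[of x] by (cases "norm x \<le> r") (auto simp: abs_mult mult.commute)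
    qed
  qed
qed

lemma L2_component:
  fixes F :: "'a \<Rightarrow> real^'n::finite"
  assumes "L2 M F"
  shows "L2 M (\<lambda>x. F x $ i)" "L2_norm M (\<lambda>x. F x $ i) \<le> L2_norm M F"
proof -
  have m: "(\<lambda>x. F x $ i) \<in> borel_measurable M" by (rule borel_measurable_component[OF L2_measurable[OF assms]])
  have b: "AE x in M. norm (F x $ i) \<le> 1 * norm (F x)"
    by (intro AE_I2) (simp add: component_le_norm_cart)
  show "L2 M (\<lambda>x. F x $ i)" by (rule L2_bound[OF assms m b])
  show "L2_norm M (\<lambda>x. F x $ i) \<le> L2_norm M F" using L2_norm_mono[OF assms m b] by simp
qed

text \<open>The hypothesis speaks only of products with cutoffs. Along cutoffs equal to 1 on growing
  balls these products are, at each point, eventually equal to f and to G.\<close>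

lemma H12_loc_grad_measurable:
  assumes "locally_finite M" "H12_loc_grad M f G"
  shows "f \<in> borel_measurable borel" "G \<in> borel_measurable borel"
proof -
  have "\<exists>\<zeta>::real^'a \<Rightarrow> real. test_fun \<zeta> \<and> (\<forall>x. norm x < real (Suc n) \<longrightarrow> \<zeta> x = 1 \<and> grad \<zeta> x = 0)" for n
    using cutoff_ex[of "real (Suc n)"] by (metis of_nat_0_less_iff zero_less_Suc)
  then obtain \<zeta> :: "nat \<Rightarrow> real^'a \<Rightarrow> real" where z: "\<And>n. test_fun (\<zeta> n)"
    "\<And>n x. norm x < real (Suc n) \<Longrightarrow> \<zeta> n x = 1 \<and> grad (\<zeta> n) x = 0" by metis
  have ev: "\<forall>\<^sub>F n in sequentially. norm x < real (Suc n)" for x :: "real^'a"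
  proof -
    obtain N :: nat where "norm x < real N" using reals_Archimedean2 by blast
    then show ?thesis by (intro eventually_sequentiallyI[of N]) auto
  qed
  have L: "L2 M (\<lambda>x. f x * \<zeta> n x)" "L2 M (\<lambda>x. \<zeta> n x *\<^sub>R G x + f x *\<^sub>R grad (\<zeta> n) x)" for n
    using assms(2) z(1)[of n] unfolding H12_loc_grad_def H12_grad_def by blast+
  have "(\<lambda>x. f x * \<zeta> n x) \<in> borel_measurable borel" for n
    using L2_measurable[OF L(1)] locally_finite_measurable[OF assms(1)] by blast
  then show "f \<in> borel_measurable borel"
  proof (rule borel_measurable_LIMSEQ_metric)
    fix x show "(\<lambda>n. f x * \<zeta> n x) \<longlonglongrightarrow> f x"
      by (rule tendsto_eventually) (use ev[of x] in eventually_elim, simp add: z(2))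
  qed
  have "(\<lambda>x. \<zeta> n x *\<^sub>R G x + f x *\<^sub>R grad (\<zeta> n) x) \<in> borel_measurable borel" for n
    using L2_measurable[OF L(2)] locally_finite_measurable[OF assms(1)] by blast
  then show "G \<in> borel_measurable borel"
  proof (rule borel_measurable_LIMSEQ_metric)
    fix x show "(\<lambda>n. \<zeta> n x *\<^sub>R G x + f x *\<^sub>R grad (\<zeta> n) x) \<longlonglongrightarrow> G x"
      by (rule tendsto_eventually) (use ev[of x] in eventually_elim, simp add: z(2))
  qed
qed

text \<open>Choose the cutoff equal to 1 where g is nonzero: there f \<zeta> is f, and the
  product-rule gradient is G.\<close>

lemma H12_loc_grad_loc_L2:
  assumes "locally_finite M" "H12_loc_grad M f G"
  shows "loc_L2 M f" "loc_L2 M (\<lambda>x. G x $ i)"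
proof -
  have "L2 M (\<lambda>x. f x * g x) \<and> L2 M (\<lambda>x. G x $ i * g x)" if g: "bounded_support g" for g
  proof -
    obtain b r where br: "0 < r" "\<And>x. \<bar>g x\<bar> \<le> b" "\<And>x. r \<le> norm x \<Longrightarrow> g x = 0"
      using bounded_supportE[OF g] by metis
    obtain \<zeta> :: "real^'a \<Rightarrow> real" where z: "test_fun \<zeta>" "\<And>x. norm x < r \<Longrightarrow> \<zeta> x = 1"
      "\<And>x. norm x < r \<Longrightarrow> grad \<zeta> x = 0" using cutoff_ex[OF br(1)] by metis
    have L: "L2 M (\<lambda>x. f x * \<zeta> x)" "L2 M (\<lambda>x. \<zeta> x *\<^sub>R G x + f x *\<^sub>R grad \<zeta> x)"
      using assms(2) z(1) unfolding H12_loc_grad_def H12_grad_def by blast+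
    have gm: "g \<in> borel_measurable M" using bounded_support_measurable[OF g] locally_finite_measurable[OF assms(1)] by blast
    have "L2 M (\<lambda>x. g x * (f x * \<zeta> x))" by (rule L2_mult_bounded[OF L(1) gm br(2)])
    moreover have "(\<lambda>x. g x * (f x * \<zeta> x)) = (\<lambda>x. f x * g x)"
      using z(2) br(3) by (intro ext) (metis linorder_not_less mult.commute mult.right_neutral mult_zero_left)
    moreover have "L2 M (\<lambda>x. g x * (\<zeta> x *\<^sub>R G x + f x *\<^sub>R grad \<zeta> x) $ i)"
      by (rule L2_mult_bounded[OF L2_component(1)[OF L(2)] gm br(2)])
    moreover have "(\<lambda>x. g x * (\<zeta> x *\<^sub>R G x + f x *\<^sub>R grad \<zeta> x) $ i) = (\<lambda>x. G x $ i * g x)"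
    proof
      fix x show "g x * (\<zeta> x *\<^sub>R G x + f x *\<^sub>R grad \<zeta> x) $ i = G x $ i * g x"
        using z(2,3)[of x] br(3)[of x] by (cases "norm x < r") auto
    qed
    ultimately show ?thesis by (simp only:)
  qed
  then show "loc_L2 M f" "loc_L2 M (\<lambda>x. G x $ i)" by (auto simp: loc_L2_def)
qed

section \<open>Integration by parts\<close>

text \<open>By translation invariance every difference quotient of \<open>h\<close> integrates to 0.\<close>

lemma integral_partial_deriv_zero:
  fixes h :: "real^'n::finite \<Rightarrow> real"
  assumes "test_fun h"
  shows "(\<integral>x. partial_deriv i h x \<partial>lborel) = 0"
proof -
  obtain r b where rb: "r > 0" "b > 0" "\<And>x. r < norm x \<Longrightarrow> h x = 0 \<and> grad h x = 0"
    "\<And>x. \<bar>h x\<bar> \<le> b" "\<And>x. norm (grad h x) \<le> b"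
    using test_fun_bounds[OF assms] by metis
  have sm: "smooth_fun h" by (rule test_fun_smooth[OF assms])
  let ?e = "axis i (1::real) :: real^'n"
  let ?s = "\<lambda>n. inverse (real (Suc n))"
  define D where "D = (\<lambda>n x. (h (x + ?s n *\<^sub>R ?e) - h x) / ?s n)"
  have hi: "integrable lborel h"
    by (intro bounded_support_integrable locally_finite_lborel test_fun_bounded_support_fun assms)
  have hm [measurable]: "h \<in> borel_measurable borel" by (rule smooth_fun_borel[OF sm])
  have shift: "integrable lborel (\<lambda>x. h (x + c))" "(\<integral>x. h (x + c) \<partial>lborel) = (\<integral>x. h x \<partial>lborel)" for c
  proof -
    have "integrable (distr lborel borel ((+) c)) h" unfolding lborel_distr_plus by (rule hi)
    then show "integrable lborel (\<lambda>x. h (x + c))"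
      by (subst (asm) integrable_distr_eq) (auto simp: add.commute)
    have "(\<integral>x. h x \<partial>lborel) = (\<integral>x. h x \<partial>(distr lborel borel ((+) c)))" by (simp only: lborel_distr_plus)
    also have "\<dots> = (\<integral>x. h (c + x) \<partial>lborel)" by (rule integral_distr) auto
    finally show "(\<integral>x. h (x + c) \<partial>lborel) = (\<integral>x. h x \<partial>lborel)" by (simp add: add.commute)
  qed
  have D0: "(\<integral>x. D n x \<partial>lborel) = 0" for n
    unfolding D_def using shift[of "?s n *\<^sub>R ?e"] hi by simp
  \<comment> \<open>By the mean value theorem each quotient is a partial derivative at a nearby
    point, hence at most b; the supports stay within radius r + 1 because the steps are at most
    1.\<close>
  have "(\<lambda>n. \<integral>x. D n x \<partial>lborel) \<longlonglongrightarrow> (\<integral>x. partial_deriv i h x \<partial>lborel)"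
  proof (rule integral_dominated_convergence[where w="\<lambda>x. b * indicator (cball (0 :: real^'n) (r + 1)) x"])
    show "partial_deriv i h \<in> borel_measurable lborel"
      using smooth_fun_borel[OF smooth_fun_partial_deriv[OF sm]] by simp
    show "D n \<in> borel_measurable lborel" for n unfolding D_def by measurable
    show "integrable lborel (\<lambda>x. b * indicator (cball (0 :: real^'n) (r + 1)) x)"
      by (intro integrable_mult_right bounded_support_integrable locally_finite_lborel bounded_support_indicator)
    show "AE x in lborel. (\<lambda>n. D n x) \<longlonglongrightarrow> partial_deriv i h x"
    proof (rule AE_I2)
      fix x
      have "((\<lambda>s. (h (x + s *\<^sub>R ?e) - h x) / s) \<longlongrightarrow> partial_deriv i h x) (at 0)"
        using smooth_fun_directional[OF sm, of x i 0] by (simp add: has_field_derivative_iff)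
      moreover have "filterlim ?s (at 0) sequentially"
        unfolding filterlim_at using LIMSEQ_inverse_real_of_nat by auto
      ultimately show "(\<lambda>n. D n x) \<longlonglongrightarrow> partial_deriv i h x"
        unfolding D_def by (rule filterlim_compose)
    qed
    show "AE x in lborel. norm (D n x) \<le> b * indicator (cball 0 (r + 1)) x" for n
    proof (rule AE_I2)
      fix x
      obtain t where t: "0 < t" "t < ?s n"
        "h (x + ?s n *\<^sub>R ?e) - h x = ?s n * partial_deriv i h (x + t *\<^sub>R ?e)"
        using smooth_fun_directional_mvt[OF sm, of "?s n" x i] by (auto simp del: of_nat_Suc)
      have D: "D n x = partial_deriv i h (x + t *\<^sub>R ?e)" unfolding D_def t(3) by simp
      have "norm (D n x) \<le> b"
        using component_le_norm_cart[of "grad h (x + t *\<^sub>R ?e)" i] rb(5)[of "x + t *\<^sub>R ?e"]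
        by (simp add: D partial_deriv_eq_grad)
      moreover have "D n x = 0" if "r + 1 < norm x"
      proof -
        have "?s n \<le> 1" by (simp add: field_simps)
        then have "t < 1" using t(2) by linarith
        then have "norm (t *\<^sub>R ?e) \<le> 1" using t(1) by simp
        then have "r < norm (x + t *\<^sub>R ?e)"
          using norm_triangle_ineq4[of "x + t *\<^sub>R ?e" "t *\<^sub>R ?e"] that by simp
        then show ?thesis using rb(3) by (simp add: D partial_deriv_eq_grad)
      qed
      ultimately show "norm (D n x) \<le> b * indicator (cball 0 (r + 1)) x"
        by (cases "r + 1 < norm x") (auto simp: indicator_def)
    qed
  qed
  then show ?thesis unfolding D0 using LIMSEQ_unique tendsto_const by blast
qed

locale weighted_space =
  fixes \<phi> :: "real^'n::finite \<Rightarrow> real" and D\<phi> :: "real^'n \<Rightarrow> real^'n"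
  assumes \<phi>: "H12_loc_grad lborel \<phi> D\<phi>" and \<phi>_pos: "AE x in lborel. \<phi> x > 0"
begin

abbreviation \<mu> :: "(real^'n) measure" where "\<mu> \<equiv> weighted \<phi>"

lemma \<phi>_measurable [measurable]: "\<phi> \<in> borel_measurable borel"
  and D\<phi>_measurable [measurable]: "D\<phi> \<in> borel_measurable borel"
  using H12_loc_grad_measurable[OF locally_finite_lborel \<phi>] by auto

lemma \<phi>_loc_L2: "loc_L2 lborel \<phi>" and D\<phi>_loc_L2: "loc_L2 lborel (\<lambda>x. D\<phi> x $ i)"
  using H12_loc_grad_loc_L2[OF locally_finite_lborel \<phi>] by auto

lemma integral_\<mu>: "f \<in> borel_measurable borel \<Longrightarrow> (\<integral>x. f x \<partial>\<mu>) = (\<integral>x. (\<phi> x)\<^sup>2 * f x \<partial>lborel)" for f :: "real^'n \<Rightarrow> real"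
  unfolding weighted_def by (subst integral_density) auto

lemma integrable_\<mu>: "f \<in> borel_measurable borel \<Longrightarrow>
    integrable \<mu> f \<longleftrightarrow> integrable lborel (\<lambda>x. (\<phi> x)\<^sup>2 * f x)" for f :: "real^'n \<Rightarrow> real"
  unfolding weighted_def by (subst integrable_density) auto

lemma AE_\<mu>I: "AE x in lborel. P x \<Longrightarrow> AE x in \<mu>. P x"
  unfolding weighted_def by (subst AE_density) (auto elim: eventually_mono)

lemma locally_finite_\<mu>: "locally_finite \<mu>"
proof -
  have "emeasure \<mu> (cball 0 r) < \<infinity>" for r
  proof -
    have "integrable lborel (\<lambda>x. (\<phi> x * indicator (cball 0 r) x)\<^sup>2)"
      using loc_L2D[OF \<phi>_loc_L2 bounded_support_indicator] by (simp add: L2_real_iff)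
    then have "(\<integral>\<^sup>+x. ennreal (norm ((\<phi> x * indicator (cball 0 r) x)\<^sup>2)) \<partial>lborel) < \<infinity>"
      by (simp add: integrable_iff_bounded)
    moreover have "emeasure \<mu> (cball 0 r) = (\<integral>\<^sup>+x. ennreal (norm ((\<phi> x * indicator (cball 0 r) x)\<^sup>2)) \<partial>lborel)"
      unfolding weighted_def
      by (subst emeasure_density) (auto intro!: nn_integral_cong simp: indicator_def)
    ultimately show ?thesis by simp
  qed
  then show ?thesis by (simp add: locally_finite_def weighted_def)
qed

lemma \<mu>_measurable_iff: "f \<in> borel_measurable \<mu> \<longleftrightarrow> f \<in> borel_measurable borel"
  for f :: "real^'n \<Rightarrow> 'b::topological_space"
  by (rule locally_finite_measurable[OF locally_finite_\<mu>])

text \<open>A component of grad (log \<phi>^2), the logarithmic derivative of the density of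
  \<mu>.\<close>

definition dlog :: "'n \<Rightarrow> real^'n \<Rightarrow> real" where
  "dlog j x = 2 * D\<phi> x $ j / \<phi> x"

lemma dlog_measurable [measurable]: "dlog j \<in> borel_measurable borel"
  unfolding dlog_def
  by (intro borel_measurable_divide borel_measurable_times borel_measurable_const
      borel_measurable_component D\<phi>_measurable \<phi>_measurable)

text \<open>The weight cancels the denominator: \<phi>^2 times the square of \<open>dlog j\<close>
  is 4 times the squared partial derivative of \<phi>, almost everywhere.\<close>

lemma dlog_loc_L2: "loc_L2 \<mu> (dlog j)"
  unfolding loc_L2_def
proof (intro allI impI)
  fix g :: "real^'n \<Rightarrow> real" assume g: "bounded_support g"
  have gm [measurable]: "g \<in> borel_measurable borel" by (rule bounded_support_measurable[OF g])
  have D [measurable]: "(\<lambda>x. D\<phi> x $ j) \<in> borel_measurable borel"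
    by (rule borel_measurable_component[OF D\<phi>_measurable])
  have "integrable lborel (\<lambda>x. 4 * (D\<phi> x $ j * g x)\<^sup>2)"
    using loc_L2D[OF D\<phi>_loc_L2 g] by (simp add: L2_real_iff)
  then have "integrable lborel (\<lambda>x. (\<phi> x)\<^sup>2 * (dlog j x * g x)\<^sup>2)"
  proof (rule integrable_cong_AE_imp)
    show "AE x in lborel. 4 * (D\<phi> x $ j * g x)\<^sup>2 = (\<phi> x)\<^sup>2 * (dlog j x * g x)\<^sup>2"
      using \<phi>_pos by eventually_elim (simp add: dlog_def power_mult_distrib power_divide)
  qed measurable
  then have "integrable \<mu> (\<lambda>x. (dlog j x * g x)\<^sup>2)" by (subst integrable_\<mu>) measurable
  moreover have "(\<lambda>x. dlog j x * g x) \<in> borel_measurable \<mu>" unfolding \<mu>_measurable_iff by measurable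
  ultimately show "L2 \<mu> (\<lambda>x. dlog j x * g x)" by (simp add: L2_real_iff)
qed

lemma test_fun_borel: "test_fun f \<Longrightarrow> f \<in> borel_measurable borel" "test_fun f \<Longrightarrow> partial_deriv i f \<in> borel_measurable borel"
  by (auto intro: smooth_fun_borel test_fun_smooth smooth_fun_partial_deriv)

text \<open>Approximate \<phi>, cut off near the support of g, by test functions u in the Sobolev
  norm, and integrate the partial derivative of g u^2, which gives 0. Every term is quadratic in u
  and grad u, so L2 convergence suffices for the limit.\<close>

lemma weight_by_parts:
  assumes g: "test_fun g"
  shows "(\<integral>x. partial_deriv j g x \<partial>\<mu>) + (\<integral>x. g x * dlog j x \<partial>\<mu>) = 0"
proof -
  obtain r where r: "r > 0" "\<And>x. r \<le> norm x \<Longrightarrow> g x = 0" using test_fun_bounded_support[OF g] by auto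
  \<comment> \<open>The margin 1 keeps the cutoff constant on a neighbourhood of the support of g,
    as \<open>grad_zero_outside\<close> applies only strictly beyond radius r.\<close>
  obtain \<zeta> :: "real^'n \<Rightarrow> real" where z: "test_fun \<zeta>" "\<And>x. norm x < r + 1 \<Longrightarrow> \<zeta> x = 1"
      "\<And>x. norm x < r + 1 \<Longrightarrow> grad \<zeta> x = 0" using cutoff_ex[of "r + 1"] r(1) by (metis add_pos_pos zero_less_one)
  define F where "F = (\<lambda>x. \<phi> x * \<zeta> x)"
  define G where "G = (\<lambda>x. \<zeta> x *\<^sub>R D\<phi> x + \<phi> x *\<^sub>R grad \<zeta> x)"
  have "H12_grad lborel F G" using \<phi> z(1) by (auto simp: H12_loc_grad_def F_def G_def)
  then obtain u where F: "L2 lborel F" and G: "L2 lborel G" and u: "\<And>n. test_fun (u n)"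
    "(\<lambda>n. L2_norm lborel (\<lambda>x. u n x - F x)) \<longlonglongrightarrow> 0"
    "(\<lambda>n. L2_norm lborel (\<lambda>x. grad (u n) x - G x)) \<longlonglongrightarrow> 0"
    by (auto simp: H12_grad_def)
  note lb = locally_finite_lborel
  have gb: "bounded_support g" "bounded_support (partial_deriv j g)"
    by (simp_all add: test_fun_bounded_support_fun test_fun_bounded_support_partial g)
  obtain b c where b: "\<And>x. \<bar>g x\<bar> \<le> b" and c: "\<And>x. \<bar>partial_deriv j g x\<bar> \<le> c"
    using bounded_supportE[OF gb(1)] bounded_supportE[OF gb(2)] by metis
  have gm: "g \<in> borel_measurable lborel" "partial_deriv j g \<in> borel_measurable lborel"
    using gb bounded_support_measurable by auto
  have gF: "L2 lborel (\<lambda>x. g x * F x)" "L2 lborel (\<lambda>x. partial_deriv j g x * F x)"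
    by (rule L2_mult_bounded[OF F gm(1) b], rule L2_mult_bounded[OF F gm(2) c])
  have uL: "L2 lborel (u n)" "L2 lborel (partial_deriv j (u n))" for n
    by (simp_all add: test_fun_L2 test_fun_L2_partial lb u)
  have gu: "L2 lborel (\<lambda>x. g x * u n x)" "L2 lborel (\<lambda>x. partial_deriv j g x * u n x)" for n
    by (rule L2_mult_bounded[OF uL(1) gm(1) b], rule L2_mult_bounded[OF uL(1) gm(2) c])
  have lim_mult: "(\<lambda>n. L2_norm lborel (\<lambda>x. h x * u n x - h x * F x)) \<longlonglongrightarrow> 0"
    if hm: "h \<in> borel_measurable lborel" and hb: "\<And>x. \<bar>h x\<bar> \<le> d" for h d
  proof (rule tendsto_sandwich[OF _ _ tendsto_const])
    have d: "0 \<le> d" using hb[of 0] by linarith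
    show "\<forall>\<^sub>F n in sequentially. L2_norm lborel (\<lambda>x. h x * u n x - h x * F x) \<le> d * L2_norm lborel (\<lambda>x. u n x - F x)"
    proof (intro always_eventually allI L2_norm_mono d AE_I2)
      fix n x
      show "L2 lborel (\<lambda>x. u n x - F x)" by (rule L2_diff[OF uL(1) F])
      show "(\<lambda>x. h x * u n x - h x * F x) \<in> borel_measurable lborel"
        by (intro borel_measurable_diff borel_measurable_times hm L2_measurable[OF uL(1)] L2_measurable[OF F])
      show "norm (h x * u n x - h x * F x) \<le> d * norm (u n x - F x)"
        using hb[of x] by (simp add: abs_mult mult_right_mono flip: right_diff_distrib)
    qed
    show "(\<lambda>n. d * L2_norm lborel (\<lambda>x. u n x - F x)) \<longlonglongrightarrow> 0"
      using tendsto_mult_left[OF u(2), of d] by simp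
  qed (simp add: L2_norm_nonneg)
  have Glim: "(\<lambda>n. L2_norm lborel (\<lambda>x. partial_deriv j (u n) x - G x $ j)) \<longlonglongrightarrow> 0"
  proof (rule tendsto_sandwich[OF _ _ tendsto_const u(3)])
    \<comment> \<open>To be shown separately: a small \<open>L2_norm\<close> says nothing about a
      function that is not square-integrable, because its Bochner integral is 0 by
      convention.\<close>
    have "L2 lborel (\<lambda>x. grad (u n) x - G x)" for n
    proof -
      have "bounded_support (\<lambda>x. grad (u n) x $ i)" for i
        using test_fun_bounded_support_partial[OF u(1)] by (simp add: partial_deriv_eq_grad[abs_def])
      then have c: "integrable lborel (\<lambda>x. ((grad (u n) x - G x) $ i)\<^sup>2)" for i
        using L2_diff[OF bounded_support_L2[OF lb] L2_component(1)[OF G], of "\<lambda>x. grad (u n) x $ i" i]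
        by (simp add: L2_real_iff)
      have "(norm v)\<^sup>2 = (\<Sum>i\<in>UNIV. (v $ i)\<^sup>2)" for v :: "real^'n"
        by (simp add: norm_vec_def L2_set_def sum_nonneg)
      then have "integrable lborel (\<lambda>x. (norm (grad (u n) x - G x))\<^sup>2)"
        using c by (simp only: ) (rule Bochner_Integration.integrable_sum)
      moreover have "(\<lambda>x. grad (u n) x - G x) \<in> borel_measurable lborel"
        using smooth_fun_borel_grad[OF test_fun_smooth[OF u(1)]] L2_measurable[OF G]
        by (intro borel_measurable_diff) simp_all
      ultimately show ?thesis by (simp add: L2_def)
    qed
    from L2_component(2)[OF this, of _ j]
    show "\<forall>\<^sub>F n in sequentially. L2_norm lborel (\<lambda>x. partial_deriv j (u n) x - G x $ j)
        \<le> L2_norm lborel (\<lambda>x. grad (u n) x - G x)"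
      by (simp add: partial_deriv_eq_grad)
  qed (simp add: L2_norm_nonneg)
  have "L2_inner lborel (\<lambda>x. partial_deriv j g x * u n x) (u n)
      + 2 * L2_inner lborel (\<lambda>x. g x * u n x) (partial_deriv j (u n)) = 0" for n
  proof -
    have t: "test_fun (\<lambda>x. g x * (u n x * u n x))" by (intro test_fun_mult g u)
    have "partial_deriv j (\<lambda>x. g x * (u n x * u n x)) x
        = (partial_deriv j g x * u n x) * u n x + 2 * ((g x * u n x) * partial_deriv j (u n) x)" for x
      by (simp add: partial_deriv_mult smooth_fun_mult test_fun_smooth g u algebra_simps)
    then show ?thesis using integral_partial_deriv_zero[OF t, of j]
      by (simp add: L2_inner_def L2_integrable_mult gu uL)
  qed
  moreover have "(\<lambda>n. L2_inner lborel (\<lambda>x. partial_deriv j g x * u n x) (u n)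
      + 2 * L2_inner lborel (\<lambda>x. g x * u n x) (partial_deriv j (u n)))
      \<longlonglongrightarrow> L2_inner lborel (\<lambda>x. partial_deriv j g x * F x) F + 2 * L2_inner lborel (\<lambda>x. g x * F x) (\<lambda>x. G x $ j)"
    by (intro tendsto_intros L2_inner_tendsto gu uL gF F L2_component(1)[OF G] lim_mult[OF gm(1) b]
        lim_mult[OF gm(2) c] u(2) Glim)
  ultimately have "L2_inner lborel (\<lambda>x. partial_deriv j g x * F x) F + 2 * L2_inner lborel (\<lambda>x. g x * F x) (\<lambda>x. G x $ j) = 0"
    by (simp add: LIMSEQ_const_iff)
  moreover have "L2_inner lborel (\<lambda>x. partial_deriv j g x * F x) F = (\<integral>x. partial_deriv j g x \<partial>\<mu>)"
  proof -
    have "partial_deriv j g x * F x * F x = (\<phi> x)\<^sup>2 * partial_deriv j g x" for x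
    proof (cases "norm x < r + 1")
      case False
      then have "grad g x = 0" using grad_zero_outside[of r g 0 x] r(2) by simp
      then show ?thesis by (simp add: partial_deriv_eq_grad)
    qed (simp add: F_def z power2_eq_square)
    then have "(\<lambda>x. partial_deriv j g x * F x * F x) = (\<lambda>x. (\<phi> x)\<^sup>2 * partial_deriv j g x)" by (rule ext)
    then show ?thesis unfolding L2_inner_def integral_\<mu>[OF test_fun_borel(2)[OF g]] by (simp only:)
  qed
  moreover have "2 * L2_inner lborel (\<lambda>x. g x * F x) (\<lambda>x. G x $ j) = (\<integral>x. g x * dlog j x \<partial>\<mu>)"
  proof -
    have "AE x in lborel. 2 * (g x * F x * G x $ j) = (\<phi> x)\<^sup>2 * (g x * dlog j x)"
      using \<phi>_pos
    proof eventually_elim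
      case (elim x)
      show ?case
      proof (cases "norm x < r + 1")
        case True
        then show ?thesis using elim by (simp add: F_def G_def z dlog_def power2_eq_square)
      next
        case False
        then show ?thesis using r(2) by simp
      qed
    qed
    moreover have "(\<lambda>x. 2 * (g x * F x * G x $ j)) \<in> borel_measurable lborel"
      by (intro borel_measurable_times borel_measurable_const gm(1) L2_measurable[OF F]
          borel_measurable_component L2_measurable[OF G])
    moreover have "(\<lambda>x. (\<phi> x)\<^sup>2 * (g x * dlog j x)) \<in> borel_measurable lborel"
      using gm(1) by measurable
    ultimately have "(\<integral>x. 2 * (g x * F x * G x $ j) \<partial>lborel) = (\<integral>x. (\<phi> x)\<^sup>2 * (g x * dlog j x) \<partial>lborel)"
      by (intro integral_cong_AE)
    moreover have "(\<lambda>x. g x * dlog j x) \<in> borel_measurable borel" using gm(1) by measurable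
    ultimately show ?thesis by (simp add: L2_inner_def integral_\<mu>)
  qed
  ultimately show ?thesis by simp
qed

text \<open>Apply \<open>weight_by_parts\<close> to u h for test functions u approximating a near
  the support of h; each term is a scalar product that converges with u and grad u.\<close>

lemma sobolev_by_parts:
  assumes a: "H12_loc_grad \<mu> a G" and h: "test_fun h"
  shows "(\<integral>x. G x $ j * h x \<partial>\<mu>) + (\<integral>x. a x * partial_deriv j h x \<partial>\<mu>) + (\<integral>x. a x * dlog j x * h x \<partial>\<mu>) = 0"
proof -
  obtain r where r: "r > 0" "\<And>x. r \<le> norm x \<Longrightarrow> h x = 0" using test_fun_bounded_support[OF h] by auto
  obtain \<zeta> :: "real^'n \<Rightarrow> real" where z: "test_fun \<zeta>" "\<And>x. norm x < r + 1 \<Longrightarrow> \<zeta> x = 1"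
      "\<And>x. norm x < r + 1 \<Longrightarrow> grad \<zeta> x = 0" using cutoff_ex[of "r + 1"] r(1) by (metis add_pos_pos zero_less_one)
  define F where "F = (\<lambda>x. a x * \<zeta> x)"
  define E where "E = (\<lambda>x. \<zeta> x *\<^sub>R G x + a x *\<^sub>R grad \<zeta> x)"
  have "H12_grad \<mu> F E" using a z(1) by (auto simp: H12_loc_grad_def F_def E_def)
  then obtain u where F: "L2 \<mu> F" and E: "L2 \<mu> E" and u: "\<And>n. test_fun (u n)"
    "(\<lambda>n. L2_norm \<mu> (\<lambda>x. u n x - F x)) \<longlonglongrightarrow> 0"
    "(\<lambda>n. L2_norm \<mu> (\<lambda>x. grad (u n) x - E x)) \<longlonglongrightarrow> 0"
    by (auto simp: H12_grad_def)
  note lf = locally_finite_\<mu>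
  have hL: "L2 \<mu> h" "L2 \<mu> (partial_deriv j h)" by (simp_all add: test_fun_L2 test_fun_L2_partial lf h)
  have dL: "L2 \<mu> (\<lambda>x. dlog j x * h x)"
    by (rule loc_L2D[OF dlog_loc_L2 test_fun_bounded_support_fun[OF h]])
  have uL: "L2 \<mu> (u n)" "L2 \<mu> (partial_deriv j (u n))" for n
    by (simp_all add: test_fun_L2 test_fun_L2_partial lf u)
  have Elim: "(\<lambda>n. L2_norm \<mu> (\<lambda>x. partial_deriv j (u n) x - E x $ j)) \<longlonglongrightarrow> 0"
  proof (rule tendsto_sandwich[OF _ _ tendsto_const u(3)])
    have "L2 \<mu> (\<lambda>x. grad (u n) x - E x)" for n
    proof -
      have "bounded_support (\<lambda>x. grad (u n) x $ i)" for i
        using test_fun_bounded_support_partial[OF u(1)] by (simp add: partial_deriv_eq_grad[abs_def])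
      then have c: "integrable \<mu> (\<lambda>x. ((grad (u n) x - E x) $ i)\<^sup>2)" for i
        using L2_diff[OF bounded_support_L2[OF lf] L2_component(1)[OF E], of "\<lambda>x. grad (u n) x $ i" i]
        by (simp add: L2_real_iff)
      have "(norm v)\<^sup>2 = (\<Sum>i\<in>UNIV. (v $ i)\<^sup>2)" for v :: "real^'n"
        by (simp add: norm_vec_def L2_set_def sum_nonneg)
      then have "integrable \<mu> (\<lambda>x. (norm (grad (u n) x - E x))\<^sup>2)"
        using c by (simp only: ) (rule Bochner_Integration.integrable_sum)
      moreover have "(\<lambda>x. grad (u n) x - E x) \<in> borel_measurable \<mu>"
        using smooth_fun_borel_grad[OF test_fun_smooth[OF u(1)]] L2_measurable[OF E] \<mu>_measurable_iff
        by (intro borel_measurable_diff) blast+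
      ultimately show ?thesis by (simp add: L2_def)
    qed
    from L2_component(2)[OF this, of _ j]
    show "\<forall>\<^sub>F n in sequentially. L2_norm \<mu> (\<lambda>x. partial_deriv j (u n) x - E x $ j)
        \<le> L2_norm \<mu> (\<lambda>x. grad (u n) x - E x)"
      by (simp add: partial_deriv_eq_grad)
  qed (simp add: L2_norm_nonneg)
  have "L2_inner \<mu> (partial_deriv j (u n)) h + L2_inner \<mu> (u n) (partial_deriv j h)
      + L2_inner \<mu> (u n) (\<lambda>x. dlog j x * h x) = 0" for n
  proof -
    have t: "test_fun (\<lambda>x. u n x * h x)" by (intro test_fun_mult h u)
    have "partial_deriv j (\<lambda>x. u n x * h x) x = partial_deriv j (u n) x * h x + u n x * partial_deriv j h x" for x
      by (simp add: partial_deriv_mult test_fun_smooth h u)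
    then show ?thesis using weight_by_parts[OF t, of j]
      by (simp add: L2_inner_def L2_integrable_mult uL hL dL mult_ac)
  qed
  moreover have "(\<lambda>n. L2_inner \<mu> (partial_deriv j (u n)) h + L2_inner \<mu> (u n) (partial_deriv j h)
      + L2_inner \<mu> (u n) (\<lambda>x. dlog j x * h x))
      \<longlonglongrightarrow> L2_inner \<mu> (\<lambda>x. E x $ j) h + L2_inner \<mu> F (partial_deriv j h) + L2_inner \<mu> F (\<lambda>x. dlog j x * h x)"
    by (intro tendsto_intros L2_inner_tendsto uL hL dL F L2_component(1)[OF E] u(2) Elim)
       (simp_all add: L2_norm_def)
  ultimately have "L2_inner \<mu> (\<lambda>x. E x $ j) h + L2_inner \<mu> F (partial_deriv j h) + L2_inner \<mu> F (\<lambda>x. dlog j x * h x) = 0"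
    by (simp add: LIMSEQ_const_iff)
  moreover have "E x $ j * h x = G x $ j * h x" "F x * partial_deriv j h x = a x * partial_deriv j h x"
    "F x * (dlog j x * h x) = a x * dlog j x * h x" for x
  proof -
    have "h x = 0 \<and> partial_deriv j h x = 0" if "r + 1 \<le> norm x"
      using grad_zero_outside[of r h 0 x] r(2) that by (simp add: partial_deriv_eq_grad)
    then show "E x $ j * h x = G x $ j * h x" "F x * partial_deriv j h x = a x * partial_deriv j h x"
      "F x * (dlog j x * h x) = a x * dlog j x * h x"
      by (cases "norm x < r + 1"; simp add: E_def F_def z)+
  qed
  ultimately show ?thesis unfolding L2_inner_def by (simp only:)
qed

end

section \<open>The form in terms of the drift\<close>

lemma bil_add_left: "bil m (\<xi> + \<xi>') \<eta> = bil m \<xi> \<eta> + bil m \<xi>' \<eta>"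
  and bil_add_right: "bil m \<xi> (\<eta> + \<eta>') = bil m \<xi> \<eta> + bil m \<xi> \<eta>'"
  and bil_scale_left: "bil m (c *\<^sub>R \<xi>) \<eta> = c * bil m \<xi> \<eta>"
  and bil_scale_right: "bil m \<xi> (c *\<^sub>R \<eta>) = c * bil m \<xi> \<eta>"
  by (simp_all add: bil_def sum.distrib[symmetric] sum_distrib_left algebra_simps)

lemma bil_diff_left: "bil m (\<xi> - \<xi>') \<eta> = bil m \<xi> \<eta> - bil m \<xi>' \<eta>"
  using bil_add_left[of m \<xi> "(-1) *\<^sub>R \<xi>'" \<eta>] by (simp only: bil_scale_left) simp

lemma bil_diff_right: "bil m \<xi> (\<eta> - \<eta>') = bil m \<xi> \<eta> - bil m \<xi> \<eta>'"
  using bil_add_right[of m \<xi> \<eta> "(-1) *\<^sub>R \<eta>'"] by (simp only: bil_scale_right) simp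

lemma bil_zero_left: "bil m 0 \<eta> = 0" and bil_zero_right: "bil m \<xi> 0 = 0"
  by (simp_all add: bil_def)

lemma bil_sym_part_commute: "bil (sym_part A x) \<xi> \<eta> = bil (sym_part A x) \<eta> \<xi>"
  unfolding bil_def
  by (subst sum.swap) (simp add: sym_part_def add.commute mult_ac)

lemma bil_split: "bil (A x) \<xi> \<eta> = bil (sym_part A x) \<xi> \<eta> + bil (skew_part A x) \<xi> \<eta>"
  unfolding bil_def sum.distrib[symmetric]
  by (intro sum.cong refl) (simp add: sym_part_def skew_part_def field_simps)

lemma psd_sum3:
  assumes "\<And>\<xi>. 0 \<le> bil m \<xi> \<xi>" "\<And>\<xi> \<eta>. bil m \<xi> \<eta> = bil m \<eta> \<xi>"
  shows "bil m (\<xi> + \<eta> + \<zeta>) (\<xi> + \<eta> + \<zeta>) \<le> 3 * (bil m \<xi> \<xi> + bil m \<eta> \<eta> + bil m \<zeta> \<zeta>)"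
proof -
  have "0 \<le> bil m (\<xi> - \<eta>) (\<xi> - \<eta>) + bil m (\<eta> - \<zeta>) (\<eta> - \<zeta>) + bil m (\<xi> - \<zeta>) (\<xi> - \<zeta>)"
    by (intro add_nonneg_nonneg assms(1))
  then show ?thesis
    using assms(2)[of \<eta> \<xi>] assms(2)[of \<zeta> \<xi>] assms(2)[of \<zeta> \<eta>]
    by (simp add: bil_add_left bil_add_right bil_diff_left bil_diff_right)
qed

lemma psd_sum2:
  assumes "\<And>\<xi>. 0 \<le> bil m \<xi> \<xi>" "\<And>\<xi> \<eta>. bil m \<xi> \<eta> = bil m \<eta> \<xi>"
  shows "bil m (\<xi> + \<eta>) (\<xi> + \<eta>) \<le> 2 * (bil m \<xi> \<xi> + bil m \<eta> \<eta>)"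
  using assms(1)[of "\<xi> - \<eta>"] assms(2)[of \<eta> \<xi>]
  by (simp add: bil_add_left bil_add_right bil_diff_left bil_diff_right)

locale drift_form = weighted_space \<phi> D\<phi>
  for \<phi> :: "real^'n::finite \<Rightarrow> real" and D\<phi> +
  fixes A :: "real^'n \<Rightarrow> real^'n^'n" and Da :: "'n \<Rightarrow> 'n \<Rightarrow> real^'n \<Rightarrow> real^'n"
    and B :: "real^'n \<Rightarrow> real^'n"
  assumes A_loc: "\<And>i j. loc_L1 \<mu> (\<lambda>x. A x $ i $ j)"
    and skew: "\<And>i j. H12_loc_grad \<mu> (\<lambda>x. skew_part A x $ i $ j) (Da i j)"
    and B_loc: "\<And>i. loc_L2 \<mu> (\<lambda>x. B x $ i)"
    and B_div: "\<And>f. test_fun f \<Longrightarrow> (\<integral>x. B x \<bullet> grad f x \<partial>\<mu>) = 0"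
    and psd: "AE x in \<mu>. \<forall>\<xi>. 0 \<le> bil (sym_part A x) \<xi> \<xi>"
begin

abbreviation \<beta> :: "real^'n \<Rightarrow> real^'n" where "\<beta> \<equiv> drift \<phi> D\<phi> A Da B"

abbreviation Q :: "(real^'n \<Rightarrow> real) \<Rightarrow> (real^'n \<Rightarrow> real) \<Rightarrow> real" where "Q \<equiv> form \<mu> A B"

abbreviation a :: "real^'n \<Rightarrow> real^'n \<Rightarrow> real^'n \<Rightarrow> real" where "a x \<equiv> bil (sym_part A x)"

lemmas lf = locally_finite_\<mu>

lemma sym_loc: "loc_L1 \<mu> (\<lambda>x. sym_part A x $ i $ j)"
  using loc_L1_add[OF loc_L1_cmult[OF A_loc[of i j], of "1/2"] loc_L1_cmult[OF A_loc[of j i], of "1/2"]]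
  by (simp add: sym_part_def add_divide_distrib)

lemma skew_loc_L2: "loc_L2 \<mu> (\<lambda>x. skew_part A x $ i $ j)" and Da_loc_L2: "loc_L2 \<mu> (\<lambda>x. Da i j x $ k)"
  using H12_loc_grad_loc_L2[OF lf skew] by auto

lemma \<beta>_component: "\<beta> x $ i = B x $ i + (\<Sum>j\<in>UNIV. Da i j x $ j + skew_part A x $ i $ j * dlog j x)"
  by (simp add: drift_def dlog_def)

lemma \<beta>_loc: "loc_L1 \<mu> (\<lambda>x. \<beta> x $ i)"
  unfolding \<beta>_component
  by (intro loc_L1_add loc_L1_sum loc_L2_imp_L1[OF lf] B_loc Da_loc_L2 loc_L2_mult skew_loc_L2 dlog_loc_L2)

lemma bil_integrable:
  assumes "\<And>i j. loc_L1 \<mu> (\<lambda>x. m x $ i $ j)" "test_fun f" "test_fun g"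
  shows "integrable \<mu> (\<lambda>x. bil (m x) (grad f x) (grad g x))"
proof -
  have "integrable \<mu> (\<lambda>x. m x $ i $ j * (partial_deriv i f x * partial_deriv j g x))" for i j
    by (intro loc_L1D[OF assms(1)] bounded_support_mult test_fun_bounded_support_partial assms)
  then show ?thesis
    by (auto simp: bil_def mult.assoc partial_deriv_eq_grad intro!: Bochner_Integration.integrable_sum)
qed

lemma bil_weight_integrable:
  assumes "\<And>i j. loc_L1 \<mu> (\<lambda>x. m x $ i $ j)" "test_fun f" "test_fun g" "smooth_fun h"
  shows "integrable \<mu> (\<lambda>x. bil (m x) (grad f x) (grad g x) * h x)"
proof -
  have "integrable \<mu> (\<lambda>x. m x $ i $ j * ((partial_deriv i f x * partial_deriv j g x) * h x))" for i j
    by (intro loc_L1D[OF assms(1)] bounded_support_mult_smooth bounded_support_mult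
        test_fun_bounded_support_partial assms)
  then show ?thesis
    by (auto simp: bil_def mult.assoc partial_deriv_eq_grad sum_distrib_right
        intro!: Bochner_Integration.integrable_sum)
qed

lemma drift_integrable:
  assumes "\<And>i. loc_L1 \<mu> (\<lambda>x. b x $ i)" "test_fun f"
  shows "integrable \<mu> (\<lambda>x. b x \<bullet> grad f x)"
    and "smooth_fun g \<Longrightarrow> integrable \<mu> (\<lambda>x. (b x \<bullet> grad f x) * g x)"
proof -
  have "integrable \<mu> (\<lambda>x. b x $ i * partial_deriv i f x)" for i
    by (intro loc_L1D[OF assms(1)] test_fun_bounded_support_partial assms)
  then show "integrable \<mu> (\<lambda>x. b x \<bullet> grad f x)"
    by (auto simp: inner_vec_def partial_deriv_eq_grad intro!: Bochner_Integration.integrable_sum)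
  assume "smooth_fun g"
  then have "integrable \<mu> (\<lambda>x. b x $ i * (partial_deriv i f x * g x))" for i
    by (intro loc_L1D[OF assms(1)] bounded_support_mult_smooth test_fun_bounded_support_partial assms)
  then show "integrable \<mu> (\<lambda>x. (b x \<bullet> grad f x) * g x)"
    by (auto simp: inner_vec_def partial_deriv_eq_grad sum_distrib_right mult.assoc
        intro!: Bochner_Integration.integrable_sum)
qed

text \<open>Integrate the (i, j) entry by parts against \<open>partial_deriv i f x * g x\<close> and
  sum. \<open>X\<close> and \<open>W\<close> assemble to \<beta> - B, \<open>Y\<close> to the skew
  form, and \<open>Z\<close> pairs the antisymmetric matrix with the symmetric Hessian of f, so that
  its sum vanishes.\<close>

lemma skew_by_parts:
  assumes f: "test_fun f" and g: "test_fun g"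
  shows "(\<integral>x. bil (skew_part A x) (grad f x) (grad g x) \<partial>\<mu>)
      = - (\<integral>x. ((\<beta> x - B x) \<bullet> grad f x) * g x \<partial>\<mu>)"
proof -
  let ?s = "\<lambda>i j x. skew_part A x $ i $ j"
  have sf: "smooth_fun f" "smooth_fun g" by (simp_all add: test_fun_smooth f g)
  have bf: "bounded_support (\<lambda>x. partial_deriv i f x * g x)" for i
    by (intro bounded_support_mult test_fun_bounded_support_partial test_fun_bounded_support_fun f g)
  have bg: "bounded_support (\<lambda>x. partial_deriv i f x * partial_deriv j g x)" for i j
    by (intro bounded_support_mult test_fun_bounded_support_partial f g)
  have bh: "bounded_support (\<lambda>x. g x * partial_deriv j (partial_deriv i f) x)" for i j
    by (intro bounded_support_mult_smooth test_fun_bounded_support_fun smooth_fun_partial_deriv sf g)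
  define X where "X = (\<lambda>i j x. Da i j x $ j * (partial_deriv i f x * g x))"
  define Y where "Y = (\<lambda>i j x. ?s i j x * (partial_deriv i f x * partial_deriv j g x))"
  define Z where "Z = (\<lambda>i j x. ?s i j x * (g x * partial_deriv j (partial_deriv i f) x))"
  define W where "W = (\<lambda>i j x. ?s i j x * dlog j x * (partial_deriv i f x * g x))"
  have sl: "loc_L1 \<mu> (?s i j)" for i j by (rule loc_L2_imp_L1[OF lf skew_loc_L2])
  have iX: "integrable \<mu> (X i j)" for i j
    unfolding X_def by (rule loc_L1D[OF loc_L2_imp_L1[OF lf Da_loc_L2] bf])
  have iY: "integrable \<mu> (Y i j)" for i j unfolding Y_def by (rule loc_L1D[OF sl bg])
  have iZ: "integrable \<mu> (Z i j)" for i j unfolding Z_def by (rule loc_L1D[OF sl bh])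
  have iW: "integrable \<mu> (W i j)" for i j
    unfolding W_def by (rule loc_L1D[OF loc_L2_mult[OF skew_loc_L2 dlog_loc_L2] bf])
  have parts: "integral\<^sup>L \<mu> (X i j) + (integral\<^sup>L \<mu> (Y i j) + integral\<^sup>L \<mu> (Z i j)) + integral\<^sup>L \<mu> (W i j) = 0" for i j
  proof -
    have t: "test_fun (\<lambda>x. partial_deriv i f x * g x)"
      by (intro test_fun_mult_smooth(2) smooth_fun_partial_deriv sf g)
    have "?s i j x * partial_deriv j (\<lambda>x. partial_deriv i f x * g x) x = Y i j x + Z i j x" for x
      by (simp add: partial_deriv_mult smooth_fun_partial_deriv sf Y_def Z_def algebra_simps)
    then show ?thesis
      using sobolev_by_parts[OF skew t, of i j j] iY iZ by (simp add: X_def W_def)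
  qed
  have Z0: "(\<Sum>i\<in>UNIV. \<Sum>j\<in>UNIV. Z i j x) = 0" for x
  proof -
    have "(\<Sum>i\<in>UNIV. \<Sum>j\<in>UNIV. Z i j x) = (\<Sum>j\<in>UNIV. \<Sum>i\<in>UNIV. Z i j x)" by (rule sum.swap)
    also have "\<dots> = (\<Sum>j\<in>UNIV. \<Sum>i\<in>UNIV. - Z j i x)"
      by (intro sum.cong refl)
         (simp add: Z_def partial_deriv_commute[OF sf(1)] skew_part_def field_simps)
    finally show ?thesis by (simp add: sum_negf)
  qed
  have "0 = (\<Sum>i\<in>UNIV. \<Sum>j\<in>UNIV. integral\<^sup>L \<mu> (X i j) + (integral\<^sup>L \<mu> (Y i j) + integral\<^sup>L \<mu> (Z i j)) + integral\<^sup>L \<mu> (W i j))"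
    unfolding parts by simp
  also have "\<dots> = (\<integral>x. (\<Sum>i\<in>UNIV. \<Sum>j\<in>UNIV. X i j x + (Y i j x + Z i j x) + W i j x) \<partial>\<mu>)"
    by (simp add: iX iY iZ iW)
  also have "\<dots> = (\<integral>x. bil (skew_part A x) (grad f x) (grad g x) + ((\<beta> x - B x) \<bullet> grad f x) * g x \<partial>\<mu>)"
  proof (intro Bochner_Integration.integral_cong refl)
    fix x
    have "(\<Sum>i\<in>UNIV. \<Sum>j\<in>UNIV. Y i j x) = bil (skew_part A x) (grad f x) (grad g x)"
      by (simp add: Y_def bil_def partial_deriv_eq_grad mult.assoc)
    moreover have "(\<Sum>i\<in>UNIV. \<Sum>j\<in>UNIV. X i j x + W i j x) = ((\<beta> x - B x) \<bullet> grad f x) * g x"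
      by (simp add: X_def W_def inner_vec_def \<beta>_component partial_deriv_eq_grad sum_distrib_right
          sum_distrib_left distrib_right mult.assoc)
    ultimately show "(\<Sum>i\<in>UNIV. \<Sum>j\<in>UNIV. X i j x + (Y i j x + Z i j x) + W i j x)
        = bil (skew_part A x) (grad f x) (grad g x) + ((\<beta> x - B x) \<bullet> grad f x) * g x"
      using Z0[of x] by (simp add: sum.distrib)
  qed
  also have "\<dots> = (\<integral>x. bil (skew_part A x) (grad f x) (grad g x) \<partial>\<mu>)
      + (\<integral>x. ((\<beta> x - B x) \<bullet> grad f x) * g x \<partial>\<mu>)"
  proof (rule Bochner_Integration.integral_add)
    show "integrable \<mu> (\<lambda>x. bil (skew_part A x) (grad f x) (grad g x))"
      by (rule bil_integrable[OF sl f g])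
    have "loc_L1 \<mu> (\<lambda>x. (\<beta> x - B x) $ i)" for i
      using loc_L1_add[OF \<beta>_loc loc_L1_cmult[OF loc_L2_imp_L1[OF lf B_loc], of "-1"]] by simp
    then show "integrable \<mu> (\<lambda>x. ((\<beta> x - B x) \<bullet> grad f x) * g x)"
      by (rule drift_integrable(2)[OF _ f sf(2)])
  qed
  finally show ?thesis by simp
qed

lemma form_eq:
  assumes f: "test_fun f" and g: "test_fun g"
  shows "Q f g = (\<integral>x. a x (grad f x) (grad g x) \<partial>\<mu>) - (\<integral>x. (\<beta> x \<bullet> grad f x) * g x \<partial>\<mu>)"
proof -
  have sg: "smooth_fun g" by (rule test_fun_smooth[OF g])
  have iB: "integrable \<mu> (\<lambda>x. (B x \<bullet> grad f x) * g x)" and i\<beta>: "integrable \<mu> (\<lambda>x. (\<beta> x \<bullet> grad f x) * g x)"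
    by (rule drift_integrable(2)[OF loc_L2_imp_L1[OF lf B_loc] f sg], rule drift_integrable(2)[OF \<beta>_loc f sg])
  have "(\<integral>x. bil (A x) (grad f x) (grad g x) \<partial>\<mu>)
     = (\<integral>x. a x (grad f x) (grad g x) \<partial>\<mu>) + (\<integral>x. bil (skew_part A x) (grad f x) (grad g x) \<partial>\<mu>)"
    unfolding bil_split[of A]
    by (intro Bochner_Integration.integral_add bil_integrable[OF sym_loc f g]
        bil_integrable[OF loc_L2_imp_L1[OF lf skew_loc_L2] f g])
  moreover have "(\<integral>x. ((\<beta> x - B x) \<bullet> grad f x) * g x \<partial>\<mu>)
      = (\<integral>x. (\<beta> x \<bullet> grad f x) * g x \<partial>\<mu>) - (\<integral>x. (B x \<bullet> grad f x) * g x \<partial>\<mu>)"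
    by (simp add: inner_diff_left left_diff_distrib iB i\<beta>)
  ultimately show ?thesis using skew_by_parts[OF f g] by (simp add: form_def energy_def)
qed

text \<open>In \<open>form_eq\<close> take g equal to 1 near the support of f. All terms containing
  grad g disappear, and what remains equates the integral of <\<beta>, grad f> with that of <B, grad
  f>.\<close>

lemma \<beta>_div:
  assumes f: "test_fun f"
  shows "(\<integral>x. \<beta> x \<bullet> grad f x \<partial>\<mu>) = 0"
proof -
  obtain r where r: "r > 0" "\<And>x. r \<le> norm x \<Longrightarrow> f x = 0" using test_fun_bounded_support[OF f] by auto
  obtain g :: "real^'n \<Rightarrow> real" where g: "test_fun g" "\<And>x. norm x < r + 1 \<Longrightarrow> g x = 1"
      "\<And>x. norm x < r + 1 \<Longrightarrow> grad g x = 0" using cutoff_ex[of "r + 1"] r(1) by (metis add_pos_pos zero_less_one)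
  have f0: "grad f x = 0" if "r + 1 \<le> norm x" for x
    using grad_zero_outside[of r f 0 x] r(2) that by simp
  have g0: "grad g x = 0 \<or> grad f x = 0" and g1: "grad f x = 0 \<or> g x = 1" for x
    using g(2,3)[of x] f0[of x] by (cases "norm x < r + 1"; simp)+
  have "bil (m x) (grad f x) (grad g x) = 0" for m :: "real^'n \<Rightarrow> real^'n^'n" and x
    using g0[of x] by (auto simp: bil_zero_left bil_zero_right)
  moreover have "(\<lambda>x. (b x \<bullet> grad f x) * g x) = (\<lambda>x. b x \<bullet> grad f x)" for b :: "real^'n \<Rightarrow> real^'n"
  proof
    fix x show "(b x \<bullet> grad f x) * g x = b x \<bullet> grad f x" using g1[of x] by auto
  qed
  ultimately show ?thesis
    using form_eq[OF f g(1)] B_div[OF f] unfolding form_def energy_def by simp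
qed

text \<open>The drift term is half of <\<beta>, grad (f^2)> and integrates to 0 by
  \<open>\<beta>_div\<close>.\<close>

lemma form_diagonal:
  assumes f: "test_fun f"
  shows "Q f f = (\<integral>x. a x (grad f x) (grad f x) \<partial>\<mu>)"
proof -
  have t: "test_fun (\<lambda>x. f x * f x)" by (rule test_fun_mult[OF f f])
  have "\<beta> x \<bullet> grad (\<lambda>x. f x * f x) x = 2 * ((\<beta> x \<bullet> grad f x) * f x)" for x
    unfolding grad_mult_smooth[OF test_fun_smooth[OF f] test_fun_smooth[OF f]] inner_add_right inner_scaleR_right
    by simp
  then have "(\<integral>x. 2 * ((\<beta> x \<bullet> grad f x) * f x) \<partial>\<mu>) = 0"
    using \<beta>_div[OF t] by (simp only:)
  then show ?thesis unfolding form_eq[OF f f] by simp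
qed

lemma form_cmult_left: "test_fun f \<Longrightarrow> Q (\<lambda>x. c * f x) g = c * Q f g"
  by (simp add: form_def energy_def grad_cmult test_fun_differentiable bil_scale_left mult.assoc
      right_diff_distrib)

lemma form_approx_Cauchy:
  assumes "form_approx \<mu> Q f u" "0 < e"
  obtains N where "\<And>m n. N \<le> m \<Longrightarrow> N \<le> n \<Longrightarrow> Q (\<lambda>x. u m x - u n x) (\<lambda>x. u m x - u n x) < e"
  using assms unfolding form_approx_def by blast

lemma form_approx_subseq:
  assumes "form_approx \<mu> Q f u" "strict_mono r"
  shows "form_approx \<mu> Q f (\<lambda>n. u (r n))"
proof -
  have "\<exists>N. \<forall>m\<ge>N. \<forall>n\<ge>N. Q (\<lambda>x. u (r m) x - u (r n) x) (\<lambda>x. u (r m) x - u (r n) x) < e" if e: "0 < e" for e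
  proof -
    obtain N where "\<And>m n. N \<le> m \<Longrightarrow> N \<le> n \<Longrightarrow> Q (\<lambda>x. u m x - u n x) (\<lambda>x. u m x - u n x) < e"
      using form_approx_Cauchy[OF assms(1) e] by blast
    moreover have "n \<le> r n" for n by (rule strict_mono_imp_increasing[OF assms(2)])
    ultimately show ?thesis by (intro exI[of _ N]) (blast intro: order_trans)
  qed
  moreover have "(\<lambda>n. L2_norm \<mu> (\<lambda>x. u (r n) x - f x)) \<longlonglongrightarrow> 0"
    using LIMSEQ_subseq_LIMSEQ[OF _ assms(2), of "\<lambda>n. L2_norm \<mu> (\<lambda>x. u n x - f x)" 0] assms(1)
    by (simp add: form_approx_def o_def)
  ultimately show ?thesis using assms(1) by (simp add: form_approx_def)
qed

lemma form_approx_cmult: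
  assumes "form_approx \<mu> Q f u"
  shows "form_approx \<mu> Q (\<lambda>x. c * f x) (\<lambda>n x. c * u n x)"
proof -
  have u: "\<And>n. test_fun (u n)" and f: "L2 \<mu> f" using assms by (auto simp: form_approx_def)
  have "\<exists>N. \<forall>m\<ge>N. \<forall>n\<ge>N. Q (\<lambda>x. c * u m x - c * u n x) (\<lambda>x. c * u m x - c * u n x) < e" if e: "0 < e" for e
  proof -
    \<comment> \<open>The summand 1 covers c = 0.\<close>
    have p: "0 < c\<^sup>2 + 1" by (simp add: add_nonneg_pos)
    then have "0 < e / (c\<^sup>2 + 1)" using e by simp
    then obtain N where N: "\<And>m n. N \<le> m \<Longrightarrow> N \<le> n \<Longrightarrow> Q (\<lambda>x. u m x - u n x) (\<lambda>x. u m x - u n x) < e / (c\<^sup>2 + 1)"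
      using form_approx_Cauchy[OF assms \<open>0 < e / (c\<^sup>2 + 1)\<close>] by blast
    have "Q (\<lambda>x. c * u m x - c * u n x) (\<lambda>x. c * u m x - c * u n x) < e" if "N \<le> m" "N \<le> n" for m n
    proof -
      have t: "test_fun (\<lambda>x. u m x - u n x)" by (rule test_fun_diff[OF u u])
      have "Q (\<lambda>x. c * u m x - c * u n x) (\<lambda>x. c * u m x - c * u n x)
          = c\<^sup>2 * Q (\<lambda>x. u m x - u n x) (\<lambda>x. u m x - u n x)"
        using form_diagonal[OF t] form_diagonal[OF test_fun_cmult[OF t, of c]]
        by (simp add: grad_cmult test_fun_differentiable t bil_scale_left bil_scale_right power2_eq_square
            mult.assoc flip: right_diff_distrib)
      also have "\<dots> \<le> c\<^sup>2 * (e / (c\<^sup>2 + 1))" using N[OF that] by (intro mult_left_mono) auto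
      also have "\<dots> < e" using e p by (simp add: pos_divide_less_eq algebra_simps)
      finally show ?thesis .
    qed
    then show ?thesis by blast
  qed
  moreover have "(\<lambda>n. L2_norm \<mu> (\<lambda>x. c * u n x - c * f x)) \<longlonglongrightarrow> 0"
  proof -
    have "(\<lambda>n. \<bar>c\<bar> * L2_norm \<mu> (\<lambda>x. u n x - f x)) \<longlonglongrightarrow> \<bar>c\<bar> * 0"
      using assms by (intro tendsto_intros) (simp add: form_approx_def)
    then show ?thesis by (simp add: L2_norm_cmult[symmetric] right_diff_distrib)
  qed
  ultimately show ?thesis using u f by (simp add: form_approx_def test_fun_cmult L2_cmult)
qed

end

section \<open>The sub-Markov property\<close>

text \<open>A smooth version \<open>\<Phi>\<close> of the normal contraction \<open>s \<mapsto> (s - 1)\<^sup>+\<close>, and its antiderivative.\<close>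

locale smooth_contraction =
  fixes \<Phi> \<Phi>' \<Theta> :: "real \<Rightarrow> real"
  assumes \<Phi>_smooth: "smooth_real \<Phi>" and \<Theta>_smooth: "smooth_real \<Theta>"
    and \<Phi>_deriv: "\<And>x. (\<Phi> has_real_derivative \<Phi>' x) (at x)"
    and \<Theta>_deriv: "\<And>x. (\<Theta> has_real_derivative \<Phi> x) (at x)"
    and \<Phi>'_nonneg: "\<And>x. 0 \<le> \<Phi>' x" and \<Phi>'_le: "\<And>x. \<Phi>' x \<le> 1"
    and \<Phi>'_cont: "continuous_on UNIV \<Phi>'"
    and below: "\<And>x. x \<le> 1 \<Longrightarrow> \<Phi> x = 0 \<and> \<Theta> x = 0"
    and above: "\<And>x. 1 < x \<Longrightarrow> 0 < \<Theta> x"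
begin

lemma \<Phi>_0: "\<Phi> 0 = 0" and \<Theta>_0: "\<Theta> 0 = 0"
  using below[of 0] by auto

lemma \<Theta>_nonneg: "0 \<le> \<Theta> x"
  using below[of x] above[of x] by (cases "x \<le> 1") auto

lemma \<Phi>_lipschitz: "\<bar>\<Phi> b - \<Phi> a\<bar> \<le> \<bar>b - a\<bar>"
proof -
  have *: "\<bar>\<Phi> y - \<Phi> x\<bar> \<le> \<bar>y - x\<bar>" if xy: "x < y" for x y
  proof -
    obtain z where "\<Phi> y - \<Phi> x = (y - x) * \<Phi>' z" using mean_value_obtain[OF \<Phi>_deriv xy] by blast
    moreover have "\<bar>y - x\<bar> * \<bar>\<Phi>' z\<bar> \<le> \<bar>y - x\<bar> * 1"
      using \<Phi>'_nonneg[of z] \<Phi>'_le[of z] by (intro mult_left_mono) auto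
    ultimately show ?thesis by (simp add: abs_mult)
  qed
  show ?thesis
    using *[of a b] *[of b a] by (cases a b rule: linorder_cases) (auto simp: abs_minus_commute)
qed

lemma \<Phi>_abs_le: "\<bar>\<Phi> x\<bar> \<le> \<bar>x\<bar>"
  using \<Phi>_lipschitz[of x 0] \<Phi>_0 by simp

lemma \<Theta>_taylor: "\<bar>\<Theta> b - \<Theta> a - \<Phi> a * (b - a)\<bar> \<le> (b - a)\<^sup>2"
proof -
  have *: "\<bar>\<Theta> y - \<Theta> x - \<Phi> w * (y - x)\<bar> \<le> (y - x)\<^sup>2" if xy: "x < y" and w: "w = x \<or> w = y" for x y w
  proof -
    obtain z where z: "x < z" "z < y" "\<Theta> y - \<Theta> x = (y - x) * \<Phi> z" using mean_value_obtain[OF \<Theta>_deriv xy] by blast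
    then have "\<Theta> y - \<Theta> x - \<Phi> w * (y - x) = (y - x) * (\<Phi> z - \<Phi> w)" by (simp add: algebra_simps)
    moreover have "\<bar>\<Phi> z - \<Phi> w\<bar> \<le> \<bar>y - x\<bar>" using \<Phi>_lipschitz[of z w] z w by auto
    then have "\<bar>y - x\<bar> * \<bar>\<Phi> z - \<Phi> w\<bar> \<le> \<bar>y - x\<bar> * \<bar>y - x\<bar>" by (intro mult_left_mono) auto
    ultimately show ?thesis by (simp add: abs_mult power2_eq_square)
  qed
  consider "a < b" | "b < a" | "a = b" by linarith
  then show ?thesis
  proof cases
    case 1 then show ?thesis using *[of a b a] by simp
  next
    case 2
    have "\<Theta> b - \<Theta> a - \<Phi> a * (b - a) = - (\<Theta> a - \<Theta> b - \<Phi> a * (a - b))" by (simp add: algebra_simps)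
    then show ?thesis using *[of b a a] 2 by (simp add: power2_commute)
  qed simp
qed

lemma \<Phi>_measurable: "\<Phi> \<in> borel_measurable borel" and \<Theta>_measurable: "\<Theta> \<in> borel_measurable borel"
  and \<Phi>'_measurable: "\<Phi>' \<in> borel_measurable borel"
  using smooth_real_continuous_on[OF \<Phi>_smooth] smooth_real_continuous_on[OF \<Theta>_smooth] \<Phi>'_cont
  by (auto intro: borel_measurable_continuous_onI)

lemma L2_\<Phi>:
  assumes "L2 M f"
  shows "L2 M (\<lambda>x. \<Phi> (f x))"
proof (rule L2_bound[OF assms])
  show "(\<lambda>x. \<Phi> (f x)) \<in> borel_measurable M"
    using measurable_compose[OF L2_measurable[OF assms] \<Phi>_measurable] .
  show "AE x in M. norm (\<Phi> (f x)) \<le> 1 * norm (f x)" using \<Phi>_abs_le by simp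
qed

lemma integrable_\<Theta>:
  assumes "L2 M f"
  shows "integrable M (\<lambda>x. \<Theta> (f x))"
proof (rule Bochner_Integration.integrable_bound)
  show "integrable M (\<lambda>x. (f x)\<^sup>2)" using assms by (simp add: L2_real_iff)
  show "(\<lambda>x. \<Theta> (f x)) \<in> borel_measurable M"
    using measurable_compose[OF L2_measurable[OF assms] \<Theta>_measurable] .
  show "AE x in M. norm (\<Theta> (f x)) \<le> norm ((f x)\<^sup>2)"
    using \<Theta>_taylor[of _ 0] by (simp add: \<Phi>_0 \<Theta>_0)
qed

text \<open>In the shape required by \<open>DERIV_quadratic_close\<close>: the integral of \<Theta>
  along an orbit becomes differentiable although the orbit itself need not be differentiable at any
  point x.\<close>

lemma \<Theta>_integral_taylor:
  assumes "L2 M f" "L2 M g"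
  shows "\<bar>(\<integral>x. \<Theta> (g x) \<partial>M) - (\<integral>x. \<Theta> (f x) \<partial>M) - L2_inner M (\<lambda>x. g x - f x) (\<lambda>x. \<Phi> (f x))\<bar>
     \<le> (L2_norm M (\<lambda>x. g x - f x))\<^sup>2"
proof -
  have d: "L2 M (\<lambda>x. g x - f x)" by (rule L2_diff[OF assms(2,1)])
  have i: "integrable M (\<lambda>x. \<Theta> (g x) - \<Theta> (f x) - (g x - f x) * \<Phi> (f x))"
    by (intro Bochner_Integration.integrable_diff integrable_\<Theta> L2_integrable_mult d L2_\<Phi> assms)
  have "(\<integral>x. \<Theta> (g x) \<partial>M) - (\<integral>x. \<Theta> (f x) \<partial>M) - L2_inner M (\<lambda>x. g x - f x) (\<lambda>x. \<Phi> (f x))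
     = (\<integral>x. \<Theta> (g x) - \<Theta> (f x) - (g x - f x) * \<Phi> (f x) \<partial>M)"
    using integrable_\<Theta>[OF assms(1)] integrable_\<Theta>[OF assms(2)] L2_integrable_mult[OF d L2_\<Phi>[OF assms(1)]]
    by (simp add: L2_inner_def)
  also have "\<bar>\<dots>\<bar> \<le> (\<integral>x. (g x - f x)\<^sup>2 \<partial>M)"
  proof (rule order_trans[OF integral_abs_bound integral_mono])
    show "integrable M (\<lambda>x. (g x - f x)\<^sup>2)" using d by (simp add: L2_real_iff)
    show "\<bar>\<Theta> (g x) - \<Theta> (f x) - (g x - f x) * \<Phi> (f x)\<bar> \<le> (g x - f x)\<^sup>2" for x
      using \<Theta>_taylor[of "g x" "f x"] by (simp add: mult.commute)
  qed (use i in simp)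
  finally show ?thesis by (simp add: L2_norm_sq)
qed

lemma \<Theta>_integral_diff:
  assumes "L2 M f" "L2 M g"
  shows "\<bar>(\<integral>x. \<Theta> (g x) \<partial>M) - (\<integral>x. \<Theta> (f x) \<partial>M)\<bar>
     \<le> L2_norm M (\<lambda>x. g x - f x) * (L2_norm M (\<lambda>x. \<Phi> (f x)) + L2_norm M (\<lambda>x. g x - f x))"
  using \<Theta>_integral_taylor[OF assms]
    L2_Cauchy_Schwarz[OF L2_diff[OF assms(2,1)] L2_\<Phi>[OF assms(1)]]
  by (simp add: power2_eq_square distrib_left)

end

lemma smooth_contraction_ex: "\<exists>\<Phi> \<Phi>' \<Theta>. smooth_contraction \<Phi> \<Phi>' \<Theta>"
proof -
  obtain S' S P Q :: "real \<Rightarrow> real" where S: "smooth_real S" "smooth_real P" "smooth_real Q"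
      "\<And>x. (S has_real_derivative S' x) (at x)" "\<And>x. (P has_real_derivative S x) (at x)"
      "\<And>x. (Q has_real_derivative P x) (at x)" "\<And>x. 0 \<le> S' x"
      "\<And>x. x \<le> 0 \<Longrightarrow> S x = 0 \<and> P x = 0 \<and> Q x = 0" "\<And>x. 1 \<le> x \<Longrightarrow> S x = 1" "\<And>x. 0 < x \<Longrightarrow> 0 < Q x"
    using smooth_step_ex by metis
  have mono: "S x \<le> S y" if "x \<le> y" for x y
    using DERIV_nonneg_imp_nondecreasing[OF that, of S] S(4,7) by blast
  have S01: "0 \<le> S x" "S x \<le> 1" for x
    using mono[of "min x 0" x] mono[of x "max x 1"] S(8)[of "min x 0"] S(9)[of "max x 1"] by auto
  have shift: "((\<lambda>x. F (x - 1)) has_real_derivative F' (x - 1)) (at x)"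
    if "\<And>x. (F has_real_derivative F' x) (at x)" for F F' :: "real \<Rightarrow> real" and x
    using DERIV_shift[of F "F' (x - 1)" x "-1"] that by simp
  have sm: "smooth_real (\<lambda>x. F (x - 1))" if "smooth_real F" for F
    using smooth_real_affine_compose[OF that, of 1 "-1"] by simp
  have "smooth_contraction (\<lambda>x. P (x - 1)) (\<lambda>x. S (x - 1)) (\<lambda>x. Q (x - 1))"
    by unfold_locales
       (simp_all add: sm S shift S01 smooth_real_continuous_on)
  then show ?thesis by blast
qed

section \<open>Normal contractions and the form domain\<close>

context drift_form
begin

text \<open>With v_N fixed, the gradient of \<Phi>(v_m) - \<Phi>(v_n) splits into \<Phi>'(v_m) grad
  (v_m - v_N), (\<Phi>'(v_m) - \<Phi>'(v_n)) grad v_N and \<Phi>'(v_n) grad (v_N - v_n). The outer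
  terms are small by the Cauchy property, the middle one by dominated convergence; for the latter
  \<Phi>' is continuous and a subsequence converging almost everywhere is taken.\<close>

lemma contraction_form_approx:
  assumes "smooth_contraction \<Phi> \<Phi>' \<Theta>" and f: "form_approx \<mu> Q f u"
  shows "\<exists>r. strict_mono r \<and> form_approx \<mu> Q (\<lambda>x. \<Phi> (f x)) (\<lambda>n x. \<Phi> (u (r n) x))"
proof -
  interpret smooth_contraction \<Phi> \<Phi>' \<Theta> by (rule assms(1))
  have fL: "L2 \<mu> f" and u: "\<And>n. test_fun (u n)" and lim: "(\<lambda>n. L2_norm \<mu> (\<lambda>x. u n x - f x)) \<longlonglongrightarrow> 0"
    using f by (auto simp: form_approx_def)
  obtain r where r: "strict_mono r" "AE x in \<mu>. (\<lambda>n. u (r n) x) \<longlonglongrightarrow> f x"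
    using L2_AE_subseq[OF test_fun_L2[OF lf u] fL lim] by blast
  define v where "v = (\<lambda>n. u (r n))"
  have v: "test_fun (v n)" for n by (simp add: v_def u)
  have va: "form_approx \<mu> Q f v" unfolding v_def by (rule form_approx_subseq[OF f r(1)])
  have vL: "L2 \<mu> (v n)" for n by (rule test_fun_L2[OF lf v])
  have t\<Phi>: "test_fun (\<lambda>x. \<Phi> (v n x))" for n by (rule test_fun_compose[OF \<Phi>_smooth \<Phi>_0 v])
  have lim\<Phi>: "(\<lambda>n. L2_norm \<mu> (\<lambda>x. \<Phi> (v n x) - \<Phi> (f x))) \<longlonglongrightarrow> 0"
  proof (rule tendsto_sandwich[OF _ _ tendsto_const])
    show "(\<lambda>n. 1 * L2_norm \<mu> (\<lambda>x. v n x - f x)) \<longlonglongrightarrow> 0" using va by (simp add: form_approx_def)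
    show "\<forall>\<^sub>F n in sequentially. L2_norm \<mu> (\<lambda>x. \<Phi> (v n x) - \<Phi> (f x)) \<le> 1 * L2_norm \<mu> (\<lambda>x. v n x - f x)"
      by (intro always_eventually allI L2_norm_mono L2_diff vL fL AE_I2
          L2_measurable[OF L2_diff[OF L2_\<Phi>[OF vL] L2_\<Phi>[OF fL]]])
         (simp_all add: \<Phi>_lipschitz)
  qed (simp add: L2_norm_nonneg)
  have cauchy: "\<exists>N. \<forall>m\<ge>N. \<forall>n\<ge>N. Q (\<lambda>x. \<Phi> (v m x) - \<Phi> (v n x)) (\<lambda>x. \<Phi> (v m x) - \<Phi> (v n x)) < e" if e: "0 < e" for e
  proof -
    \<comment> \<open>The final bound is 3 (e/12 + 2 e/24 + 2 e/24 + e/12) = e, with the factor 3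
      from \<open>psd_sum3\<close>.\<close>
    have "0 < e / 12" using e by simp
    then obtain N where N: "\<And>m n. N \<le> m \<Longrightarrow> N \<le> n \<Longrightarrow> Q (\<lambda>x. v m x - v n x) (\<lambda>x. v m x - v n x) < e / 12"
      using form_approx_Cauchy[OF va] by blast
    define w where "w = (\<lambda>x. a x (grad (v N) x) (grad (v N) x))"
    define d where "d = (\<lambda>k x. (\<Phi>' (v k x) - \<Phi>' (f x))\<^sup>2 * w x)"
    have w: "integrable \<mu> w" unfolding w_def by (rule bil_integrable[OF sym_loc v v])
    have mf: "(\<lambda>x. \<Phi>' (f x)) \<in> borel_measurable \<mu>" and mv: "(\<lambda>x. \<Phi>' (v k x)) \<in> borel_measurable \<mu>" for k
      using measurable_compose[OF L2_measurable[OF fL] \<Phi>'_measurable]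
        measurable_compose[OF L2_measurable[OF vL] \<Phi>'_measurable] by blast+
    have dm: "d k \<in> borel_measurable \<mu>" for k
      unfolding d_def
      by (intro borel_measurable_times borel_measurable_power borel_measurable_diff mf mv
          borel_measurable_integrable[OF w])
    have db: "AE x in \<mu>. norm (d k x) \<le> w x" for k
      using psd
    proof eventually_elim
      case (elim x)
      then have w0: "0 \<le> w x" by (simp add: w_def)
      have "\<bar>\<Phi>' (v k x) - \<Phi>' (f x)\<bar> \<le> 1"
        using \<Phi>'_nonneg[of "v k x"] \<Phi>'_nonneg[of "f x"] \<Phi>'_le[of "v k x"] \<Phi>'_le[of "f x"] by linarith
      then have "(\<Phi>' (v k x) - \<Phi>' (f x))\<^sup>2 \<le> 1" by (simp add: abs_square_le_1)
      then have "(\<Phi>' (v k x) - \<Phi>' (f x))\<^sup>2 * w x \<le> 1 * w x" using w0 by (intro mult_right_mono)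
      then show ?case using w0 by (simp add: d_def)
    qed
    have di: "integrable \<mu> (d k)" for k
      by (rule Bochner_Integration.integrable_bound[OF w dm]) (use db[of k] in eventually_elim, simp)
    have "(\<lambda>k. \<integral>x. d k x \<partial>\<mu>) \<longlonglongrightarrow> (\<integral>x. 0 \<partial>\<mu>)"
    proof (rule integral_dominated_convergence[OF _ dm w _ db])
      show "AE x in \<mu>. (\<lambda>k. d k x) \<longlonglongrightarrow> 0"
        using r(2)
      proof eventually_elim
        case (elim x)
        then have "(\<lambda>k. \<Phi>' (v k x)) \<longlonglongrightarrow> \<Phi>' (f x)"
          using \<Phi>'_cont by (auto intro: continuous_on_tendsto_compose simp: v_def)
        then have "(\<lambda>k. d k x) \<longlonglongrightarrow> (\<Phi>' (f x) - \<Phi>' (f x))\<^sup>2 * w x"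
          unfolding d_def by (intro tendsto_intros)
        then show ?case by simp
      qed
    qed simp
    then have "(\<lambda>k. \<integral>x. d k x \<partial>\<mu>) \<longlonglongrightarrow> 0" by simp
    moreover have "0 < e / 24" using e by simp
    ultimately have "\<forall>\<^sub>F k in sequentially. (\<integral>x. d k x \<partial>\<mu>) < e / 24" by (rule order_tendstoD)
    then obtain N' where N': "\<And>k. N' \<le> k \<Longrightarrow> (\<integral>x. d k x \<partial>\<mu>) < e / 24"
      by (auto simp: eventually_sequentially)
    have "Q (\<lambda>x. \<Phi> (v m x) - \<Phi> (v n x)) (\<lambda>x. \<Phi> (v m x) - \<Phi> (v n x)) < e"
      if mn: "max N N' \<le> m" "max N N' \<le> n" for m n
    proof -
      define p where "p = (\<lambda>x. v m x - v N x)"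
      define q where "q = (\<lambda>x. v N x - v n x)"
      have tp: "test_fun p" and tq: "test_fun q" unfolding p_def q_def by (intro test_fun_diff v)+
      define ap where "ap = (\<lambda>x. a x (grad p x) (grad p x))"
      define aq where "aq = (\<lambda>x. a x (grad q x) (grad q x))"
      have ip: "integrable \<mu> ap" "integrable \<mu> aq"
        unfolding ap_def aq_def by (intro bil_integrable[OF sym_loc] tp tq)+
      have t: "test_fun (\<lambda>x. \<Phi> (v m x) - \<Phi> (v n x))" by (rule test_fun_diff[OF t\<Phi> t\<Phi>])
      have "Q (\<lambda>x. \<Phi> (v m x) - \<Phi> (v n x)) (\<lambda>x. \<Phi> (v m x) - \<Phi> (v n x))
         \<le> (\<integral>x. 3 * (ap x + (2 * d m x + 2 * d n x) + aq x) \<partial>\<mu>)"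
        unfolding form_diagonal[OF t]
      proof (rule integral_mono_AE)
        show "integrable \<mu> (\<lambda>x. a x (grad (\<lambda>x. \<Phi> (v m x) - \<Phi> (v n x)) x) (grad (\<lambda>x. \<Phi> (v m x) - \<Phi> (v n x)) x))"
          by (rule bil_integrable[OF sym_loc t t])
        show "integrable \<mu> (\<lambda>x. 3 * (ap x + (2 * d m x + 2 * d n x) + aq x))"
          by (intro integrable_mult_right Bochner_Integration.integrable_add ip di)
        show "AE x in \<mu>. a x (grad (\<lambda>x. \<Phi> (v m x) - \<Phi> (v n x)) x) (grad (\<lambda>x. \<Phi> (v m x) - \<Phi> (v n x)) x)
            \<le> 3 * (ap x + (2 * d m x + 2 * d n x) + aq x)"
          using psd
        proof eventually_elim
          case (elim x)
          define y where "y = grad (v N) x"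
          have gp: "grad p x = grad (v m) x - y" and gq: "grad q x = y - grad (v n) x"
            unfolding p_def q_def y_def by (simp_all add: grad_diff test_fun_differentiable v)
          have g: "grad (\<lambda>x. \<Phi> (v m x) - \<Phi> (v n x)) x
             = \<Phi>' (v m x) *\<^sub>R grad p x + (\<Phi>' (v m x) - \<Phi>' (v n x)) *\<^sub>R y + \<Phi>' (v n x) *\<^sub>R grad q x"
            by (simp add: grad_diff test_fun_differentiable[OF t\<Phi>] grad_compose[OF test_fun_differentiable[OF v] \<Phi>_deriv]
                gp gq algebra_simps)
          have sc: "a x (\<Phi>' s *\<^sub>R z) (\<Phi>' s *\<^sub>R z) \<le> a x z z" for s z
          proof -
            have "\<Phi>' s * \<Phi>' s \<le> 1" using \<Phi>'_nonneg \<Phi>'_le by (intro mult_le_one) auto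
            then have "(\<Phi>' s * \<Phi>' s) * a x z z \<le> 1 * a x z z" using elim by (intro mult_right_mono) auto
            then show ?thesis by (simp add: bil_scale_left bil_scale_right)
          qed
          have "a x ((\<Phi>' (v m x) - \<Phi>' (v n x)) *\<^sub>R y) ((\<Phi>' (v m x) - \<Phi>' (v n x)) *\<^sub>R y)
              = (\<Phi>' (v m x) - \<Phi>' (v n x))\<^sup>2 * w x"
            by (simp add: bil_scale_left bil_scale_right w_def y_def power2_eq_square)
          also have "\<dots> \<le> (2 * (\<Phi>' (v m x) - \<Phi>' (f x))\<^sup>2 + 2 * (\<Phi>' (v n x) - \<Phi>' (f x))\<^sup>2) * w x"
          proof (rule mult_right_mono)
            have "(b - c)\<^sup>2 \<le> 2 * (b - h)\<^sup>2 + 2 * (c - h)\<^sup>2" for b c h :: real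
              using zero_le_power2[of "b + c - 2 * h"] by (simp add: power2_eq_square algebra_simps)
            then show "(\<Phi>' (v m x) - \<Phi>' (v n x))\<^sup>2 \<le> 2 * (\<Phi>' (v m x) - \<Phi>' (f x))\<^sup>2 + 2 * (\<Phi>' (v n x) - \<Phi>' (f x))\<^sup>2" .
            show "0 \<le> w x" using elim by (simp add: w_def)
          qed
          also have "\<dots> = 2 * d m x + 2 * d n x" by (simp add: d_def distrib_right)
          finally have mid: "a x ((\<Phi>' (v m x) - \<Phi>' (v n x)) *\<^sub>R y) ((\<Phi>' (v m x) - \<Phi>' (v n x)) *\<^sub>R y) \<le> 2 * d m x + 2 * d n x" .
          show ?case
            unfolding g
            using psd_sum3[of "sym_part A x" "\<Phi>' (v m x) *\<^sub>R grad p x" "(\<Phi>' (v m x) - \<Phi>' (v n x)) *\<^sub>R y" "\<Phi>' (v n x) *\<^sub>R grad q x"]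
              elim bil_sym_part_commute[of A x] sc[of "v m x" "grad p x"] sc[of "v n x" "grad q x"] mid
            by (simp add: ap_def aq_def)
        qed
      qed
      also have "\<dots> = 3 * (integral\<^sup>L \<mu> ap + (2 * integral\<^sup>L \<mu> (d m) + 2 * integral\<^sup>L \<mu> (d n)) + integral\<^sup>L \<mu> aq)"
        by (simp add: ip di)
      also have "\<dots> < e"
      proof -
        have "integral\<^sup>L \<mu> ap < e / 12"
          using N[of m N] mn form_diagonal[OF tp] by (simp add: ap_def p_def)
        moreover have "integral\<^sup>L \<mu> aq < e / 12"
          using N[of N n] mn form_diagonal[OF tq] by (simp add: aq_def q_def)
        moreover have "integral\<^sup>L \<mu> (d m) < e / 24" "integral\<^sup>L \<mu> (d n) < e / 24" using N' mn by auto
        moreover have "3 * (i + (2 * j + 2 * k) + h) < e" if "i < e / 12" "h < e / 12" "j < e / 24" "k < e / 24" for h i j k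
          using that by (simp add: field_simps)
        ultimately show ?thesis by blast
      qed
      finally show ?thesis .
    qed
    then show ?thesis by blast
  qed
  have "form_approx \<mu> Q (\<lambda>x. \<Phi> (f x)) (\<lambda>n x. \<Phi> (v n x))"
    unfolding form_approx_def using L2_\<Phi>[OF fL] t\<Phi> lim\<Phi> cauchy by blast
  with r(1) show ?thesis by (auto simp: v_def)
qed

text \<open>The drift integrand \<Phi>(w) <\<beta>, grad w> is <\<beta>, grad \<Theta>(w)> and
  integrates to 0. What remains is the integral of \<Phi>'(w) a(grad w, grad w).\<close>

lemma form_contraction_nonneg:
  assumes "smooth_contraction \<Phi> \<Phi>' \<Theta>" and w: "test_fun w"
  shows "0 \<le> Q w (\<lambda>x. \<Phi> (w x))"
proof -
  interpret smooth_contraction \<Phi> \<Phi>' \<Theta> by (rule assms(1))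
  have t: "test_fun (\<lambda>x. \<Phi> (w x))" "test_fun (\<lambda>x. \<Theta> (w x))"
    by (rule test_fun_compose[OF \<Phi>_smooth \<Phi>_0 w], rule test_fun_compose[OF \<Theta>_smooth \<Theta>_0 w])
  have "grad (\<lambda>x. \<Theta> (w x)) x = \<Phi> (w x) *\<^sub>R grad w x" "grad (\<lambda>x. \<Phi> (w x)) x = \<Phi>' (w x) *\<^sub>R grad w x" for x
    by (rule grad_compose[OF test_fun_differentiable[OF w] \<Theta>_deriv],
        rule grad_compose[OF test_fun_differentiable[OF w] \<Phi>_deriv])
  then have "Q w (\<lambda>x. \<Phi> (w x)) = (\<integral>x. \<Phi>' (w x) * a x (grad w x) (grad w x) \<partial>\<mu>)"
    using form_eq[OF w t(1)] \<beta>_div[OF t(2)] by (simp add: bil_scale_right mult.commute)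
  also have "\<dots> \<ge> 0" using psd by (intro integral_nonneg_AE) (auto simp: \<Phi>'_nonneg)
  finally show ?thesis .
qed

end

section \<open>The resolvent orbit as a weak solution of the evolution equation\<close>

locale form_orbit = drift_form \<phi> D\<phi> A Da B + resolvent_orbit "weighted \<phi>" T l f U
  for \<phi> :: "real^'n::finite \<Rightarrow> real" and D\<phi> A Da B T l f U +
  assumes U_value: "\<And>t g. 0 \<le> t \<Longrightarrow> g \<in> form_domain \<mu> Q \<Longrightarrow>
      closure_has_value \<mu> Q (U t) g (L2_inner \<mu> (Tz t f) g - l * L2_inner \<mu> (U t) g)"
    and U_domain: "\<And>t. 0 \<le> t \<Longrightarrow> U t \<in> form_domain \<mu> Q"
begin

lemma V_form_approx:
  assumes "0 \<le> t"
  obtains v where "form_approx \<mu> Q (V t) v"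
proof -
  obtain u where "form_approx \<mu> Q (U t) u" using U_domain[OF assms] by (auto simp: form_domain_def)
  from form_approx_cmult[OF this, of l] show ?thesis using that by (simp add: V_def[abs_def])
qed

text \<open>The resolvent equation multiplied by l. Together with \<open>V_inner_deriv\<close> it is
  the weak evolution equation: the time derivative of \<open>V t\<close> paired with g is minus the
  form at (V t, g).\<close>

lemma V_form_limit:
  assumes t: "0 \<le> t" and v: "form_approx \<mu> Q (V t) v" and w: "form_approx \<mu> Q g w"
  shows "(\<lambda>n. Q (v n) (w n)) \<longlonglongrightarrow> - L2_inner \<mu> (P t) g"
proof -
  have gL: "L2 \<mu> g" and vt: "test_fun (v n)" for n using v w by (auto simp: form_approx_def)
  have g: "g \<in> form_domain \<mu> Q" using w by (auto simp: form_domain_def)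
  have "(\<lambda>x. 1 / l * V t x) = U t" using l by (simp add: V_def fun_eq_iff)
  with form_approx_cmult[OF v, of "1 / l"] have "form_approx \<mu> Q (U t) (\<lambda>n x. 1 / l * v n x)" by simp
  then have "(\<lambda>n. Q (\<lambda>x. 1 / l * v n x) (w n)) \<longlonglongrightarrow> L2_inner \<mu> (Tz t f) g - l * L2_inner \<mu> (U t) g"
    using U_value[OF t g] w unfolding closure_has_value_def by blast
  then have "(\<lambda>n. l * (1 / l * Q (v n) (w n))) \<longlonglongrightarrow> l * (L2_inner \<mu> (Tz t f) g - l * L2_inner \<mu> (U t) g)"
    unfolding form_cmult_left[OF vt] by (rule tendsto_mult_left)
  moreover have "l * (L2_inner \<mu> (Tz t f) g - l * L2_inner \<mu> (U t) g) = - L2_inner \<mu> (P t) g"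
  proof -
    have "L2_inner \<mu> (P t) g = l * (l * L2_inner \<mu> (U t) g - L2_inner \<mu> (Tz t f) g)"
      unfolding P_def L2_inner_cmult_left
      using L2_inner_diff_left[OF V_L2[OF t] Tz_L2[OF t f] gL] L2_inner_cmult_left[of \<mu> l "U t" g]
      by (simp add: V_def[abs_def])
    then show ?thesis by (simp add: algebra_simps)
  qed
  ultimately show ?thesis using l by simp
qed

text \<open>The derivative in t is the product of \<open>P t\<close> with \<Phi>(V t), that is,
  minus a limit of the nonnegative values in \<open>form_contraction_nonneg\<close>.\<close>

lemma \<Theta>_decreasing:
  assumes "smooth_contraction \<Phi> \<Phi>' \<Theta>" and t: "0 \<le> t"
  shows "(\<integral>x. \<Theta> (V t x) \<partial>\<mu>) \<le> (\<integral>x. \<Theta> (V 0 x) \<partial>\<mu>)"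
proof -
  interpret smooth_contraction \<Phi> \<Phi>' \<Theta> by (rule assms(1))
  define F where "F = (\<lambda>t. \<integral>x. \<Theta> (V t x) \<partial>\<mu>)"
  have "\<exists>y. (F has_real_derivative y) (at s) \<and> y \<le> 0" if s: "0 < s" for s
  proof (intro exI conjI)
    have s0: "0 \<le> s" using s by simp
    have \<Phi>L: "L2 \<mu> (\<lambda>x. \<Phi> (V s x))" by (rule L2_\<Phi>[OF V_L2[OF s0]])
    show "(F has_real_derivative L2_inner \<mu> (P s) (\<lambda>x. \<Phi> (V s x))) (at s)"
    proof (rule DERIV_quadratic_close[OF V_inner_deriv(2)[OF \<Phi>L s], of "{0<..}"])
      fix s' :: real assume "s' \<in> {0<..}"
      then have s': "0 \<le> s'" by simp
      have "L2_inner \<mu> (V s') (\<lambda>x. \<Phi> (V s x)) - L2_inner \<mu> (V s) (\<lambda>x. \<Phi> (V s x))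
          = L2_inner \<mu> (\<lambda>x. V s' x - V s x) (\<lambda>x. \<Phi> (V s x))"
        by (simp add: L2_inner_diff_left[OF V_L2[OF s'] V_L2[OF s0] \<Phi>L])
      then have "\<bar>F s' - F s - (L2_inner \<mu> (V s') (\<lambda>x. \<Phi> (V s x)) - L2_inner \<mu> (V s) (\<lambda>x. \<Phi> (V s x)))\<bar>
          \<le> (L2_norm \<mu> (\<lambda>x. V s' x - V s x))\<^sup>2"
        unfolding F_def using \<Theta>_integral_taylor[OF V_L2[OF s0] V_L2[OF s']] by simp
      also have "\<dots> \<le> (Pmax * \<bar>s' - s\<bar>)\<^sup>2"
        by (intro power_mono V_lipschitz s0 s' L2_norm_nonneg)
      finally show "\<bar>F s' - F s - (L2_inner \<mu> (V s') (\<lambda>x. \<Phi> (V s x)) - L2_inner \<mu> (V s) (\<lambda>x. \<Phi> (V s x)))\<bar>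
          \<le> Pmax\<^sup>2 * (s' - s)\<^sup>2" by (simp add: power_mult_distrib)
    qed (use s in auto)
    obtain v where v: "form_approx \<mu> Q (V s) v" using V_form_approx[OF s0] .
    obtain r where r: "strict_mono r" "form_approx \<mu> Q (\<lambda>x. \<Phi> (V s x)) (\<lambda>n x. \<Phi> (v (r n) x))"
      using contraction_form_approx[OF assms(1) v] by blast
    have "(\<lambda>n. Q (v (r n)) (\<lambda>x. \<Phi> (v (r n) x))) \<longlonglongrightarrow> - L2_inner \<mu> (P s) (\<lambda>x. \<Phi> (V s x))"
      by (rule V_form_limit[OF s0 form_approx_subseq[OF v r(1)] r(2)])
    moreover have "0 \<le> Q (v (r n)) (\<lambda>x. \<Phi> (v (r n) x))" for n
      using v by (intro form_contraction_nonneg[OF assms(1)]) (auto simp: form_approx_def)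
    ultimately have "0 \<le> - L2_inner \<mu> (P s) (\<lambda>x. \<Phi> (V s x))" using LIMSEQ_le_const by blast
    then show "L2_inner \<mu> (P s) (\<lambda>x. \<Phi> (V s x)) \<le> 0" by simp
  qed
  \<comment> \<open>The derivative is available for positive times only; the initial time is reached
    by continuity.\<close>
  moreover have "continuous_on {0..t} F"
    unfolding continuous_on_def
  proof
    fix s assume "s \<in> {0..t}"
    then have s: "0 \<le> s" by simp
    define K where "K = L2_norm \<mu> (\<lambda>x. \<Phi> (V s x))"
    have "((\<lambda>s'. F s' - F s) \<longlongrightarrow> 0) (at s within {0..t})"
    proof (rule Lim_null_comparison)
      show "\<forall>\<^sub>F s' in at s within {0..t}. norm (F s' - F s) \<le> (Pmax * \<bar>s' - s\<bar>) * (K + Pmax * \<bar>s' - s\<bar>)"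
        unfolding eventually_at_filter
      proof (intro always_eventually allI impI)
        fix s' :: real assume "s' \<in> {0..t}"
        then have s': "0 \<le> s'" by simp
        have "norm (F s' - F s) \<le> L2_norm \<mu> (\<lambda>x. V s' x - V s x) * (K + L2_norm \<mu> (\<lambda>x. V s' x - V s x))"
          unfolding F_def K_def real_norm_def by (rule \<Theta>_integral_diff[OF V_L2[OF s] V_L2[OF s']])
        also have "\<dots> \<le> (Pmax * \<bar>s' - s\<bar>) * (K + Pmax * \<bar>s' - s\<bar>)"
          using V_lipschitz[OF s s'] Pmax_nonneg
          by (intro mult_mono add_mono) (auto simp: K_def L2_norm_nonneg)
        finally show "norm (F s' - F s) \<le> (Pmax * \<bar>s' - s\<bar>) * (K + Pmax * \<bar>s' - s\<bar>)" .
      qed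
      have "((\<lambda>s'. (Pmax * \<bar>s' - s\<bar>) * (K + Pmax * \<bar>s' - s\<bar>)) \<longlongrightarrow> (Pmax * \<bar>s - s\<bar>) * (K + Pmax * \<bar>s - s\<bar>)) (at s within {0..t})"
        by (intro tendsto_intros)
      then show "((\<lambda>s'. (Pmax * \<bar>s' - s\<bar>) * (K + Pmax * \<bar>s' - s\<bar>)) \<longlongrightarrow> 0) (at s within {0..t})" by simp
    qed
    then show "(F \<longlongrightarrow> F s) (at s within {0..t})" by (simp add: LIM_zero_iff)
  qed
  ultimately have "F t \<le> F 0" by (intro DERIV_nonpos_imp_decreasing_open[OF t]) blast+
  then show ?thesis by (simp add: F_def)
qed

end

section \<open>Sub-Markov bound and positivity\<close>

context drift_form
begin

lemma form_orbit_ex: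
  assumes T: "semigroup_of_form \<mu> Q T" and f: "L2 \<mu> f" and l: "0 < l"
  shows "\<exists>U. form_orbit \<phi> D\<phi> A Da B T l f U"
proof -
  interpret l2_semigroup \<mu> T by unfold_locales (use T in \<open>simp add: semigroup_of_form_def\<close>)
  have "\<forall>t. \<exists>u. 0 \<le> t \<longrightarrow> is_resolvent \<mu> T l (Tz t f) u \<and> u \<in> form_domain \<mu> Q \<and>
     (\<forall>g\<in>form_domain \<mu> Q. closure_has_value \<mu> Q u g (L2_inner \<mu> (Tz t f) g - l * L2_inner \<mu> u g))"
    using T l Tz_L2[OF _ f] unfolding semigroup_of_form_def by meson
  then obtain U where U: "\<And>t. 0 \<le> t \<Longrightarrow> is_resolvent \<mu> T l (Tz t f) (U t) \<and> U t \<in> form_domain \<mu> Q \<and>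
     (\<forall>g\<in>form_domain \<mu> Q. closure_has_value \<mu> Q (U t) g (L2_inner \<mu> (Tz t f) g - l * L2_inner \<mu> (U t) g))"
    by metis
  have "form_orbit \<phi> D\<phi> A Da B T l f U"
    by unfold_locales (use U l f in auto)
  then show ?thesis by blast
qed

text \<open>\<Theta> vanishes exactly on the values at most 1, so the integral of \<Theta>(g) is 0
  and the decrease along the orbit forces the same at time t. For finite l the orbit starts at l G_l
  g instead of g, so the conclusion is drawn only after l tends to infinity.\<close>

lemma semigroup_le_1:
  assumes T: "semigroup_of_form \<mu> Q T" and g: "L2 \<mu> g" and le: "AE x in \<mu>. g x \<le> 1" and t: "0 < t"
  shows "AE x in \<mu>. T t g x \<le> 1"
proof -
  obtain \<Phi> \<Phi>' \<Theta> where sc: "smooth_contraction \<Phi> \<Phi>' \<Theta>" using smooth_contraction_ex by blast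
  interpret smooth_contraction \<Phi> \<Phi>' \<Theta> by (rule sc)
  interpret S: l2_semigroup \<mu> T by unfold_locales (use T in \<open>simp add: semigroup_of_form_def\<close>)
  have "\<forall>n. \<exists>U. form_orbit \<phi> D\<phi> A Da B T (real (Suc n)) g U"
    by (intro allI form_orbit_ex[OF T g]) simp
  from choice[OF this] obtain U where U: "\<And>n. form_orbit \<phi> D\<phi> A Da B T (real (Suc n)) g (U n)" by blast
  define v where "v = (\<lambda>s n x. real (Suc n) * U n s x)"
  have lim: "(\<lambda>n. \<integral>x. \<Theta> (v s n x) \<partial>\<mu>) \<longlonglongrightarrow> (\<integral>x. \<Theta> (S.Tz s g x) \<partial>\<mu>)" if s: "0 \<le> s" for s
  proof -
    have res: "is_resolvent \<mu> T (real (Suc n)) (S.Tz s g) (U n s)" for n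
    proof -
      interpret O: form_orbit \<phi> D\<phi> A Da B T "real (Suc n)" g "U n" by (rule U)
      show ?thesis by (rule O.U[OF s])
    qed
    have TL: "L2 \<mu> (S.Tz s g)" by (rule S.Tz_L2[OF s g])
    have vL: "L2 \<mu> (v s n)" for n
      using res[of n] unfolding v_def is_resolvent_def by (intro L2_cmult) blast
    have c: "(\<lambda>n. L2_norm \<mu> (\<lambda>x. v s n x - S.Tz s g x)) \<longlonglongrightarrow> 0"
      unfolding v_def by (rule S.resolvent_tendsto[OF TL res])
    let ?K = "L2_norm \<mu> (\<lambda>x. \<Phi> (S.Tz s g x))"
    have "(\<lambda>n. L2_norm \<mu> (\<lambda>x. v s n x - S.Tz s g x) * (?K + L2_norm \<mu> (\<lambda>x. v s n x - S.Tz s g x))) \<longlonglongrightarrow> 0 * (?K + 0)"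
      by (intro tendsto_intros c)
    then have "(\<lambda>n. L2_norm \<mu> (\<lambda>x. v s n x - S.Tz s g x) * (?K + L2_norm \<mu> (\<lambda>x. v s n x - S.Tz s g x))) \<longlonglongrightarrow> 0" by simp
    then have "(\<lambda>n. (\<integral>x. \<Theta> (v s n x) \<partial>\<mu>) - (\<integral>x. \<Theta> (S.Tz s g x) \<partial>\<mu>)) \<longlonglongrightarrow> 0"
      by (rule Lim_null_comparison[rotated])
         (use \<Theta>_integral_diff[OF TL vL] in \<open>auto intro!: always_eventually\<close>)
    then show ?thesis by (simp add: LIM_zero_iff)
  qed
  have "(\<integral>x. \<Theta> (v t n x) \<partial>\<mu>) \<le> (\<integral>x. \<Theta> (v 0 n x) \<partial>\<mu>)" for n
  proof -
    interpret O: form_orbit \<phi> D\<phi> A Da B T "real (Suc n)" g "U n" by (rule U)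
    show ?thesis using O.\<Theta>_decreasing[OF sc, of t] t unfolding O.V_def v_def by simp
  qed
  then have "(\<integral>x. \<Theta> (S.Tz t g x) \<partial>\<mu>) \<le> (\<integral>x. \<Theta> (S.Tz 0 g x) \<partial>\<mu>)"
    using lim[of t] lim[of 0] t by (intro LIMSEQ_le) auto
  also have "\<dots> = 0"
  proof -
    have "AE x in \<mu>. \<Theta> (g x) = 0" using le by eventually_elim (simp add: below)
    then show ?thesis unfolding S.Tz_0 by (intro integral_eq_zero_AE)
  qed
  finally have "(\<integral>x. \<Theta> (T t g x) \<partial>\<mu>) = 0"
    using t Bochner_Integration.integral_nonneg[of \<mu> "\<lambda>x. \<Theta> (T t g x)", OF \<Theta>_nonneg]
    by (simp add: S.Tz_pos)
  moreover have "integrable \<mu> (\<lambda>x. \<Theta> (T t g x))"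
    using integrable_\<Theta>[OF S.Tz_L2[of t g]] t g by (simp add: S.Tz_pos)
  ultimately have "AE x in \<mu>. \<Theta> (T t g x) = 0"
    using \<Theta>_nonneg by (subst (asm) integral_nonneg_eq_0_iff_AE) auto
  then show ?thesis
  proof eventually_elim
    case (elim x)
    then show ?case using above[of "T t g x"] by (cases "T t g x \<le> 1") auto
  qed
qed

text \<open>The function -n g is at most 0, hence at most 1, for every n; so T_t g \<ge> -1/n almost
  everywhere for all n.\<close>

lemma semigroup_nonneg:
  assumes T: "semigroup_of_form \<mu> Q T" and g: "L2 \<mu> g" and ge: "AE x in \<mu>. 0 \<le> g x" and t: "0 < t"
  shows "AE x in \<mu>. 0 \<le> T t g x"
proof -
  interpret S: l2_semigroup \<mu> T by unfold_locales (use T in \<open>simp add: semigroup_of_form_def\<close>)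
  have "AE x in \<mu>. - real n * T t g x \<le> 1" for n
  proof -
    have "AE x in \<mu>. - real n * g x \<le> 1"
    proof (use ge in eventually_elim)
      case (elim x)
      then have "0 \<le> real n * g x" by simp
      then show ?case by simp
    qed
    from semigroup_le_1[OF T L2_cmult[OF g] this t]
    have "AE x in \<mu>. T t (\<lambda>x. - real n * g x) x \<le> 1" .
    moreover have "AE x in \<mu>. T t (\<lambda>x. - real n * g x + 0 * g x) x = - real n * T t g x + 0 * T t g x"
      using S.Tz_linear[of t g g "- real n" 0] t g by (simp add: S.Tz_pos)
    ultimately show ?thesis by eventually_elim simp
  qed
  then have "AE x in \<mu>. \<forall>n. - real n * T t g x \<le> 1" by (simp add: AE_all_countable)
  then show ?thesis
  proof eventually_elim
    case (elim x)
    show ?case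
    proof (rule ccontr)
      assume "\<not> 0 \<le> T t g x"
      then have p: "0 < - T t g x" by simp
      obtain n :: nat where "1 < real n * (- T t g x)" using reals_Archimedean3[OF p] by blast
      then show False using elim[rule_format, of n] by simp
    qed
  qed
qed

end

section \<open>The weighted energy estimate\<close>

lemma exp_neg_taylor:
  fixes x y :: real
  assumes "0 \<le> x" "0 \<le> y"
  shows "\<bar>exp (- y) - exp (- x)\<bar> \<le> \<bar>y - x\<bar>"
    and "\<bar>exp (- y) - exp (- x) + exp (- x) * (y - x)\<bar> \<le> (y - x)\<^sup>2"
proof -
  have D: "((\<lambda>x. exp (- x)) has_real_derivative - exp (- z)) (at z)" for z :: real
    by (auto intro!: derivative_eq_intros)
  have lip: "\<bar>exp (- b) - exp (- a)\<bar> \<le> \<bar>b - a\<bar>" if "0 \<le> a" "0 \<le> b" for a b :: real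
  proof -
    have *: "\<bar>exp (- q) - exp (- p)\<bar> \<le> \<bar>q - p\<bar>" if "0 \<le> p" "p < q" for p q :: real
    proof -
      obtain z where z: "p < z" "z < q" "exp (- q) - exp (- p) = (q - p) * (- exp (- z))"
        by (rule mean_value_obtain[OF D \<open>p < q\<close>])
      moreover have "exp (- z) \<le> 1" using z(1) that by simp
      then have "(q - p) * exp (- z) \<le> (q - p) * 1" using that by (intro mult_left_mono) auto
      ultimately show ?thesis using that by (simp add: abs_mult)
    qed
    show ?thesis
      using *[of a b] *[of b a] that by (cases a b rule: linorder_cases) (auto simp: abs_minus_commute)
  qed
  then show "\<bar>exp (- y) - exp (- x)\<bar> \<le> \<bar>y - x\<bar>" using assms by blast
  have *: "\<bar>exp (- q) - exp (- p) + exp (- w) * (q - p)\<bar> \<le> (q - p)\<^sup>2"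
    if pq: "0 \<le> p" "p < q" and w: "w = p \<or> w = q" for p q w :: real
  proof -
    obtain z where z: "p < z" "z < q" "exp (- q) - exp (- p) = (q - p) * (- exp (- z))"
      by (rule mean_value_obtain[OF D \<open>p < q\<close>])
    have "exp (- q) - exp (- p) + exp (- w) * (q - p) = (q - p) * (exp (- w) - exp (- z))"
      unfolding z(3) by (simp add: algebra_simps)
    moreover have "\<bar>exp (- w) - exp (- z)\<bar> \<le> \<bar>q - p\<bar>" using lip[of z w] z w pq by auto
    then have "\<bar>q - p\<bar> * \<bar>exp (- w) - exp (- z)\<bar> \<le> \<bar>q - p\<bar> * \<bar>q - p\<bar>" by (intro mult_left_mono) auto
    ultimately show ?thesis by (simp add: abs_mult power2_eq_square)
  qed
  consider "x < y" | "y < x" | "x = y" by linarith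
  then show "\<bar>exp (- y) - exp (- x) + exp (- x) * (y - x)\<bar> \<le> (y - x)\<^sup>2"
  proof cases
    case 1 then show ?thesis using *[of x y x] assms by simp
  next
    case 2
    have "exp (- y) - exp (- x) + exp (- x) * (y - x) = - (exp (- x) - exp (- y) + exp (- x) * (x - y))"
      by (simp add: algebra_simps)
    then have "\<bar>exp (- y) - exp (- x) + exp (- x) * (y - x)\<bar> = \<bar>exp (- x) - exp (- y) + exp (- x) * (x - y)\<bar>"
      by (simp only: abs_minus_cancel)
    then show ?thesis using *[of y x x] 2 assms by (simp add: power2_commute)
  qed simp
qed

lemma psd_young:
  assumes "\<And>\<xi>. 0 \<le> bil m \<xi> \<xi>" "\<And>\<xi> \<eta>. bil m \<xi> \<eta> = bil m \<eta> \<xi>"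
  shows "- bil m \<xi> \<xi> - bil m \<zeta> \<zeta> \<le> bil m \<zeta> \<xi>"
  using assms(1)[of "\<xi> + \<zeta>"] assms(1)[of \<xi>] assms(1)[of \<zeta>] assms(2)[of \<xi> \<zeta>]
  by (simp add: bil_add_left bil_add_right)

section \<open>Weighted functions in the form domain\<close>

context drift_form
begin

text \<open>Supplies approximants for the test function of the energy estimate. For a difference d
  of approximants, a(grad (W d), grad (W d)) \<le> 2 (a(grad d, grad d) + |k| d^2), so the Cauchy
  properties in the form and in L2 together give that of the products.\<close>

lemma form_approx_weight:
  assumes u: "form_approx \<mu> Q f u" and \<zeta>: "test_fun \<zeta>" and W: "smooth_fun W" "\<And>x. \<bar>W x\<bar> \<le> 1"
    and k: "AE x in \<mu>. a x (grad W x) (grad W x) \<le> k"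
  shows "form_approx \<mu> Q (\<lambda>x. W x * (f x - \<zeta> x)) (\<lambda>n x. W x * (u n x - \<zeta> x))"
proof -
  have fL: "L2 \<mu> f" and ut: "\<And>n. test_fun (u n)" and lim: "(\<lambda>n. L2_norm \<mu> (\<lambda>x. u n x - f x)) \<longlonglongrightarrow> 0"
    using u by (auto simp: form_approx_def)
  have uL: "L2 \<mu> (u n)" for n by (rule test_fun_L2[OF lf ut])
  have \<zeta>L: "L2 \<mu> \<zeta>" by (rule test_fun_L2[OF lf \<zeta>])
  have Wm: "W \<in> borel_measurable \<mu>" using smooth_fun_borel[OF W(1)] \<mu>_measurable_iff by blast
  have L: "L2 \<mu> (\<lambda>x. W x * (f x - \<zeta> x))"
    by (rule L2_mult_bounded[OF L2_diff[OF fL \<zeta>L] Wm W(2)])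
  have t: "test_fun (\<lambda>x. W x * (u n x - \<zeta> x))" for n
    by (intro test_fun_mult_smooth(2) test_fun_diff ut \<zeta> W)
  have "(\<lambda>n. L2_norm \<mu> (\<lambda>x. W x * (u n x - \<zeta> x) - W x * (f x - \<zeta> x))) \<longlonglongrightarrow> 0"
  proof (rule tendsto_sandwich[OF _ _ tendsto_const])
    show "(\<lambda>n. 1 * L2_norm \<mu> (\<lambda>x. u n x - f x)) \<longlonglongrightarrow> 0" using lim by simp
    show "\<forall>\<^sub>F n in sequentially. L2_norm \<mu> (\<lambda>x. W x * (u n x - \<zeta> x) - W x * (f x - \<zeta> x)) \<le> 1 * L2_norm \<mu> (\<lambda>x. u n x - f x)"
    proof (intro always_eventually allI L2_norm_mono AE_I2)
      fix n x
      show "L2 \<mu> (\<lambda>x. u n x - f x)" by (rule L2_diff[OF uL fL])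
      show "(\<lambda>x. W x * (u n x - \<zeta> x) - W x * (f x - \<zeta> x)) \<in> borel_measurable \<mu>"
        by (rule L2_measurable[OF L2_diff[OF test_fun_L2[OF lf t] L]])
      have "\<bar>W x\<bar> * \<bar>u n x - f x\<bar> \<le> 1 * \<bar>u n x - f x\<bar>" by (intro mult_right_mono W) auto
      then show "norm (W x * (u n x - \<zeta> x) - W x * (f x - \<zeta> x)) \<le> 1 * norm (u n x - f x)"
        by (simp add: abs_mult flip: right_diff_distrib)
    qed simp
  qed (simp add: L2_norm_nonneg)
  moreover have "\<exists>N. \<forall>m\<ge>N. \<forall>n\<ge>N. Q (\<lambda>x. W x * (u m x - \<zeta> x) - W x * (u n x - \<zeta> x))
      (\<lambda>x. W x * (u m x - \<zeta> x) - W x * (u n x - \<zeta> x)) < e" if e: "0 < e" for e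
  proof -
    \<comment> \<open>Two approximants within \<delta> of f differ by at most 2 \<delta>, and 2 |k|
      (2 \<delta>)^2 \<le> e/2; the other half of e is left for the form.\<close>
    define \<delta> where "\<delta> = sqrt (e / (16 * (\<bar>k\<bar> + 1)))"
    have \<delta>: "0 < \<delta>" and \<delta>2: "\<delta>\<^sup>2 = e / (16 * (\<bar>k\<bar> + 1))" using e by (auto simp: \<delta>_def)
    have "0 < e / 4" using e by simp
    then obtain N where N: "\<And>m n. N \<le> m \<Longrightarrow> N \<le> n \<Longrightarrow> Q (\<lambda>x. u m x - u n x) (\<lambda>x. u m x - u n x) < e / 4"
      using form_approx_Cauchy[OF u] by blast
    obtain N' where N': "\<And>n. N' \<le> n \<Longrightarrow> L2_norm \<mu> (\<lambda>x. u n x - f x) < \<delta>"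
      using order_tendstoD(2)[OF lim \<delta>] by (auto simp: eventually_sequentially)
    have "Q (\<lambda>x. W x * (u m x - \<zeta> x) - W x * (u n x - \<zeta> x))
      (\<lambda>x. W x * (u m x - \<zeta> x) - W x * (u n x - \<zeta> x)) < e" if mn: "max N N' \<le> m" "max N N' \<le> n" for m n
    proof -
      define d where "d = (\<lambda>x. u m x - u n x)"
      have d: "test_fun d" unfolding d_def by (rule test_fun_diff[OF ut ut])
      have eq: "(\<lambda>x. W x * (u m x - \<zeta> x) - W x * (u n x - \<zeta> x)) = (\<lambda>x. W x * d x)"
        by (simp add: d_def right_diff_distrib)
      have td: "test_fun (\<lambda>x. W x * d x)" by (rule test_fun_mult_smooth(2)[OF d W(1)])
      have dL: "L2 \<mu> d" by (rule test_fun_L2[OF lf d])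
      have i1: "integrable \<mu> (\<lambda>x. a x (grad d x) (grad d x))" by (rule bil_integrable[OF sym_loc d d])
      have i2: "integrable \<mu> (\<lambda>x. (d x)\<^sup>2)" using dL by (simp add: L2_real_iff)
      have "Q (\<lambda>x. W x * d x) (\<lambda>x. W x * d x) \<le> (\<integral>x. 2 * (a x (grad d x) (grad d x) + \<bar>k\<bar> * (d x)\<^sup>2) \<partial>\<mu>)"
        unfolding form_diagonal[OF td]
      proof (rule integral_mono_AE)
        show "integrable \<mu> (\<lambda>x. a x (grad (\<lambda>x. W x * d x) x) (grad (\<lambda>x. W x * d x) x))"
          by (rule bil_integrable[OF sym_loc td td])
        show "integrable \<mu> (\<lambda>x. 2 * (a x (grad d x) (grad d x) + \<bar>k\<bar> * (d x)\<^sup>2))"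
          using i1 i2 by simp
        show "AE x in \<mu>. a x (grad (\<lambda>x. W x * d x) x) (grad (\<lambda>x. W x * d x) x)
            \<le> 2 * (a x (grad d x) (grad d x) + \<bar>k\<bar> * (d x)\<^sup>2)"
          using psd k
        proof eventually_elim
          case (elim x)
          have "(W x)\<^sup>2 \<le> 1" using W(2)[of x] by (simp add: abs_square_le_1)
          then have "(W x)\<^sup>2 * a x (grad d x) (grad d x) \<le> 1 * a x (grad d x) (grad d x)"
            using elim(1) by (intro mult_right_mono) auto
          moreover have "(d x)\<^sup>2 * a x (grad W x) (grad W x) \<le> (d x)\<^sup>2 * \<bar>k\<bar>"
            using elim(2) by (intro mult_left_mono) auto
          ultimately show ?case
            using psd_sum2[of "sym_part A x" "W x *\<^sub>R grad d x" "d x *\<^sub>R grad W x"] elim(1) bil_sym_part_commute[of A x]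
            by (simp add: grad_mult_smooth W test_fun_smooth d bil_scale_left bil_scale_right power2_eq_square mult_ac)
        qed
      qed
      also have "\<dots> = 2 * Q d d + 2 * \<bar>k\<bar> * (L2_norm \<mu> d)\<^sup>2"
        using i1 i2 by (simp add: form_diagonal[OF d] L2_norm_sq)
      also have "\<dots> < e"
      proof -
        have q: "Q d d < e / 4" using N[of m n] mn by (simp add: d_def)
        have "L2_norm \<mu> d \<le> L2_norm \<mu> (\<lambda>x. u m x - f x) + L2_norm \<mu> (\<lambda>x. f x - u n x)"
          unfolding d_def by (rule L2_norm_triangle_diff[OF uL fL uL])
        also have "\<dots> \<le> 2 * \<delta>"
          using N'[of m] N'[of n] mn L2_norm_minus_commute[of \<mu> f "u n"] by simp
        finally have "(L2_norm \<mu> d)\<^sup>2 \<le> (2 * \<delta>)\<^sup>2" by (intro power_mono L2_norm_nonneg)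
        moreover have "(2 * \<delta>)\<^sup>2 = e / (4 * (\<bar>k\<bar> + 1))" by (simp add: power_mult_distrib \<delta>2 divide_simps)
        ultimately have "(L2_norm \<mu> d)\<^sup>2 \<le> e / (4 * (\<bar>k\<bar> + 1))" by simp
        then have "2 * \<bar>k\<bar> * (L2_norm \<mu> d)\<^sup>2 \<le> 2 * \<bar>k\<bar> * (e / (4 * (\<bar>k\<bar> + 1)))" by (intro mult_left_mono) auto
        also have "\<dots> \<le> e / 2" using e by (simp add: field_simps)
        finally show ?thesis using q by linarith
      qed
      finally show ?thesis unfolding eq .
    qed
    then show ?thesis by blast
  qed
  ultimately show ?thesis using L t by (simp add: form_approx_def)
qed

end

text \<open>\<open>\<zeta>\<close> is a cutoff and \<open>exp (- 2 * c * \<theta>)\<close> the weight. The truncated weight exponent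
  \<open>\<theta>\<close> is locally constant wherever \<open>\<zeta>\<close> is not.\<close>

locale weight_cutoff = drift_form \<phi> D\<phi> A Da B
  for \<phi> :: "real^'n::finite \<Rightarrow> real" and D\<phi> A Da B +
  fixes \<theta> \<zeta> :: "real^'n \<Rightarrow> real" and \<kappa> c0 c1 \<theta>m k :: real
  assumes \<theta>_smooth: "smooth_fun \<theta>" and \<theta>_ge: "\<And>x. 1 \<le> \<theta> x" and \<theta>_le: "\<And>x. \<theta> x \<le> \<theta>m"
    and \<theta>_drift: "\<And>c. 0 \<le> c \<Longrightarrow> c \<le> c1 \<Longrightarrow>
        AE x in \<mu>. c\<^sup>2 * a x (grad \<theta> x) (grad \<theta> x) + c * (\<beta> x \<bullet> grad \<theta> x) \<le> \<kappa> * \<theta> x"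
    and \<theta>_energy: "AE x in \<mu>. a x (grad \<theta> x) (grad \<theta> x) \<le> k"
    and \<zeta>: "test_fun \<zeta>" and disj: "\<And>x. grad \<theta> x = 0 \<or> grad \<zeta> x = 0"
    and \<zeta>_drift: "L2 \<mu> (\<lambda>x. \<beta> x \<bullet> grad \<zeta> x)"
    and \<kappa>: "0 \<le> \<kappa>" and c0: "0 \<le> c0" and k: "0 \<le> k"
begin

text \<open>The speed of the weight exponent. The part \<kappa> pays for
  \<open>\<theta>_drift\<close>; the additional 1, by way of 1 \<le> \<theta>, pays for the square
  of v that Young's inequality leaves from <\<beta>, grad \<zeta>> v.\<close>

definition "K = \<kappa> + 1"

definition "W c x = exp (- (2 * c * \<theta> x))"

text \<open>Taken with the smallest exponent c0, hence with the largest weight, so that one constant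
  serves all times.\<close>

definition "err = (\<integral>x. W c0 x * (a x (grad \<zeta> x) (grad \<zeta> x) + (\<beta> x \<bullet> grad \<zeta> x)\<^sup>2) \<partial>\<mu>)"

lemma K_pos: "0 < K"
  using \<kappa> by (simp add: K_def)

lemma W_smooth: "smooth_fun (W c)"
  unfolding W_def[abs_def]
proof -
  have "smooth_fun (\<lambda>x. (- 2 * c) * \<theta> x)" by (intro smooth_fun_mult smooth_fun_const \<theta>_smooth)
  from smooth_fun_compose[OF smooth_real_exp this] show "smooth_fun (\<lambda>x. exp (- (2 * c * \<theta> x)))" by simp
qed

lemma W_grad: "grad (W c) x = (- 2 * c * W c x) *\<^sub>R grad \<theta> x"
proof -
  have "((\<lambda>y. exp (- (2 * c * y))) has_real_derivative - 2 * c * W c x) (at (\<theta> x))"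
    by (auto intro!: derivative_eq_intros simp: W_def)
  from grad_compose[OF smooth_fun_differentiable[OF \<theta>_smooth] this] show ?thesis
    by (simp add: W_def[abs_def])
qed

lemma W_pos: "0 < W c x" and W_le: "0 \<le> c \<Longrightarrow> W c x \<le> 1"
  using \<theta>_ge[of x] by (auto simp: W_def)

lemma W_mono: "c \<le> d \<Longrightarrow> W d x \<le> W c x"
  using \<theta>_ge[of x] by (auto simp: W_def intro!: mult_right_mono)

lemma W_measurable: "W c \<in> borel_measurable \<mu>"
  using smooth_fun_borel[OF W_smooth] \<mu>_measurable_iff by blast

lemma \<theta>_measurable: "\<theta> \<in> borel_measurable \<mu>"
  using smooth_fun_borel[OF \<theta>_smooth] \<mu>_measurable_iff by blast

lemma W_energy: 
  assumes "0 \<le> c"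
  shows "AE x in \<mu>. a x (grad (W c) x) (grad (W c) x) \<le> (2 * c)\<^sup>2 * k"
  using \<theta>_energy psd
proof eventually_elim
  case (elim x)
  have "W c x * W c x \<le> 1" using W_pos[of c x] W_le[OF assms, of x] by (intro mult_le_one) auto
  then have "(2 * c)\<^sup>2 * ((W c x * W c x) * a x (grad \<theta> x) (grad \<theta> x)) \<le> (2 * c)\<^sup>2 * (1 * k)"
    using elim by (intro mult_left_mono mult_mono) auto
  then show ?case
    unfolding W_grad bil_scale_left bil_scale_right by (simp add: power2_eq_square mult_ac)
qed

lemma err_integrable: "integrable \<mu> (\<lambda>x. W c x * (a x (grad \<zeta> x) (grad \<zeta> x) + (\<beta> x \<bullet> grad \<zeta> x)\<^sup>2))" if "0 \<le> c"
proof -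
  have "integrable \<mu> (\<lambda>x. a x (grad \<zeta> x) (grad \<zeta> x) * W c x)"
    by (rule bil_weight_integrable[OF sym_loc \<zeta> \<zeta> W_smooth])
  moreover have "integrable \<mu> (\<lambda>x. W c x * (\<beta> x \<bullet> grad \<zeta> x) * (\<beta> x \<bullet> grad \<zeta> x))"
    by (rule L2_integrable_mult[OF L2_mult_bounded[OF \<zeta>_drift W_measurable] \<zeta>_drift])
       (use W_pos W_le[OF that] in \<open>auto simp: abs_of_pos\<close>)
  ultimately show ?thesis by (simp add: distrib_left power2_eq_square mult_ac)
qed

text \<open>Completing the square turns the diffusion part into a(q, q) minus W v^2 c^2 a(grad
  \<theta>, grad \<theta>). The drift part is half of <\<beta>, grad (W v^2)> plus c W v^2 <\<beta>,
  grad \<theta>>, up to the cutoff term. The two \<theta>-terms combine into the left-hand side of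
  \<open>\<theta>_drift\<close>, and a(q, q) absorbs the pairing of grad \<zeta> with grad
  v.\<close>

lemma weighted_form_lower_bound:
  assumes v: "test_fun v" and c: "c0 \<le> c" "c \<le> c1"
  shows "- K * (\<integral>x. \<theta> x * W c x * (v x)\<^sup>2 \<partial>\<mu>) - err \<le> Q (\<lambda>x. v x + \<zeta> x) (\<lambda>x. W c x * v x)"
proof -
  have c_nonneg: "0 \<le> c" using c c0 by simp
  have sv: "smooth_fun v" and s\<zeta>: "smooth_fun \<zeta>" by (simp_all add: test_fun_smooth v \<zeta>)
  have tw: "test_fun (\<lambda>x. W c x * v x)" by (rule test_fun_mult_smooth(2)[OF v W_smooth])
  have tv: "test_fun (\<lambda>x. v x + \<zeta> x)" by (rule test_fun_add[OF v \<zeta>])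
  have tvv: "test_fun (\<lambda>x. (W c x * v x) * v x)" by (rule test_fun_mult[OF tw v])
  have i1: "integrable \<mu> (\<lambda>x. a x (grad (\<lambda>x. v x + \<zeta> x) x) (grad (\<lambda>x. W c x * v x) x))"
    by (rule bil_integrable[OF sym_loc tv tw])
  have i2: "integrable \<mu> (\<lambda>x. (\<beta> x \<bullet> grad (\<lambda>x. v x + \<zeta> x) x) * (W c x * v x))"
    by (rule drift_integrable(2)[OF \<beta>_loc tv test_fun_smooth[OF tw]])
  have i3: "integrable \<mu> (\<lambda>x. \<beta> x \<bullet> grad (\<lambda>x. (W c x * v x) * v x) x)"
    by (rule drift_integrable(1)[OF \<beta>_loc tvv])
  have i4: "integrable \<mu> (\<lambda>x. \<theta> x * W c x * (v x)\<^sup>2)"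
  proof -
    have "test_fun (\<lambda>x. \<theta> x * ((W c x * v x) * v x))" by (rule test_fun_mult_smooth(2)[OF tvv \<theta>_smooth])
    from bounded_support_integrable[OF lf test_fun_bounded_support_fun[OF this]]
    show ?thesis by (simp add: power2_eq_square mult_ac)
  qed
  have i5: "integrable \<mu> (\<lambda>x. W c0 x * (a x (grad \<zeta> x) (grad \<zeta> x) + (\<beta> x \<bullet> grad \<zeta> x)\<^sup>2))"
    by (rule err_integrable[OF c0])
  \<comment> \<open>The term with grad (W v^2) has no sign. It is carried through the pointwise
    inequality and vanishes only after integration, by \<open>\<beta>_div\<close>.\<close>
  have "(\<integral>x. - (1 / 2) * (\<beta> x \<bullet> grad (\<lambda>x. (W c x * v x) * v x) x) - K * (\<theta> x * W c x * (v x)\<^sup>2)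
      - W c0 x * (a x (grad \<zeta> x) (grad \<zeta> x) + (\<beta> x \<bullet> grad \<zeta> x)\<^sup>2) \<partial>\<mu>)
    \<le> (\<integral>x. a x (grad (\<lambda>x. v x + \<zeta> x) x) (grad (\<lambda>x. W c x * v x) x)
      - (\<beta> x \<bullet> grad (\<lambda>x. v x + \<zeta> x) x) * (W c x * v x) \<partial>\<mu>)"
  proof (rule integral_mono_AE)
    show "integrable \<mu> (\<lambda>x. - (1 / 2) * (\<beta> x \<bullet> grad (\<lambda>x. (W c x * v x) * v x) x) - K * (\<theta> x * W c x * (v x)\<^sup>2)
      - W c0 x * (a x (grad \<zeta> x) (grad \<zeta> x) + (\<beta> x \<bullet> grad \<zeta> x)\<^sup>2))"
      by (intro Bochner_Integration.integrable_diff integrable_mult_right i3 i4 i5)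
    show "integrable \<mu> (\<lambda>x. a x (grad (\<lambda>x. v x + \<zeta> x) x) (grad (\<lambda>x. W c x * v x) x)
      - (\<beta> x \<bullet> grad (\<lambda>x. v x + \<zeta> x) x) * (W c x * v x))"
      by (intro Bochner_Integration.integrable_diff i1 i2)
    show "AE x in \<mu>. - (1 / 2) * (\<beta> x \<bullet> grad (\<lambda>x. (W c x * v x) * v x) x) - K * (\<theta> x * W c x * (v x)\<^sup>2)
      - W c0 x * (a x (grad \<zeta> x) (grad \<zeta> x) + (\<beta> x \<bullet> grad \<zeta> x)\<^sup>2)
      \<le> a x (grad (\<lambda>x. v x + \<zeta> x) x) (grad (\<lambda>x. W c x * v x) x)
      - (\<beta> x \<bullet> grad (\<lambda>x. v x + \<zeta> x) x) * (W c x * v x)"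
      using psd \<theta>_drift[OF c_nonneg c(2)]
    proof eventually_elim
      case (elim x)
      define g p z where "g = grad v x" and "p = grad \<theta> x" and "z = grad \<zeta> x"
      define w y where "w = W c x" and "y = v x"
      define \<eta> where "\<eta> = sqrt w"
      have w: "0 < w" by (simp add: w_def W_pos)
      have \<eta>: "\<eta> * \<eta> = w" using w by (simp add: \<eta>_def)
      \<comment> \<open>With \<eta> the square root of the weight this is exp (-c \<theta>) (grad v
        - c v grad \<theta>), the gradient of exp (-c \<theta>) v.\<close>
      define q where "q = \<eta> *\<^sub>R (g - (c * y) *\<^sub>R p)"
      have gW: "grad (\<lambda>x. W c x * v x) x = w *\<^sub>R g - (2 * c * w * y) *\<^sub>R p"
        by (simp add: grad_mult_smooth W_smooth sv W_grad g_def p_def w_def y_def mult_ac)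
      have gvv: "grad (\<lambda>x. (W c x * v x) * v x) x = (2 * w * y) *\<^sub>R g - (2 * c * w * y\<^sup>2) *\<^sub>R p"
        unfolding grad_mult_smooth[OF smooth_fun_mult[OF W_smooth sv] sv] gW
        by (simp add: vec_eq_iff algebra_simps power2_eq_square flip: g_def w_def y_def)
      have gv: "grad (\<lambda>x. v x + \<zeta> x) x = g + z"
        by (simp add: grad_add smooth_fun_differentiable sv s\<zeta> g_def z_def)
      have sym: "a x \<xi> \<eta>' = a x \<eta>' \<xi>" for \<xi> \<eta>' by (rule bil_sym_part_commute)
      \<comment> \<open>Disjoint gradients: hence pairing grad \<zeta> with q gives only its pairing
        with grad v.\<close>
      have zp: "a x z p = 0" "a x p z = 0"
        using disj[of x] by (auto simp: z_def p_def bil_zero_left bil_zero_right)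
      have qq: "a x q q = w * (a x g g - 2 * (c * y) * a x g p + (c * y)\<^sup>2 * a x p p)"
        unfolding \<eta>[symmetric] q_def
        by (simp add: bil_scale_left bil_scale_right bil_diff_left bil_diff_right sym[of p g]
            power2_eq_square algebra_simps)
      have zq: "a x (\<eta> *\<^sub>R z) q = w * a x z g"
        unfolding \<eta>[symmetric] q_def
        by (simp add: bil_scale_left bil_scale_right bil_diff_left bil_diff_right zp mult.assoc)
      have zz: "a x (\<eta> *\<^sub>R z) (\<eta> *\<^sub>R z) = w * a x z z"
        unfolding \<eta>[symmetric] by (simp add: bil_scale_left bil_scale_right mult.assoc)
      have young: "- a x q q - w * a x z z \<le> w * a x z g"
        using psd_young[of "sym_part A x" q "\<eta> *\<^sub>R z"] elim(1) sym unfolding zq zz by blast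
      have A_part: "a x (g + z) (w *\<^sub>R g - (2 * c * w * y) *\<^sub>R p)
          = a x q q - w * y\<^sup>2 * (c\<^sup>2 * a x p p) + w * a x z g"
        unfolding qq
        by (simp add: bil_add_left bil_diff_right bil_scale_right zp power2_eq_square algebra_simps)
      have d2: "w * (\<beta> x \<bullet> z) * y \<le> w * ((\<beta> x \<bullet> z)\<^sup>2 / 2 + y\<^sup>2 / 2)"
      proof -
        have "(\<beta> x \<bullet> z) * y \<le> (\<beta> x \<bullet> z)\<^sup>2 / 2 + y\<^sup>2 / 2"
          using zero_le_power2[of "(\<beta> x \<bullet> z) - y"] by (simp add: power2_eq_square algebra_simps)
        then show ?thesis using w by (simp add: mult.assoc mult_left_mono)
      qed
      have d3: "w * y\<^sup>2 * (c\<^sup>2 * a x p p + c * (\<beta> x \<bullet> p)) \<le> w * y\<^sup>2 * (\<kappa> * \<theta> x)"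
        using elim(2) w by (intro mult_left_mono) (auto simp: p_def)
      have d4: "w * y\<^sup>2 * (1 / 2) \<le> w * y\<^sup>2 * \<theta> x"
        using \<theta>_ge[of x] w by (intro mult_left_mono) auto
      have "0 \<le> a x z z" "0 \<le> (\<beta> x \<bullet> z)\<^sup>2" using elim(1) by auto
      then have d5: "w * (a x z z + (\<beta> x \<bullet> z)\<^sup>2) \<le> W c0 x * (a x z z + (\<beta> x \<bullet> z)\<^sup>2)"
        using W_mono[OF c(1), of x] by (intro mult_right_mono) (auto simp: w_def)
      have d6: "0 \<le> w * (\<beta> x \<bullet> z)\<^sup>2" using w by simp
      have B_part: "(\<beta> x \<bullet> (g + z)) * (w * y)
          = 1 / 2 * (\<beta> x \<bullet> ((2 * w * y) *\<^sub>R g - (2 * c * w * y\<^sup>2) *\<^sub>R p)) + w * y\<^sup>2 * (c * (\<beta> x \<bullet> p)) + w * (\<beta> x \<bullet> z) * y"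
        by (simp add: inner_add_right inner_diff_right power2_eq_square algebra_simps)
      have e1: "w * ((\<beta> x \<bullet> z)\<^sup>2 / 2 + y\<^sup>2 / 2) = w * (\<beta> x \<bullet> z)\<^sup>2 / 2 + w * y\<^sup>2 * (1 / 2)"
        and e2: "w * y\<^sup>2 * (c\<^sup>2 * a x p p + c * (\<beta> x \<bullet> p)) = w * y\<^sup>2 * (c\<^sup>2 * a x p p) + w * y\<^sup>2 * (c * (\<beta> x \<bullet> p))"
        and e3: "w * (a x z z + (\<beta> x \<bullet> z)\<^sup>2) = w * a x z z + w * (\<beta> x \<bullet> z)\<^sup>2"
        and e4: "K * (\<theta> x * w * y\<^sup>2) = w * y\<^sup>2 * (\<kappa> * \<theta> x) + w * y\<^sup>2 * \<theta> x"
        by (simp_all add: algebra_simps K_def)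
      show ?case
        unfolding gW gvv gv A_part B_part
          w_def[symmetric] y_def[symmetric] z_def[symmetric] e4
        using young d2 d3 d4 d5 d6 unfolding e1 e2 e3 by linarith
    qed
  qed
  moreover have "(\<integral>x. - (1 / 2) * (\<beta> x \<bullet> grad (\<lambda>x. (W c x * v x) * v x) x) - K * (\<theta> x * W c x * (v x)\<^sup>2)
      - W c0 x * (a x (grad \<zeta> x) (grad \<zeta> x) + (\<beta> x \<bullet> grad \<zeta> x)\<^sup>2) \<partial>\<mu>)
      = - K * (\<integral>x. \<theta> x * W c x * (v x)\<^sup>2 \<partial>\<mu>) - err"
  proof -
    have j1: "integrable \<mu> (\<lambda>x. - (1 / 2) * (\<beta> x \<bullet> grad (\<lambda>x. (W c x * v x) * v x) x))"
      and j2: "integrable \<mu> (\<lambda>x. K * (\<theta> x * W c x * (v x)\<^sup>2))"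
      by (intro integrable_mult_right i3 i4)+
    have "(\<integral>x. - (1 / 2) * (\<beta> x \<bullet> grad (\<lambda>x. (W c x * v x) * v x) x) \<partial>\<mu>) = 0"
      using \<beta>_div[OF tvv] by (subst integral_mult_right_zero) simp
    moreover have "(\<integral>x. K * (\<theta> x * W c x * (v x)\<^sup>2) \<partial>\<mu>) = K * (\<integral>x. \<theta> x * W c x * (v x)\<^sup>2 \<partial>\<mu>)"
      by (rule integral_mult_right_zero)
    ultimately show ?thesis
      unfolding err_def Bochner_Integration.integral_diff[OF Bochner_Integration.integrable_diff[OF j1 j2] i5]
        Bochner_Integration.integral_diff[OF j1 j2] by simp
  qed
  moreover have "Q (\<lambda>x. v x + \<zeta> x) (\<lambda>x. W c x * v x)
     = (\<integral>x. a x (grad (\<lambda>x. v x + \<zeta> x) x) (grad (\<lambda>x. W c x * v x) x)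
      - (\<beta> x \<bullet> grad (\<lambda>x. v x + \<zeta> x) x) * (W c x * v x) \<partial>\<mu>)"
    unfolding form_eq[OF tv tw] using i1 i2 by simp
  ultimately show ?thesis by linarith
qed

end

section \<open>Evolution of the weighted energy\<close>

locale weighted_orbit = weight_cutoff \<phi> D\<phi> A Da B \<theta> \<zeta> \<kappa> c0 c1 \<theta>m k + form_orbit \<phi> D\<phi> A Da B T l \<zeta> U
  for \<phi> :: "real^'n::finite \<Rightarrow> real" and D\<phi> A Da B \<theta> \<zeta> \<kappa> c0 c1 \<theta>m k T l U
begin

definition "ct t = c0 + K * t"

lemma ct_ge: "0 \<le> t \<Longrightarrow> c0 \<le> ct t" and ct_nonneg: "0 \<le> t \<Longrightarrow> 0 \<le> ct t"
  using K_pos c0 by (auto simp: ct_def)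

definition "dev t x = V t x - \<zeta> x"

definition "F t = (\<integral>x. (W (ct t) x * dev t x) * dev t x \<partial>\<mu>)"

text \<open>Up to the factor -2 K, the part of the derivative of \<open>F\<close> that comes from
  the moving exponent. It is matched to the \<theta>-integral in
  \<open>weighted_form_lower_bound\<close>.\<close>

definition "decay t = (\<integral>x. (\<theta> x * (W (ct t) x * dev t x)) * dev t x \<partial>\<mu>)"

lemma dev_L2: "0 \<le> t \<Longrightarrow> L2 \<mu> (dev t)"
  unfolding dev_def by (intro L2_diff V_L2 f)

lemma Wdev_L2:
  assumes "0 \<le> t" "0 \<le> s"
  shows "L2 \<mu> (\<lambda>x. W (ct s) x * dev t x)"
  using W_pos[of "ct s"] W_le[OF ct_nonneg[OF assms(2)]]
  by (intro L2_mult_bounded[OF dev_L2[OF assms(1)] W_measurable, of _ 1]) (auto simp: abs_of_pos)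

lemma \<theta>Wdev_L2:
  assumes "0 \<le> t"
  shows "L2 \<mu> (\<lambda>x. \<theta> x * (W (ct t) x * dev t x))"
proof (rule L2_mult_bounded[OF Wdev_L2[OF assms assms] \<theta>_measurable])
  show "\<bar>\<theta> x\<bar> \<le> \<theta>m" for x using \<theta>_ge[of x] \<theta>_le[of x] by simp
qed

text \<open>Both the orbit and the weight move with time. The orbit is Lipschitz in L2 and the
  weight, as an exponential of a bounded exponent, has a quadratic Taylor remainder uniformly in x;
  q collects the two first-order terms.\<close>

lemma F_taylor:
  assumes s: "0 \<le> s" and t: "0 \<le> t"
  defines "q \<equiv> \<lambda>r. 2 * L2_inner \<mu> (V r) (\<lambda>x. W (ct t) x * dev t x) - r * (2 * K * decay t)"
  shows "\<bar>F s - F t - (q s - q t)\<bar> \<le> (2 * (2 * K * \<theta>m)\<^sup>2 * (L2_norm \<mu> (dev t))\<^sup>2 + 2 * Pmax\<^sup>2) * (s - t)\<^sup>2"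
proof -
  define D where "D = (\<lambda>x. V s x - V t x)"
  have DL: "L2 \<mu> D" unfolding D_def by (rule L2_diff[OF V_L2[OF s] V_L2[OF t]])
  define E where "E = (\<lambda>x. (W (ct s) x * dev s x) * dev s x - (W (ct t) x * dev t x) * dev t x
      - 2 * (D x * (W (ct t) x * dev t x)) + (s - t) * 2 * K * ((\<theta> x * (W (ct t) x * dev t x)) * dev t x))"
  define G where "G = (\<lambda>x. 2 * (2 * K * \<theta>m)\<^sup>2 * (s - t)\<^sup>2 * (dev t x)\<^sup>2 + 2 * (D x)\<^sup>2)"
  note i1 = L2_integrable_mult[OF Wdev_L2[OF s s] dev_L2[OF s]]
  note i2 = L2_integrable_mult[OF Wdev_L2[OF t t] dev_L2[OF t]]
  note i3 = L2_integrable_mult[OF DL Wdev_L2[OF t t]]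
  note i4 = L2_integrable_mult[OF \<theta>Wdev_L2[OF t] dev_L2[OF t]]
  have Ei: "integrable \<mu> E" unfolding E_def
    by (intro Bochner_Integration.integrable_add Bochner_Integration.integrable_diff integrable_mult_right i1 i2 i3 i4)
  have Gi: "integrable \<mu> G" unfolding G_def
    using dev_L2[OF t] DL by (intro Bochner_Integration.integrable_add integrable_mult_right) (auto simp: L2_real_iff)
  have "q s - q t = 2 * L2_inner \<mu> D (\<lambda>x. W (ct t) x * dev t x) - (s - t) * 2 * K * decay t"
    unfolding q_def D_def L2_inner_diff_left[OF V_L2[OF s] V_L2[OF t] Wdev_L2[OF t t]] by (simp add: algebra_simps)
  then have "F s - F t - (q s - q t) = integral\<^sup>L \<mu> E"
    unfolding E_def F_def decay_def L2_inner_def using i1 i2 i3 i4 by simp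
  moreover have "\<bar>integral\<^sup>L \<mu> E\<bar> \<le> integral\<^sup>L \<mu> G"
  proof (rule order_trans[OF integral_abs_bound integral_mono[OF integrable_abs[OF Ei] Gi]])
    fix x
    define w w0 v b where "w = W (ct s) x" and "w0 = W (ct t) x" and "v = dev t x"
      and "b = 2 * K * \<theta>m * \<bar>s - t\<bar>"
    have ds: "dev s x = v + D x" by (simp add: v_def D_def dev_def)
    have y: "2 * ct s * \<theta> x - 2 * ct t * \<theta> x = 2 * K * \<theta> x * (s - t)" by (simp add: ct_def algebra_simps)
    have \<theta>0: "0 \<le> \<theta> x" using \<theta>_ge[of x] by simp
    have nn: "0 \<le> 2 * ct t * \<theta> x" "0 \<le> 2 * ct s * \<theta> x" using ct_nonneg s t \<theta>0 by auto
    have yb: "\<bar>2 * K * \<theta> x * (s - t)\<bar> \<le> b"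
      unfolding b_def using K_pos \<theta>0 \<theta>_le[of x] by (auto simp: abs_mult intro!: mult_right_mono)
    have t1: "\<bar>w - w0\<bar> \<le> b"
      using exp_neg_taylor(1)[OF nn] yb unfolding y by (simp add: w_def w0_def W_def)
    have t2: "\<bar>w - w0 + w0 * (2 * K * \<theta> x * (s - t))\<bar> \<le> b\<^sup>2"
    proof -
      have "(2 * K * \<theta> x * (s - t))\<^sup>2 \<le> b\<^sup>2" using power_mono[OF yb, of 2] by simp
      then show ?thesis using exp_neg_taylor(2)[OF nn] unfolding y by (simp add: w_def w0_def W_def)
    qed
    \<comment> \<open>After substituting dev s = dev t + D, the three summands are the second-order
      error of the weight, the product of the two increments, and the square of the orbit
      increment.\<close>
    have "E x = (w - w0 + w0 * (2 * K * \<theta> x * (s - t))) * v\<^sup>2 + 2 * ((w - w0) * v * D x) + w * (D x)\<^sup>2"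
      unfolding E_def ds w_def[symmetric] w0_def[symmetric] v_def[symmetric]
      by (simp add: power2_eq_square algebra_simps)
    moreover have "\<bar>(w - w0 + w0 * (2 * K * \<theta> x * (s - t))) * v\<^sup>2\<bar> \<le> b\<^sup>2 * v\<^sup>2"
      unfolding abs_mult using t2 by (intro mult_mono) auto
    moreover have "\<bar>2 * ((w - w0) * v * D x)\<bar> \<le> b\<^sup>2 * v\<^sup>2 + (D x)\<^sup>2"
    proof -
      have "\<bar>(w - w0) * v * D x\<bar> \<le> b * \<bar>v\<bar> * \<bar>D x\<bar>"
        unfolding abs_mult using t1 by (intro mult_right_mono) auto
      moreover have "2 * (b * \<bar>v\<bar> * \<bar>D x\<bar>) \<le> (b * \<bar>v\<bar>)\<^sup>2 + \<bar>D x\<bar>\<^sup>2"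
        using sum_squares_bound[of "b * \<bar>v\<bar>" "\<bar>D x\<bar>"] by (simp add: mult.assoc)
      ultimately show ?thesis by (simp add: power_mult_distrib)
    qed
    moreover have "\<bar>w * (D x)\<^sup>2\<bar> \<le> (D x)\<^sup>2"
      using W_pos[of "ct s" x] W_le[OF ct_nonneg[OF s], of x]
      by (simp add: w_def abs_mult mult_left_le_one_le)
    ultimately have "\<bar>E x\<bar> \<le> 2 * (b\<^sup>2 * v\<^sup>2) + 2 * (D x)\<^sup>2" by linarith
    also have "b\<^sup>2 = (2 * K * \<theta>m)\<^sup>2 * (s - t)\<^sup>2" by (simp add: b_def power_mult_distrib)
    finally show "\<bar>E x\<bar> \<le> G x" by (simp add: G_def v_def)
  qed
  moreover have "integral\<^sup>L \<mu> G = 2 * (2 * K * \<theta>m)\<^sup>2 * (s - t)\<^sup>2 * (L2_norm \<mu> (dev t))\<^sup>2 + 2 * (L2_norm \<mu> D)\<^sup>2"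
    unfolding G_def L2_norm_sq using dev_L2[OF t] DL by (simp add: L2_real_iff)
  moreover have "(L2_norm \<mu> D)\<^sup>2 \<le> (Pmax * \<bar>s - t\<bar>)\<^sup>2"
    unfolding D_def by (intro power_mono V_lipschitz t s L2_norm_nonneg)
  ultimately show ?thesis by (simp add: power_mult_distrib algebra_simps)
qed

lemma F_deriv:
  assumes t: "0 < t"
  shows "(F has_real_derivative 2 * L2_inner \<mu> (P t) (\<lambda>x. W (ct t) x * dev t x) - 2 * K * decay t) (at t)"
proof -
  have t0: "0 \<le> t" using t by simp
  define q where "q = (\<lambda>r. 2 * L2_inner \<mu> (V r) (\<lambda>x. W (ct t) x * dev t x) - r * (2 * K * decay t))"
  have "(q has_real_derivative 2 * L2_inner \<mu> (P t) (\<lambda>x. W (ct t) x * dev t x) - 1 * (2 * K * decay t)) (at t)"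
    unfolding q_def
    by (intro DERIV_diff DERIV_cmult V_inner_deriv(2)[OF Wdev_L2[OF t0 t0] t] DERIV_cmult_right DERIV_ident)
  then have "(q has_real_derivative 2 * L2_inner \<mu> (P t) (\<lambda>x. W (ct t) x * dev t x) - 2 * K * decay t) (at t)" by simp
  then show ?thesis
  proof (rule DERIV_quadratic_close[of q _ t "{0<..}"])
    fix s :: real assume "s \<in> {0<..}"
    then show "\<bar>F s - F t - (q s - q t)\<bar> \<le> (2 * (2 * K * \<theta>m)\<^sup>2 * (L2_norm \<mu> (dev t))\<^sup>2 + 2 * Pmax\<^sup>2) * (s - t)\<^sup>2"
      unfolding q_def by (intro F_taylor t0) simp
  qed (use t in auto)
qed

lemma F_continuous: "continuous_on {0..b} F"
  unfolding continuous_on_def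
proof
  fix t assume "t \<in> {0..b}"
  then have t: "0 \<le> t" "t \<in> {0..}" by auto
  define q where "q = (\<lambda>r. 2 * L2_inner \<mu> (V r) (\<lambda>x. W (ct t) x * dev t x) - r * (2 * K * decay t))"
  define C where "C = 2 * (2 * K * \<theta>m)\<^sup>2 * (L2_norm \<mu> (dev t))\<^sup>2 + 2 * Pmax\<^sup>2"
  have "continuous_on {0..} q" unfolding q_def
    by (intro continuous_intros V_inner_deriv(1)[OF Wdev_L2[OF t(1) t(1)]])
  then have "(q \<longlongrightarrow> q t) (at t within {0..})" using t(2) by (simp add: continuous_on_def)
  then have q: "(q \<longlongrightarrow> q t) (at t within {0..b})" by (rule tendsto_within_subset) auto
  have "((\<lambda>s. F s - F t - (q s - q t)) \<longlongrightarrow> 0) (at t within {0..b})"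
  proof (rule Lim_null_comparison)
    show "\<forall>\<^sub>F s in at t within {0..b}. norm (F s - F t - (q s - q t)) \<le> C * (s - t)\<^sup>2"
      unfolding eventually_at_filter q_def C_def using F_taylor[OF _ t(1)] by (auto intro!: always_eventually)
    have "((\<lambda>s. C * (s - t)\<^sup>2) \<longlongrightarrow> C * (t - t)\<^sup>2) (at t within {0..b})" by (intro tendsto_intros)
    then show "((\<lambda>s. C * (s - t)\<^sup>2) \<longlongrightarrow> 0) (at t within {0..b})" by simp
  qed
  from tendsto_add[OF this tendsto_diff[OF q tendsto_const[of "q t"]]]
  show "(F \<longlongrightarrow> F t) (at t within {0..b})" by (simp add: LIM_zero_iff)
qed

text \<open>Apply the lower bound to v_n - \<zeta> for approximants v_n of \<open>V t\<close> and
  pass to the limit: the form converges by the evolution equation, the \<theta>-integral because its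
  factors are bounded. The two \<open>decay\<close> terms then cancel.\<close>

lemma F_deriv_le:
  assumes t: "0 \<le> t" and c: "ct t \<le> c1"
  shows "2 * L2_inner \<mu> (P t) (\<lambda>x. W (ct t) x * dev t x) - 2 * K * decay t \<le> 2 * err"
proof -
  obtain v where v: "form_approx \<mu> Q (V t) v" using V_form_approx[OF t] .
  have vt: "\<And>n. test_fun (v n)" and lim: "(\<lambda>n. L2_norm \<mu> (\<lambda>x. v n x - V t x)) \<longlonglongrightarrow> 0"
    using v by (auto simp: form_approx_def)
  have cn: "0 \<le> ct t" by (rule ct_nonneg[OF t])
  have W1: "\<bar>W (ct t) x\<bar> \<le> 1" for x using W_pos[of "ct t" x] W_le[OF cn, of x] by simp
  have w: "form_approx \<mu> Q (\<lambda>x. W (ct t) x * dev t x) (\<lambda>n x. W (ct t) x * (v n x - \<zeta> x))"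
    unfolding dev_def by (rule form_approx_weight[OF v \<zeta> W_smooth W1 W_energy[OF cn]])
  have wt: "test_fun (\<lambda>x. W (ct t) x * (v n x - \<zeta> x))" and vd: "test_fun (\<lambda>x. v n x - \<zeta> x)" for n
    by (intro test_fun_mult_smooth(2) test_fun_diff vt \<zeta> W_smooth)+
  have L1: "(\<lambda>n. Q (v n) (\<lambda>x. W (ct t) x * (v n x - \<zeta> x))) \<longlonglongrightarrow> - L2_inner \<mu> (P t) (\<lambda>x. W (ct t) x * dev t x)"
    by (rule V_form_limit[OF t v w])
  have dl: "(\<lambda>n. L2_norm \<mu> (\<lambda>x. (v n x - \<zeta> x) - dev t x)) \<longlonglongrightarrow> 0" using lim by (simp add: dev_def)
  have \<theta>1: "\<bar>\<theta> x\<bar> \<le> \<theta>m" for x using \<theta>_ge[of x] \<theta>_le[of x] by simp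
  have vdL: "L2 \<mu> (\<lambda>x. v n x - \<zeta> x)" and wL: "L2 \<mu> (\<lambda>x. W (ct t) x * (v n x - \<zeta> x))" for n
    by (rule test_fun_L2[OF lf vd], rule test_fun_L2[OF lf wt])
  have \<theta>wL: "L2 \<mu> (\<lambda>x. \<theta> x * (W (ct t) x * (v n x - \<zeta> x)))" for n
    by (rule L2_mult_bounded[OF wL \<theta>_measurable \<theta>1])
  have "(\<lambda>n. L2_inner \<mu> (\<lambda>x. \<theta> x * (W (ct t) x * (v n x - \<zeta> x))) (\<lambda>x. v n x - \<zeta> x))
      \<longlonglongrightarrow> L2_inner \<mu> (\<lambda>x. \<theta> x * (W (ct t) x * dev t x)) (dev t)"
  proof (rule L2_inner_tendsto[OF \<theta>wL vdL \<theta>Wdev_L2[OF t] dev_L2[OF t] _ dl])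
    show "(\<lambda>n. L2_norm \<mu> (\<lambda>x. \<theta> x * (W (ct t) x * (v n x - \<zeta> x)) - \<theta> x * (W (ct t) x * dev t x))) \<longlonglongrightarrow> 0"
    proof (rule tendsto_sandwich[OF _ _ tendsto_const])
      show "\<forall>\<^sub>F n in sequentially. L2_norm \<mu> (\<lambda>x. \<theta> x * (W (ct t) x * (v n x - \<zeta> x)) - \<theta> x * (W (ct t) x * dev t x))
          \<le> \<theta>m * L2_norm \<mu> (\<lambda>x. (v n x - \<zeta> x) - dev t x)"
      proof (intro always_eventually allI L2_norm_mono AE_I2)
        fix n x
        show "L2 \<mu> (\<lambda>x. (v n x - \<zeta> x) - dev t x)" by (rule L2_diff[OF vdL dev_L2[OF t]])
        show "(\<lambda>x. \<theta> x * (W (ct t) x * (v n x - \<zeta> x)) - \<theta> x * (W (ct t) x * dev t x)) \<in> borel_measurable \<mu>"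
          by (rule L2_measurable[OF L2_diff[OF \<theta>wL \<theta>Wdev_L2[OF t]]])
        have "\<bar>\<theta> x\<bar> * \<bar>W (ct t) x\<bar> * \<bar>(v n x - \<zeta> x) - dev t x\<bar> \<le> (\<theta>m * 1) * \<bar>(v n x - \<zeta> x) - dev t x\<bar>"
          using \<theta>1 W1 \<theta>_ge[of x] \<theta>_le[of x] by (intro mult_right_mono mult_mono) auto
        then show "norm (\<theta> x * (W (ct t) x * (v n x - \<zeta> x)) - \<theta> x * (W (ct t) x * dev t x)) \<le> \<theta>m * norm ((v n x - \<zeta> x) - dev t x)"
          by (simp add: abs_mult mult.assoc flip: right_diff_distrib)
        show "0 \<le> \<theta>m" using \<theta>_ge[of x] \<theta>_le[of x] by linarith
      qed
      show "(\<lambda>n. \<theta>m * L2_norm \<mu> (\<lambda>x. (v n x - \<zeta> x) - dev t x)) \<longlonglongrightarrow> 0"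
        using tendsto_mult_left[OF dl, of \<theta>m] by simp
    qed (simp add: L2_norm_nonneg)
  qed
  then have L2: "(\<lambda>n. - K * (\<integral>x. \<theta> x * W (ct t) x * (v n x - \<zeta> x)\<^sup>2 \<partial>\<mu>) - err) \<longlonglongrightarrow> - K * decay t - err"
    unfolding decay_def by (intro tendsto_intros) (simp add: L2_inner_def power2_eq_square mult_ac)
  have "- K * (\<integral>x. \<theta> x * W (ct t) x * (v n x - \<zeta> x)\<^sup>2 \<partial>\<mu>) - err \<le> Q (v n) (\<lambda>x. W (ct t) x * (v n x - \<zeta> x))" for n
    using weighted_form_lower_bound[OF vd ct_ge[OF t] c, of n] by simp
  then have "- K * decay t - err \<le> - L2_inner \<mu> (P t) (\<lambda>x. W (ct t) x * dev t x)"
    using LIMSEQ_le[OF L2 L1] by blast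
  then show ?thesis by simp
qed

lemma F_bound:
  assumes t: "0 \<le> t" and c: "ct t \<le> c1"
  shows "F t \<le> F 0 + 2 * err * t"
proof -
  have "\<exists>y. ((\<lambda>s. F s - 2 * err * s) has_real_derivative y) (at s) \<and> y \<le> 0" if s: "0 < s" "s < t" for s
  proof (intro exI conjI)
    have "((\<lambda>s. F s - 2 * err * s) has_real_derivative
        (2 * L2_inner \<mu> (P s) (\<lambda>x. W (ct s) x * dev s x) - 2 * K * decay s) - 2 * err * 1) (at s)"
      by (intro DERIV_diff F_deriv s DERIV_cmult DERIV_ident)
    then show "((\<lambda>s. F s - 2 * err * s) has_real_derivative
        (2 * L2_inner \<mu> (P s) (\<lambda>x. W (ct s) x * dev s x) - 2 * K * decay s) - 2 * err) (at s)" by simp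
    have "K * s \<le> K * t" using K_pos s by (intro mult_left_mono) auto
    then have "ct s \<le> c1" using c by (simp add: ct_def)
    then show "(2 * L2_inner \<mu> (P s) (\<lambda>x. W (ct s) x * dev s x) - 2 * K * decay s) - 2 * err \<le> 0"
      using F_deriv_le[of s] s by simp
  qed
  moreover have "continuous_on {0..t} (\<lambda>s. F s - 2 * err * s)" by (intro continuous_intros F_continuous)
  ultimately have "F t - 2 * err * t \<le> F 0 - 2 * err * 0"
    by (intro DERIV_nonpos_imp_decreasing_open[OF t]) blast+
  then show ?thesis by simp
qed

end

section \<open>Transfer of the estimate to the semigroup\<close>

context weight_cutoff
begin

text \<open>At finite l the orbit does not start at \<zeta>, so \<open>F_bound\<close> contains an
  initial deviation, which disappears as l tends to infinity. The weight at time t is then replaced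
  by the smaller one with exponent c1.\<close>

lemma semigroup_deviation_bound:
  assumes T: "semigroup_of_form \<mu> Q T" and t: "0 < t" and c: "c0 + K * t \<le> c1"
  shows "(\<integral>x. W c1 x * (T t \<zeta> x - \<zeta> x)\<^sup>2 \<partial>\<mu>) \<le> 2 * err * t"
proof -
  have \<zeta>L: "L2 \<mu> \<zeta>" by (rule test_fun_L2[OF lf \<zeta>])
  interpret S: l2_semigroup \<mu> T by unfold_locales (use T in \<open>simp add: semigroup_of_form_def\<close>)
  have "\<forall>n. \<exists>U. form_orbit \<phi> D\<phi> A Da B T (real (Suc n)) \<zeta> U"
    by (intro allI form_orbit_ex[OF T \<zeta>L]) simp
  from choice[OF this] obtain U where U: "\<And>n. form_orbit \<phi> D\<phi> A Da B T (real (Suc n)) \<zeta> (U n)" by blast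
  have orb: "weighted_orbit \<phi> D\<phi> A Da B \<theta> \<zeta> \<kappa> c0 c1 \<theta>m k T (real (Suc n)) (U n)" for n
    unfolding weighted_orbit_def using U weight_cutoff_axioms by blast
  define v where "v = (\<lambda>s n x. real (Suc n) * U n s x)"
  define w where "w = W (c0 + K * t)"
  have cn: "0 \<le> c0 + K * t" using c0 K_pos t by simp
  have c1n: "0 \<le> c1" using cn c by simp
  have wm: "w \<in> borel_measurable \<mu>" and w1: "\<bar>w x\<bar> \<le> 1" for x
    using W_measurable W_pos[of "c0 + K * t" x] W_le[OF cn, of x] by (auto simp: w_def)
  have res: "is_resolvent \<mu> T (real (Suc n)) (S.Tz s \<zeta>) (U n s)" if "0 \<le> s" for n s
  proof -
    interpret O: form_orbit \<phi> D\<phi> A Da B T "real (Suc n)" \<zeta> "U n" by (rule U)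
    show ?thesis by (rule O.U[OF that])
  qed
  have vL: "L2 \<mu> (v s n)" if "0 \<le> s" for n s
    using res[OF that, of n] unfolding v_def is_resolvent_def by (intro L2_cmult) blast
  have conv: "(\<lambda>n. L2_norm \<mu> (\<lambda>x. v s n x - S.Tz s \<zeta> x)) \<longlonglongrightarrow> 0" if "0 \<le> s" for s
    unfolding v_def by (rule S.resolvent_tendsto[OF S.Tz_L2[OF that \<zeta>L] res[OF that]])
  have bound: "(\<integral>x. (w x * (v t n x - \<zeta> x)) * (v t n x - \<zeta> x) \<partial>\<mu>) \<le> (L2_norm \<mu> (\<lambda>x. v 0 n x - \<zeta> x))\<^sup>2 + 2 * err * t" for n
  proof -
    interpret O: weighted_orbit \<phi> D\<phi> A Da B \<theta> \<zeta> \<kappa> c0 c1 \<theta>m k T "real (Suc n)" "U n" by (rule orb)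
    have d0: "L2 \<mu> (\<lambda>x. v 0 n x - \<zeta> x)" by (rule L2_diff[OF vL \<zeta>L]) simp
    have "O.F 0 \<le> (\<integral>x. (v 0 n x - \<zeta> x)\<^sup>2 \<partial>\<mu>)"
      unfolding O.F_def
    proof (rule integral_mono)
      show "integrable \<mu> (\<lambda>x. (W (O.ct 0) x * O.dev 0 x) * O.dev 0 x)"
        by (rule L2_integrable_mult[OF O.Wdev_L2 O.dev_L2]) auto
      show "integrable \<mu> (\<lambda>x. (v 0 n x - \<zeta> x)\<^sup>2)" using d0 by (simp add: L2_real_iff)
      fix x
      have "W (O.ct 0) x * (v 0 n x - \<zeta> x)\<^sup>2 \<le> 1 * (v 0 n x - \<zeta> x)\<^sup>2"
        using W_le[OF O.ct_nonneg[of 0], of x] by (intro mult_right_mono) auto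
      then show "(W (O.ct 0) x * O.dev 0 x) * O.dev 0 x \<le> (v 0 n x - \<zeta> x)\<^sup>2"
        unfolding O.dev_def O.V_def v_def by (simp add: power2_eq_square mult.assoc)
    qed
    moreover have "O.F t \<le> O.F 0 + 2 * err * t"
      by (rule O.F_bound) (use t c in \<open>auto simp: O.ct_def\<close>)
    moreover have "O.F t = (\<integral>x. (w x * (v t n x - \<zeta> x)) * (v t n x - \<zeta> x) \<partial>\<mu>)"
      unfolding O.F_def O.dev_def O.V_def O.ct_def w_def v_def ..
    ultimately show ?thesis by (simp add: L2_norm_sq)
  qed
  have TL: "L2 \<mu> (T t \<zeta>)" using S.Tz_L2[of t \<zeta>] t \<zeta>L by (simp add: S.Tz_pos)
  have dL: "L2 \<mu> (\<lambda>x. v t n x - \<zeta> x)" for n using vL[of t n] \<zeta>L t by (intro L2_diff) auto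
  have TdL: "L2 \<mu> (\<lambda>x. T t \<zeta> x - \<zeta> x)" by (rule L2_diff[OF TL \<zeta>L])
  have conv_t: "(\<lambda>n. L2_norm \<mu> (\<lambda>x. (v t n x - \<zeta> x) - (T t \<zeta> x - \<zeta> x))) \<longlonglongrightarrow> 0"
    using conv[of t] t by (simp add: S.Tz_pos)
  have lim: "(\<lambda>n. L2_inner \<mu> (\<lambda>x. w x * (v t n x - \<zeta> x)) (\<lambda>x. v t n x - \<zeta> x))
      \<longlonglongrightarrow> L2_inner \<mu> (\<lambda>x. w x * (T t \<zeta> x - \<zeta> x)) (\<lambda>x. T t \<zeta> x - \<zeta> x)"
  proof (rule L2_inner_tendsto[OF L2_mult_bounded[OF dL wm w1] dL L2_mult_bounded[OF TdL wm w1] TdL _ conv_t])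
    show "(\<lambda>n. L2_norm \<mu> (\<lambda>x. w x * (v t n x - \<zeta> x) - w x * (T t \<zeta> x - \<zeta> x))) \<longlonglongrightarrow> 0"
    proof (rule tendsto_sandwich[OF _ _ tendsto_const])
      show "\<forall>\<^sub>F n in sequentially. L2_norm \<mu> (\<lambda>x. w x * (v t n x - \<zeta> x) - w x * (T t \<zeta> x - \<zeta> x))
         \<le> 1 * L2_norm \<mu> (\<lambda>x. (v t n x - \<zeta> x) - (T t \<zeta> x - \<zeta> x))"
      proof (intro always_eventually allI L2_norm_mono AE_I2)
        fix n x
        show "L2 \<mu> (\<lambda>x. (v t n x - \<zeta> x) - (T t \<zeta> x - \<zeta> x))" by (rule L2_diff[OF dL TdL])
        show "(\<lambda>x. w x * (v t n x - \<zeta> x) - w x * (T t \<zeta> x - \<zeta> x)) \<in> borel_measurable \<mu>"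
          by (rule L2_measurable[OF L2_diff[OF L2_mult_bounded[OF dL wm w1] L2_mult_bounded[OF TdL wm w1]]])
        have "\<bar>w x\<bar> * \<bar>(v t n x - \<zeta> x) - (T t \<zeta> x - \<zeta> x)\<bar> \<le> 1 * \<bar>(v t n x - \<zeta> x) - (T t \<zeta> x - \<zeta> x)\<bar>"
          using w1 by (intro mult_right_mono) auto
        then show "norm (w x * (v t n x - \<zeta> x) - w x * (T t \<zeta> x - \<zeta> x)) \<le> 1 * norm ((v t n x - \<zeta> x) - (T t \<zeta> x - \<zeta> x))"
          unfolding right_diff_distrib[symmetric] by (simp only: real_norm_def abs_mult)
      qed simp
      show "(\<lambda>n. 1 * L2_norm \<mu> (\<lambda>x. (v t n x - \<zeta> x) - (T t \<zeta> x - \<zeta> x))) \<longlonglongrightarrow> 0" using conv_t by simp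
    qed (simp add: L2_norm_nonneg)
  qed
  have "(\<lambda>n. (L2_norm \<mu> (\<lambda>x. v 0 n x - \<zeta> x))\<^sup>2 + 2 * err * t) \<longlonglongrightarrow> 0\<^sup>2 + 2 * err * t"
    using conv[of 0] by (intro tendsto_intros) (simp add: S.Tz_0)
  then have "L2_inner \<mu> (\<lambda>x. w x * (T t \<zeta> x - \<zeta> x)) (\<lambda>x. T t \<zeta> x - \<zeta> x) \<le> 0\<^sup>2 + 2 * err * t"
    using lim bound by (intro LIMSEQ_le[OF lim]) (auto simp: L2_inner_def)
  moreover have "(\<integral>x. W c1 x * (T t \<zeta> x - \<zeta> x)\<^sup>2 \<partial>\<mu>) \<le> L2_inner \<mu> (\<lambda>x. w x * (T t \<zeta> x - \<zeta> x)) (\<lambda>x. T t \<zeta> x - \<zeta> x)"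
    unfolding L2_inner_def
  proof (rule integral_mono)
    have "integrable \<mu> (\<lambda>x. (W c1 x * (T t \<zeta> x - \<zeta> x)) * (T t \<zeta> x - \<zeta> x))"
      using W_pos[of c1] W_le[OF c1n]
      by (intro L2_integrable_mult[OF L2_mult_bounded[OF TdL W_measurable, of _ 1] TdL]) (auto simp: abs_of_pos)
    then show "integrable \<mu> (\<lambda>x. W c1 x * (T t \<zeta> x - \<zeta> x)\<^sup>2)" by (simp add: power2_eq_square mult.assoc)
    show "integrable \<mu> (\<lambda>x. (w x * (T t \<zeta> x - \<zeta> x)) * (T t \<zeta> x - \<zeta> x))"
      by (rule L2_integrable_mult[OF L2_mult_bounded[OF TdL wm w1] TdL])
    fix x
    have "W c1 x * (T t \<zeta> x - \<zeta> x)\<^sup>2 \<le> w x * (T t \<zeta> x - \<zeta> x)\<^sup>2"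
      unfolding w_def using W_mono[OF c] by (intro mult_right_mono) auto
    then show "W c1 x * (T t \<zeta> x - \<zeta> x)\<^sup>2 \<le> (w x * (T t \<zeta> x - \<zeta> x)) * (T t \<zeta> x - \<zeta> x)"
      by (simp add: power2_eq_square mult.assoc)
  qed
  ultimately show ?thesis by simp
qed

end

section \<open>From cutoffs to conservativeness\<close>

context drift_form
begin

lemma semigroup_mono:
  assumes T: "semigroup_of_form \<mu> Q T" and t: "0 < t"
    and f: "L2 \<mu> f" and g: "L2 \<mu> g" and le: "AE x in \<mu>. f x \<le> g x"
  shows "AE x in \<mu>. T t f x \<le> T t g x"
proof -
  interpret S: l2_semigroup \<mu> T by unfold_locales (use T in \<open>simp add: semigroup_of_form_def\<close>)
  have "AE x in \<mu>. 0 \<le> g x - f x" using le by eventually_elim simp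
  from semigroup_nonneg[OF T L2_diff[OF g f] this t]
  have "AE x in \<mu>. 0 \<le> T t (\<lambda>x. g x - f x) x" .
  then show ?thesis using S.Tz_diff[of t g f] t f g by (auto simp: S.Tz_pos)
qed

text \<open>Conservation at one time, demanded for every monotone approximation of 1. In this
  strength it composes: T_t g_n is again such an approximation, to which the property at time s
  applies.\<close>

definition conserved_at :: "(real \<Rightarrow> (real^'n \<Rightarrow> real) \<Rightarrow> real^'n \<Rightarrow> real) \<Rightarrow> real \<Rightarrow> bool" where
  "conserved_at T t \<longleftrightarrow> (\<forall>g. monotone_approx \<mu> (\<lambda>_. 1) g \<longrightarrow> (AE x in \<mu>. (\<lambda>n. T t (g n) x) \<longlonglongrightarrow> 1))"

lemma semigroup_monotone_approx:
  assumes T: "semigroup_of_form \<mu> Q T" and t: "0 < t" and g: "monotone_approx \<mu> (\<lambda>_. 1) g"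
  shows "\<And>n. L2 \<mu> (T t (g n))"
    and "AE x in \<mu>. (\<forall>n. 0 \<le> T t (g n) x) \<and> (\<forall>n. T t (g n) x \<le> 1) \<and> incseq (\<lambda>n. T t (g n) x)"
proof -
  interpret S: l2_semigroup \<mu> T by unfold_locales (use T in \<open>simp add: semigroup_of_form_def\<close>)
  have gL: "L2 \<mu> (g n)" for n using g by (simp add: monotone_approx_def)
  have ae: "AE x in \<mu>. (\<forall>n. 0 \<le> g n x) \<and> incseq (\<lambda>n. g n x) \<and> (\<lambda>n. g n x) \<longlonglongrightarrow> 1"
    using g by (simp add: monotone_approx_def)
  show "L2 \<mu> (T t (g n))" for n using S.Tz_L2[of t "g n"] t gL by (simp add: S.Tz_pos)
  have "AE x in \<mu>. 0 \<le> T t (g n) x" for n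
    by (rule semigroup_nonneg[OF T gL _ t]) (use ae in eventually_elim, simp)
  then have 1: "AE x in \<mu>. \<forall>n. 0 \<le> T t (g n) x" by (simp add: AE_all_countable)
  have "AE x in \<mu>. T t (g n) x \<le> 1" for n
    by (rule semigroup_le_1[OF T gL _ t]) (use ae in eventually_elim, auto intro: incseq_le)
  then have 2: "AE x in \<mu>. \<forall>n. T t (g n) x \<le> 1" by (simp add: AE_all_countable)
  have "AE x in \<mu>. T t (g n) x \<le> T t (g (Suc n)) x" for n
    by (rule semigroup_mono[OF T t gL gL]) (use ae in eventually_elim, simp add: incseq_Suc_iff)
  then have 3: "AE x in \<mu>. \<forall>n. T t (g n) x \<le> T t (g (Suc n)) x" by (simp add: AE_all_countable)
  show "AE x in \<mu>. (\<forall>n. 0 \<le> T t (g n) x) \<and> (\<forall>n. T t (g n) x \<le> 1) \<and> incseq (\<lambda>n. T t (g n) x)"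
    using 1 2 3 by eventually_elim (simp add: incseq_Suc_iff)
qed

lemma conserved_at_add:
  assumes T: "semigroup_of_form \<mu> Q T" and s: "0 < s" "conserved_at T s" and t: "0 < t" "conserved_at T t"
  shows "conserved_at T (s + t)"
  unfolding conserved_at_def
proof (intro allI impI)
  fix g assume g: "monotone_approx \<mu> (\<lambda>_. 1) g"
  interpret S: l2_semigroup \<mu> T by unfold_locales (use T in \<open>simp add: semigroup_of_form_def\<close>)
  have gL: "L2 \<mu> (g n)" for n using g by (simp add: monotone_approx_def)
  have "monotone_approx \<mu> (\<lambda>_. 1) (\<lambda>n. T t (g n))"
    unfolding monotone_approx_def
    using semigroup_monotone_approx[OF T t(1) g] t(2) g by (auto simp: conserved_at_def)
  then have lim: "AE x in \<mu>. (\<lambda>n. T s (T t (g n)) x) \<longlonglongrightarrow> 1" using s(2) by (simp add: conserved_at_def)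
  have "AE x in \<mu>. T (s + t) (g n) x = T s (T t (g n)) x" for n
    using S.Tz_add[of s t "g n"] s t gL by (simp add: S.Tz_pos)
  then have "AE x in \<mu>. \<forall>n. T (s + t) (g n) x = T s (T t (g n)) x" by (simp add: AE_all_countable)
  with lim show "AE x in \<mu>. (\<lambda>n. T (s + t) (g n) x) \<longlonglongrightarrow> 1" by eventually_elim simp
qed

text \<open>Divide t into m equal steps of length at most t0.\<close>

lemma conserved_at_all:
  assumes T: "semigroup_of_form \<mu> Q T" and t0: "0 < t0" and small: "\<And>t. 0 < t \<Longrightarrow> t \<le> t0 \<Longrightarrow> conserved_at T t"
    and t: "0 < t"
  shows "conserved_at T t"
proof -
  obtain m :: nat where m: "t / t0 < real m" using reals_Archimedean2 by blast
  have m0: "0 < m" using m t t0 by (cases m) (auto simp: field_simps)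
  define s where "s = t / real m"
  have s: "0 < s" "s \<le> t0" using t t0 m m0 by (auto simp: s_def field_simps)
  have "conserved_at T (real (Suc j) * s)" for j
  proof (induction j)
    case 0
    then show ?case using small[OF s] by simp
  next
    case (Suc j)
    have p: "0 < real (Suc j) * s" using s by (intro mult_pos_pos) auto
    have "conserved_at T (real (Suc j) * s + s)"
      by (rule conserved_at_add[OF T p Suc.IH s(1) small[OF s]])
    moreover have "real (Suc (Suc j)) * s = real (Suc j) * s + s" by (simp add: algebra_simps)
    ultimately show ?case by simp
  qed
  from this[of "m - 1"] show ?thesis using m0 by (simp add: s_def)
qed

lemma conserved_imp_conservative:
  assumes "\<And>t. 0 < t \<Longrightarrow> conserved_at T t"
  shows "conservative \<mu> T"
  unfolding conservative_def Linf_extension_def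
proof (intro allI impI conjI)
  fix t :: real and g assume "0 < t" "monotone_approx \<mu> (\<lambda>_. 1) g"
  then show "AE x in \<mu>. (\<lambda>n. T t (g n) x) \<longlonglongrightarrow> 1" using assms by (simp add: conserved_at_def)
next
  have "monotone_approx \<mu> (\<lambda>_. 1) (\<lambda>n x. indicator (cball 0 (real n)) x)"
    unfolding monotone_approx_def
  proof (intro conjI allI AE_I2)
    show "L2 \<mu> (indicator (cball 0 (real n)) :: real^'n \<Rightarrow> real)" for n by (rule bounded_support_L2[OF lf bounded_support_indicator])
    fix x :: "real^'n"
    show "0 \<le> indicat_real (cball 0 (real n)) x" for n by simp
    show "incseq (\<lambda>n. indicat_real (cball 0 (real n)) x)"
      by (rule incseq_SucI) (auto simp: indicator_def)
    obtain N :: nat where "norm x < real N" using reals_Archimedean2 by blast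
    then have "\<forall>\<^sub>F n in sequentially. indicat_real (cball 0 (real n)) x = 1"
      by (intro eventually_sequentiallyI[of N]) (auto simp: indicator_def)
    then show "(\<lambda>n. indicat_real (cball 0 (real n)) x) \<longlonglongrightarrow> 1" by (rule tendsto_eventually)
  qed
  then show "\<exists>g. monotone_approx \<mu> (\<lambda>_. 1) g" by blast
qed

text \<open>Links the special cutoffs to an arbitrary approximation g. The increasing limit h of T_t
  g_m satisfies T_t \<zeta>_n \<le> h \<le> 1 for every n, so (h - 1)^2 is at most (T_t \<zeta>_n -
  1)^2, whose integral over each ball tends to 0.\<close>

lemma conserved_atI:
  assumes T: "semigroup_of_form \<mu> Q T" and t: "0 < t"
    and \<zeta>: "\<And>n. test_fun (\<zeta> n)" "\<And>n x. 0 \<le> \<zeta> n x" "\<And>n x. \<zeta> n x \<le> 1"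
    and lim: "\<And>\<rho>. 0 < \<rho> \<Longrightarrow> (\<lambda>n. \<integral>x. indicator (cball 0 \<rho>) x * (T t (\<zeta> n) x - 1)\<^sup>2 \<partial>\<mu>) \<longlonglongrightarrow> 0"
  shows "conserved_at T t"
  unfolding conserved_at_def
proof (intro allI impI)
  fix g assume g: "monotone_approx \<mu> (\<lambda>_. 1) g"
  interpret S: l2_semigroup \<mu> T by unfold_locales (use T in \<open>simp add: semigroup_of_form_def\<close>)
  have gL: "L2 \<mu> (g n)" for n using g by (simp add: monotone_approx_def)
  have gae: "AE x in \<mu>. (\<forall>n. 0 \<le> g n x) \<and> incseq (\<lambda>n. g n x) \<and> (\<lambda>n. g n x) \<longlonglongrightarrow> 1"
    using g by (simp add: monotone_approx_def)
  note TgL = semigroup_monotone_approx(1)[OF T t g]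
  note Tg = semigroup_monotone_approx(2)[OF T t g]
  define h where "h = (\<lambda>x. lim (\<lambda>n. T t (g n) x))"
  have hl: "AE x in \<mu>. (\<lambda>n. T t (g n) x) \<longlonglongrightarrow> h x \<and> h x \<le> 1 \<and> 0 \<le> h x"
    using Tg
  proof eventually_elim
    case (elim x)
    obtain L where L: "(\<lambda>n. T t (g n) x) \<longlonglongrightarrow> L"
      by (rule incseq_convergent[of "\<lambda>n. T t (g n) x" 1]) (use elim in auto)
    then have "h x = L" by (simp add: h_def limI)
    moreover have "L \<le> 1" by (rule LIMSEQ_le_const2[OF L]) (use elim in auto)
    moreover have "0 \<le> L" by (rule LIMSEQ_le_const[OF L]) (use elim in auto)
    ultimately show ?case using L by simp
  qed
  have hm: "h \<in> borel_measurable \<mu>" unfolding h_def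
    by (rule borel_measurable_lim_metric[OF L2_measurable[OF TgL]])
  have \<zeta>L: "L2 \<mu> (\<zeta> n)" for n by (rule test_fun_L2[OF lf \<zeta>(1)])
  have T\<zeta>L: "L2 \<mu> (T t (\<zeta> n))" for n using S.Tz_L2[of t "\<zeta> n"] t \<zeta>L by (simp add: S.Tz_pos)
  have ge: "AE x in \<mu>. T t (\<zeta> n) x \<le> h x" for n
  proof -
    \<comment> \<open>For fixed n the minimum tends to \<zeta>_n in L2 as m grows, as \<zeta>_n is
      at most 1 = lim g_m, while monotonicity of T_t keeps its image below T_t g_m.\<close>
    define u where "u = (\<lambda>m x. min (g m x) (\<zeta> n x))"
    have um: "u m \<in> borel_measurable \<mu>" for m unfolding u_def
      using L2_measurable[OF gL] L2_measurable[OF \<zeta>L] by (intro borel_measurable_min)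
    have uL: "L2 \<mu> (u m)" for m
    proof (rule L2_bound[OF \<zeta>L um])
      show "AE x in \<mu>. norm (u m x) \<le> 1 * norm (\<zeta> n x)"
        using gae by eventually_elim (use \<zeta>(2) in \<open>auto simp: u_def min_def\<close>)
    qed
    have "(\<lambda>m. \<integral>x. (u m x - \<zeta> n x)\<^sup>2 \<partial>\<mu>) \<longlonglongrightarrow> (\<integral>x. 0 \<partial>\<mu>)"
    proof (rule integral_dominated_convergence[where w="\<lambda>x. (\<zeta> n x)\<^sup>2"])
      show "integrable \<mu> (\<lambda>x. (\<zeta> n x)\<^sup>2)" using \<zeta>L by (simp add: L2_real_iff)
      show "(\<lambda>x. (u m x - \<zeta> n x)\<^sup>2) \<in> borel_measurable \<mu>" for m
        by (intro borel_measurable_power borel_measurable_diff um L2_measurable[OF \<zeta>L])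
      show "AE x in \<mu>. (\<lambda>m. (u m x - \<zeta> n x)\<^sup>2) \<longlonglongrightarrow> 0"
        using gae
      proof eventually_elim
        case (elim x)
        then have "(\<lambda>m. (min (g m x) (\<zeta> n x) - \<zeta> n x)\<^sup>2) \<longlonglongrightarrow> (min 1 (\<zeta> n x) - \<zeta> n x)\<^sup>2"
          by (intro tendsto_intros) auto
        then show ?case using \<zeta>(3)[of n x] by (simp add: u_def)
      qed
      show "AE x in \<mu>. norm ((u m x - \<zeta> n x)\<^sup>2) \<le> (\<zeta> n x)\<^sup>2" for m
        using gae
      proof eventually_elim
        case (elim x)
        then have "0 \<le> g m x" by simp
        then have "\<bar>u m x - \<zeta> n x\<bar> \<le> \<bar>\<zeta> n x\<bar>" using \<zeta>(2)[of n x] by (auto simp: u_def min_def)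
        then show ?case using abs_le_square_iff[of "u m x - \<zeta> n x" "\<zeta> n x"] by simp
      qed
    qed simp
    then have "(\<lambda>m. sqrt (\<integral>x. (u m x - \<zeta> n x)\<^sup>2 \<partial>\<mu>)) \<longlonglongrightarrow> sqrt 0" by (intro tendsto_intros) simp
    then have ul: "(\<lambda>m. L2_norm \<mu> (\<lambda>x. u m x - \<zeta> n x)) \<longlonglongrightarrow> 0" by (simp add: L2_norm_def)
    have TuL: "L2 \<mu> (T t (u m))" for m using S.Tz_L2[of t "u m"] t uL by (simp add: S.Tz_pos)
    have "L2_norm \<mu> (\<lambda>x. T t (u m) x - T t (\<zeta> n) x) \<le> L2_norm \<mu> (\<lambda>x. u m x - \<zeta> n x)" for m
    proof -
      have d: "L2 \<mu> (\<lambda>x. u m x - \<zeta> n x)" by (rule L2_diff[OF uL \<zeta>L])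
      have "AE x in \<mu>. T t (\<lambda>x. u m x - \<zeta> n x) x = T t (u m) x - T t (\<zeta> n) x"
        using S.Tz_diff[of t "u m" "\<zeta> n"] t uL \<zeta>L by (simp add: S.Tz_pos)
      then have "L2_norm \<mu> (T t (\<lambda>x. u m x - \<zeta> n x)) = L2_norm \<mu> (\<lambda>x. T t (u m) x - T t (\<zeta> n) x)"
        using S.Tz_L2[OF _ d, of t] t by (intro L2_norm_cong L2_diff TuL T\<zeta>L) (auto simp: S.Tz_pos)
      then show ?thesis using S.Tz_norm_le[OF _ d, of t] t by (simp add: S.Tz_pos)
    qed
    then have "(\<lambda>m. L2_norm \<mu> (\<lambda>x. T t (u m) x - T t (\<zeta> n) x)) \<longlonglongrightarrow> 0"
      by (intro tendsto_sandwich[OF _ _ tendsto_const ul]) (auto simp: L2_norm_nonneg)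
    from L2_AE_subseq[OF TuL T\<zeta>L this] obtain r :: "nat \<Rightarrow> nat" where
      r: "strict_mono r" "AE x in \<mu>. (\<lambda>m. T t (u (r m)) x) \<longlonglongrightarrow> T t (\<zeta> n) x" by blast
    have "AE x in \<mu>. T t (u m) x \<le> T t (g m) x" for m
      by (rule semigroup_mono[OF T t uL gL]) (simp add: u_def)
    then have "AE x in \<mu>. \<forall>m. T t (u m) x \<le> T t (g m) x" by (simp add: AE_all_countable)
    then show ?thesis using r(2) hl
    proof eventually_elim
      case (elim x)
      have "(\<lambda>m. T t (g (r m)) x) \<longlonglongrightarrow> h x"
        using LIMSEQ_subseq_LIMSEQ[OF _ r(1)] elim by (auto simp: o_def)
      then show ?case using elim by (intro LIMSEQ_le[OF elim(2)]) auto
    qed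
  qed
  have "AE x in \<mu>. norm x \<le> real (Suc j) \<longrightarrow> h x = 1" for j
  proof -
    let ?I = "indicator (cball 0 (real (Suc j))) :: real^'n \<Rightarrow> real"
    have IL: "L2 \<mu> ?I" by (rule bounded_support_L2[OF lf bounded_support_indicator])
    have Im: "?I \<in> borel_measurable \<mu>" by (rule L2_measurable[OF IL])
    have "L2 \<mu> (\<lambda>x. ?I x * (h x - 1))"
    proof (rule L2_bound[OF IL])
      show "(\<lambda>x. ?I x * (h x - 1)) \<in> borel_measurable \<mu>" using Im hm by measurable
      show "AE x in \<mu>. norm (?I x * (h x - 1)) \<le> 1 * norm (?I x)"
        using hl by eventually_elim (auto simp: indicator_def)
    qed
    then have "integrable \<mu> (\<lambda>x. (?I x * (h x - 1))\<^sup>2)" by (simp add: L2_real_iff)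
    moreover have "(?I x * (h x - 1))\<^sup>2 = ?I x * (h x - 1)\<^sup>2" for x by (simp add: indicator_def)
    ultimately have hi: "integrable \<mu> (\<lambda>x. ?I x * (h x - 1)\<^sup>2)" by simp
    have Ti: "integrable \<mu> (\<lambda>x. ?I x * (T t (\<zeta> n) x - 1)\<^sup>2)" for n
    proof -
      have "L2 \<mu> (\<lambda>x. ?I x * T t (\<zeta> n) x - ?I x)"
        by (intro L2_diff IL L2_mult_bounded[OF T\<zeta>L Im, where c=1]) (simp add: indicator_def)
      then have "integrable \<mu> (\<lambda>x. (?I x * T t (\<zeta> n) x - ?I x)\<^sup>2)" by (simp add: L2_real_iff)
      moreover have "(?I x * T t (\<zeta> n) x - ?I x)\<^sup>2 = ?I x * (T t (\<zeta> n) x - 1)\<^sup>2" for x by (simp add: indicator_def)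
      ultimately show ?thesis by simp
    qed
    have "(\<integral>x. ?I x * (h x - 1)\<^sup>2 \<partial>\<mu>) \<le> (\<integral>x. ?I x * (T t (\<zeta> n) x - 1)\<^sup>2 \<partial>\<mu>)" for n
    proof (rule integral_mono_AE[OF hi Ti])
      show "AE x in \<mu>. ?I x * (h x - 1)\<^sup>2 \<le> ?I x * (T t (\<zeta> n) x - 1)\<^sup>2"
        using hl ge[of n]
      proof eventually_elim
        case (elim x)
        then have "\<bar>h x - 1\<bar> \<le> \<bar>T t (\<zeta> n) x - 1\<bar>" by simp
        then have "(h x - 1)\<^sup>2 \<le> (T t (\<zeta> n) x - 1)\<^sup>2" by (simp only: abs_le_square_iff)
        then show ?case by (intro mult_left_mono) auto
      qed
    qed
    then have "(\<integral>x. ?I x * (h x - 1)\<^sup>2 \<partial>\<mu>) \<le> 0"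
      using lim[of "real (Suc j)"] by (intro LIMSEQ_le_const[OF lim]) auto
    moreover have "0 \<le> (\<integral>x. ?I x * (h x - 1)\<^sup>2 \<partial>\<mu>)" by (rule Bochner_Integration.integral_nonneg) simp
    ultimately have "(\<integral>x. ?I x * (h x - 1)\<^sup>2 \<partial>\<mu>) = 0" by (rule antisym)
    then have "AE x in \<mu>. ?I x * (h x - 1)\<^sup>2 = 0" using hi by (subst (asm) integral_nonneg_eq_0_iff_AE) auto
    then show ?thesis by eventually_elim (auto simp: indicator_def)
  qed
  then have "AE x in \<mu>. \<forall>j. norm x \<le> real (Suc j) \<longrightarrow> h x = 1" by (simp only: AE_all_countable) blast
  then show "AE x in \<mu>. (\<lambda>n. T t (g n) x) \<longlonglongrightarrow> 1"
    using hl
  proof eventually_elim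
    case (elim x)
    obtain j :: nat where "norm x < real j" using reals_Archimedean2 by blast
    then have "h x = 1" using elim(1)[rule_format, of j] by simp
    then show ?case using elim(2) by simp
  qed
qed

end

section \<open>Logarithmic weights\<close>

text \<open>The derivative is a polynomial times the square of the function itself, so the induction
  on the order closes without a larger family.\<close>

lemma smooth_real_inverse_1_plus_sq: "smooth_real (\<lambda>s. inverse (1 + s * s))"
proof -
  have pos: "1 + s * s \<noteq> 0" for s :: real using zero_le_square[of s] by linarith
  have D: "((\<lambda>s. inverse (1 + s * s)) has_real_derivative
      (-2 * s + 0) * (inverse (1 + s * s) * inverse (1 + s * s))) (at s)" for s :: real
    using pos[of s] by (auto intro!: derivative_eq_intros)
  have "cont_diff k (\<lambda>s. inverse (1 + s * s))" for k
  proof (induction k)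
    case 0
    then show ?case using D by (auto simp: differentiable_on_def real_differentiable_def)
  next
    case (Suc k)
    then have "cont_diff k (\<lambda>s. (-2 * s + 0) * (inverse (1 + s * s) * inverse (1 + s * s)))"
      by (intro cont_diff_mult cont_diff_affine)
    with D show ?case
      unfolding cont_diff.simps
      by (intro exI[of _ "\<lambda>s. (-2 * s + 0) * (inverse (1 + s * s) * inverse (1 + s * s))"] conjI allI)
  qed
  then show ?thesis by (simp add: smooth_real_def)
qed

text \<open>\<open>soft_log x\<close> is comparable to \<open>ln (norm x + 1)\<close> and, being a function of \<open>(x \<bullet> x)\<^sup>2\<close>, smooth.\<close>

definition soft_log :: "real^'n::finite \<Rightarrow> real" where
  "soft_log x = ln (1 + (x \<bullet> x) * (x \<bullet> x)) / 4"

lemma soft_log_norm: "soft_log x = ln (1 + norm x ^ 4) / 4"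
  by (simp add: soft_log_def dot_square_norm flip: power_add)

lemma soft_log_mono_iff:
  fixes x y :: "real^'n::finite"
  shows "soft_log x \<le> soft_log y \<longleftrightarrow> norm x \<le> norm y"
proof -
  have p: "0 < 1 + norm z ^ 4" for z :: "real^'n" by (simp add: add_pos_nonneg)
  have "soft_log x \<le> soft_log y \<longleftrightarrow> norm x ^ 4 \<le> norm y ^ 4"
    using p[of x] p[of y] by (simp add: soft_log_norm)
  also have "\<dots> \<longleftrightarrow> norm x \<le> norm y" by (simp add: power_mono_iff)
  finally show ?thesis .
qed

text \<open>Logarithms of 1 + r^4 \<le> (r + 1)^4 \<le> 8 (1 + r^4), where the second inequality
  applies (a + b)^2 \<le> 2 (a^2 + b^2) twice; the additive constant 1 comes from ln 8 \<le>
  4.\<close>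

lemma soft_log_bounds: "soft_log x \<le> ln (norm x + 1)" "ln (norm x + 1) \<le> soft_log x + 1"
proof -
  let ?r = "norm x"
  have p: "0 < 1 + ?r ^ 4" by (simp add: add_pos_nonneg)
  have r: "0 \<le> ?r" by simp
  have 4: "4 * ln (?r + 1) = ln ((?r + 1) ^ 4)"
    using ln_realpow[of "?r + 1" 4] by (simp add: add_nonneg_pos)
  have "1 + ?r ^ 4 \<le> (?r + 1) ^ 4" using r by (simp add: power4_eq_xxxx algebra_simps)
  then have "ln (1 + ?r ^ 4) \<le> 4 * ln (?r + 1)"
    unfolding 4 using p by (intro ln_le_cancel_iff[THEN iffD2]) auto
  then show "soft_log x \<le> ln (norm x + 1)" by (simp add: soft_log_norm)
  have "(?r + 1) ^ 4 \<le> 8 * (1 + ?r ^ 4)"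
  proof -
    have a: "(?r + 1)\<^sup>2 \<le> 2 * (1 + ?r\<^sup>2)" using zero_le_power2[of "?r - 1"] by (simp add: power2_eq_square algebra_simps)
    have b: "(1 + ?r\<^sup>2)\<^sup>2 \<le> 2 * (1 + ?r ^ 4)" using zero_le_power2[of "?r\<^sup>2 - 1"] by (simp add: power2_eq_square power4_eq_xxxx algebra_simps)
    have "(?r + 1) ^ 4 = ((?r + 1)\<^sup>2)\<^sup>2" by simp
    also have "\<dots> \<le> (2 * (1 + ?r\<^sup>2))\<^sup>2" using a by (intro power_mono) auto
    also have "\<dots> = 4 * (1 + ?r\<^sup>2)\<^sup>2" unfolding power_mult_distrib by simp
    finally show ?thesis using b by linarith
  qed
  then have "4 * ln (?r + 1) \<le> ln (8 * (1 + ?r ^ 4))"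
    unfolding 4 using p r by (intro ln_le_cancel_iff[THEN iffD2] zero_less_power) (simp_all add: add_nonneg_pos)
  also have "\<dots> = ln 8 + ln (1 + ?r ^ 4)" using p by (intro ln_mult_pos) auto
  also have "ln (8 :: real) \<le> 4"
  proof -
    have "(2 :: real) \<le> exp 1" using exp_ge_add_one_self[of 1] by simp
    then have "(2 :: real) ^ 4 \<le> exp 1 ^ 4" by (intro power_mono) auto
    also have "exp (1::real) ^ 4 = exp 4" by (simp flip: exp_of_nat_mult)
    finally have "(8 :: real) \<le> exp 4" by simp
    then show ?thesis using ln_le_cancel_iff[of 8 "exp 4"] by simp
  qed
  finally show "ln (norm x + 1) \<le> soft_log x + 1" by (simp add: soft_log_norm)
qed

lemma smooth_fun_soft_log: "smooth_fun (soft_log :: real^'n::finite \<Rightarrow> real)"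
  and grad_soft_log: "grad soft_log y = ((y \<bullet> y) / (1 + (y \<bullet> y) * (y \<bullet> y))) *\<^sub>R (y :: real^'n)"
proof -
  have pos: "0 < 1 + s * s" for s :: real using zero_le_square[of s] by linarith
  have D: "((\<lambda>s. ln (1 + s * s) / 4) has_real_derivative (1 / 2 * s + 0) * inverse (1 + s * s)) (at s)" for s :: real
  proof -
    have "((\<lambda>s. 1 + s * s) has_real_derivative 2 * s) (at s)" by (auto intro!: derivative_eq_intros)
    from DERIV_cdivide[OF DERIV_chain2[OF DERIV_ln[OF pos] this], of 4] show ?thesis by (simp add: mult.commute)
  qed
  have "smooth_real (\<lambda>s. ln (1 + s * s) / 4)"
    by (rule smooth_real_antideriv[OF D])
       (intro smooth_real_mult smooth_real_affine smooth_real_inverse_1_plus_sq)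
  from smooth_fun_compose[OF this smooth_fun_inner_self]
  show "smooth_fun (soft_log :: real^'n \<Rightarrow> real)" by (simp add: soft_log_def[abs_def])
  show "grad soft_log y = ((y \<bullet> y) / (1 + (y \<bullet> y) * (y \<bullet> y))) *\<^sub>R y"
  proof -
    have "soft_log = (\<lambda>y::real^'n. ln (1 + (y \<bullet> y) * (y \<bullet> y)) / 4)" by (rule ext) (rule soft_log_def)
    then have "grad soft_log y = ((1 / 2 * (y \<bullet> y) + 0) * inverse (1 + (y \<bullet> y) * (y \<bullet> y))) *\<^sub>R (2 *\<^sub>R y)"
      using grad_compose[OF smooth_fun_differentiable[OF smooth_fun_inner_self] D, of y]
      by (simp only: grad_inner_self)
    then show ?thesis unfolding divide_inverse scaleR_scaleR by (simp add: mult.commute)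
  qed
qed

text \<open>The weight exponent is \<open>soft_log\<close> truncated smoothly near the spheres of radii \<open>R\<close> and \<open>N\<close>.\<close>

lemma log_weight_ex:
  assumes R: "exp 1 \<le> R" and N: "exp 2 * (R + 1) \<le> N + 1"
  shows "\<exists>\<theta> :: real^'n::finite \<Rightarrow> real. \<exists>m \<theta>m. smooth_fun \<theta> \<and> (\<forall>x. 1 \<le> \<theta> x \<and> \<theta> x \<le> \<theta>m) \<and>
     (\<forall>x. grad \<theta> x = m x *\<^sub>R x) \<and> (\<forall>x. 0 \<le> m x \<and> m x \<le> 1 \<and> m x * norm x * norm x \<le> 1) \<and>
     (\<forall>x. m x \<noteq> 0 \<longrightarrow> R < norm x \<and> norm x < N \<and> ln (norm x + 1) \<le> 4 * \<theta> x) \<and>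
     (\<forall>x. N \<le> norm x \<longrightarrow> ln (N + 1) - 2 \<le> \<theta> x) \<and>
     (\<forall>x. \<theta> x \<le> ln (max R (norm x) + 1))"
proof -
  obtain S' S P Q :: "real \<Rightarrow> real" and L where S: "smooth_real S" "smooth_real P"
      "\<And>x. (S has_real_derivative S' x) (at x)" "\<And>x. (P has_real_derivative S x) (at x)" "\<And>x. 0 \<le> S' x"
      "\<And>x. x \<le> 0 \<Longrightarrow> S x = 0 \<and> P x = 0" "\<And>x. 1 \<le> x \<Longrightarrow> S x = 1"
    using smooth_step_ex by metis
  have mono: "S x \<le> S y" if "x \<le> y" for x y
    using DERIV_nonneg_imp_nondecreasing[OF that, of S] S(3,5) by blast
  have S01: "0 \<le> S x" "S x \<le> 1" for x
    using mono[of "min x 0" x] mono[of x "max x 1"] S(6)[of "min x 0"] S(7)[of "max x 1"] by auto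
  have P_diff: "0 \<le> P y - P x \<and> P y - P x \<le> y - x" if "x \<le> y" for x y
  proof (cases "x = y")
    case False
    then have xy: "x < y" using that by simp
    obtain z where "P y - P x = (y - x) * S z" using mean_value_obtain[OF S(4) xy] by blast
    then show ?thesis using S01[of z] xy by (simp add: mult_left_le)
  qed simp
  have P_nonneg: "0 \<le> P x" for x using P_diff[of "min x 0" x] S(6)[of "min x 0"] by auto
  have P_le: "P x \<le> max x 0" for x using P_diff[of "min x 0" x] S(6)[of "min x 0"] by auto
  have P_lin: "P x = P 1 + (x - 1)" if "1 \<le> x" for x
  proof (cases "x = 1")
    case False
    then have "1 < x" using that by simp
    from mean_value_obtain[OF S(4) this] obtain z where "1 < z" "P x - P 1 = (x - 1) * S z" by blast
    then show ?thesis using S(7)[of z] by simp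
  qed simp
  have P_ge: "x - 1 \<le> P x" for x
    using P_lin[of x] P_nonneg[of 1] P_nonneg[of x] by (cases "1 \<le> x") auto
  \<comment> \<open>Any direction will do: \<open>soft_log\<close> depends only on the norm, so its
    thresholds are read off at one point of each sphere.\<close>
  define e where "e = (SOME i. i \<in> (UNIV :: 'n set))"
  define pt where "pt = (\<lambda>r. r *\<^sub>R axis e 1 :: real^'n)"
  have Rp: "0 < R" using R exp_gt_zero[of "1::real"] by linarith
  have "exp 2 * (R + 1) \<ge> 1 * (R + 1)" using Rp by (intro mult_right_mono) auto
  then have RN: "R \<le> N" using N by simp
  have npt: "norm (pt r) = \<bar>r\<bar>" for r by (simp add: pt_def)
  define y0 where "y0 = soft_log (pt R)"
  define y1 where "y1 = soft_log (pt N) - 1"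
  have y0_ge: "1 \<le> y0"
  proof -
    have "exp 1 ^ 4 \<le> R ^ 4" using R by (intro power_mono) auto
    then have "exp 4 \<le> 1 + R ^ 4" by (simp flip: exp_of_nat_mult)
    then have "4 \<le> ln (1 + R ^ 4)" using ln_le_cancel_iff[of "exp 4" "1 + R ^ 4"] by (simp add: add_pos_nonneg)
    then show ?thesis using Rp by (simp add: y0_def soft_log_norm npt)
  qed
  have ln_N: "ln (N + 1) - 2 \<le> y1" using soft_log_bounds(2)[of "pt N"] RN Rp by (simp add: y1_def npt)
  \<comment> \<open>The factor \<open>exp 2\<close> in the gap between R and N pays for the 2 lost
    in \<open>ln_N\<close>.\<close>
  have y01: "y0 \<le> y1"
  proof -
    have "y0 \<le> ln (R + 1)" using soft_log_bounds(1)[of "pt R"] Rp by (simp add: y0_def npt)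
    moreover have "ln (exp 2 * (R + 1)) \<le> ln (N + 1)" using N Rp RN by (subst ln_le_cancel_iff) auto
    then have "2 + ln (R + 1) \<le> ln (N + 1)" using Rp by (simp add: ln_mult)
    ultimately show ?thesis using ln_N by linarith
  qed
  have above_R: "R < norm x" if "y0 < soft_log x" for x :: "real^'n"
    using that soft_log_mono_iff[of x "pt R"] Rp by (auto simp: y0_def npt)
  have below_N: "norm x < N" if "soft_log x < y1 + 1" for x :: "real^'n"
    using that soft_log_mono_iff[of "pt N" x] Rp RN by (auto simp: y1_def npt)
  have above_N: "y1 + 1 \<le> soft_log x" if "N \<le> norm x" for x :: "real^'n"
    using that soft_log_mono_iff[of "pt N" x] Rp RN by (auto simp: y1_def npt)
  \<comment> \<open>A ramp in \<open>soft_log\<close>: it leaves the level y0 at the sphere of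
    radius R and is constant y1 from y1 + 1 on. The shift by 1 in y1 places that end exactly at the
    sphere of radius N.\<close>
  define \<theta> where "\<theta> = (\<lambda>x::real^'n. y0 + (P (soft_log x - y0) - P (soft_log x - y1)))"
  define h where "h = (\<lambda>x::real^'n. S (soft_log x - y0) - S (soft_log x - y1))"
  define m where "m = (\<lambda>x::real^'n. h x * ((x \<bullet> x) / (1 + (x \<bullet> x) * (x \<bullet> x))))"
  have sm: "smooth_fun \<theta>"
    unfolding \<theta>_def
    by (intro smooth_fun_add smooth_fun_diff smooth_fun_const smooth_fun_compose[OF S(2)] smooth_fun_soft_log)
  have h01: "0 \<le> h x" "h x \<le> 1" for x
    using mono[of "soft_log x - y1" "soft_log x - y0"] y01 S01(2)[of "soft_log x - y0"] S01(1)[of "soft_log x - y1"]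
    by (auto simp: h_def)
  have g: "grad \<theta> x = m x *\<^sub>R x" for x
  proof -
    have d: "soft_log differentiable (at x)" by (rule smooth_fun_differentiable[OF smooth_fun_soft_log])
    have gl: "grad (\<lambda>x. P (soft_log x - y)) x = S (soft_log x - y) *\<^sub>R grad soft_log x" for y
    proof (rule grad_compose[where F="\<lambda>s. P (s - y)", OF d])
      show "((\<lambda>s. P (s - y)) has_real_derivative S (soft_log x - y)) (at (soft_log x))"
        using DERIV_shift[of P "S (soft_log x - y)" "soft_log x" "- y"] S(4) by simp
    qed
    have dP: "(\<lambda>x. P (soft_log x - y)) differentiable (at x)" for y
      by (intro smooth_fun_differentiable smooth_fun_compose[OF S(2)] smooth_fun_diff smooth_fun_const smooth_fun_soft_log)
    have "grad \<theta> x = grad (\<lambda>x. y0) x + grad (\<lambda>x. P (soft_log x - y0) - P (soft_log x - y1)) x"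
      unfolding \<theta>_def by (rule grad_add) (auto intro: differentiable_diff dP)
    also have "\<dots> = h x *\<^sub>R grad soft_log x"
      by (simp add: grad_const grad_diff[OF dP dP] gl h_def scaleR_diff_left)
    finally show ?thesis by (simp add: grad_soft_log m_def)
  qed
  have m_bounds: "0 \<le> m x \<and> m x \<le> 1 \<and> m x * norm x * norm x \<le> 1" for x
  proof -
    define s where "s = x \<bullet> x"
    have s: "0 \<le> s" "0 < 1 + s * s" "norm x * norm x = s"
      using zero_le_square[of "x \<bullet> x"] by (auto simp: s_def power2_norm_eq_inner simp flip: power2_eq_square intro: add_pos_nonneg)
    have q: "0 \<le> s / (1 + s * s)" "s / (1 + s * s) \<le> 1" "s * s / (1 + s * s) \<le> 1"
      using s zero_le_power2[of "s - 1"] by (auto simp: power2_eq_square algebra_simps divide_le_eq)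
    have "m x * (norm x * norm x) = h x * (s * s / (1 + s * s))" unfolding s(3) by (simp add: m_def s_def)
    also have "\<dots> \<le> 1" using h01[of x] q(3) s by (intro mult_le_one) auto
    finally have "m x * norm x * norm x \<le> 1" by (simp add: mult.assoc)
    moreover have "0 \<le> m x" "m x \<le> 1"
      unfolding m_def s_def[symmetric]
      by (rule mult_nonneg_nonneg[OF h01(1) q(1)], rule mult_le_one[OF h01(2) q(1,2)])
    ultimately show ?thesis by blast
  qed
  have m_nz: "R < norm x \<and> norm x < N \<and> ln (norm x + 1) \<le> 4 * \<theta> x" if "m x \<noteq> 0" for x
  proof -
    have hx: "h x \<noteq> 0" using that by (auto simp: m_def)
    have a: "y0 < soft_log x"
    proof (rule ccontr)
      assume "\<not> y0 < soft_log x"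
      then show False using hx S(6)[of "soft_log x - y0"] S(6)[of "soft_log x - y1"] y01 by (simp add: h_def)
    qed
    have b: "soft_log x < y1 + 1"
    proof (rule ccontr)
      assume "\<not> soft_log x < y1 + 1"
      then show False using hx S(7)[of "soft_log x - y0"] S(7)[of "soft_log x - y1"] y01 by (simp add: h_def)
    qed
    have "soft_log x - 2 \<le> \<theta> x"
      using P_ge[of "soft_log x - y0"] P_le[of "soft_log x - y1"] b by (simp add: \<theta>_def)
    moreover have "1 \<le> \<theta> x" using y0_ge P_diff[of "soft_log x - y1" "soft_log x - y0"] y01 by (simp add: \<theta>_def)
    \<comment> \<open>The factor 4: ln (|x| + 1) \<le> soft_log x + 1 \<le> \<theta> x + 3 \<le> 4
      \<theta> x, the last because 1 \<le> \<theta> x.\<close>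
    ultimately have "ln (norm x + 1) \<le> 4 * \<theta> x" using soft_log_bounds(2)[of x] by linarith
    then show ?thesis using above_R[OF a] below_N[OF b] by simp
  qed
  have "1 \<le> \<theta> x \<and> \<theta> x \<le> y1" for x
    using y0_ge P_diff[of "soft_log x - y1" "soft_log x - y0"] y01 by (simp add: \<theta>_def)
  moreover have "ln (N + 1) - 2 \<le> \<theta> x" if "N \<le> norm x" for x
    using P_lin[of "soft_log x - y0"] P_lin[of "soft_log x - y1"] above_N[OF that] y01 ln_N by (simp add: \<theta>_def)
  moreover have "\<theta> x \<le> ln (max R (norm x) + 1)" for x
  proof -
    have "\<theta> x \<le> max y0 (soft_log x)"
    proof -
      have "max (soft_log x - y0) 0 = max y0 (soft_log x) - y0" by (simp add: max_def)
      then show ?thesis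
        using P_le[of "soft_log x - y0"] P_nonneg[of "soft_log x - y1"] unfolding \<theta>_def by linarith
    qed
    moreover have "ln (r + 1) \<le> ln (max R (norm x) + 1)" if "0 \<le> r" "r \<le> max R (norm x)" for r
      by (intro ln_le_cancel_iff[THEN iffD2]) (use that in auto)
    from this[of R] this[of "norm x"]
    have "ln (R + 1) \<le> ln (max R (norm x) + 1)" "ln (norm x + 1) \<le> ln (max R (norm x) + 1)"
      using Rp by auto
    moreover have "y0 \<le> ln (R + 1)" using soft_log_bounds(1)[of "pt R"] Rp by (simp add: y0_def npt)
    ultimately show ?thesis using soft_log_bounds(1)[of x] by linarith
  qed
  ultimately show ?thesis
    using sm g m_bounds m_nz by (intro exI[of _ \<theta>] exI[of _ m] exI[of _ y1]) blast
qed

section \<open>The growth conditions\<close>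

locale growth_form = drift_form \<phi> D\<phi> A Da B
  for \<phi> :: "real^'n::finite \<Rightarrow> real" and D\<phi> A Da B +
  fixes K0 K :: "(real^'n) set" and M C \<alpha> :: real
  assumes sym_bounded: "\<And>i j. Linf_loc (- K0) \<mu> (\<lambda>x. sym_part A x $ i $ j)"
    and \<beta>_bounded: "Linf_loc (- K0) \<mu> (\<lambda>x. norm (\<beta> x))"
    and K: "compact K" "K0 \<subseteq> K"
    and const_pos: "0 < M" "0 < C" "0 < \<alpha>" "\<alpha> < 1"
    and growth: "AE x in \<mu>. x \<notin> K \<longrightarrow>
           \<bar>a x x x / (norm x)\<^sup>2 + (norm x + 1) / (C * norm x) * (\<beta> x \<bullet> x)\<bar>
             \<le> M * (norm x + 1)\<^sup>2 * ln (norm x + 1)"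
    and A_hat_le: "\<forall>\<^sub>F n in sequentially.
           A_hat \<mu> A \<beta> (\<lambda>r. C * ln (r + 1)) n \<le> real n * (real n + 1) powr (\<alpha> * C)"
begin

lemma Linf_locD: "Linf_loc S N h \<Longrightarrow> compact E \<Longrightarrow> E \<subseteq> S \<Longrightarrow> \<exists>c. AE x in N. x \<in> E \<longrightarrow> \<bar>h x\<bar> \<le> c"
  by (simp add: Linf_loc_def)

text \<open>Beyond K, and hence beyond K0, a closed shell is a compact subset of the complement of
  K0, where the local bounds on the coefficients apply.\<close>

lemma shell_bounded:
  assumes R: "\<forall>x\<in>K. norm x < R"
  shows "\<exists>b\<ge>0. AE x in \<mu>. R \<le> norm x \<and> norm x \<le> N \<longrightarrow> a x x x \<le> b \<and> norm (\<beta> x) \<le> b"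
proof -
  let ?S = "cball 0 N - ball 0 R :: (real^'n) set"
  have S: "compact ?S" by (intro compact_diff compact_cball open_ball)
  have sub: "?S \<subseteq> - K0" using R K(2) by force
  have "\<forall>p. \<exists>c. AE x in \<mu>. x \<in> ?S \<longrightarrow> \<bar>sym_part A x $ fst p $ snd p\<bar> \<le> c"
    by (intro allI Linf_locD[OF sym_bounded S sub])
  from choice[OF this] obtain c' where
    "\<And>p. AE x in \<mu>. x \<in> ?S \<longrightarrow> \<bar>sym_part A x $ fst p $ snd p\<bar> \<le> c' p" by blast
  from this[of "(_, _)"] obtain c where c: "\<And>i j. AE x in \<mu>. x \<in> ?S \<longrightarrow> \<bar>sym_part A x $ i $ j\<bar> \<le> c i j"
    by (intro that[of "\<lambda>i j. c' (i, j)"]) simp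
  obtain d where d: "AE x in \<mu>. x \<in> ?S \<longrightarrow> \<bar>norm (\<beta> x)\<bar> \<le> d"
    using Linf_locD[OF \<beta>_bounded S sub] by blast
  define b where "b = max (\<Sum>i\<in>UNIV. \<Sum>j\<in>UNIV. \<bar>c i j\<bar> * \<bar>N\<bar> * \<bar>N\<bar>) \<bar>d\<bar>"
  have "AE x in \<mu>. \<forall>i\<in>UNIV. \<forall>j\<in>UNIV. x \<in> ?S \<longrightarrow> \<bar>sym_part A x $ i $ j\<bar> \<le> c i j"
    by (intro AE_finite_allI finite c)
  then have "AE x in \<mu>. R \<le> norm x \<and> norm x \<le> N \<longrightarrow> a x x x \<le> b \<and> norm (\<beta> x) \<le> b"
    using d
  proof eventually_elim
    case (elim x)
    show ?case
    proof
      assume x: "R \<le> norm x \<and> norm x \<le> N"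
      then have xS: "x \<in> ?S" by simp
      have "a x x x \<le> (\<Sum>i\<in>UNIV. \<Sum>j\<in>UNIV. \<bar>c i j\<bar> * \<bar>N\<bar> * \<bar>N\<bar>)"
        unfolding bil_def
      proof (intro sum_mono)
        fix i j
        have "\<bar>x $ i\<bar> \<le> \<bar>N\<bar>" "\<bar>x $ j\<bar> \<le> \<bar>N\<bar>"
          using component_le_norm_cart[of x i] component_le_norm_cart[of x j] x by linarith+
        moreover have "\<bar>sym_part A x $ i $ j\<bar> \<le> \<bar>c i j\<bar>"
          using elim(1) xS by (blast intro: order_trans[OF _ abs_ge_self])
        ultimately have "\<bar>sym_part A x $ i $ j\<bar> * \<bar>x $ i\<bar> * \<bar>x $ j\<bar> \<le> \<bar>c i j\<bar> * \<bar>N\<bar> * \<bar>N\<bar>"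
          by (intro mult_mono) auto
        then show "sym_part A x $ i $ j * x $ i * x $ j \<le> \<bar>c i j\<bar> * \<bar>N\<bar> * \<bar>N\<bar>"
          by (simp flip: abs_mult)
      qed
      moreover have "norm (\<beta> x) \<le> \<bar>d\<bar>" using elim(2) xS by auto
      ultimately show "a x x x \<le> b \<and> norm (\<beta> x) \<le> b" by (auto simp: b_def)
    qed
  qed
  moreover have "0 \<le> b" by (simp add: b_def)
  ultimately show ?thesis by blast
qed

text \<open>Integrability against indicators of balls makes the truncated coefficients measurable;
  the coefficients are their eventually constant pointwise limits.\<close>

lemma sym_entry_measurable: "(\<lambda>x. sym_part A x $ i $ j) \<in> borel_measurable borel"
  and \<beta>_measurable: "\<beta> \<in> borel_measurable borel"
proof -
  have m: "h \<in> borel_measurable borel" if h: "loc_L1 \<mu> h" for h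
  proof -
    have "(\<lambda>x. h x * indicator (cball 0 (real n)) x) \<in> borel_measurable borel" for n
      using borel_measurable_integrable[OF loc_L1D[OF h bounded_support_indicator]] \<mu>_measurable_iff by blast
    then show ?thesis
    proof (rule borel_measurable_LIMSEQ_metric)
      fix x :: "real^'n"
      obtain N :: nat where "norm x < real N" using reals_Archimedean2 by blast
      then have "\<forall>\<^sub>F n in sequentially. h x * indicator (cball 0 (real n)) x = h x"
        by (intro eventually_sequentiallyI[of N]) (auto simp: indicator_def)
      then show "(\<lambda>n. h x * indicator (cball 0 (real n)) x) \<longlonglongrightarrow> h x" by (rule tendsto_eventually)
    qed
  qed
  show "(\<lambda>x. sym_part A x $ i $ j) \<in> borel_measurable borel" by (rule m[OF sym_loc])
  show "\<beta> \<in> borel_measurable borel"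
    by (subst borel_measurable_euclidean_space) (auto simp: Basis_vec_def inner_axis m[OF \<beta>_loc])
qed

lemma annulus_iff: "x \<in> annulus n \<longleftrightarrow> real (2 * n) \<le> norm x \<and> norm x < real (4 * n)"
  by (auto simp: annulus_def)

text \<open>Brings \<open>A_hat\<close> into the form in which the error of the cutoff appears, by
  p^2 + q^2 \<le> (p + q)^2 for nonnegative p and q. Since \<open>esssup_on\<close> sends infinite
  values to 0, the pointwise bound by \<open>an\<close> relies on the coefficients being bounded on
  the annulus, which R \<le> 2 n secures.\<close>

lemma annulus_estimate:
  assumes R: "\<forall>x\<in>K. norm x < R" and n: "0 < n" "R \<le> real (2 * n)"
  defines "an \<equiv> esssup_on \<mu> (annulus n) (radial_coeff A)"
    and "Bn \<equiv> \<integral>x. indicator (annulus n) x * ((\<beta> x \<bullet> x) / norm x)\<^sup>2 \<partial>\<mu>"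
    and "Ah \<equiv> A_hat \<mu> A \<beta> (\<lambda>r. C * ln (r + 1)) n"
  shows "AE x in \<mu>. x \<in> annulus n \<longrightarrow> radial_coeff A x \<le> an"
    and "integrable \<mu> (\<lambda>x. indicator (annulus n) x * ((\<beta> x \<bullet> x) / norm x)\<^sup>2)"
    and "integrable \<mu> (indicator (annulus n) :: real^'n \<Rightarrow> real)"
    and "0 \<le> Ah" and "an * measure \<mu> (annulus n) + Bn \<le> Ah\<^sup>2"
proof -
  have "annulus n \<in> sets borel" by (simp add: annulus_def)
  then have An: "annulus n \<in> sets \<mu>" using lf by (simp add: locally_finite_def)
  have sp: "space \<mu> = UNIV" by (simp add: weighted_def)
  have An': "annulus n \<inter> space \<mu> \<in> sets \<mu>" using An by (simp add: sp)
  have ar: "(AE x in restrict_space \<mu> (annulus n). P x) \<longleftrightarrow> (AE x in \<mu>. x \<in> annulus n \<longrightarrow> P x)" for P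
    by (rule AE_restrict_space_iff[OF An'])
  have bs: "bounded_support (indicator (annulus n) :: real^'n \<Rightarrow> real)"
  proof -
    have "\<bar>indicat_real (annulus n) x\<bar> \<le> 1" for x :: "real^'n" by (simp add: indicator_def)
    moreover have "indicat_real (annulus n) x = 0" if "real (4 * n) < norm x" for x :: "real^'n"
      using that annulus_iff[of x n] by (simp add: indicator_def)
    ultimately show ?thesis unfolding bounded_support_def
      by (blast intro: borel_measurable_indicator \<open>annulus n \<in> sets borel\<close>)
  qed
  show ii: "integrable \<mu> (indicator (annulus n) :: real^'n \<Rightarrow> real)" by (rule bounded_support_integrable[OF lf bs])
  obtain b where b: "0 \<le> b" "AE x in \<mu>. R \<le> norm x \<and> norm x \<le> real (4 * n) \<longrightarrow> a x x x \<le> b \<and> norm (\<beta> x) \<le> b"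
    using shell_bounded[OF R] by blast
  have r_pos: "0 < norm x" if "x \<in> annulus n" for x :: "real^'n" using that n(1) annulus_iff[of x n] by linarith
  have ab: "AE x in \<mu>. x \<in> annulus n \<longrightarrow> a x x x \<le> b \<and> norm (\<beta> x) \<le> b"
    using b(2) by eventually_elim (use annulus_iff n in force)
  have rm: "radial_coeff A \<in> borel_measurable borel"
    unfolding radial_coeff_def[abs_def] bil_def
    by (intro borel_measurable_divide borel_measurable_sum borel_measurable_times sym_entry_measurable
        borel_measurable_component borel_measurable_power) auto
  have r0: "AE x in \<mu>. 0 \<le> radial_coeff A x"
    using psd by eventually_elim (simp add: radial_coeff_def)
  have r_le: "AE x in \<mu>. x \<in> annulus n \<longrightarrow> radial_coeff A x \<le> b / (real (2 * n))\<^sup>2"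
    using ab psd
  proof eventually_elim
    case (elim x)
    show ?case
    proof
      assume x: "x \<in> annulus n"
      have "(real (2 * n))\<^sup>2 \<le> (norm x)\<^sup>2" using x annulus_iff[of x n] by (intro power_mono) auto
      then show "radial_coeff A x \<le> b / (real (2 * n))\<^sup>2"
        unfolding radial_coeff_def using elim x b(1) n(1) by (intro frac_le) auto
    qed
  qed
  define e where "e = esssup (restrict_space \<mu> (annulus n)) (\<lambda>x. ereal (radial_coeff A x))"
  have an: "an = real_of_ereal e" by (simp add: an_def e_def esssup_on_def)
  have emeas: "(\<lambda>x. ereal (radial_coeff A x)) \<in> borel_measurable (restrict_space \<mu> (annulus n))"
  proof (rule measurable_restrict_space1)
    have "radial_coeff A \<in> borel_measurable \<mu>" using rm \<mu>_measurable_iff by blast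
    then show "(\<lambda>x. ereal (radial_coeff A x)) \<in> borel_measurable \<mu>" by (rule borel_measurable_ereal)
  qed
  have e_le: "e \<le> ereal (b / (real (2 * n))\<^sup>2)"
    unfolding e_def by (rule esssup_I[OF emeas]) (use r_le in \<open>simp add: ar\<close>)
  have "AE x in \<mu>. x \<in> annulus n \<longrightarrow> ereal (radial_coeff A x) \<le> e"
    using esssup_AE[of "\<lambda>x. ereal (radial_coeff A x)" "restrict_space \<mu> (annulus n)"] unfolding ar e_def .
  then show r_an: "AE x in \<mu>. x \<in> annulus n \<longrightarrow> radial_coeff A x \<le> an"
    by eventually_elim (use e_le in \<open>cases e; auto simp: an\<close>)
  have bm: "(\<lambda>x. (\<beta> x \<bullet> x) / norm x) \<in> borel_measurable \<mu>"
    unfolding \<mu>_measurable_iff using \<beta>_measurable by measurable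
  have bL: "L2 \<mu> (\<lambda>x. indicator (annulus n) x * ((\<beta> x \<bullet> x) / norm x))"
  proof (rule L2_bound[OF bounded_support_L2[OF lf bs]])
    show "(\<lambda>x. indicator (annulus n) x * ((\<beta> x \<bullet> x) / norm x)) \<in> borel_measurable \<mu>"
      by (intro borel_measurable_times bm borel_measurable_indicator An)
    show "AE x in \<mu>. norm (indicator (annulus n) x * ((\<beta> x \<bullet> x) / norm x)) \<le> b * norm (indicat_real (annulus n) x)"
      using ab
    proof eventually_elim
      case (elim x)
      show ?case
      proof (cases "x \<in> annulus n")
        case True
        then have "norm (\<beta> x) * norm x \<le> b * norm x" using elim by (intro mult_right_mono) auto
        then have "\<bar>\<beta> x \<bullet> x\<bar> \<le> b * norm x" using Cauchy_Schwarz_ineq2[of "\<beta> x" x] by linarith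
        then show ?thesis using True r_pos[OF True] by (simp add: abs_divide pos_divide_le_eq)
      qed simp
    qed
  qed
  have sq: "(indicat_real (annulus n) x * y)\<^sup>2 = indicat_real (annulus n) x * y\<^sup>2" for x :: "real^'n" and y
    by (simp add: indicator_def)
  show bi: "integrable \<mu> (\<lambda>x. indicator (annulus n) x * ((\<beta> x \<bullet> x) / norm x)\<^sup>2)"
    using bL unfolding L2_real_iff sq by blast
  define Lb where "Lb = L2_norm (restrict_space \<mu> (annulus n)) (\<lambda>x. (\<beta> x \<bullet> x) / norm x)"
  have Lb2: "Lb\<^sup>2 = Bn"
    unfolding Lb_def L2_norm_sq Bn_def by (subst integral_restrict_space[OF An']) (simp add: power_divide)
  have Lb0: "0 \<le> Lb" by (simp add: Lb_def L2_norm_nonneg)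
  define e' where "e' = esssup (restrict_space \<mu> (annulus n))
      (\<lambda>x. ereal (deriv (\<lambda>r. C * ln (r + 1)) (norm x) * radial_coeff A x))"
  have Ah: "Ah = (sqrt an + real_of_ereal e') * sqrt (measure \<mu> (annulus n)) + Lb"
    by (simp add: Ah_def A_hat_def an_def e'_def Lb_def esssup_on_def)
  show "0 \<le> Ah" and "an * measure \<mu> (annulus n) + Bn \<le> Ah\<^sup>2"
  proof -
    \<comment> \<open>The essential suprema are known to be nonnegative only if the annulus has
      positive measure; otherwise the measure factor removes them.\<close>
    have "0 \<le> Ah \<and> an * measure \<mu> (annulus n) + Bn \<le> Ah\<^sup>2"
    proof (cases "measure \<mu> (annulus n) = 0")
      case True
      then show ?thesis using Lb2 Lb0 by (simp add: Ah)
    next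
      case False
      have nonnull: "\<not> (AE x in \<mu>. x \<notin> annulus n)"
      proof
        assume "AE x in \<mu>. x \<notin> annulus n"
        then have "emeasure \<mu> (annulus n) = 0" using An by (subst (asm) AE_iff_measurable[of "annulus n"]) (auto simp: sp)
        then show False using False by (simp add: measure_def)
      qed
      have an0: "0 \<le> an"
      proof (rule ccontr)
        assume "\<not> 0 \<le> an"
        then have "AE x in \<mu>. x \<notin> annulus n" using r0 r_an by (auto elim: AE_mp)
        then show False using nonnull by simp
      qed
      have r1: "AE x in \<mu>. x \<in> annulus n \<longrightarrow> ereal (deriv (\<lambda>r. C * ln (r + 1)) (norm x) * radial_coeff A x) \<le> e'"
        using esssup_AE[of "\<lambda>x. ereal (deriv (\<lambda>r. C * ln (r + 1)) (norm x) * radial_coeff A x)" "restrict_space \<mu> (annulus n)"]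
        unfolding ar e'_def .
      have dv: "0 \<le> deriv (\<lambda>r. C * ln (r + 1)) (norm x)" for x :: "real^'n"
      proof -
        have p: "0 < norm x + 1" by (simp add: add_nonneg_pos)
        then have "((\<lambda>r. C * ln (r + 1)) has_real_derivative C * (1 / (norm x + 1))) (at (norm x))"
          by (auto intro!: derivative_eq_intros)
        from DERIV_imp_deriv[OF this] show ?thesis using p const_pos by simp
      qed
      have e'A: "AE x in \<mu>. x \<in> annulus n \<longrightarrow> 0 \<le> e'"
        using r1 r0
      proof eventually_elim
        case (elim x)
        show ?case
        proof
          assume "x \<in> annulus n"
          then have le: "ereal (deriv (\<lambda>r. C * ln (r + 1)) (norm x) * radial_coeff A x) \<le> e'" using elim by simp
          have "(0::ereal) \<le> ereal (deriv (\<lambda>r. C * ln (r + 1)) (norm x) * radial_coeff A x)"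
            using mult_nonneg_nonneg[OF dv elim(2)] by simp
          then show "0 \<le> e'" using le by (rule order_trans)
        qed
      qed
      have "0 \<le> e'"
      proof (rule ccontr)
        assume "\<not> 0 \<le> e'"
        then have "AE x in \<mu>. x \<notin> annulus n" using e'A by simp
        then show False using nonnull by simp
      qed
      then have "0 \<le> real_of_ereal e'" by (rule real_of_ereal_pos)
      then have ge: "sqrt an * sqrt (measure \<mu> (annulus n)) + Lb \<le> Ah"
        unfolding Ah by (intro add_mono mult_right_mono) auto
      have p: "0 \<le> sqrt an * sqrt (measure \<mu> (annulus n))" using an0 by simp
      have "an * measure \<mu> (annulus n) + Bn = (sqrt an * sqrt (measure \<mu> (annulus n)))\<^sup>2 + Lb\<^sup>2"
        using an0 by (simp add: power_mult_distrib Lb2)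
      also have "\<dots> \<le> (sqrt an * sqrt (measure \<mu> (annulus n)) + Lb)\<^sup>2"
        using p Lb0 by (simp add: power2_sum)
      also have "\<dots> \<le> Ah\<^sup>2" using ge p Lb0 by (intro power_mono) auto
      finally show ?thesis using ge p Lb0 by linarith
    qed
    then show "0 \<le> Ah" and "an * measure \<mu> (annulus n) + Bn \<le> Ah\<^sup>2" by auto
  qed
qed

text \<open>The exponents \<open>\<alpha> * C < c0 < c1 < C\<close>: the weight exponent moves from \<open>c0\<close> to \<open>c1\<close> in time \<open>t0\<close>.\<close>

definition "c0 = C * (1 + 2 * \<alpha>) / 3"
definition "c1 = C * (2 + \<alpha>) / 3"
definition "\<kappa> = 4 * C\<^sup>2 * M"
definition "t0 = (c1 - c0) / (\<kappa> + 1)"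

lemma exponents: "\<alpha> * C < c0" "c0 < c1" "c1 < C" "0 < c0" "0 < c1" "0 \<le> \<kappa>" "0 < t0"
proof -
  have *: "0 < C * (1 - \<alpha>)" "0 < C * \<alpha>" using const_pos by simp_all
  show c: "\<alpha> * C < c0" "c0 < c1" "c1 < C"
    using * const_pos by (simp_all add: c0_def c1_def algebra_simps)
  have "0 < \<alpha> * C" using const_pos by simp
  then show "0 < c0" "0 < c1" using c by linarith+
  show "0 \<le> \<kappa>" using const_pos by (simp add: \<kappa>_def)
  then show "0 < t0" using c by (simp add: t0_def)
qed

text \<open>Here b = a x x x and q = <\<beta>, x>. The factor k is chosen so that k times the drift
  coefficient (r + 1) / (C r) is exactly c m; then the diffusion term is dominated as soon as u
  \<le> C. This follows from m r^2 \<le> 1 and from c1 (r + 1) \<le> C r, the point where r must be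
  large. Finally k (r + 1)^2 = u C \<le> C^2 and ln (r + 1) \<le> 4 \<theta> give \<kappa> = 4 C^2
  M.\<close>

lemma drift_bound:
  fixes r m c b q \<theta> :: real
  assumes r: "0 < r" "c1 \<le> (C - c1) * r" and m: "0 \<le> m" "m * r * r \<le> 1" and c: "0 \<le> c" "c \<le> c1"
    and b: "0 \<le> b" and ln: "ln (r + 1) \<le> 4 * \<theta>"
    and g: "\<bar>b / r\<^sup>2 + (r + 1) / (C * r) * q\<bar> \<le> M * (r + 1)\<^sup>2 * ln (r + 1)"
  shows "c\<^sup>2 * (m\<^sup>2 * b) + c * (m * q) \<le> \<kappa> * \<theta>"
proof -
  define u where "u = c * m * r * (r + 1)"
  have u0: "0 \<le> u" using c m r by (simp add: u_def)
  have "u * r \<le> c1 * (r + 1)"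
  proof -
    have "u * r = c * (m * r * r) * (r + 1)" by (simp add: u_def)
    also have "\<dots> \<le> c1 * 1 * (r + 1)" using c m r exponents(5) by (intro mult_right_mono mult_mono) auto
    finally show ?thesis by simp
  qed
  also have "\<dots> \<le> C * r" using r(2) by (simp add: algebra_simps)
  finally have uC: "u \<le> C" using r(1) by simp
  define k where "k = u * C / (r + 1)\<^sup>2"
  have k0: "0 \<le> k" using u0 const_pos by (simp add: k_def)
  have "u / (r + 1) = c * m * r" using r(1) by (simp add: u_def)
  then have "u * u / (r + 1)\<^sup>2 = (c * m * r)\<^sup>2" by (metis power2_eq_square power_divide)
  then have "c\<^sup>2 * (m\<^sup>2 * b) = u * u / (r + 1)\<^sup>2 * (b / r\<^sup>2)"
    using r(1) by (simp add: power_mult_distrib)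
  also have "\<dots> \<le> k * (b / r\<^sup>2)"
    unfolding k_def using uC u0 b by (intro mult_right_mono divide_right_mono mult_left_mono) auto
  finally have 1: "c\<^sup>2 * (m\<^sup>2 * b) \<le> k * (b / r\<^sup>2)" .
  have 2: "c * (m * q) = k * ((r + 1) / (C * r) * q)"
  proof -
    have "k * ((r + 1) / (C * r)) = c * m"
      using r(1) const_pos by (simp add: k_def u_def divide_simps power2_eq_square)
    then have "(k * ((r + 1) / (C * r))) * q = (c * m) * q" by (simp only:)
    then show ?thesis by (simp only: mult.assoc)
  qed
  have "c\<^sup>2 * (m\<^sup>2 * b) + c * (m * q) \<le> k * (b / r\<^sup>2 + (r + 1) / (C * r) * q)"
    using 1 2 by (simp only: distrib_left)
  also have "\<dots> \<le> k * (M * (r + 1)\<^sup>2 * ln (r + 1))" using g k0 by (intro mult_left_mono) auto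
  also have "\<dots> = u * (C * M * ln (r + 1))" using r(1) by (simp add: k_def)
  also have "\<dots> \<le> C * (C * M * ln (r + 1))" using uC const_pos r(1) by (intro mult_right_mono) auto
  also have "\<dots> \<le> C * (C * M * (4 * \<theta>))" using ln const_pos by (intro mult_left_mono) auto
  finally show ?thesis by (simp add: \<kappa>_def power2_eq_square mult_ac)
qed

text \<open>The power of 1 / (n + 1) left over when the weight, of order (n + 1)^(-2 c0), meets the
  squared bound (n + 1)^(2 \<alpha> C) on \<open>A_hat\<close>.\<close>

definition "decay_rate = 2 * (c0 - \<alpha> * C)"

text \<open>On the ball of radius \<rho> the weight is bounded below independently of n, because
  \<theta> x \<le> ln (max R |x| + 1); this gives the first exponential, and
  \<open>exp (4 * c0)\<close> comes from \<theta> \<ge> ln (N + 1) - 2 beyond N. The cutoff depends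
  on n alone, so one sequence of cutoffs serves all times up to \<open>t0\<close> and all
  balls.\<close>

lemma cutoff_estimate_aux:
  assumes R: "exp 1 \<le> R" "c1 \<le> (C - c1) * R" "\<forall>x\<in>K. norm x < R"
    and cz: "0 < cz" "\<forall>r>0. \<exists>\<zeta> :: real^'n \<Rightarrow> real. \<exists>k. test_fun \<zeta> \<and> (\<forall>x. 0 \<le> \<zeta> x \<and> \<zeta> x \<le> 1) \<and>
     (\<forall>x. norm x \<le> r \<longrightarrow> \<zeta> x = 1) \<and> (\<forall>x. grad \<zeta> x = k x *\<^sub>R x) \<and>
     (\<forall>x. \<bar>k x\<bar> * norm x \<le> cz / r) \<and> (\<forall>x. norm x < r \<or> 2 * r \<le> norm x \<longrightarrow> k x = 0)"
    and n: "0 < n" "exp 2 * (R + 1) \<le> real (2 * n) + 1"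
    and Ah: "A_hat \<mu> A \<beta> (\<lambda>r. C * ln (r + 1)) n \<le> real n * (real n + 1) powr (\<alpha> * C)"
  shows "\<exists>\<zeta>. test_fun \<zeta> \<and> (\<forall>x. 0 \<le> \<zeta> x \<and> \<zeta> x \<le> 1) \<and>
     (\<forall>T t \<rho>. semigroup_of_form \<mu> Q T \<longrightarrow> 0 < t \<longrightarrow> t \<le> t0 \<longrightarrow> \<rho> \<le> real (2 * n) \<longrightarrow>
        (\<integral>x. indicator (cball 0 \<rho>) x * (T t \<zeta> x - 1)\<^sup>2 \<partial>\<mu>)
          \<le> exp (2 * c1 * ln (max R \<rho> + 1)) * (2 * (exp (4 * c0) * cz\<^sup>2 / 4 * exp (- decay_rate * ln (real n + 1))) * t))"
proof -
  \<comment> \<open>The transition region N \<le> |x| < 2 N of the cutoff is then exactly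
    \<open>annulus n\<close>.\<close>
  define N where "N = real (2 * n)"
  have N: "0 < N" using n(1) by (simp add: N_def)
  have R1: "1 < R" using R(1) exp_ge_add_one_self[of 1] by simp
  have RN: "R \<le> N"
  proof -
    have "1 * (R + 1) \<le> exp 2 * (R + 1)" using R1 by (intro mult_right_mono) auto
    then show ?thesis using n(2) by (simp add: N_def)
  qed
  obtain \<theta> :: "real^'n \<Rightarrow> real" and m \<theta>m where \<theta>: "smooth_fun \<theta>" "\<And>x. 1 \<le> \<theta> x" "\<And>x. \<theta> x \<le> \<theta>m"
     "\<And>x. grad \<theta> x = m x *\<^sub>R x" "\<And>x. 0 \<le> m x" "\<And>x. m x \<le> 1" "\<And>x. m x * norm x * norm x \<le> 1"
     "\<And>x. m x \<noteq> 0 \<Longrightarrow> R < norm x" "\<And>x. m x \<noteq> 0 \<Longrightarrow> norm x < N" "\<And>x. m x \<noteq> 0 \<Longrightarrow> ln (norm x + 1) \<le> 4 * \<theta> x"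
     "\<And>x. N \<le> norm x \<Longrightarrow> ln (N + 1) - 2 \<le> \<theta> x" "\<And>x. \<theta> x \<le> ln (max R (norm x) + 1)"
    using log_weight_ex[OF R(1) n(2), where 'n='n, folded N_def] by blast
  obtain \<zeta> :: "real^'n \<Rightarrow> real" and k where \<zeta>: "test_fun \<zeta>" "\<And>x. 0 \<le> \<zeta> x \<and> \<zeta> x \<le> 1"
     "\<And>x. norm x \<le> N \<Longrightarrow> \<zeta> x = 1" "\<And>x. grad \<zeta> x = k x *\<^sub>R x"
     "\<And>x. \<bar>k x\<bar> * norm x \<le> cz / N" "\<And>x. norm x < N \<or> 2 * N \<le> norm x \<Longrightarrow> k x = 0"
    using cz(2)[rule_format, OF N] by blast
  obtain b where b: "0 \<le> b" "AE x in \<mu>. R \<le> norm x \<and> norm x \<le> 2 * N \<longrightarrow> a x x x \<le> b \<and> norm (\<beta> x) \<le> b"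
    using shell_bounded[OF R(3)] by blast
  have drift_grad_bound: "AE x in \<mu>. \<bar>\<beta> x \<bullet> grad \<zeta> x\<bar> \<le> (cz / N * b) * \<bar>indicat_real (cball 0 (2 * N)) x\<bar>"
    using b(2)
  proof eventually_elim
    case (elim x)
    show ?case
    proof (cases "norm x < N \<or> 2 * N \<le> norm x")
      case True
      then show ?thesis using \<zeta>(6) cz(1) N b(1) by (simp add: \<zeta>(4))
    next
      case False
      then have "norm (\<beta> x) \<le> b" using elim RN by auto
      have "\<bar>\<beta> x \<bullet> grad \<zeta> x\<bar> \<le> \<bar>k x\<bar> * (norm (\<beta> x) * norm x)"
        unfolding \<zeta>(4) inner_scaleR_right abs_mult
        using Cauchy_Schwarz_ineq2[of "\<beta> x" x] by (intro mult_left_mono) auto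
      also have "\<dots> = (\<bar>k x\<bar> * norm x) * norm (\<beta> x)" by simp
      also have "\<dots> \<le> (cz / N) * b"
        using \<zeta>(5)[of x] \<open>norm (\<beta> x) \<le> b\<close> cz(1) N by (intro mult_mono) auto
      finally show ?thesis using False by simp
    qed
  qed
  interpret E: weight_cutoff \<phi> D\<phi> A Da B \<theta> \<zeta> \<kappa> c0 c1 \<theta>m b
  proof
    show "smooth_fun \<theta>" "\<And>x. 1 \<le> \<theta> x" "\<And>x. \<theta> x \<le> \<theta>m" "test_fun \<zeta>" "0 \<le> b"
      by (fact \<theta> \<zeta>(1) b(1))+
    show "0 \<le> \<kappa>" "0 \<le> c0" using exponents by auto
    \<comment> \<open>The gradient of \<theta> lives in |x| < N, that of \<zeta> in N \<le> |x| < 2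
      N.\<close>
    show "grad \<theta> x = 0 \<or> grad \<zeta> x = 0" for x
      using \<theta>(9)[of x] \<zeta>(6)[of x] by (auto simp: \<theta>(4) \<zeta>(4))
    show "AE x in \<mu>. c\<^sup>2 * a x (grad \<theta> x) (grad \<theta> x) + c * (\<beta> x \<bullet> grad \<theta> x) \<le> \<kappa> * \<theta> x"
      if c: "0 \<le> c" "c \<le> c1" for c
      using growth psd
    proof eventually_elim
      case (elim x)
      show ?case
      proof (cases "m x = 0")
        case True
        then show ?thesis using exponents(6) \<theta>(2)[of x] by (simp add: \<theta>(4) bil_zero_left)
      next
        case False
        have Rx: "R < norm x" by (rule \<theta>(8)[OF False])
        then have xK: "x \<notin> K" using R(3) by auto
        have "(C - c1) * R \<le> (C - c1) * norm x" using Rx exponents by (intro mult_left_mono) auto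
        then have "c1 \<le> (C - c1) * norm x" using R(2) by linarith
        moreover have "0 < norm x" using Rx R1 by linarith
        ultimately have "c\<^sup>2 * ((m x)\<^sup>2 * a x x x) + c * (m x * (\<beta> x \<bullet> x)) \<le> \<kappa> * \<theta> x"
          using elim xK \<theta>(5,7)[of x] c \<theta>(10)[OF False] by (intro drift_bound[of "norm x"]) auto
        then show ?thesis
          by (simp add: \<theta>(4) bil_scale_left bil_scale_right power2_eq_square mult.assoc)
      qed
    qed
    show "AE x in \<mu>. a x (grad \<theta> x) (grad \<theta> x) \<le> b"
      using b(2) psd
    proof eventually_elim
      case (elim x)
      show ?case
      proof (cases "m x = 0")
        case True
        then show ?thesis using b(1) by (simp add: \<theta>(4) bil_zero_left)
      next
        case False
        then have "a x x x \<le> b" using elim \<theta>(8,9)[of x] N by auto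
        moreover have "m x * m x \<le> 1" using \<theta>(5,6)[of x] by (intro mult_le_one) auto
        ultimately have "(m x * m x) * a x x x \<le> 1 * b" using elim(2) by (intro mult_mono) auto
        then show ?thesis by (simp add: \<theta>(4) bil_scale_left bil_scale_right mult.assoc)
      qed
    qed
    show "L2 \<mu> (\<lambda>x. \<beta> x \<bullet> grad \<zeta> x)"
    proof (rule L2_bound[OF bounded_support_L2[OF lf bounded_support_indicator[of "2 * N"]]])
      show "(\<lambda>x. \<beta> x \<bullet> grad \<zeta> x) \<in> borel_measurable \<mu>"
        by (rule borel_measurable_integrable[OF drift_integrable(1)[OF \<beta>_loc \<zeta>(1)]])
      show "AE x in \<mu>. norm (\<beta> x \<bullet> grad \<zeta> x) \<le> (cz / N * b) * norm (indicat_real (cball 0 (2 * N)) x)"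
        using drift_grad_bound by simp
    qed
  qed
  define an where "an = esssup_on \<mu> (annulus n) (radial_coeff A)"
  define Bn where "Bn = (\<integral>x. indicator (annulus n) x * ((\<beta> x \<bullet> x) / norm x)\<^sup>2 \<partial>\<mu>)"
  note est = annulus_estimate[OF R(3) n(1) RN[unfolded N_def], folded an_def Bn_def]
  \<comment> \<open>On the annulus: the largest possible weight with exponent c0, times the squared
    bound cz / N on the gradient of the cutoff.\<close>
  define H where "H = exp (- (2 * c0 * (ln (N + 1) - 2))) * (cz / N)\<^sup>2"
  have H0: "0 \<le> H" by (simp add: H_def)
  have "E.err \<le> (\<integral>x. H * (an * indicator (annulus n) x + indicator (annulus n) x * ((\<beta> x \<bullet> x) / norm x)\<^sup>2) \<partial>\<mu>)"
    unfolding E.err_def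
  proof (rule integral_mono_AE[OF E.err_integrable])
    show "0 \<le> c0" using exponents by simp
    show "integrable \<mu> (\<lambda>x. H * (an * indicator (annulus n) x + indicator (annulus n) x * ((\<beta> x \<bullet> x) / norm x)\<^sup>2))"
      by (intro integrable_mult_right Bochner_Integration.integrable_add est(2,3))
    show "AE x in \<mu>. E.W c0 x * (a x (grad \<zeta> x) (grad \<zeta> x) + (\<beta> x \<bullet> grad \<zeta> x)\<^sup>2)
        \<le> H * (an * indicator (annulus n) x + indicator (annulus n) x * ((\<beta> x \<bullet> x) / norm x)\<^sup>2)"
      using est(1) psd
    proof eventually_elim
      case (elim x)
      show ?case
      proof (cases "x \<in> annulus n")
        case False
        then have "k x = 0" using \<zeta>(6)[of x] annulus_iff[of x n] by (auto simp: N_def)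
        then show ?thesis using False by (simp add: \<zeta>(4) bil_zero_left)
      next
        case True
        then have Nx: "N \<le> norm x" using annulus_iff[of x n] by (simp add: N_def)
        then have r: "0 < norm x" using N by linarith
        have W: "E.W c0 x \<le> exp (- (2 * c0 * (ln (N + 1) - 2)))"
          unfolding E.W_def using \<theta>(11)[OF Nx] exponents(4) by simp
        have "(\<bar>k x\<bar> * norm x)\<^sup>2 \<le> (cz / N)\<^sup>2" using \<zeta>(5)[of x] by (intro power_mono) auto
        then have kx: "(k x)\<^sup>2 * (norm x)\<^sup>2 \<le> (cz / N)\<^sup>2" by (simp add: power_mult_distrib)
        have "a x (grad \<zeta> x) (grad \<zeta> x) + (\<beta> x \<bullet> grad \<zeta> x)\<^sup>2
            = ((k x)\<^sup>2 * (norm x)\<^sup>2) * (radial_coeff A x + ((\<beta> x \<bullet> x) / norm x)\<^sup>2)"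
          using r unfolding \<zeta>(4) radial_coeff_def
          by (simp add: bil_scale_left bil_scale_right power2_eq_square field_simps)
        also have "\<dots> \<le> (cz / N)\<^sup>2 * (an + ((\<beta> x \<bullet> x) / norm x)\<^sup>2)"
          using kx elim True
          by (intro mult_mono add_right_mono add_nonneg_nonneg) (auto simp: radial_coeff_def)
        finally have "E.W c0 x * (a x (grad \<zeta> x) (grad \<zeta> x) + (\<beta> x \<bullet> grad \<zeta> x)\<^sup>2)
            \<le> exp (- (2 * c0 * (ln (N + 1) - 2))) * ((cz / N)\<^sup>2 * (an + ((\<beta> x \<bullet> x) / norm x)\<^sup>2))"
          using W elim E.W_pos[of c0 x] by (intro mult_mono) auto
        then show ?thesis using True by (simp add: H_def mult.assoc)
      qed
    qed
  qed
  also have "\<dots> = H * (an * measure \<mu> (annulus n) + Bn)"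
  proof -
    have "(\<integral>x. indicator (annulus n) x \<partial>\<mu>) = measure \<mu> (annulus n)"
      by (simp add: weighted_def)
    then show ?thesis using est(2,3) by (simp add: Bn_def)
  qed
  also have "\<dots> \<le> H * (real n * (real n + 1) powr (\<alpha> * C))\<^sup>2"
  proof (rule mult_left_mono[OF _ H0])
    have "(A_hat \<mu> A \<beta> (\<lambda>r. C * ln (r + 1)) n)\<^sup>2 \<le> (real n * (real n + 1) powr (\<alpha> * C))\<^sup>2"
      by (rule power_mono[OF Ah est(4)])
    then show "an * measure \<mu> (annulus n) + Bn \<le> (real n * (real n + 1) powr (\<alpha> * C))\<^sup>2"
      using est(5) by linarith
  qed
  also have "\<dots> \<le> exp (4 * c0) * cz\<^sup>2 / 4 * exp (- decay_rate * ln (real n + 1))"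
  proof -
    have p: "((real n + 1) powr (\<alpha> * C))\<^sup>2 = exp (2 * (\<alpha> * C) * ln (real n + 1))"
      by (simp add: powr_def power2_eq_square mult.assoc flip: exp_add)
    \<comment> \<open>The 1 / N of the cutoff gradient cancels the factor n in the bound on
      \<open>A_hat\<close>; the 4 comes from N = 2 n.\<close>
    have q: "(cz / N)\<^sup>2 * (real n)\<^sup>2 = cz\<^sup>2 / 4" using n(1) by (simp add: N_def power_divide power_mult_distrib)
    have "ln (real n + 1) \<le> ln (N + 1)" by (intro ln_le_cancel_iff[THEN iffD2]) (auto simp: N_def)
    then have "2 * c0 * ln (real n + 1) \<le> 2 * c0 * ln (N + 1)" using exponents(4) by (intro mult_left_mono) auto
    then have "- (2 * c0 * (ln (N + 1) - 2)) \<le> 4 * c0 - 2 * c0 * ln (real n + 1)" by (simp add: algebra_simps)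
    then have e: "exp (- (2 * c0 * (ln (N + 1) - 2))) \<le> exp (4 * c0 - 2 * c0 * ln (real n + 1))" by simp
    have "H * (real n * (real n + 1) powr (\<alpha> * C))\<^sup>2
        = exp (- (2 * c0 * (ln (N + 1) - 2))) * ((cz / N)\<^sup>2 * (real n)\<^sup>2) * exp (2 * (\<alpha> * C) * ln (real n + 1))"
      unfolding H_def power_mult_distrib p by (simp add: mult_ac)
    also have "\<dots> \<le> exp (4 * c0 - 2 * c0 * ln (real n + 1)) * (cz\<^sup>2 / 4) * exp (2 * (\<alpha> * C) * ln (real n + 1))"
      unfolding q by (intro mult_right_mono e) auto
    also have "\<dots> = exp (4 * c0) * cz\<^sup>2 / 4 * (exp (- (2 * c0 * ln (real n + 1))) * exp (2 * (\<alpha> * C) * ln (real n + 1)))"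
      by (simp add: exp_diff exp_minus field_simps)
    also have "exp (- (2 * c0 * ln (real n + 1))) * exp (2 * (\<alpha> * C) * ln (real n + 1)) = exp (- decay_rate * ln (real n + 1))"
      unfolding exp_add[symmetric] by (simp add: decay_rate_def algebra_simps)
    finally show ?thesis .
  qed
  finally have err: "E.err \<le> exp (4 * c0) * cz\<^sup>2 / 4 * exp (- decay_rate * ln (real n + 1))" .
  have main: "(\<integral>x. indicator (cball 0 \<rho>) x * (T t \<zeta> x - 1)\<^sup>2 \<partial>\<mu>)
          \<le> exp (2 * c1 * ln (max R \<rho> + 1)) * (2 * (exp (4 * c0) * cz\<^sup>2 / 4 * exp (- decay_rate * ln (real n + 1))) * t)"
    if T: "semigroup_of_form \<mu> Q T" and t: "0 < t" "t \<le> t0" and \<rho>: "\<rho> \<le> real (2 * n)" for T t \<rho>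
  proof -
    interpret S: l2_semigroup \<mu> T by unfold_locales (use T in \<open>simp add: semigroup_of_form_def\<close>)
    let ?e = "exp (2 * c1 * ln (max R \<rho> + 1))"
    have "(\<kappa> + 1) * t \<le> (\<kappa> + 1) * t0" using t exponents by (intro mult_left_mono) auto
    also have "\<dots> = c1 - c0" using exponents by (simp add: t0_def)
    finally have c: "c0 + E.K * t \<le> c1" by (simp add: E.K_def)
    have TL: "L2 \<mu> (\<lambda>x. T t \<zeta> x - \<zeta> x)"
      using S.Tz_L2[of t \<zeta>] t test_fun_L2[OF lf \<zeta>(1)] by (intro L2_diff) (auto simp: S.Tz_pos)
    have W1: "\<bar>E.W c1 x\<bar> \<le> 1" for x using E.W_pos[of c1 x] E.W_le[of c1 x] exponents by simp
    have "integrable \<mu> (\<lambda>x. (E.W c1 x * (T t \<zeta> x - \<zeta> x)) * (T t \<zeta> x - \<zeta> x))"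
      by (rule L2_integrable_mult[OF L2_mult_bounded[OF TL E.W_measurable W1] TL])
    then have i: "integrable \<mu> (\<lambda>x. ?e * (E.W c1 x * (T t \<zeta> x - \<zeta> x)\<^sup>2))"
      by (intro integrable_mult_right) (simp add: power2_eq_square mult.assoc)
    have "(\<integral>x. indicator (cball 0 \<rho>) x * (T t \<zeta> x - 1)\<^sup>2 \<partial>\<mu>) \<le> (\<integral>x. ?e * (E.W c1 x * (T t \<zeta> x - \<zeta> x)\<^sup>2) \<partial>\<mu>)"
    proof (rule integral_mono'[OF i])
      fix x
      show "0 \<le> ?e * (E.W c1 x * (T t \<zeta> x - \<zeta> x)\<^sup>2)" using E.W_pos[of c1 x] by simp
      show "indicator (cball 0 \<rho>) x * (T t \<zeta> x - 1)\<^sup>2 \<le> ?e * (E.W c1 x * (T t \<zeta> x - \<zeta> x)\<^sup>2)"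
      proof (cases "norm x \<le> \<rho>")
        case True
        then have \<zeta>1: "\<zeta> x = 1" using \<zeta>(3)[of x] \<rho> by (simp add: N_def)
        have "ln (max R (norm x) + 1) \<le> ln (max R \<rho> + 1)"
          by (intro ln_le_cancel_iff[THEN iffD2]) (use True R1 in auto)
        then have "\<theta> x \<le> ln (max R \<rho> + 1)" using \<theta>(12)[of x] by linarith
        then have "2 * c1 * \<theta> x \<le> 2 * c1 * ln (max R \<rho> + 1)" using exponents by (intro mult_left_mono) auto
        then have "1 \<le> ?e * E.W c1 x" unfolding E.W_def exp_add[symmetric] by simp
        then have "1 * (T t \<zeta> x - 1)\<^sup>2 \<le> (?e * E.W c1 x) * (T t \<zeta> x - 1)\<^sup>2" by (intro mult_right_mono) auto
        then show ?thesis using True \<zeta>1 by (simp add: mult.assoc)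
      next
        case False
        then show ?thesis using E.W_pos[of c1 x] by simp
      qed
    qed
    also have "\<dots> = ?e * (\<integral>x. E.W c1 x * (T t \<zeta> x - \<zeta> x)\<^sup>2 \<partial>\<mu>)" by simp
    also have "\<dots> \<le> ?e * (2 * E.err * t)"
      by (intro mult_left_mono E.semigroup_deviation_bound[OF T t(1) c]) simp
    also have "\<dots> \<le> ?e * (2 * (exp (4 * c0) * cz\<^sup>2 / 4 * exp (- decay_rate * ln (real n + 1))) * t)"
      using err t by (intro mult_left_mono mult_right_mono) auto
    finally show ?thesis .
  qed
  show ?thesis using \<zeta>(1,2) main by blast
qed

lemma semigroup_conservative:
  assumes T: "semigroup_of_form \<mu> Q T"
  shows "conservative \<mu> T"
proof -
  obtain cz where cz: "0 < cz" "\<forall>r>0. \<exists>\<zeta> :: real^'n \<Rightarrow> real. \<exists>k. test_fun \<zeta> \<and> (\<forall>x. 0 \<le> \<zeta> x \<and> \<zeta> x \<le> 1) \<and>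
     (\<forall>x. norm x \<le> r \<longrightarrow> \<zeta> x = 1) \<and> (\<forall>x. grad \<zeta> x = k x *\<^sub>R x) \<and>
     (\<forall>x. \<bar>k x\<bar> * norm x \<le> cz / r) \<and> (\<forall>x. norm x < r \<or> 2 * r \<le> norm x \<longrightarrow> k x = 0)"
    using radial_cutoff_ex[where 'n='n] by (elim exE conjE) (rule that)
  obtain RK where RK: "\<And>x. x \<in> K \<Longrightarrow> norm x \<le> RK"
    using compact_imp_bounded[OF K(1)] unfolding bounded_iff by blast
  \<comment> \<open>At least \<open>exp 1\<close> for \<open>log_weight_ex\<close>, strictly beyond
    K for the growth bound, and at least c1 / (C - c1) for \<open>drift_bound\<close>.\<close>
  define R where "R = max (exp 1) (max (RK + 1) (c1 / (C - c1)))"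
  have "c1 / (C - c1) \<le> R" by (simp add: R_def)
  then have R2: "c1 \<le> (C - c1) * R" using exponents by (simp add: pos_divide_le_eq mult.commute)
  have R1: "exp 1 \<le> R" by (simp add: R_def)
  have R3: "\<forall>x\<in>K. norm x < R"
  proof
    fix x assume "x \<in> K"
    then have "norm x \<le> RK" by (rule RK)
    moreover have "RK + 1 \<le> R" by (simp add: R_def)
    ultimately show "norm x < R" by linarith
  qed
  obtain n1 where n1: "\<And>n. n1 \<le> n \<Longrightarrow> A_hat \<mu> A \<beta> (\<lambda>r. C * ln (r + 1)) n \<le> real n * (real n + 1) powr (\<alpha> * C)"
    using A_hat_le unfolding eventually_sequentially by blast
  obtain n2 :: nat where n2: "exp 2 * (R + 1) < real n2" using reals_Archimedean2 by blast
  \<comment> \<open>From n1 on the bound on \<open>A_hat\<close> holds, n2 makes room between R and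
    2 n for the weight, and the final 1 keeps the index positive.\<close>
  define n0 where "n0 = n1 + n2 + 1"
  define D where "D = (\<lambda>n. exp (4 * c0) * cz\<^sup>2 / 4 * exp (- decay_rate * ln (real n + 1)))"
  have "\<forall>j. \<exists>\<zeta>. test_fun \<zeta> \<and> (\<forall>x. 0 \<le> \<zeta> x \<and> \<zeta> x \<le> 1) \<and>
     (\<forall>T t \<rho>. semigroup_of_form \<mu> Q T \<longrightarrow> 0 < t \<longrightarrow> t \<le> t0 \<longrightarrow> \<rho> \<le> real (2 * (j + n0)) \<longrightarrow>
        (\<integral>x. indicator (cball 0 \<rho>) x * (T t \<zeta> x - 1)\<^sup>2 \<partial>\<mu>)
          \<le> exp (2 * c1 * ln (max R \<rho> + 1)) * (2 * D (j + n0) * t))"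
    unfolding D_def
  proof (rule allI, rule cutoff_estimate_aux[OF R1 R2 R3 cz])
    fix j
    show "0 < j + n0" by (simp add: n0_def)
    show "exp 2 * (R + 1) \<le> real (2 * (j + n0)) + 1" using n2 by (simp add: n0_def)
    show "A_hat \<mu> A \<beta> (\<lambda>r. C * ln (r + 1)) (j + n0) \<le> real (j + n0) * (real (j + n0) + 1) powr (\<alpha> * C)"
      by (rule n1) (simp add: n0_def)
  qed
  from choice[OF this] obtain \<zeta> where \<zeta>: "\<And>j. test_fun (\<zeta> j)" "\<And>j x. 0 \<le> \<zeta> j x" "\<And>j x. \<zeta> j x \<le> 1"
     "\<And>j T t \<rho>. semigroup_of_form \<mu> Q T \<Longrightarrow> 0 < t \<Longrightarrow> t \<le> t0 \<Longrightarrow> \<rho> \<le> real (2 * (j + n0)) \<Longrightarrow>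
        (\<integral>x. indicator (cball 0 \<rho>) x * (T t (\<zeta> j) x - 1)\<^sup>2 \<partial>\<mu>)
          \<le> exp (2 * c1 * ln (max R \<rho> + 1)) * (2 * D (j + n0) * t)" by blast
  have D0: "(\<lambda>j. D (j + n0)) \<longlonglongrightarrow> 0"
  proof -
    have d: "0 < decay_rate" using exponents by (simp add: decay_rate_def)
    have "filterlim (\<lambda>n. ln (real n + 1)) at_top sequentially"
      by (rule filterlim_compose[OF ln_at_top filterlim_compose[OF filterlim_tendsto_add_at_top[OF tendsto_const filterlim_ident] filterlim_real_sequentially, of 1, unfolded add.commute[of 1]]])
    then have "filterlim (\<lambda>n. decay_rate * ln (real n + 1)) at_top sequentially"
      by (rule filterlim_tendsto_pos_mult_at_top[OF tendsto_const d])
    then have "(\<lambda>n. exp (- (decay_rate * ln (real n + 1)))) \<longlonglongrightarrow> 0"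
      by (intro filterlim_compose[OF exp_at_bot] filterlim_compose[OF filterlim_uminus_at_bot_at_top])
    then have "(\<lambda>n. exp (4 * c0) * cz\<^sup>2 / 4 * exp (- (decay_rate * ln (real n + 1)))) \<longlonglongrightarrow> exp (4 * c0) * cz\<^sup>2 / 4 * 0"
      by (rule tendsto_mult_left)
    then have "D \<longlonglongrightarrow> 0" by (simp add: D_def)
    then show ?thesis by (rule LIMSEQ_ignore_initial_segment)
  qed
  have small: "conserved_at T t" if t: "0 < t" "t \<le> t0" for t
  proof (rule conserved_atI[OF T t(1) \<zeta>(1-3)])
    fix \<rho> :: real assume "0 < \<rho>"
    let ?e = "exp (2 * c1 * ln (max R \<rho> + 1))"
    have lim: "(\<lambda>j. ?e * (2 * D (j + n0) * t)) \<longlonglongrightarrow> 0"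
      using tendsto_mult_left[OF tendsto_mult_right[OF tendsto_mult_left[OF D0, of 2], of t], of ?e] by simp
    obtain j0 :: nat where j0: "\<rho> < real j0" using reals_Archimedean2 by blast
    show "(\<lambda>j. \<integral>x. indicator (cball 0 \<rho>) x * (T t (\<zeta> j) x - 1)\<^sup>2 \<partial>\<mu>) \<longlonglongrightarrow> 0"
    proof (rule tendsto_sandwich[OF _ _ tendsto_const lim])
      show "\<forall>\<^sub>F j in sequentially. 0 \<le> (\<integral>x. indicator (cball 0 \<rho>) x * (T t (\<zeta> j) x - 1)\<^sup>2 \<partial>\<mu>)"
        by (intro always_eventually allI Bochner_Integration.integral_nonneg) simp
      show "\<forall>\<^sub>F j in sequentially. (\<integral>x. indicator (cball 0 \<rho>) x * (T t (\<zeta> j) x - 1)\<^sup>2 \<partial>\<mu>) \<le> ?e * (2 * D (j + n0) * t)"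
        by (rule eventually_sequentiallyI[of j0], rule \<zeta>(4)[OF T t]) (use j0 in simp)
    qed
  qed
  show ?thesis
    by (rule conserved_imp_conservative, rule conserved_at_all[OF T exponents(7) small])
qed

end

theorem mainTheorem8:
  fixes \<phi> :: "real^'n::finite \<Rightarrow> real"
    and D\<phi> :: "real^'n \<Rightarrow> real^'n"
    and A :: "real^'n \<Rightarrow> real^'n^'n"
    and Da :: "'n \<Rightarrow> 'n \<Rightarrow> real^'n \<Rightarrow> real^'n"
    and B \<beta> :: "real^'n \<Rightarrow> real^'n"
    and \<mu> :: "(real^'n) measure"
    and K0 K :: "(real^'n) set"
    and T :: "real \<Rightarrow> (real^'n \<Rightarrow> real) \<Rightarrow> real^'n \<Rightarrow> real"
    and M C \<alpha> :: real
  defines "\<mu> \<equiv> weighted \<phi>"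
    and "\<beta> \<equiv> drift \<phi> D\<phi> A Da B"
  assumes "H12_loc lborel \<phi>" and "H12_loc_grad lborel \<phi> D\<phi>"
    and "AE x in lborel. \<phi> x > 0"
    \<comment> \<open>the diffusion matrix\<close>
    and "\<And>i j. L1_loc \<mu> (\<lambda>x. A x $ i $ j)"
    and "compact K0"
    and "\<And>i j. Linf_loc (- K0) \<mu> (\<lambda>x. sym_part A x $ i $ j)"
    and "\<And>i j. H12_loc \<mu> (\<lambda>x. skew_part A x $ i $ j)"
    and "\<And>i j. H12_loc_grad \<mu> (\<lambda>x. skew_part A x $ i $ j) (Da i j)"
    and "\<And>i j. Linf_loc UNIV \<mu> (\<lambda>x. skew_part A x $ i $ j)"
    and "\<exists>L>0. \<forall>S. compact S \<longrightarrow> (\<exists>\<nu>>0.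
           (\<forall>i j. esssup (restrict_space \<mu> S) (\<lambda>x. ereal \<bar>skew_part A x $ i $ j\<bar>) \<le> ereal (L * \<nu>)) \<and>
           (AE x in \<mu>. x \<in> S \<longrightarrow> (\<forall>\<xi>. \<nu> * (norm \<xi>)\<^sup>2 \<le> bil (sym_part A x) \<xi> \<xi>)))"
    \<comment> \<open>the divergence-free vector field\<close>
    and "L2_loc \<mu> B"
    and "\<And>f. test_fun f \<Longrightarrow> (\<integral>x. B x \<bullet> grad f x \<partial>\<mu>) = 0"
    and "\<exists>c>0. \<forall>f g. test_fun f \<and> test_fun g \<longrightarrow>
           \<bar>\<integral>x. (B x \<bullet> grad f x) * g x \<partial>\<mu>\<bar>
             \<le> c * sqrt (energy1 \<mu> (sym_part A) f f) * sqrt (energy1 \<mu> (sym_part A) g g)"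
    and "Linf_loc (- K0) \<mu> (\<lambda>x. norm (\<beta> x))"
    and "semigroup_of_form \<mu> (form \<mu> A B) T"
    \<comment> \<open>the growth conditions\<close>
    and "M > 0" and "C > 0" and "0 < \<alpha>" and "\<alpha> < 1"
    and "compact K" and "K0 \<subseteq> K"
    and "AE x in lborel. x \<notin> K \<longrightarrow>
           \<bar>bil (sym_part A x) x x / (norm x)\<^sup>2 + (norm x + 1) / (C * norm x) * (\<beta> x \<bullet> x)\<bar>
             \<le> M * (norm x + 1)\<^sup>2 * ln (norm x + 1)"
    and "\<forall>\<^sub>F n in sequentially.
           A_hat \<mu> A \<beta> (\<lambda>r. C * ln (r + 1)) n \<le> real n * (real n + 1) powr (\<alpha> * C)"
  shows "conservative \<mu> T"
proof -
  interpret weighted_space \<phi> D\<phi>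
    using \<open>H12_loc_grad lborel \<phi> D\<phi>\<close> \<open>AE x in lborel. \<phi> x > 0\<close> by unfold_locales
  have psd: "AE x in \<mu>. \<forall>\<xi>. 0 \<le> bil (sym_part A x) \<xi> \<xi>"
  proof -
    \<comment> \<open>The ellipticity constant depends on the compact set; its sign survives the
      union over countably many balls.\<close>
    have "AE x in \<mu>. x \<in> cball 0 (real n) \<longrightarrow> (\<forall>\<xi>. 0 \<le> bil (sym_part A x) \<xi> \<xi>)" for n
    proof -
      obtain \<nu> where \<nu>: "\<nu> > 0" "AE x in \<mu>. x \<in> cball 0 (real n) \<longrightarrow> (\<forall>\<xi>. \<nu> * (norm \<xi>)\<^sup>2 \<le> bil (sym_part A x) \<xi> \<xi>)"
        using assms(12) compact_cball by blast
      from \<nu>(2) show ?thesis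
      proof eventually_elim
        case (elim x)
        have "0 \<le> \<nu> * (norm \<xi>)\<^sup>2" for \<xi> :: "real^'n" using \<nu>(1) by simp
        then show ?case using elim order_trans by blast
      qed
    qed
    then have "AE x in \<mu>. \<forall>n. x \<in> cball 0 (real n) \<longrightarrow> (\<forall>\<xi>. 0 \<le> bil (sym_part A x) \<xi> \<xi>)"
      by (simp only: AE_all_countable) blast
    then show ?thesis
    proof eventually_elim
      case (elim x)
      obtain n :: nat where "norm x < real n" using reals_Archimedean2 by blast
      then show ?case using elim[rule_format, of n] by simp
    qed
  qed
  have lf: "locally_finite (weighted \<phi>)" by (rule locally_finite_\<mu>)
  interpret growth_form \<phi> D\<phi> A Da B K0 K M C \<alpha>
  proof
    show "loc_L1 (weighted \<phi>) (\<lambda>x. A x $ i $ j)" for i j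
      using L1_loc_imp[OF lf] assms(6) unfolding \<mu>_def by blast
    show "loc_L2 (weighted \<phi>) (\<lambda>x. B x $ i)" for i
      using L2_loc_imp[OF lf] assms(13) unfolding \<mu>_def by blast
    show "AE x in weighted \<phi>. x \<notin> K \<longrightarrow>
        \<bar>bil (sym_part A x) x x / (norm x)\<^sup>2 + (norm x + 1) / (C * norm x) * (drift \<phi> D\<phi> A Da B x \<bullet> x)\<bar>
             \<le> M * (norm x + 1)\<^sup>2 * ln (norm x + 1)"
      using assms(24) unfolding \<beta>_def by (rule AE_\<mu>I)
  qed (use assms psd in \<open>simp_all only: \<mu>_def \<beta>_def\<close>)
  show ?thesis
    using semigroup_conservative assms(17) unfolding \<mu>_def by blast
qed

end
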